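(* The functor $\mathcal P_f:\mathbf{RegOp}\to\mathbf{LT}$ is full on isomorphisms and its essential image is $\mathbf{RegLT}$. In particular, the category $\mathbf{RegOp}$ of regular operads is equivalent to the category $\mathbf{RegLT}$ of regular Lawvere theories and regular interpretations.
   Context: Notation: $(n]=\{1,\dots,n\}$ for $n\in\omega=\{0,1,2,\dots\}$. $\mathbb F$ is the category with objects $(n]$, $n\in\omega$, and all functions as morphisms; $\mathbb S$ (resp. $\mathbb I$) is its subcategory with the same objects and surjections (resp. injections). **Regular operads.** For $\phi\in\mathbb F(n,m)$ and $\psi_i\in\mathbb F(k_i,l_i)$, $i\in(m]$, let $\langle\psi_1,\dots,\psi_m\rangle\star\phi:\sum_{j=1}^n(k_{\phi(j)}]\to\sum_{i=1}^m(l_i]$ be the function sending the element $r$ of the $j$-th summand to the element $\psi_{\phi(j)}(r)$ of the $\phi(j)$-th summand (sums ordered lexicographically). A regular operad $\mathcal O$ consists of sets $\mathcal O_n$ ($n\in\omega$), a unit $\iota\in\mathcal O_1$, multiplications $\mathcal O_{n_1}\times\dots\times\mathcal O_{n_k}\times\mathcal O_k\to\mathcal O_{n_1+\dots+n_k}$, $(b_1,\dots,b_k,a)\mapsto\langle b_1,\dots,b_k\rangle\ast a$, and a left (functorial) action $\cdot:\mathbb S(n,m)\times\mathcal O_n\to\mathcal O_m$, such that $\ast$ is associative, $\langle a\rangle\ast\iota=a=\langle\iota,\dots,\iota\rangle\ast a$, and $\langle\psi_1\cdot b_1,\dots,\psi_m\cdot b_m\rangle\ast(\phi\cdot a)=(\langle\psi_1,\dots,\psi_m\rangle\star\phi)\cdot(\langle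 b_{\phi(1)},\dots,b_{\phi(n)}\rangle\ast a)$ for $\phi\in\mathbb S(n,m)$, $a\in\mathcal O_n$, $\psi_i\in\mathbb S(k_i,l_i)$, $b_i\in\mathcal O_{k_i}$. Morphisms preserve arities, unit, multiplication and action. This gives the category $\mathbf{RegOp}$. **Lawvere theories.** $\mathbf{LT}$: a Lawvere theory is a category $\mathbf T$ with objects $n\in\omega$ and chosen projections $\pi^n_i:n\to1$ making $n$ an $n$-fold product of $1$; morphisms (interpretations) are identity-on-objects functors preserving chosen projections. $\mathbb F^{op}$ is initial in $\mathbf{LT}$; $\pi:\mathbb F^{op}\to\mathbf T$, $\phi\mapsto\pi_\phi$, is the unique interpretation. A projection morphism in $\mathbf T$ is a morphism in the closure under isomorphisms of $\{\pi_\phi:\phi\in\mathbb I\}$. A morphism $r$ is regular if it is right orthogonal to all projection morphisms $p$: whenever $ru=vp$ there is a unique $d$ with $dp=u$, $rd=v$. $\mathbf T$ has simple automorphisms if for every $n$ the map $S_n\times Aut(1)^n\to Aut(n)$, $(\sigma,a_1,\dots,a_n)\mapsto(a_1\times\dots\times a_n)\circ\pi_\sigma$, is a bijection. $\mathbf T$ is a regular Lawvere theory if projection morphisms and regular morphisms form an (orthogonal) factorization system (each morphism is a projection morphism followed by a regular one) and $\mathbf T$ has simple automorphisms. A regular interpretation is an interpretation preserving regular morphisms. $\mathbf{RegLT}\subset\mathbf{LT}$ is the (non-full) subcategory of regular Lawvere theories and regular interpretations. **The functor $\mathcal P_f$.** For a regular operad $\mathcal O$, morphisms $n\to m$ in $\mathcal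 P_f(\mathcal O)$ are equivalence classes of spans $\langle\phi,f,g_i\rangle_{i\in(m]}$, where $\phi:(r]\to(n]$ is a function, $f:(r]\to(m]$ is a monotone function, $\phi$ is injective on each fiber of $f$, and $g_i\in\mathcal O_{r_i}$ with $r_i=|f^{-1}(i)|$. Spans $\langle\phi,f,g_i\rangle$ and $\langle\phi',f',g'_i\rangle$ are equivalent if $f=f'$ and there are permutations $\sigma_i\in S_{r_i}$, $i\in(m]$, with $g_i=\sigma_i\cdot g'_i$ and $\phi\circ\sum_i\sigma_i=\phi'$, where $\sum_i\sigma_i$ is the permutation of $(r]$ acting as $\sigma_i$ on the fiber over $i$. Regularization: given $\langle\phi,f,g_i\rangle_{i\in(m]}$ with $\phi:(r]\to(n]$ a function, $f:(r]\to(m]$ a monotone function and $g_i\in\mathcal O_{r_i}$, $r_i=|f^{-1}(i)|$, but with $\phi$ not necessarily injective on fibers of $f$, factor the restriction $\phi_i$ of $\phi$ to $f^{-1}(i)$ as $\phi_i=\phi'_i\circ\psi_i$ with $\psi_i:(r_i]\to(r'_i]$ surjective and $\phi'_i$ injective; its regularization is $\langle\phi',f',\psi_i\cdot g_i\rangle$ with $\phi'=[\phi'_1,\dots,\phi'_m]:(\sum_i r'_i]\to(n]$ and $f'$ the monotone map sending the $i$-th block to $i$. The composition of $\langle\phi,f,g_i\rangle:n\to m$ with $\langle\phi',f',g'_j\rangle:m\to k$ is the regularization of $\langle\phi\circ\bar\phi,\,f'\circ\bar f,\,\langle g_{\phi'(l)}\rangle_{l\in f'^{-1}(j)}\ast g'_j\rangle_{j\in(k]}$,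 where $\bar\phi:(r'']\to(r]$, $\bar f:(r'']\to(r']$ is the pullback of $f$ and $\phi'$ (so $f\bar\phi=\phi'\bar f$), chosen with $\bar f$ monotone and $\bar\phi$ monotone on the fibers of $\bar f$. The identity on $n$ is $\langle 1_n,1_n,\iota\rangle$; the projection $\pi^n_i:n\to1$ is $\langle\tilde i,1_1,\iota\rangle$ with $\tilde i(1)=i$. For a morphism $h:\mathcal O\to\mathcal O'$, $\mathcal P_f(h)(\langle\phi,f,g_i\rangle)=\langle\phi,f,h(g_i)\rangle$. The essential image of a functor is the subcategory of the target consisting of objects isomorphic to values of the functor and morphisms that, up to composition with isomorphisms, are values of the functor. Full on isomorphisms: every isomorphism $\mathcal P_f(\mathcal O)\to\mathcal P_f(\mathcal O')$ is $\mathcal P_f(h)$ for some $h$. *)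

theory Defs
  imports "HOL-Library.FuncSet" "HOL-Library.Equipollence"
begin

section \<open>Categories, functors, equivalences\<close>

record ('o, 'm) cat =
  Obj :: "'o set"
  Arr :: "'m set"
  Dom :: "'m \<Rightarrow> 'o"
  Cod :: "'m \<Rightarrow> 'o"
  Ident :: "'o \<Rightarrow> 'm"
  Comp :: "'m \<Rightarrow> 'm \<Rightarrow> 'm"

text \<open>\<open>Comp C g f\<close> is the composite \<open>g \<circ> f\<close>; its value matters only for composable arrows.\<close>

definition Hom :: "('o, 'm, 'z) cat_scheme \<Rightarrow> 'o \<Rightarrow> 'o \<Rightarrow> 'm set" where
  "Hom C x y = {f \<in> Arr C. Dom C f = x \<and> Cod C f = y}"

definition category :: "('o, 'm, 'z) cat_scheme \<Rightarrow> bool" where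
  "category C \<longleftrightarrow>
     (\<forall>f\<in>Arr C. Dom C f \<in> Obj C \<and> Cod C f \<in> Obj C) \<and>
     (\<forall>x\<in>Obj C. Ident C x \<in> Hom C x x) \<and>
     (\<forall>f\<in>Arr C. \<forall>g\<in>Arr C. Dom C g = Cod C f \<longrightarrow> Comp C g f \<in> Hom C (Dom C f) (Cod C g)) \<and>
     (\<forall>f\<in>Arr C. Comp C f (Ident C (Dom C f)) = f \<and> Comp C (Ident C (Cod C f)) f = f) \<and>
     (\<forall>f\<in>Arr C. \<forall>g\<in>Arr C. \<forall>h\<in>Arr C. Dom C g = Cod C f \<longrightarrow> Dom C h = Cod C g \<longrightarrow>
        Comp C h (Comp C g f) = Comp C (Comp C h g) f)"

definition iso_arrows :: "('o, 'm, 'z) cat_scheme \<Rightarrow> 'm set" where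
  "iso_arrows C = {f \<in> Arr C. \<exists>g\<in>Hom C (Cod C f) (Dom C f).
     Comp C g f = Ident C (Dom C f) \<and> Comp C f g = Ident C (Cod C f)}"

definition Iso :: "('o, 'm, 'z) cat_scheme \<Rightarrow> 'o \<Rightarrow> 'o \<Rightarrow> 'm set" where
  "Iso C x y = Hom C x y \<inter> iso_arrows C"

text \<open>A functor is given by its object map and its arrow map.\<close>

definition is_functor :: "('o, 'm, 'z) cat_scheme \<Rightarrow> ('p, 'n, 'w) cat_scheme \<Rightarrow>
    ('o \<Rightarrow> 'p) \<times> ('m \<Rightarrow> 'n) \<Rightarrow> bool" where
  "is_functor C D F \<longleftrightarrow> category C \<and> category D \<and>
     (\<forall>x\<in>Obj C. fst F x \<in> Obj D) \<and>
     (\<forall>f\<in>Arr C. snd F f \<in> Hom D (fst F (Dom C f)) (fst F (Cod C f))) \<and>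
     (\<forall>x\<in>Obj C. snd F (Ident C x) = Ident D (fst F x)) \<and>
     (\<forall>f\<in>Arr C. \<forall>g\<in>Arr C. Dom C g = Cod C f \<longrightarrow>
        snd F (Comp C g f) = Comp D (snd F g) (snd F f))"

definition functor_comp :: "('p \<Rightarrow> 'q) \<times> ('n \<Rightarrow> 'k) \<Rightarrow> ('o \<Rightarrow> 'p) \<times> ('m \<Rightarrow> 'n) \<Rightarrow>
    ('o \<Rightarrow> 'q) \<times> ('m \<Rightarrow> 'k)" where
  "functor_comp G F = (fst G \<circ> fst F, snd G \<circ> snd F)"

definition natural_iso :: "('o, 'm, 'z) cat_scheme \<Rightarrow> ('p, 'n, 'w) cat_scheme \<Rightarrow>
    ('o \<Rightarrow> 'p) \<times> ('m \<Rightarrow> 'n) \<Rightarrow> ('o \<Rightarrow> 'p) \<times> ('m \<Rightarrow> 'n) \<Rightarrow> ('o \<Rightarrow> 'n) \<Rightarrow> bool" where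
  "natural_iso C D F G \<eta> \<longleftrightarrow>
     (\<forall>x\<in>Obj C. \<eta> x \<in> Iso D (fst F x) (fst G x)) \<and>
     (\<forall>f\<in>Arr C. Comp D (\<eta> (Cod C f)) (snd F f) = Comp D (snd G f) (\<eta> (Dom C f)))"

definition equivalent_categories :: "('o, 'm, 'z) cat_scheme \<Rightarrow> ('p, 'n, 'w) cat_scheme \<Rightarrow> bool" where
  "equivalent_categories C D \<longleftrightarrow> (\<exists>F G \<eta> \<epsilon>.
     is_functor C D F \<and> is_functor D C G \<and>
     natural_iso C C (id, id) (functor_comp G F) \<eta> \<and>
     natural_iso D D (functor_comp F G) (id, id) \<epsilon>)"

definition full_on_isos :: "('o, 'm, 'z) cat_scheme \<Rightarrow> ('p, 'n, 'w) cat_scheme \<Rightarrow>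
    ('o \<Rightarrow> 'p) \<times> ('m \<Rightarrow> 'n) \<Rightarrow> bool" where
  "full_on_isos C D F \<longleftrightarrow>
     (\<forall>x\<in>Obj C. \<forall>y\<in>Obj C. \<forall>t\<in>Iso D (fst F x) (fst F y). \<exists>h\<in>Hom C x y. snd F h = t)"

definition essential_image :: "('o, 'm, 'z) cat_scheme \<Rightarrow> ('p, 'n) cat \<Rightarrow>
    ('o \<Rightarrow> 'p) \<times> ('m \<Rightarrow> 'n) \<Rightarrow> ('p, 'n) cat" where
  "essential_image C D F = D\<lparr>
     Obj := {d \<in> Obj D. \<exists>c\<in>Obj C. Iso D (fst F c) d \<noteq> {}},
     Arr := {t \<in> Arr D. \<exists>h\<in>Arr C.
       \<exists>a\<in>Iso D (Dom D t) (fst F (Dom C h)). \<exists>b\<in>Iso D (fst F (Cod C h)) (Cod D t).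
         t = Comp D b (Comp D (snd F h) a)}\<rparr>"

text \<open>Right orthogonality of \<open>r\<close> to \<open>p\<close>, with unique diagonal.\<close>

definition orthogonal :: "('o, 'm, 'z) cat_scheme \<Rightarrow> 'm \<Rightarrow> 'm \<Rightarrow> bool" where
  "orthogonal C p r \<longleftrightarrow>
     (\<forall>u\<in>Hom C (Dom C p) (Dom C r). \<forall>v\<in>Hom C (Cod C p) (Cod C r).
        Comp C r u = Comp C v p \<longrightarrow>
        (\<exists>!d. d \<in> Hom C (Cod C p) (Dom C r) \<and> Comp C d p = u \<and> Comp C r d = v))"

definition factorization_system :: "('o, 'm, 'z) cat_scheme \<Rightarrow> 'm set \<Rightarrow> 'm set \<Rightarrow> bool" where
  "factorization_system C E M \<longleftrightarrow>
     E \<subseteq> Arr C \<and> M \<subseteq> Arr C \<and> iso_arrows C \<subseteq> E \<and> iso_arrows C \<subseteq> M \<and>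
     (\<forall>f\<in>E. \<forall>g\<in>E. Dom C g = Cod C f \<longrightarrow> Comp C g f \<in> E) \<and>
     (\<forall>f\<in>M. \<forall>g\<in>M. Dom C g = Cod C f \<longrightarrow> Comp C g f \<in> M) \<and>
     (\<forall>e\<in>E. \<forall>m\<in>M. orthogonal C e m) \<and>
     (\<forall>f\<in>Arr C. \<exists>e\<in>E. \<exists>m\<in>M. Dom C m = Cod C e \<and> f = Comp C m e)"


section \<open>Functions between finite ordinals\<close>

text \<open>The object \<open>(n]\<close> is \<open>{1..n}\<close>; functions are extensional, i.e. \<open>undefined\<close> off their domain.\<close>

definition Fun :: "nat \<Rightarrow> nat \<Rightarrow> (nat \<Rightarrow> nat) set" where
  "Fun n m = {1..n} \<rightarrow>\<^sub>E {1..m}"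

definition Surj :: "nat \<Rightarrow> nat \<Rightarrow> (nat \<Rightarrow> nat) set" where
  "Surj n m = {\<phi> \<in> Fun n m. \<phi> ` {1..n} = {1..m}}"

definition Inj :: "nat \<Rightarrow> nat \<Rightarrow> (nat \<Rightarrow> nat) set" where
  "Inj n m = {\<phi> \<in> Fun n m. inj_on \<phi> {1..n}}"

definition Sym :: "nat \<Rightarrow> (nat \<Rightarrow> nat) set" where
  "Sym n = {\<sigma> \<in> Fun n n. bij_betw \<sigma> {1..n} {1..n}}"

abbreviation idf :: "nat \<Rightarrow> nat \<Rightarrow> nat" where
  "idf n \<equiv> restrict id {1..n}"

text \<open>
  A sum \<open>(k 1] + (k 2] + \<dots>\<close> is identified with an initial segment of the positive naturals
  lexicographically: \<open>pos k j x\<close> is the element \<open>x\<close> of the \<open>j\<close>-th summand, and \<open>block k p\<close>,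
  \<open>offset k p\<close> recover \<open>j\<close> and \<open>x\<close> from \<open>p = pos k j x\<close>.
\<close>

definition pos :: "(nat \<Rightarrow> nat) \<Rightarrow> nat \<Rightarrow> nat \<Rightarrow> nat" where
  "pos k j x = (\<Sum>i=1..<j. k i) + x"

definition block :: "(nat \<Rightarrow> nat) \<Rightarrow> nat \<Rightarrow> nat" where
  "block k p = (LEAST j. p \<le> (\<Sum>i=1..j. k i))"

definition offset :: "(nat \<Rightarrow> nat) \<Rightarrow> nat \<Rightarrow> nat" where
  "offset k p = p - (\<Sum>i=1..<block k p. k i)"

text \<open>For \<open>\<phi> : (n] \<rightarrow> (m]\<close> and \<open>\<psi> i : (k i] \<rightarrow> (l i]\<close>, this is \<open>\<langle>\<psi>\<^sub>1, \<dots>, \<psi>\<^sub>m\<rangle> \<star> \<phi>\<close>.\<close>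

definition star :: "nat \<Rightarrow> (nat \<Rightarrow> nat) \<Rightarrow> (nat \<Rightarrow> nat) \<Rightarrow> (nat \<Rightarrow> nat) \<Rightarrow> (nat \<Rightarrow> nat \<Rightarrow> nat) \<Rightarrow>
    nat \<Rightarrow> nat" where
  "star n \<phi> k l \<psi> = (\<lambda>p\<in>{1..\<Sum>j=1..n. k (\<phi> j)}.
     let j = block (k \<circ> \<phi>) p; x = offset (k \<circ> \<phi>) p in pos l (\<phi> j) (\<psi> (\<phi> j) x))"

text \<open>The sum of \<open>\<psi> i : (k i] \<rightarrow> (l i]\<close> and the copairing of \<open>\<psi> i : (k i] \<rightarrow> (n]\<close>, for \<open>i \<in> (m]\<close>.\<close>

definition sum_fun :: "nat \<Rightarrow> (nat \<Rightarrow> nat) \<Rightarrow> (nat \<Rightarrow> nat) \<Rightarrow> (nat \<Rightarrow> nat \<Rightarrow> nat) \<Rightarrow> nat \<Rightarrow> nat" where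
  "sum_fun m k l \<psi> = (\<lambda>p\<in>{1..\<Sum>i=1..m. k i}. pos l (block k p) (\<psi> (block k p) (offset k p)))"

definition copair :: "nat \<Rightarrow> (nat \<Rightarrow> nat) \<Rightarrow> (nat \<Rightarrow> nat \<Rightarrow> nat) \<Rightarrow> nat \<Rightarrow> nat" where
  "copair m k \<psi> = (\<lambda>p\<in>{1..\<Sum>i=1..m. k i}. \<psi> (block k p) (offset k p))"


section \<open>Regular operads\<close>

definition tup :: "nat \<Rightarrow> (nat \<Rightarrow> 'a) \<Rightarrow> 'a list" where
  "tup n b = map b [1..<Suc n]"

text \<open>
  \<open>op_mult P [n\<^sub>1, \<dots>, n\<^sub>k] [b\<^sub>1, \<dots>, b\<^sub>k] a\<close> is \<open>\<langle>b\<^sub>1, \<dots>, b\<^sub>k\<rangle> * a\<close> and \<open>op_act P n m \<phi> a\<close> is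
  \<open>\<phi> \<cdot> a\<close>.  The arities are explicit arguments since the sets \<open>ops P n\<close> need not be disjoint.
\<close>

record 'a regop =
  ops :: "nat \<Rightarrow> 'a set"
  op_unit :: 'a
  op_mult :: "nat list \<Rightarrow> 'a list \<Rightarrow> 'a \<Rightarrow> 'a"
  op_act :: "nat \<Rightarrow> nat \<Rightarrow> (nat \<Rightarrow> nat) \<Rightarrow> 'a \<Rightarrow> 'a"

definition regular_operad :: "'a regop \<Rightarrow> bool" where
  "regular_operad P \<longleftrightarrow>
     op_unit P \<in> ops P 1 \<and>
     (\<forall>k n b a. (\<forall>i\<in>{1..k}. b i \<in> ops P (n i)) \<longrightarrow> a \<in> ops P k \<longrightarrow>
        op_mult P (tup k n) (tup k b) a \<in> ops P (\<Sum>i=1..k. n i)) \<and>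
     (\<forall>n m. \<forall>\<phi>\<in>Surj n m. \<forall>a\<in>ops P n. op_act P n m \<phi> a \<in> ops P m) \<and>
     (\<forall>n. \<forall>a\<in>ops P n. op_act P n n (idf n) a = a) \<and>
     (\<forall>n m l. \<forall>\<phi>\<in>Surj n m. \<forall>\<psi>\<in>Surj m l. \<forall>a\<in>ops P n.
        op_act P n l (compose {1..n} \<psi> \<phi>) a = op_act P m l \<psi> (op_act P n m \<phi> a)) \<and>
     (\<forall>k n q a b c. a \<in> ops P k \<longrightarrow> (\<forall>i\<in>{1..k}. b i \<in> ops P (n i)) \<longrightarrow>
        (\<forall>i\<in>{1..k}. \<forall>j\<in>{1..n i}. c i j \<in> ops P (q i j)) \<longrightarrow>
        op_mult P (concat (tup k (\<lambda>i. tup (n i) (q i)))) (concat (tup k (\<lambda>i. tup (n i) (c i))))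
          (op_mult P (tup k n) (tup k b) a) =
        op_mult P (tup k (\<lambda>i. \<Sum>j=1..n i. q i j))
          (tup k (\<lambda>i. op_mult P (tup (n i) (q i)) (tup (n i) (c i)) (b i))) a) \<and>
     (\<forall>n. \<forall>a\<in>ops P n. op_mult P [n] [a] (op_unit P) = a) \<and>
     (\<forall>n. \<forall>a\<in>ops P n. op_mult P (tup n (\<lambda>_. 1)) (tup n (\<lambda>_. op_unit P)) a = a) \<and>
     (\<forall>n m k l \<phi> \<psi> a b. \<phi> \<in> Surj n m \<longrightarrow> a \<in> ops P n \<longrightarrow>
        (\<forall>i\<in>{1..m}. \<psi> i \<in> Surj (k i) (l i) \<and> b i \<in> ops P (k i)) \<longrightarrow>
        op_mult P (tup m l) (tup m (\<lambda>i. op_act P (k i) (l i) (\<psi> i) (b i))) (op_act P n m \<phi> a) =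
        op_act P (\<Sum>j=1..n. k (\<phi> j)) (\<Sum>i=1..m. l i) (star n \<phi> k l \<psi>)
          (op_mult P (tup n (\<lambda>j. k (\<phi> j))) (tup n (\<lambda>j. b (\<phi> j))) a))"

definition regop_hom :: "'a regop \<Rightarrow> 'b regop \<Rightarrow> (nat \<Rightarrow> 'a \<Rightarrow> 'b) \<Rightarrow> bool" where
  "regop_hom P Q h \<longleftrightarrow>
     (\<forall>n. h n \<in> ops P n \<rightarrow>\<^sub>E ops Q n) \<and>
     h 1 (op_unit P) = op_unit Q \<and>
     (\<forall>k n b a. (\<forall>i\<in>{1..k}. b i \<in> ops P (n i)) \<longrightarrow> a \<in> ops P k \<longrightarrow>
        h (\<Sum>i=1..k. n i) (op_mult P (tup k n) (tup k b) a) =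
        op_mult Q (tup k n) (tup k (\<lambda>i. h (n i) (b i))) (h k a)) \<and>
     (\<forall>n m. \<forall>\<phi>\<in>Surj n m. \<forall>a\<in>ops P n. h m (op_act P n m \<phi> a) = op_act Q n m \<phi> (h n a))"

type_synonym 'a regop_arrow = "'a regop \<times> (nat \<Rightarrow> 'a \<Rightarrow> 'a) \<times> 'a regop"

definition RegOp :: "('a regop, 'a regop_arrow) cat" where
  "RegOp = \<lparr>
     Obj = {P. regular_operad P},
     Arr = {(P, h, Q). regular_operad P \<and> regular_operad Q \<and> regop_hom P Q h},
     Dom = (\<lambda>(P, h, Q). P),
     Cod = (\<lambda>(P, h, Q). Q),
     Ident = (\<lambda>P. (P, (\<lambda>n. restrict id (ops P n)), P)),
     Comp = (\<lambda>(Q', g, R) (P, f, Q). (P, (\<lambda>n. compose (ops P n) (g n) (f n)), R))\<rparr>"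


section \<open>Lawvere theories\<close>

record 'm lawvere = "(nat, 'm) cat" +
  Proj :: "nat \<Rightarrow> nat \<Rightarrow> 'm"

text \<open>
  The condition \<open>Proj T 1 1 = Ident T 1\<close> is what makes the opposite of the category of finite
  ordinals initial among Lawvere theories: there the projection of \<open>1\<close> to \<open>1\<close> is the identity,
  so it must be in the target of any interpretation.
\<close>

definition lawvere_theory :: "'m lawvere \<Rightarrow> bool" where
  "lawvere_theory T \<longleftrightarrow> category T \<and> Obj T = UNIV \<and>
     (\<forall>n. \<forall>i\<in>{1..n}. Proj T n i \<in> Hom T n 1) \<and>
     (\<forall>n k f. (\<forall>i\<in>{1..n}. f i \<in> Hom T k 1) \<longrightarrow>
        (\<exists>!h. h \<in> Hom T k n \<and> (\<forall>i\<in>{1..n}. Comp T (Proj T n i) h = f i))) \<and>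
     Proj T 1 1 = Ident T 1"

definition interpretation_of :: "'m lawvere \<Rightarrow> 'n lawvere \<Rightarrow> ('m \<Rightarrow> 'n) \<Rightarrow> bool" where
  "interpretation_of T T' I \<longleftrightarrow>
     I \<in> Arr T \<rightarrow>\<^sub>E Arr T' \<and>
     (\<forall>f\<in>Arr T. Dom T' (I f) = Dom T f \<and> Cod T' (I f) = Cod T f) \<and>
     (\<forall>n. I (Ident T n) = Ident T' n) \<and>
     (\<forall>f\<in>Arr T. \<forall>g\<in>Arr T. Dom T g = Cod T f \<longrightarrow> I (Comp T g f) = Comp T' (I g) (I f)) \<and>
     (\<forall>n. \<forall>i\<in>{1..n}. I (Proj T n i) = Proj T' n i)"

text \<open>
  The Lawvere theory \<open>\<F>\<^sup>o\<^sup>p\<close>: a triple \<open>(m, n, \<phi>)\<close> with \<open>\<phi> : (m] \<rightarrow> (n]\<close> is an arrow \<open>n \<rightarrow> m\<close>.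
\<close>

definition Fop :: "(nat \<times> nat \<times> (nat \<Rightarrow> nat)) lawvere" where
  "Fop = \<lparr>
     Obj = UNIV,
     Arr = {(m, n, \<phi>). \<phi> \<in> Fun m n},
     Dom = (\<lambda>(m, n, \<phi>). n),
     Cod = (\<lambda>(m, n, \<phi>). m),
     Ident = (\<lambda>n. (n, n, idf n)),
     Comp = (\<lambda>(l, m', \<psi>) (m, n, \<phi>). (l, n, compose {1..l} \<phi> \<psi>)),
     Proj = (\<lambda>n i. (1, n, \<lambda>_\<in>{1..1}. i))\<rparr>"

text \<open>The arrow \<open>\<pi>\<^sub>\<phi> : n \<rightarrow> m\<close> for \<open>\<phi> : (m] \<rightarrow> (n]\<close>.\<close>

definition pi_arrow :: "'m lawvere \<Rightarrow> nat \<Rightarrow> nat \<Rightarrow> (nat \<Rightarrow> nat) \<Rightarrow> 'm" where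
  "pi_arrow T m n \<phi> = (THE I. interpretation_of Fop T I) (m, n, \<phi>)"

definition projection_arrows :: "'m lawvere \<Rightarrow> 'm set" where
  "projection_arrows T = {p \<in> Arr T. \<exists>m n. \<exists>\<phi>\<in>Inj m n.
     \<exists>a\<in>Iso T (Dom T p) n. \<exists>b\<in>Iso T m (Cod T p).
       p = Comp T b (Comp T (pi_arrow T m n \<phi>) a)}"

definition regular_arrows :: "'m lawvere \<Rightarrow> 'm set" where
  "regular_arrows T = {r \<in> Arr T. \<forall>p\<in>projection_arrows T. orthogonal T p r}"

definition power_arrow :: "'m lawvere \<Rightarrow> nat \<Rightarrow> (nat \<Rightarrow> 'm) \<Rightarrow> 'm" where
  "power_arrow T n a = (THE h. h \<in> Hom T n n \<and>
     (\<forall>i\<in>{1..n}. Comp T (Proj T n i) h = Comp T (a i) (Proj T n i)))"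

definition simple_automorphisms :: "'m lawvere \<Rightarrow> bool" where
  "simple_automorphisms T \<longleftrightarrow> (\<forall>n.
     bij_betw (\<lambda>(\<sigma>, a). Comp T (power_arrow T n a) (pi_arrow T n n \<sigma>))
       (Sym n \<times> ({1..n} \<rightarrow>\<^sub>E Iso T 1 1)) (Iso T n n))"

definition regular_lawvere_theory :: "'m lawvere \<Rightarrow> bool" where
  "regular_lawvere_theory T \<longleftrightarrow> lawvere_theory T \<and>
     factorization_system T (projection_arrows T) (regular_arrows T) \<and> simple_automorphisms T"


section \<open>Spans and the functor \<open>\<P>\<^sub>f\<close>\<close>

text \<open>
  The span \<open>\<langle>\<phi>, f, g\<^sub>i\<rangle>\<close> from \<open>src = n\<close> to \<open>tgt = m\<close> with \<open>\<phi> = lleg\<close> and \<open>f = rleg\<close> defined on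
  \<open>(apex]\<close>.
\<close>

record 'a span =
  src :: nat
  tgt :: nat
  apex :: nat
  lleg :: "nat \<Rightarrow> nat"
  rleg :: "nat \<Rightarrow> nat"
  lab :: "nat \<Rightarrow> 'a"

definition fib :: "'a span \<Rightarrow> nat \<Rightarrow> nat set" where
  "fib s i = {x \<in> {1..apex s}. rleg s x = i}"

definition fcard :: "'a span \<Rightarrow> nat \<Rightarrow> nat" where
  "fcard s i = card (fib s i)"

definition is_prespan :: "'a regop \<Rightarrow> 'a span \<Rightarrow> bool" where
  "is_prespan P s \<longleftrightarrow>
     lleg s \<in> Fun (apex s) (src s) \<and>
     rleg s \<in> Fun (apex s) (tgt s) \<and> mono_on {1..apex s} (rleg s) \<and>
     lab s \<in> (\<Pi>\<^sub>E i\<in>{1..tgt s}. ops P (fcard s i))"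

definition is_span :: "'a regop \<Rightarrow> 'a span \<Rightarrow> bool" where
  "is_span P s \<longleftrightarrow> is_prespan P s \<and> (\<forall>i\<in>{1..tgt s}. inj_on (lleg s) (fib s i))"

definition span_rel :: "'a regop \<Rightarrow> ('a span \<times> 'a span) set" where
  "span_rel P = {(s, s'). is_span P s \<and> is_span P s' \<and>
     src s = src s' \<and> tgt s = tgt s' \<and> apex s = apex s' \<and> rleg s = rleg s' \<and>
     (\<exists>\<sigma>. (\<forall>i\<in>{1..tgt s}. \<sigma> i \<in> Sym (fcard s i) \<and>
              lab s i = op_act P (fcard s i) (fcard s i) (\<sigma> i) (lab s' i)) \<and>
          compose {1..apex s} (lleg s) (sum_fun (tgt s) (fcard s) (fcard s) \<sigma>) = lleg s')}"

text \<open>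
  \<open>t\<close> is a regularization of \<open>s\<close>.  As \<open>rleg s\<close> is monotone, the fibre over \<open>i\<close> is the \<open>i\<close>-th block
  of \<open>(apex s]\<close>, so that \<open>\<lambda>x. lleg s (pos (fcard s) i x)\<close> is the restriction of \<open>lleg s\<close> to it.
\<close>

definition is_regularization :: "'a regop \<Rightarrow> 'a span \<Rightarrow> 'a span \<Rightarrow> bool" where
  "is_regularization P s t \<longleftrightarrow> (\<exists>k \<phi> \<psi>.
     (\<forall>i\<in>{1..tgt s}. \<psi> i \<in> Surj (fcard s i) (k i) \<and> \<phi> i \<in> Inj (k i) (src s) \<and>
        (\<forall>x\<in>{1..fcard s i}. lleg s (pos (fcard s) i x) = \<phi> i (\<psi> i x))) \<and>
     t = \<lparr>src = src s, tgt = tgt s, apex = (\<Sum>i=1..tgt s. k i),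
          lleg = copair (tgt s) k \<phi>,
          rleg = (\<lambda>p\<in>{1..\<Sum>i=1..tgt s. k i}. block k p),
          lab = (\<lambda>i\<in>{1..tgt s}. op_act P (fcard s i) (k i) (\<psi> i) (lab s i))\<rparr>)"

text \<open>
  \<open>\<phi>\<close> and \<open>f\<close>, defined on \<open>(q]\<close>, form the pullback of \<open>rleg s\<close> and \<open>lleg s'\<close>, chosen with \<open>f\<close>
  monotone and \<open>\<phi>\<close> monotone on the fibres of \<open>f\<close>.
\<close>

definition is_pullback :: "'a span \<Rightarrow> 'a span \<Rightarrow> nat \<Rightarrow> (nat \<Rightarrow> nat) \<Rightarrow> (nat \<Rightarrow> nat) \<Rightarrow> bool" where
  "is_pullback s s' q \<phi> f \<longleftrightarrow>
     \<phi> \<in> Fun q (apex s) \<and> f \<in> Fun q (apex s') \<and>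
     bij_betw (\<lambda>p. (\<phi> p, f p)) {1..q}
       {(x, y). x \<in> {1..apex s} \<and> y \<in> {1..apex s'} \<and> rleg s x = lleg s' y} \<and>
     mono_on {1..q} f \<and>
     (\<forall>y\<in>{1..apex s'}. mono_on {p \<in> {1..q}. f p = y} \<phi>)"

text \<open>The composite of \<open>s : n \<rightarrow> m\<close> and \<open>s' : m \<rightarrow> k\<close> before regularization.\<close>

definition is_precomposite :: "'a regop \<Rightarrow> 'a span \<Rightarrow> 'a span \<Rightarrow> 'a span \<Rightarrow> bool" where
  "is_precomposite P s s' t \<longleftrightarrow> (\<exists>q \<phi> f. is_pullback s s' q \<phi> f \<and>
     t = \<lparr>src = src s, tgt = tgt s', apex = q,
          lleg = compose {1..q} (lleg s) \<phi>,
          rleg = compose {1..q} (rleg s') f,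
          lab = (\<lambda>j\<in>{1..tgt s'}. let ys = sorted_list_of_set (fib s' j) in
            op_mult P (map (\<lambda>y. fcard s (lleg s' y)) ys) (map (\<lambda>y. lab s (lleg s' y)) ys)
              (lab s' j))\<rparr>)"

definition id_span :: "'a regop \<Rightarrow> nat \<Rightarrow> 'a span" where
  "id_span P n = \<lparr>src = n, tgt = n, apex = n, lleg = idf n, rleg = idf n,
     lab = (\<lambda>_\<in>{1..n}. op_unit P)\<rparr>"

definition proj_span :: "'a regop \<Rightarrow> nat \<Rightarrow> nat \<Rightarrow> 'a span" where
  "proj_span P n i = \<lparr>src = n, tgt = 1, apex = 1, lleg = (\<lambda>_\<in>{1..1}. i), rleg = idf 1,
     lab = (\<lambda>_\<in>{1..1}. op_unit P)\<rparr>"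

definition Pf_obj :: "'a regop \<Rightarrow> 'a span set lawvere" where
  "Pf_obj P = \<lparr>
     Obj = UNIV,
     Arr = {s. is_span P s} // span_rel P,
     Dom = (\<lambda>A. THE n. \<forall>s\<in>A. src s = n),
     Cod = (\<lambda>A. THE m. \<forall>s\<in>A. tgt s = m),
     Ident = (\<lambda>n. span_rel P `` {id_span P n}),
     Comp = (\<lambda>B A. span_rel P `` {t. \<exists>s\<in>A. \<exists>s'\<in>B. \<exists>u.
       is_precomposite P s s' u \<and> is_regularization P u t}),
     Proj = (\<lambda>n i. span_rel P `` {proj_span P n i})\<rparr>"

definition map_span :: "(nat \<Rightarrow> 'a \<Rightarrow> 'a) \<Rightarrow> 'a span \<Rightarrow> 'a span" where
  "map_span h s = s\<lparr>lab := (\<lambda>i\<in>{1..tgt s}. h (fcard s i) (lab s i))\<rparr>"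

text \<open>
  Size convention.  An operad in \<open>RegOp\<close> has its elements in \<open>'a\<close>; the type \<open>'a span set\<close>, in which
  the arrows of \<open>Pf_obj P\<close> live, is larger.  Accordingly the category \<open>LT\<close> consists of the Lawvere
  theories on that type which have at most as many arrows as \<open>'a\<close> has elements.  For infinite \<open>'a\<close>,
  \<open>RegOp\<close> and \<open>LT\<close> thus contain, up to isomorphism, precisely the regular operads and the Lawvere
  theories of cardinality at most that of \<open>'a\<close>.
\<close>

type_synonym 'a theory_arrow =
  "'a span set lawvere \<times> ('a span set \<Rightarrow> 'a span set) \<times> 'a span set lawvere"

definition LT_objects :: "'a span set lawvere set" where
  "LT_objects = {T. lawvere_theory T \<and> Arr T \<lesssim> (UNIV :: 'a set)}"

definition LT :: "('a span set lawvere, 'a theory_arrow) cat" where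
  "LT = \<lparr>
     Obj = LT_objects,
     Arr = {(T, I, T'). T \<in> LT_objects \<and> T' \<in> LT_objects \<and> interpretation_of T T' I},
     Dom = (\<lambda>(T, I, T'). T),
     Cod = (\<lambda>(T, I, T'). T'),
     Ident = (\<lambda>T. (T, restrict id (Arr T), T)),
     Comp = (\<lambda>(T', J, T'') (T, I, S). (T, compose (Arr T) J I, T''))\<rparr>"

definition RegLT :: "('a span set lawvere, 'a theory_arrow) cat" where
  "RegLT = LT\<lparr>
     Obj := {T \<in> Obj LT. regular_lawvere_theory T},
     Arr := {(T, I, T') \<in> Arr LT. regular_lawvere_theory T \<and> regular_lawvere_theory T' \<and>
       I ` regular_arrows T \<subseteq> regular_arrows T'}\<rparr>"

definition Pf :: "('a regop \<Rightarrow> 'a span set lawvere) \<times> ('a regop_arrow \<Rightarrow> 'a theory_arrow)" where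
  "Pf = (Pf_obj, \<lambda>(P, h, Q).
     (Pf_obj P, \<lambda>A\<in>Arr (Pf_obj P). span_rel Q `` (map_span h ` A), Pf_obj Q))"

end

theory Submission
  imports Defs "HOL-Library.Nat_Bijection"
begin

text \<open>
  Factoring the left leg of a span through its image and letting the surjective part act on the
  labels, one sees that an arrow \<open>n \<rightarrow> 1\<close> of \<open>\<P>\<^sub>f(\<O>)\<close> is the same as a subset of \<open>(n]\<close>, its
  support, with an operation of as many variables.  Call a Lawvere theory presented by \<open>\<O>\<close> if
  its arrows into \<open>1\<close> have this form, compatibly with the operad structure.  The support of a
  composite is the union of the supports of the arrows substituted.  Therefore the isomorphisms
  of a presented theory are the permutations followed by automorphisms of \<open>1\<close>, an arrow is
  regular iff the supports of its components cover the source, the theory is regular, and its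
  regular arrows into \<open>1\<close> are exactly the operations.  So regular interpretations between
  presented theories are the same as morphisms of operads.

  Conversely, a regular Lawvere theory is presented by the operad of its regular arrows into \<open>1\<close>:
  existence and uniqueness of the normal form come from the factorization system.  Simple
  automorphisms exclude isomorphisms \<open>s : n \<rightarrow> m\<close> with \<open>n \<noteq> m\<close>, for \<open>s \<times> s\<^sup>-\<^sup>1\<close> is an
  automorphism of \<open>n + m\<close>.
\<close>


section \<open>Lexicographic sums of finite ordinals\<close>

text \<open>Spans enter only through a complete invariant: the monotone right leg cuts the apex into
  blocks, and the normal forms of the blocks make up a family. Enumerating supports in increasing
  order replaces the quotient by permutations. Composition of spans then becomes substitution of
  families, and what has to be shown is that substitution is independent of representatives and
  associative. Both are statements about sums of sums, which is why lexicographic sums come with a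
  calculus of coordinates.

  Presentations are formulated for an arbitrary theory because they arise in two ways, from the
  invariant for \<open>Pf_obj P\<close> and from the factorization system for a regular theory, and
  because they can be transported along isomorphisms. The transport shows that isomorphisms preserve
  regular arrows, whence fullness on isomorphisms.

  The passage from theories to operads has to name arrows by elements of \<open>'a\<close>: the
  cardinality bound in \<open>LT\<close> supplies the names, and infinity of \<open>'a\<close>
  ensures that \<open>Pf_obj P\<close> satisfies this bound.\<close>

definition cop :: "(nat \<Rightarrow> nat) \<Rightarrow> (nat \<Rightarrow> nat \<Rightarrow> 'b) \<Rightarrow> nat \<Rightarrow> 'b" where
  "cop k F p = F (block k p) (offset k p)"

text \<open>Partial sums are monotone, and since \<open>x\<close> is at least 1 the position lies
  strictly beyond all blocks before \<open>j\<close>; so no smaller index can reach it.\<close>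

lemma block_pos:
  assumes "1 \<le> j" "x \<in> {1..k j}"
  shows "block k (pos k j x) = j"
  unfolding block_def
proof (rule Least_equality)
  have "{1..j} = insert j {1..<j}" using assms by auto
  then show "pos k j x \<le> (\<Sum>i=1..j. k i)" using assms by (simp add: pos_def)
next
  fix y assume y: "pos k j x \<le> (\<Sum>i=1..y. k i)"
  show "j \<le> y"
  proof (rule ccontr)
    assume "\<not> j \<le> y"
    then have "{1..y} \<subseteq> {1..<j}" by auto
    then have "(\<Sum>i=1..y. k i) \<le> (\<Sum>i=1..<j. k i)" by (intro sum_mono2) auto
    with y assms show False by (simp add: pos_def)
  qed
qed

lemma offset_pos: "1 \<le> j \<Longrightarrow> x \<in> {1..k j} \<Longrightarrow> offset k (pos k j x) = x"
  by (simp add: offset_def block_pos) (simp add: pos_def)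

text \<open>The computation rule by which copairings are evaluated. Values in an arbitrary type let
  the same \<open>cop\<close> concatenate arities, labels, reindexings and arrows of a
  theory.\<close>

lemma cop_pos [simp]: "1 \<le> j \<Longrightarrow> 1 \<le> x \<Longrightarrow> x \<le> k j \<Longrightarrow> cop k F (pos k j x) = F j x"
  by (simp add: cop_def block_pos offset_pos)

text \<open>Coordinates (summand, element) for a position. Equations between functions on a sum are
  proved by passing to them and evaluating with \<open>cop_pos\<close>.\<close>

lemma pos_cases:
  assumes "p \<in> {1..\<Sum>i=1..m. k i}"
  obtains j x where "j \<in> {1..m}" "x \<in> {1..k j}" "p = pos k j x"
proof -
  have "\<exists>j x. j \<in> {1..m} \<and> x \<in> {1..k j} \<and> p = pos k j x"
    using assms
  proof (induction m)
    case (Suc m)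
    show ?case
    proof (cases "p \<le> (\<Sum>i=1..m. k i)")
      case True
      with Suc.prems have "p \<in> {1..\<Sum>i=1..m. k i}" by simp
      then obtain j x where "j \<in> {1..m} \<and> x \<in> {1..k j} \<and> p = pos k j x"
        using Suc.IH by blast
      then show ?thesis by (intro exI[of _ j] exI[of _ x]) auto
    next
      case False
      have "(\<Sum>i=1..<Suc m. k i) = (\<Sum>i=1..m. k i)"
        by (simp add: atLeastLessThanSuc_atLeastAtMost)
      with False Suc.prems show ?thesis
        by (intro exI[of _ "Suc m"] exI[of _ "p - (\<Sum>i=1..m. k i)"]) (auto simp: pos_def)
    qed
  qed auto
  then show ?thesis using that by blast
qed

lemma pos_less_pos:
  assumes "1 \<le> j" "j < j'" "x \<le> k j" "1 \<le> x'"
  shows "pos k j x < pos k j' x'"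
proof -
  have "(\<Sum>i=1..<j. k i) + k j = (\<Sum>i=1..<Suc j. k i)" using assms by simp
  also have "\<dots> \<le> (\<Sum>i=1..<j'. k i)" using assms by (intro sum_mono2) auto
  finally show ?thesis using assms by (simp add: pos_def)
qed

lemma pos_mem:
  assumes "j \<in> {1..m}" "x \<in> {1..k j}"
  shows "pos k j x \<in> {1..\<Sum>i=1..m. k i}"
proof -
  have "(\<Sum>i=1..<j. k i) + k j = (\<Sum>i=1..<Suc j. k i)" using assms by simp
  also have "\<dots> \<le> (\<Sum>i=1..m. k i)" using assms by (intro sum_mono2) auto
  finally show ?thesis using assms by (simp add: pos_def)
qed

lemma pos_inject:
  assumes "1 \<le> j" "x \<in> {1..k j}" "1 \<le> j'" "x' \<in> {1..k j'}" "pos k j x = pos k j' x'"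
  shows "j = j' \<and> x = x'"
  by (metis assms block_pos offset_pos)

text \<open>Identifies the ordinal sum with the disjoint union of its blocks, so that sums and
  images over it become iterated ones (\<open>sum_cop\<close>, \<open>cop_image\<close>).\<close>

lemma bij_betw_pos:
  "bij_betw (\<lambda>(j, x). pos k j x) (SIGMA j:{1..m}. {1..k j}) {1..\<Sum>i=1..m. k i}"
  unfolding bij_betw_def
proof
  show "inj_on (\<lambda>(j, x). pos k j x) (SIGMA j:{1..m}. {1..k j})"
  proof (rule inj_onI)
    fix z z'
    assume "z \<in> (SIGMA j:{1..m}. {1..k j})" "z' \<in> (SIGMA j:{1..m}. {1..k j})"
      and "(case z of (j, x) \<Rightarrow> pos k j x) = (case z' of (j, x) \<Rightarrow> pos k j x)"
    then show "z = z'"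
      using pos_inject[of "fst z" "snd z" k "fst z'" "snd z'"] by (auto simp: split_beta prod_eq_iff)
  qed
  show "(\<lambda>(j, x). pos k j x) ` (SIGMA j:{1..m}. {1..k j}) = {1..\<Sum>i=1..m. k i}"
  proof (intro set_eqI iffI)
    fix p assume "p \<in> {1..\<Sum>i=1..m. k i}"
    then show "p \<in> (\<lambda>(j, x). pos k j x) ` (SIGMA j:{1..m}. {1..k j})"
      by (rule pos_cases) auto
  qed (use pos_mem in \<open>auto\<close>)
qed

lemma sum_cop: "(\<Sum>p=1..\<Sum>i=1..m. k i. cop k F p) = (\<Sum>j=1..m. \<Sum>x=1..k j. F j x)"
  for F :: "nat \<Rightarrow> nat \<Rightarrow> nat"
proof -
  have "(\<Sum>j=1..m. \<Sum>x=1..k j. F j x) = (\<Sum>z\<in>(SIGMA j:{1..m}. {1..k j}). F (fst z) (snd z))"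
    by (simp add: sum.Sigma split_beta)
  also have "\<dots> = (\<Sum>z\<in>(SIGMA j:{1..m}. {1..k j}). cop k F (case z of (j, x) \<Rightarrow> pos k j x))"
    by (intro sum.cong) auto
  also have "\<dots> = (\<Sum>p=1..\<Sum>i=1..m. k i. cop k F p)"
    by (rule sum.reindex_bij_betw[OF bij_betw_pos])
  finally show ?thesis by simp
qed

lemma cop_cong:
  assumes "p \<in> {1..\<Sum>i=1..m. k i}" "\<And>j. j \<in> {1..m} \<Longrightarrow> k j = k' j"
    "\<And>j x. j \<in> {1..m} \<Longrightarrow> x \<in> {1..k j} \<Longrightarrow> F j x = F' j x"
  shows "cop k F p = cop k' F' p"
proof -
  obtain j x where jx: "j \<in> {1..m}" "x \<in> {1..k j}" "p = pos k j x"
    using assms(1) by (rule pos_cases)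
  \<comment> \<open>Agreement of \<open>k\<close> and \<open>k'\<close> up to \<open>m\<close>
    suffices, because the position of block \<open>j\<close> involves only earlier arities.\<close>
  have "(\<Sum>i=1..<j. k i) = (\<Sum>i=1..<j. k' i)" using jx assms(2) by (intro sum.cong) auto
  then have "pos k j x = pos k' j x" by (simp add: pos_def)
  then have "cop k' F' p = F' j x" using jx assms(2)[of j] by simp
  with jx assms(3)[of j x] show ?thesis by simp
qed

lemma cop_image: "cop k F ` {1..\<Sum>i=1..m. k i} = (\<Union>j\<in>{1..m}. F j ` {1..k j})"
proof -
  have "{1..\<Sum>i=1..m. k i} = (\<lambda>(j, x). pos k j x) ` (SIGMA j:{1..m}. {1..k j})"
    using bij_betw_pos by (metis bij_betw_def)
  then have "cop k F ` {1..\<Sum>i=1..m. k i} =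
      (\<lambda>z. cop k F (case z of (j, x) \<Rightarrow> pos k j x)) ` (SIGMA j:{1..m}. {1..k j})"
    by (simp add: image_image)
  also have "\<dots> = (\<lambda>z. F (fst z) (snd z)) ` (SIGMA j:{1..m}. {1..k j})"
    by (intro image_cong) auto
  also have "\<dots> = (\<Union>j\<in>{1..m}. F j ` {1..k j})" by force
  finally show ?thesis .
qed

lemma cop_pos_id: "p \<in> {1..\<Sum>i=1..m. k i} \<Longrightarrow> cop k (pos k) p = p"
  by (erule pos_cases) auto

lemma cop_one: "p \<in> {1..n} \<Longrightarrow> cop (\<lambda>_. 1) F p = F p 1"
  using cop_pos[of p 1 "\<lambda>_. 1" F] by (simp add: pos_def)

lemma pos_first: "pos k 1 x = x"
  by (simp add: pos_def)

lemma cop_first: "x \<in> {1..k 1} \<Longrightarrow> cop k F x = F 1 x"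
  using cop_pos[of 1 x k F] by (simp add: pos_def)

text \<open>Associativity of lexicographic sums in coordinates. The positions before summand
  \<open>(i, j)\<close> of the flat sum consist of the complete groups before \<open>i\<close>,
  counted by \<open>sum_cop\<close>, and of the summands before \<open>j\<close> in group
  \<open>i\<close>.\<close>

lemma pos_pos:
  assumes "1 \<le> i" "j \<in> {1..n i}"
  shows "pos (cop n q) (pos n i j) x = pos (\<lambda>i. \<Sum>j=1..n i. q i j) i (pos (q i) j x)"
proof -
  let ?s = "\<Sum>i'=1..<i. n i'"
  have eq: "{1..<i} = {1..i - 1}" using assms by auto
  have "{1..<pos n i j} = {1..?s} \<union> pos n i ` {1..<j}"
  proof (intro set_eqI iffI)
    fix p assume p: "p \<in> {1..<pos n i j}"
    show "p \<in> {1..?s} \<union> pos n i ` {1..<j}"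
    proof (cases "p \<le> ?s")
      case False
      with p show ?thesis by (intro UnI2 image_eqI[of _ _ "p - ?s"]) (auto simp: pos_def)
    qed (use p in auto)
  qed (use assms in \<open>auto simp: pos_def\<close>)
  then have "(\<Sum>p=1..<pos n i j. cop n q p) =
      (\<Sum>p=1..?s. cop n q p) + (\<Sum>p\<in>pos n i ` {1..<j}. cop n q p)"
    by (simp add: sum.union_disjoint disjoint_iff pos_def)
  also have "(\<Sum>p=1..?s. cop n q p) = (\<Sum>i'=1..<i. \<Sum>j=1..n i'. q i' j)"
    unfolding eq by (rule sum_cop)
  also have "(\<Sum>p\<in>pos n i ` {1..<j}. cop n q p) = (\<Sum>j'=1..<j. cop n q (pos n i j'))"
    by (subst sum.reindex) (auto simp: inj_on_def pos_def)
  also have "\<dots> = (\<Sum>j'=1..<j. q i j')"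
    using assms by (intro sum.cong) auto
  finally show ?thesis by (simp add: pos_def)
qed

text \<open>Associativity of copairing, read off from \<open>pos_pos\<close>; it matches nested with
  flattened reindexings.\<close>

lemma cop_cop:
  assumes "p \<in> {1..\<Sum>i=1..m. \<Sum>j=1..n i. q i j}"
  shows "cop (cop n q) (cop n F) p = cop (\<lambda>i. \<Sum>j=1..n i. q i j) (\<lambda>i. cop (q i) (F i)) p"
proof -
  obtain i y where i: "i \<in> {1..m}" "y \<in> {1..\<Sum>j=1..n i. q i j}"
    and p: "p = pos (\<lambda>i. \<Sum>j=1..n i. q i j) i y"
    using assms by (rule pos_cases)
  obtain j x where j: "j \<in> {1..n i}" "x \<in> {1..q i j}" and y: "y = pos (q i) j x"
    using i(2) by (rule pos_cases)
  have p': "p = pos (cop n q) (pos n i j) x" using i j by (simp add: p y pos_pos)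
  have "pos n i j \<in> {1..\<Sum>i=1..m. n i}" using i j by (intro pos_mem)
  with i j have "cop (cop n q) (cop n F) p = F i j x" by (simp add: p')
  moreover have "cop (\<lambda>i. \<Sum>j=1..n i. q i j) (\<lambda>i. cop (q i) (F i)) p = F i j x"
    using i j by (simp add: p y)
  ultimately show ?thesis by simp
qed

section \<open>Argument lists of the operad multiplication\<close>

lemma length_tup [simp]: "length (tup k f) = k"
  by (simp add: tup_def)

lemma nth_tup [simp]: "i < k \<Longrightarrow> tup k f ! i = f (Suc i)"
  by (simp add: tup_def del: upt_Suc)

lemma tup_cong: "(\<And>i. i \<in> {1..k} \<Longrightarrow> f i = g i) \<Longrightarrow> tup k f = tup k g"
  by (auto simp: tup_def)

lemma tup_Suc: "tup (Suc k) f = tup k f @ [f (Suc k)]"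
  by (simp add: tup_def)

lemma tup_add: "tup (a + b) f = tup a f @ tup b (\<lambda>x. f (a + x))"
  by (induction b) (simp_all add: tup_Suc tup_def[of 0])

text \<open>Translates the concatenated argument lists in the associativity law of operads into
  copairings.\<close>

lemma concat_tup: "concat (tup k (\<lambda>i. tup (n i) (q i))) = tup (\<Sum>i=1..k. n i) (cop n q)"
proof (induction k)
  case (Suc k)
  have "tup (n (Suc k)) (q (Suc k)) = tup (n (Suc k)) (\<lambda>x. cop n q ((\<Sum>i=1..k. n i) + x))"
  proof (rule tup_cong)
    fix x assume "x \<in> {1..n (Suc k)}"
    then have "cop n q (pos n (Suc k) x) = q (Suc k) x" by simp
    then show "q (Suc k) x = cop n q ((\<Sum>i=1..k. n i) + x)"
      by (simp add: pos_def atLeastLessThanSuc_atLeastAtMost)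
  qed
  with Suc show ?case by (simp add: tup_Suc tup_add)
qed (simp add: tup_def)


section \<open>Enumeration of finite sets\<close>

text \<open>List entries are counted from 0, elements of \<open>(n]\<close> from 1, hence
  \<open>i - 1\<close>. The increasing order is a canonical choice among the bijections onto
  \<open>A\<close>, and it makes the enumeration of \<open>{1..n}\<close> the identity.\<close>

definition enum :: "nat set \<Rightarrow> nat \<Rightarrow> nat" where
  "enum A i = sorted_list_of_set A ! (i - 1)"

definition rank :: "nat set \<Rightarrow> nat \<Rightarrow> nat" where
  "rank A = inv_into {1..card A} (enum A)"

lemma bij_betw_enum:
  assumes "finite A"
  shows "bij_betw (enum A) {1..card A} A"
proof -
  have "bij_betw ((!) (sorted_list_of_set A)) {..<card A} A"
    using assms by (intro bij_betw_nth) auto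
  moreover have "bij_betw (\<lambda>i. i - 1) {1..card A} {..<card A}"
    by (rule bij_betw_byWitness[of _ Suc]) auto
  ultimately have "bij_betw ((!) (sorted_list_of_set A) \<circ> (\<lambda>i. i - 1)) {1..card A} A"
    by (rule bij_betw_trans[rotated])
  then show ?thesis by (simp add: enum_def[abs_def] comp_def)
qed

lemma bij_betw_rank: "finite A \<Longrightarrow> bij_betw (rank A) A {1..card A}"
  unfolding rank_def by (intro bij_betw_inv_into bij_betw_enum)

lemma enum_rank: "finite A \<Longrightarrow> x \<in> A \<Longrightarrow> enum A (rank A x) = x"
  unfolding rank_def using bij_betw_enum bij_betw_inv_into_right by metis

lemma rank_enum: "finite A \<Longrightarrow> i \<in> {1..card A} \<Longrightarrow> rank A (enum A i) = i"
  unfolding rank_def using bij_betw_enum bij_betw_inv_into_left by metis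

lemma enum_mem: "finite A \<Longrightarrow> i \<in> {1..card A} \<Longrightarrow> enum A i \<in> A"
  using bij_betw_enum bij_betwE by metis

lemma rank_mem: "finite A \<Longrightarrow> x \<in> A \<Longrightarrow> rank A x \<in> {1..card A}"
  using bij_betw_rank bij_betwE by metis

lemma enum_interval: "i \<in> {1..n} \<Longrightarrow> enum {1..n} i = i"
proof -
  have "{1..n} = {1..<Suc n}" by auto
  then have "sorted_list_of_set {1..n} = [1..<Suc n]" by (metis sorted_list_of_set_range)
  then show "i \<in> {1..n} \<Longrightarrow> enum {1..n} i = i" by (simp add: enum_def del: upt_Suc)
qed

lemma enum_singleton: "i \<in> {1..Suc 0} \<Longrightarrow> enum {x} i = x"
  using enum_mem[of "{x}" i] by simp

lemma enum_image: "finite A \<Longrightarrow> enum A ` {1..card A} = A"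
  by (rule bij_betw_imp_surj_on[OF bij_betw_enum])


text \<open>Keeps the object \<open>1\<close> from being rewritten to \<open>Suc 0\<close>, so that
  statements about arrows into \<open>1\<close> match.\<close>

declare One_nat_def [simp del]

section \<open>Orthogonality and isomorphisms\<close>

locale cate =
  fixes C :: "('o, 'm, 'z) cat_scheme"
  assumes category: "category C"
begin

abbreviation comp (infixr "\<bullet>" 70) where "g \<bullet> f \<equiv> Comp C g f"
abbreviation hom where "hom x y \<equiv> Hom C x y"
abbreviation one where "one x \<equiv> Ident C x"

lemma arr_hom: "f \<in> Arr C \<Longrightarrow> f \<in> hom (Dom C f) (Cod C f)"
  by (simp add: Hom_def)

lemma homD: "f \<in> hom x y \<Longrightarrow> f \<in> Arr C \<and> Dom C f = x \<and> Cod C f = y"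
  by (simp add: Hom_def)

lemma hom_obj: "f \<in> hom x y \<Longrightarrow> x \<in> Obj C \<and> y \<in> Obj C"
  using category by (auto simp: Hom_def category_def)

lemma one_hom: "x \<in> Obj C \<Longrightarrow> one x \<in> hom x x"
  using category by (simp add: category_def)

lemma comp_hom: "f \<in> hom x y \<Longrightarrow> g \<in> hom y z \<Longrightarrow> g \<bullet> f \<in> hom x z"
  using category unfolding category_def by (metis homD)

lemma comp_assoc:
  "f \<in> hom x y \<Longrightarrow> g \<in> hom y z \<Longrightarrow> h \<in> hom z w \<Longrightarrow> (h \<bullet> g) \<bullet> f = h \<bullet> g \<bullet> f"
  using category unfolding category_def by (metis homD)

lemma comp_one: "f \<in> hom x y \<Longrightarrow> f \<bullet> one x = f"
  and one_comp: "f \<in> hom x y \<Longrightarrow> one y \<bullet> f = f"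
  using category unfolding category_def by (metis homD)+

lemma arr_comp: "f \<in> Arr C \<Longrightarrow> g \<in> Arr C \<Longrightarrow> Dom C g = Cod C f \<Longrightarrow> g \<bullet> f \<in> Arr C"
  and dom_comp: "f \<in> Arr C \<Longrightarrow> g \<in> Arr C \<Longrightarrow> Dom C g = Cod C f \<Longrightarrow> Dom C (g \<bullet> f) = Dom C f"
  and cod_comp: "f \<in> Arr C \<Longrightarrow> g \<in> Arr C \<Longrightarrow> Dom C g = Cod C f \<Longrightarrow> Cod C (g \<bullet> f) = Cod C g"
  using comp_hom[of f "Dom C f" "Cod C f" g "Cod C g"] by (auto simp: Hom_def)

lemma assoc: "f \<in> Arr C \<Longrightarrow> g \<in> Arr C \<Longrightarrow> h \<in> Arr C \<Longrightarrow> Dom C g = Cod C f \<Longrightarrow>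
    Dom C h = Cod C g \<Longrightarrow> (h \<bullet> g) \<bullet> f = h \<bullet> g \<bullet> f"
  using category unfolding category_def by metis

lemma unit_left: "f \<in> Arr C \<Longrightarrow> Cod C f = y \<Longrightarrow> one y \<bullet> f = f"
  and unit_right: "f \<in> Arr C \<Longrightarrow> Dom C f = x \<Longrightarrow> f \<bullet> one x = f"
  using category unfolding category_def by metis+

lemmas arrow_simps = Hom_def arr_comp dom_comp cod_comp assoc unit_left unit_right

text \<open>\<open>arrow_simps\<close> associates to the right, so an inverse pair usually meets in
  front of a third arrow; in this form the pair can be cancelled there.\<close>

lemma cancel_left:
  assumes "g \<bullet> f = one x" "f \<in> hom x y" "g \<in> hom y x" "h \<in> Arr C" "Cod C h = x"
  shows "g \<bullet> f \<bullet> h = h"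
  using assms assoc[of h f g] by (simp add: Hom_def unit_left)

lemma Iso_iff: "f \<in> Iso C x y \<longleftrightarrow> f \<in> hom x y \<and> (\<exists>g\<in>hom y x. g \<bullet> f = one x \<and> f \<bullet> g = one y)"
  by (auto simp: Iso_def iso_arrows_def Hom_def)

lemma iso_arrows_iff: "f \<in> iso_arrows C \<longleftrightarrow> f \<in> Arr C \<and> f \<in> Iso C (Dom C f) (Cod C f)"
  by (auto simp: Iso_def iso_arrows_def Hom_def)

lemma IsoI: "f \<in> hom x y \<Longrightarrow> g \<in> hom y x \<Longrightarrow> g \<bullet> f = one x \<Longrightarrow> f \<bullet> g = one y \<Longrightarrow> f \<in> Iso C x y"
  by (auto simp: Iso_iff)

lemma Iso_hom: "f \<in> Iso C x y \<Longrightarrow> f \<in> hom x y"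
  by (simp add: Iso_iff)

lemma Iso_inverse:
  assumes "f \<in> Iso C x y"
  obtains g where "g \<in> Iso C y x" "g \<bullet> f = one x" "f \<bullet> g = one y"
  using assms by (auto simp: Iso_iff)

lemma Iso_one: "x \<in> Obj C \<Longrightarrow> one x \<in> Iso C x x"
  using one_hom comp_one by (auto intro!: IsoI)

lemma Iso_comp:
  assumes "f \<in> Iso C x y" "g \<in> Iso C y z"
  shows "g \<bullet> f \<in> Iso C x z"
proof -
  obtain f' where f': "f' \<in> hom y x" "f' \<bullet> f = one x" "f \<bullet> f' = one y"
    using assms by (auto simp: Iso_iff)
  obtain g' where g': "g' \<in> hom z y" "g' \<bullet> g = one y" "g \<bullet> g' = one z"
    using assms by (auto simp: Iso_iff)
  have fg: "f \<in> hom x y" "g \<in> hom y z" using assms by (auto dest: Iso_hom)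
  note [simp] = arrow_simps f' g' cancel_left[OF g'(2) fg(2) g'(1)] cancel_left[OF f'(3) f'(1) fg(1)]
  show ?thesis
    by (rule IsoI[of _ _ _ "f' \<bullet> g'"]) (use fg f' g' in auto)
qed

lemma orthogonal_iff:
  assumes "p \<in> hom x y" "r \<in> hom z w"
  shows "orthogonal C p r \<longleftrightarrow> (\<forall>u\<in>hom x z. \<forall>v\<in>hom y w. r \<bullet> u = v \<bullet> p \<longrightarrow>
    (\<exists>!d. d \<in> hom y z \<and> d \<bullet> p = u \<and> r \<bullet> d = v))"
  using homD[OF assms(1)] homD[OF assms(2)] by (simp add: orthogonal_def)

text \<open>Lift twice: the square against \<open>r'\<close> with upper side
  \<open>r \<bullet> u\<close> has a diagonal \<open>e\<close>, which becomes the lower side of a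
  square against \<open>r\<close>. Following a diagonal for the composite by \<open>r\<close> gives
  a diagonal of the first square, so both uniqueness statements apply.\<close>

lemma orthogonal_comp:
  assumes "p \<in> hom x y" "r \<in> hom z w" "r' \<in> hom w t" "orthogonal C p r" "orthogonal C p r'"
  shows "orthogonal C p (r' \<bullet> r)"
proof -
  note [simp] = arrow_simps
  have "\<exists>!d. d \<in> hom y z \<and> d \<bullet> p = u \<and> (r' \<bullet> r) \<bullet> d = v"
    if u: "u \<in> hom x z" and v: "v \<in> hom y t" and eq: "(r' \<bullet> r) \<bullet> u = v \<bullet> p" for u v
  proof -
    have ru: "r \<bullet> u \<in> hom x w" and eq': "r' \<bullet> r \<bullet> u = v \<bullet> p" using eq u assms by auto
    have "\<exists>!e. e \<in> hom y w \<and> e \<bullet> p = r \<bullet> u \<and> r' \<bullet> e = v"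
      using assms(5) ru v eq' unfolding orthogonal_iff[OF assms(1,3)] by blast
    then obtain e where e: "e \<in> hom y w" "e \<bullet> p = r \<bullet> u" "r' \<bullet> e = v"
        and e': "\<And>e'. e' \<in> hom y w \<Longrightarrow> e' \<bullet> p = r \<bullet> u \<Longrightarrow> r' \<bullet> e' = v \<Longrightarrow> e' = e"
      by blast
    have "\<exists>!d. d \<in> hom y z \<and> d \<bullet> p = u \<and> r \<bullet> d = e"
      using assms(4) u e(1) e(2)[symmetric] unfolding orthogonal_iff[OF assms(1,2)] by blast
    then obtain d where d: "d \<in> hom y z" "d \<bullet> p = u" "r \<bullet> d = e"
        and d': "\<And>d'. d' \<in> hom y z \<Longrightarrow> d' \<bullet> p = u \<Longrightarrow> r \<bullet> d' = e \<Longrightarrow> d' = d"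
      by blast
    show ?thesis
    proof (rule ex1I[of _ d])
      show "d \<in> hom y z \<and> d \<bullet> p = u \<and> (r' \<bullet> r) \<bullet> d = v"
        using d e assms by auto
      fix f assume f: "f \<in> hom y z \<and> f \<bullet> p = u \<and> (r' \<bullet> r) \<bullet> f = v"
      then have "r \<bullet> f = e" using assms by (intro e') auto
      then show "f = d" using d' f by blast
    qed
  qed
  then show ?thesis
    unfolding orthogonal_iff[OF assms(1) comp_hom[OF assms(2,3)]] by blast
qed

text \<open>The diagonal can only be \<open>r' \<bullet> v\<close> with \<open>r'\<close> the
  inverse of \<open>r\<close>.\<close>

lemma orthogonal_Iso:
  assumes p: "p \<in> hom x y" and r: "r \<in> Iso C z w"
  shows "orthogonal C p r"
proof -
  obtain r' where r': "r' \<in> hom w z" "r' \<bullet> r = one z" "r \<bullet> r' = one w" and rh: "r \<in> hom z w"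
    using r by (auto simp: Iso_iff)
  have "\<exists>!d. d \<in> hom y z \<and> d \<bullet> p = u \<and> r \<bullet> d = v"
    if u: "u \<in> hom x z" and v: "v \<in> hom y w" and eq: "r \<bullet> u = v \<bullet> p" for u v
  proof (rule ex1I[of _ "r' \<bullet> v"], intro conjI)
    show "r' \<bullet> v \<in> hom y z" by (rule comp_hom[OF v r'(1)])
    have "(r' \<bullet> v) \<bullet> p = r' \<bullet> r \<bullet> u" unfolding eq using p v r' by (simp add: arrow_simps)
    then show "(r' \<bullet> v) \<bullet> p = u" using u by (simp add: Hom_def cancel_left[OF r'(2) rh r'(1)])
    show "r \<bullet> r' \<bullet> v = v" using v by (simp add: Hom_def cancel_left[OF r'(3) r'(1) rh])
    fix d assume d: "d \<in> hom y z \<and> d \<bullet> p = u \<and> r \<bullet> d = v"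
    then have "r' \<bullet> r \<bullet> d = d" by (intro cancel_left[OF r'(2) rh r'(1)]) (simp_all add: Hom_def)
    with d show "d = r' \<bullet> v" by simp
  qed
  then show ?thesis unfolding orthogonal_iff[OF p rh] by blast
qed

text \<open>Projection arrows are closed under isomorphism on both sides by definition; this reduces
  their orthogonality to that of the reindexings. A square for the conjugate becomes one for
  \<open>p\<close> when \<open>u\<close> is composed with the inverse of \<open>a\<close> and
  \<open>v\<close> with \<open>b\<close>; composing its diagonal with the inverse of
  \<open>b\<close> returns the diagonal sought.\<close>

lemma orthogonal_conjugate:
  assumes p: "p \<in> hom x y" and r: "r \<in> hom z w" and a: "a \<in> Iso C x' x" and b: "b \<in> Iso C y y'"
    and orth: "orthogonal C p r"
  shows "orthogonal C (b \<bullet> p \<bullet> a) r"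
proof -
  obtain a' where a': "a' \<in> hom x x'" "a' \<bullet> a = one x'" "a \<bullet> a' = one x" and ah: "a \<in> hom x' x"
    using a by (auto simp: Iso_iff)
  obtain b' where b': "b' \<in> hom y' y" "b' \<bullet> b = one y" "b \<bullet> b' = one y'" and bh: "b \<in> hom y y'"
    using b by (auto simp: Iso_iff)
  note [simp] = arrow_simps cancel_left[OF b'(2) bh b'(1)]
  have "\<exists>!d. d \<in> hom y' z \<and> d \<bullet> b \<bullet> p \<bullet> a = u \<and> r \<bullet> d = v"
    if u: "u \<in> hom x' z" and v: "v \<in> hom y' w" and eq: "r \<bullet> u = v \<bullet> b \<bullet> p \<bullet> a" for u v
  proof -
    have "r \<bullet> u \<bullet> a' = (r \<bullet> u) \<bullet> a'" using u r a' by simp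
    also have "\<dots> = (v \<bullet> b) \<bullet> p" unfolding eq using v bh p a' ah by simp
    finally have "\<exists>!d. d \<in> hom y z \<and> d \<bullet> p = u \<bullet> a' \<and> r \<bullet> d = v \<bullet> b"
      using orth comp_hom[OF a'(1) u] comp_hom[OF bh v] unfolding orthogonal_iff[OF p r] by blast
    then obtain d where d: "d \<in> hom y z" "d \<bullet> p = u \<bullet> a'" "r \<bullet> d = v \<bullet> b"
        and d': "\<And>d'. d' \<in> hom y z \<Longrightarrow> d' \<bullet> p = u \<bullet> a' \<Longrightarrow> r \<bullet> d' = v \<bullet> b \<Longrightarrow> d' = d"
      by blast
    show ?thesis
    proof (rule ex1I[of _ "d \<bullet> b'"], intro conjI)
      show "d \<bullet> b' \<in> hom y' z" using d b' comp_hom by blast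
      have "(d \<bullet> b') \<bullet> b \<bullet> p \<bullet> a = (d \<bullet> p) \<bullet> a" using d(1) b' bh p ah by simp
      then show "(d \<bullet> b') \<bullet> b \<bullet> p \<bullet> a = u" unfolding d(2) using u a' ah by simp
      have "r \<bullet> d \<bullet> b' = (r \<bullet> d) \<bullet> b'" using r d(1) b' by simp
      then show "r \<bullet> d \<bullet> b' = v" unfolding d(3) using v b' bh by simp
    next
      fix f assume "f \<in> hom y' z \<and> f \<bullet> b \<bullet> p \<bullet> a = u \<and> r \<bullet> f = v"
      then have f: "f \<in> hom y' z" and fu: "f \<bullet> b \<bullet> p \<bullet> a = u" and fv: "r \<bullet> f = v" by auto
      have "f \<bullet> b = d"
      proof (rule d')
        show "f \<bullet> b \<in> hom y z" using f bh comp_hom by blast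
        have "(f \<bullet> b) \<bullet> p = (f \<bullet> b \<bullet> p \<bullet> a) \<bullet> a'" using p ah a' f bh by simp
        then show "(f \<bullet> b) \<bullet> p = u \<bullet> a'" by (simp only: fu)
        have "r \<bullet> f \<bullet> b = (r \<bullet> f) \<bullet> b" using f bh r by simp
        then show "r \<bullet> f \<bullet> b = v \<bullet> b" by (simp only: fv)
      qed
      moreover have "(f \<bullet> b) \<bullet> b' = f" using f bh b' by simp
      ultimately show "f = d \<bullet> b'" by simp
    qed
  qed
  then show ?thesis
    unfolding orthogonal_iff[OF comp_hom[OF comp_hom[OF ah p] bh] r] by blast
qed

end


section \<open>Lawvere theories\<close>

locale law = cate T for T :: "'m lawvere" +
  assumes lawvere_theory: "lawvere_theory T"
begin

notation comp (infixr "\<bullet>" 70)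

abbreviation proj where "proj n i \<equiv> Proj T n i"

definition tuple :: "nat \<Rightarrow> nat \<Rightarrow> (nat \<Rightarrow> 'm) \<Rightarrow> 'm" where
  "tuple k n f = (THE h. h \<in> hom k n \<and> (\<forall>i\<in>{1..n}. proj n i \<bullet> h = f i))"

text \<open>\<open>pr m n \<phi>\<close> is \<open>\<pi>\<^sub>\<phi> : n \<rightarrow> m\<close>; only the values of \<open>\<phi>\<close> on \<open>{1..m}\<close> matter.\<close>

definition pr :: "nat \<Rightarrow> nat \<Rightarrow> (nat \<Rightarrow> nat) \<Rightarrow> 'm" where
  "pr m n \<phi> = tuple n m (\<lambda>i. proj n (\<phi> i))"

text \<open>The product \<open>f 1 \<times> \<dots> \<times> f k\<close> of arrows \<open>f i : n i \<rightarrow> 1\<close>.\<close>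

definition par :: "nat \<Rightarrow> (nat \<Rightarrow> nat) \<Rightarrow> (nat \<Rightarrow> 'm) \<Rightarrow> 'm" where
  "par k n f = tuple (\<Sum>i=1..k. n i) k (\<lambda>i. f i \<bullet> pr (n i) (\<Sum>i=1..k. n i) (pos n i))"

lemma Obj_T [simp]: "Obj T = UNIV"
  using lawvere_theory by (simp add: lawvere_theory_def)

lemma proj_hom: "i \<in> {1..n} \<Longrightarrow> proj n i \<in> hom n 1"
  using lawvere_theory by (simp add: lawvere_theory_def)

lemma proj_one: "proj 1 1 = one 1"
  using lawvere_theory by (simp add: lawvere_theory_def)

lemma tuple_ex1:
  assumes "\<And>i. i \<in> {1..n} \<Longrightarrow> f i \<in> hom k 1"
  shows "\<exists>!h. h \<in> hom k n \<and> (\<forall>i\<in>{1..n}. proj n i \<bullet> h = f i)"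
proof -
  have "\<forall>n k f. (\<forall>i\<in>{1..n}. f i \<in> hom k 1) \<longrightarrow>
      (\<exists>!h. h \<in> hom k n \<and> (\<forall>i\<in>{1..n}. proj n i \<bullet> h = f i))"
    using lawvere_theory unfolding lawvere_theory_def by blast
  with assms show ?thesis by blast
qed

lemma tuple_hom: "(\<And>i. i \<in> {1..n} \<Longrightarrow> f i \<in> hom k 1) \<Longrightarrow> tuple k n f \<in> hom k n"
  and proj_tuple: "(\<And>i. i \<in> {1..n} \<Longrightarrow> f i \<in> hom k 1) \<Longrightarrow> j \<in> {1..n} \<Longrightarrow>
    proj n j \<bullet> tuple k n f = f j"
  using theI'[OF tuple_ex1[of n f k]] unfolding tuple_def by auto

lemma proj_comp_hom: "h \<in> hom k n \<Longrightarrow> i \<in> {1..n} \<Longrightarrow> proj n i \<bullet> h \<in> hom k 1"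
  using comp_hom proj_hom by blast

lemma hom_eqI:
  assumes "h \<in> hom k n" "h' \<in> hom k n" "\<And>i. i \<in> {1..n} \<Longrightarrow> proj n i \<bullet> h = proj n i \<bullet> h'"
  shows "h = h'"
proof -
  have "\<exists>!g. g \<in> hom k n \<and> (\<forall>i\<in>{1..n}. proj n i \<bullet> g = proj n i \<bullet> h')"
    by (rule tuple_ex1) (rule proj_comp_hom[OF assms(2)])
  moreover have "h \<in> hom k n \<and> (\<forall>i\<in>{1..n}. proj n i \<bullet> h = proj n i \<bullet> h')"
    "h' \<in> hom k n \<and> (\<forall>i\<in>{1..n}. proj n i \<bullet> h' = proj n i \<bullet> h')"
    using assms by auto
  ultimately show ?thesis by blast
qed

lemma tuple_proj:
  assumes "h \<in> hom k n"
  shows "tuple k n (\<lambda>i. proj n i \<bullet> h) = h"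
proof (rule hom_eqI[OF tuple_hom])
  show "\<And>i. i \<in> {1..n} \<Longrightarrow> proj n i \<bullet> tuple k n (\<lambda>i. proj n i \<bullet> h) = proj n i \<bullet> h"
    by (rule proj_tuple[OF proj_comp_hom[OF assms]])
qed (use assms proj_comp_hom in auto)

lemma tuple_cong: "(\<And>i. i \<in> {1..n} \<Longrightarrow> f i = g i) \<Longrightarrow> tuple k n f = tuple k n g"
  by (simp add: tuple_def)

lemma hom_zero: "h \<in> hom k 0 \<Longrightarrow> h' \<in> hom k 0 \<Longrightarrow> h = h'"
  by (rule hom_eqI) auto

lemma tuple_comp:
  assumes f: "\<And>i. i \<in> {1..n} \<Longrightarrow> f i \<in> hom k 1" and g: "g \<in> hom l k"
  shows "tuple k n f \<bullet> g = tuple l n (\<lambda>i. f i \<bullet> g)"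
proof (rule hom_eqI)
  have fg: "\<And>i. i \<in> {1..n} \<Longrightarrow> f i \<bullet> g \<in> hom l 1" by (rule comp_hom[OF g f])
  show "tuple k n f \<bullet> g \<in> hom l n" "tuple l n (\<lambda>i. f i \<bullet> g) \<in> hom l n"
    by (rule comp_hom[OF g tuple_hom[OF f]], simp, rule tuple_hom[OF fg])
  fix i assume i: "i \<in> {1..n}"
  have "proj n i \<bullet> tuple k n f \<bullet> g = (proj n i \<bullet> tuple k n f) \<bullet> g"
    using comp_assoc[OF g tuple_hom proj_hom, of n f i] f i by simp
  then show "proj n i \<bullet> tuple k n f \<bullet> g = proj n i \<bullet> tuple l n (\<lambda>i. f i \<bullet> g)"
    by (simp only: proj_tuple[OF f i] proj_tuple[OF fg i])
qed

lemma proj_comp_comp: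
  "h \<in> hom k n \<Longrightarrow> g \<in> hom l k \<Longrightarrow> i \<in> {1..n} \<Longrightarrow> proj n i \<bullet> h \<bullet> g = (proj n i \<bullet> h) \<bullet> g"
  using comp_assoc proj_hom by metis

lemma pr_hom: "\<phi> \<in> {1..m} \<rightarrow> {1..n} \<Longrightarrow> pr m n \<phi> \<in> hom n m"
  unfolding pr_def by (intro tuple_hom proj_hom) auto

lemma proj_pr: "\<phi> \<in> {1..m} \<rightarrow> {1..n} \<Longrightarrow> i \<in> {1..m} \<Longrightarrow> proj m i \<bullet> pr m n \<phi> = proj n (\<phi> i)"
  unfolding pr_def by (intro proj_tuple proj_hom) auto

lemma pr_cong: "(\<And>i. i \<in> {1..m} \<Longrightarrow> \<phi> i = \<psi> i) \<Longrightarrow> pr m n \<phi> = pr m n \<psi>"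
  unfolding pr_def by (rule tuple_cong) auto

lemma pr_tuple:
  assumes "\<psi> \<in> {1..l} \<rightarrow> {1..n}" "\<And>i. i \<in> {1..n} \<Longrightarrow> f i \<in> hom k 1"
  shows "pr l n \<psi> \<bullet> tuple k n f = tuple k l (\<lambda>i. f (\<psi> i))"
proof -
  have "\<And>i. i \<in> {1..l} \<Longrightarrow> \<psi> i \<in> {1..n}" using assms(1) by auto
  then show ?thesis
    using assms unfolding pr_def
    by (subst tuple_comp) (auto intro!: proj_hom tuple_hom tuple_cong proj_tuple)
qed

lemma pr_pr:
  assumes "\<psi> \<in> {1..l} \<rightarrow> {1..m}" "\<phi> \<in> {1..m} \<rightarrow> {1..n}"
  shows "pr l m \<psi> \<bullet> pr m n \<phi> = pr l n (\<lambda>i. \<phi> (\<psi> i))"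
  using assms unfolding pr_def[of m] by (subst pr_tuple) (auto simp: pr_def intro: proj_hom)

lemma pr_ident: "(\<And>i. i \<in> {1..n} \<Longrightarrow> \<phi> i = i) \<Longrightarrow> pr n n \<phi> = one n"
  by (rule hom_eqI) (auto simp: proj_pr one_hom comp_one[OF proj_hom] intro!: pr_hom)

text \<open>Uses that the projection of \<open>1\<close> to itself is the identity: the component of
  \<open>pr 1 n\<close> is taken with \<open>proj 1 1\<close>.\<close>

lemma proj_eq_pr: "i \<in> {1..n} \<Longrightarrow> proj n i = pr 1 n (\<lambda>_. i)"
  using one_comp[OF pr_hom, of "\<lambda>_. i" 1 n] proj_pr[of "\<lambda>_. i" 1 n 1]
  by (simp add: proj_one[simplified])

lemma pos_Pi: "i \<in> {1..k} \<Longrightarrow> pos n i \<in> {1..n i} \<rightarrow> {1..\<Sum>i=1..k. n i}"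
  using pos_mem by blast

lemma par_hom: "(\<And>i. i \<in> {1..k} \<Longrightarrow> f i \<in> hom (n i) 1) \<Longrightarrow> par k n f \<in> hom (\<Sum>i=1..k. n i) k"
  unfolding par_def by (intro tuple_hom comp_hom[OF pr_hom] pos_Pi) auto

lemma proj_par:
  assumes "\<And>i. i \<in> {1..k} \<Longrightarrow> f i \<in> hom (n i) 1" "i \<in> {1..k}"
  shows "proj k i \<bullet> par k n f = f i \<bullet> pr (n i) (\<Sum>i=1..k. n i) (pos n i)"
  unfolding par_def using assms by (intro proj_tuple comp_hom[OF pr_hom] pos_Pi) auto

lemma par_cong: "(\<And>i. i \<in> {1..k} \<Longrightarrow> n i = n' i) \<Longrightarrow> (\<And>i. i \<in> {1..k} \<Longrightarrow> f i = f' i) \<Longrightarrow>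
    par k n f = par k n' f'"
proof -
  assume n: "\<And>i. i \<in> {1..k} \<Longrightarrow> n i = n' i" and f: "\<And>i. i \<in> {1..k} \<Longrightarrow> f i = f' i"
  have "(\<Sum>i=1..k. n i) = (\<Sum>i=1..k. n' i)" using n by simp
  moreover have "pos n i = pos n' i" if "i \<in> {1..k}" for i
    using n that unfolding pos_def[abs_def] by (intro ext arg_cong2[of _ _ _ _ "(+)"] sum.cong) auto
  ultimately show ?thesis unfolding par_def using n f by (auto intro!: tuple_cong)
qed

text \<open>Reindexing a concatenated tuple along \<open>pos n i\<close> returns its
  \<open>i\<close>-th block, so each factor of the product sees only its own arguments.\<close>

lemma par_tuple:
  assumes f: "\<And>i. i \<in> {1..k} \<Longrightarrow> f i \<in> hom (n i) 1"
    and h: "\<And>i j. i \<in> {1..k} \<Longrightarrow> j \<in> {1..n i} \<Longrightarrow> h i j \<in> hom l 1"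
  shows "par k n f \<bullet> tuple l (\<Sum>i=1..k. n i) (cop n h) = tuple l k (\<lambda>i. f i \<bullet> tuple l (n i) (h i))"
proof -
  let ?N = "\<Sum>i=1..k. n i"
  have ch: "cop n h p \<in> hom l 1" if "p \<in> {1..?N}" for p
    using that
  proof (rule pos_cases)
    fix j x assume "j \<in> {1..k}" "x \<in> {1..n j}" "p = pos n j x"
    then show ?thesis using h[of j x] by simp
  qed
  have th: "tuple l ?N (cop n h) \<in> hom l ?N" by (rule tuple_hom) (rule ch)
  have "par k n f \<bullet> tuple l ?N (cop n h) =
      tuple l k (\<lambda>i. (f i \<bullet> pr (n i) ?N (pos n i)) \<bullet> tuple l ?N (cop n h))"
    unfolding par_def by (intro tuple_comp th comp_hom[OF pr_hom] pos_Pi f)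
  also have "\<dots> = tuple l k (\<lambda>i. f i \<bullet> tuple l (n i) (h i))"
  proof (rule tuple_cong)
    fix i assume i: "i \<in> {1..k}"
    have "(f i \<bullet> pr (n i) ?N (pos n i)) \<bullet> tuple l ?N (cop n h) =
        f i \<bullet> pr (n i) ?N (pos n i) \<bullet> tuple l ?N (cop n h)"
      using comp_assoc th pr_hom[OF pos_Pi[OF i]] f[OF i] by metis
    also have "pr (n i) ?N (pos n i) \<bullet> tuple l ?N (cop n h) = tuple l (n i) (\<lambda>j. cop n h (pos n i j))"
      by (rule pr_tuple[OF pos_Pi[OF i] ch])
    also have "\<dots> = tuple l (n i) (h i)" using i by (intro tuple_cong) auto
    finally show "(f i \<bullet> pr (n i) ?N (pos n i)) \<bullet> tuple l ?N (cop n h) = f i \<bullet> tuple l (n i) (h i)" .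
  qed
  finally show ?thesis .
qed

text \<open>\<open>pr m n \<phi>\<close> has a section \<rho> as soon as an arrow
  \<open>m \<rightarrow> 1\<close> exists: a component of \<rho> in the image of \<phi> is the
  matching projection, every other one is the arrow \<open>s\<close>. For \<open>c = 0\<close> any
  two arrows agree.\<close>

lemma pr_inj_epi:
  assumes \<phi>: "\<phi> \<in> {1..m} \<rightarrow> {1..n}" "inj_on \<phi> {1..m}" and f: "f \<in> hom m c" "f' \<in> hom m c"
    and eq: "f \<bullet> pr m n \<phi> = f' \<bullet> pr m n \<phi>"
  shows "f = f'"
proof (cases "c = 0")
  case True
  with f show ?thesis using hom_zero by blast
next
  case c: False
  text \<open>If \<open>m = 0\<close>, a constant is needed to split \<open>n \<rightarrow> 0\<close>; a component of \<open>f\<close> provides one.\<close>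
  have "\<exists>s. s \<in> hom m 1"
  proof (cases "m = 0")
    case True
    then show ?thesis using proj_comp_hom[OF f(1), of 1] c by auto
  next
    case False
    then show ?thesis using proj_hom[of 1 m] by auto
  qed
  then obtain s where s: "s \<in> hom m 1" ..
  define \<rho> where "\<rho> = tuple m n (\<lambda>i. if i \<in> \<phi> ` {1..m} then proj m (inv_into {1..m} \<phi> i) else s)"
  have comp: "(if i \<in> \<phi> ` {1..m} then proj m (inv_into {1..m} \<phi> i) else s) \<in> hom m 1" for i
    using s proj_hom[OF inv_into_into] by metis
  then have \<rho>: "\<rho> \<in> hom m n" unfolding \<rho>_def by (intro tuple_hom)
  have "pr m n \<phi> \<bullet> \<rho> = tuple m m (\<lambda>i. proj m i)"
    unfolding \<rho>_def by (subst pr_tuple[OF \<phi>(1) comp]) (use \<phi>(2) in \<open>auto intro!: tuple_cong\<close>)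
  also have "\<dots> = one m" using pr_ident[of m "\<lambda>i. i"] by (simp add: pr_def)
  finally have "pr m n \<phi> \<bullet> \<rho> = one m" .
  then have "f = (f \<bullet> pr m n \<phi>) \<bullet> \<rho>" "f' = (f' \<bullet> pr m n \<phi>) \<bullet> \<rho>"
    using f \<rho> pr_hom[OF \<phi>(1)] comp_assoc comp_one by metis+
  with eq show ?thesis by simp
qed

lemma interpretation_Fop:
  "interpretation_of Fop T (\<lambda>(m, n, \<phi>)\<in>Arr Fop. pr m n \<phi>)"
  unfolding interpretation_of_def
proof (intro conjI)
  show "(\<lambda>(m, n, \<phi>)\<in>Arr Fop. pr m n \<phi>) \<in> Arr Fop \<rightarrow>\<^sub>E Arr T"
    by (auto simp: Fop_def Fun_def PiE_iff dest!: homD[OF pr_hom, rotated] intro!: Pi_I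
      conjunct1[OF homD[OF pr_hom]])
  show "\<forall>f\<in>Arr Fop. Dom T ((\<lambda>(m, n, \<phi>)\<in>Arr Fop. pr m n \<phi>) f) = Dom Fop f \<and>
      Cod T ((\<lambda>(m, n, \<phi>)\<in>Arr Fop. pr m n \<phi>) f) = Cod Fop f"
    using homD[OF pr_hom] by (fastforce simp: Fop_def Fun_def PiE_iff)
  show "\<forall>n. (\<lambda>(m, n, \<phi>)\<in>Arr Fop. pr m n \<phi>) (Ident Fop n) = one n"
    by (auto simp: Fop_def Fun_def intro!: pr_ident)
  show "\<forall>f\<in>Arr Fop. \<forall>g\<in>Arr Fop. Dom Fop g = Cod Fop f \<longrightarrow>
      (\<lambda>(m, n, \<phi>)\<in>Arr Fop. pr m n \<phi>) (Comp Fop g f) =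
      (\<lambda>(m, n, \<phi>)\<in>Arr Fop. pr m n \<phi>) g \<bullet> (\<lambda>(m, n, \<phi>)\<in>Arr Fop. pr m n \<phi>) f"
  proof (intro ballI impI)
    fix f g assume "f \<in> Arr Fop" "g \<in> Arr Fop" "Dom Fop g = Cod Fop f"
    then obtain l m n \<phi> \<psi> where f: "f = (m, n, \<phi>)" "\<phi> \<in> Fun m n" and g: "g = (l, m, \<psi>)" "\<psi> \<in> Fun l m"
      by (auto simp: Fop_def)
    then have F: "\<phi> \<in> {1..m} \<rightarrow> {1..n}" "\<psi> \<in> {1..l} \<rightarrow> {1..m}" by (auto simp: Fun_def)
    then have "compose {1..l} \<phi> \<psi> \<in> Fun l n" by (auto simp: Fun_def compose_def)
    with f g show "(\<lambda>(m, n, \<phi>)\<in>Arr Fop. pr m n \<phi>) (Comp Fop g f) =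
      (\<lambda>(m, n, \<phi>)\<in>Arr Fop. pr m n \<phi>) g \<bullet> (\<lambda>(m, n, \<phi>)\<in>Arr Fop. pr m n \<phi>) f"
      by (auto simp: Fop_def pr_pr[OF F(2,1)] compose_eq intro!: pr_cong)
  qed
  show "\<forall>n. \<forall>i\<in>{1..n}. (\<lambda>(m, n, \<phi>)\<in>Arr Fop. pr m n \<phi>) (Proj Fop n i) = proj n i"
    by (auto simp: Fop_def Fun_def proj_eq_pr[simplified] intro!: pr_cong)
qed

text \<open>Replaces the definite description by a tuple. An interpretation preserves composition
  and projections, and in \<open>Fop\<close> the \<open>i\<close>-th component of the arrow given by
  \<phi> is the projection with index \<open>\<phi> i\<close>; so its values are forced.\<close>

lemma pi_arrow_eq_pr:
  assumes "\<phi> \<in> Fun m n"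
  shows "pi_arrow T m n \<phi> = pr m n \<phi>"
proof -
  have "(THE I. interpretation_of Fop T I) = (\<lambda>(m, n, \<phi>)\<in>Arr Fop. pr m n \<phi>)"
  proof (rule the_equality, rule interpretation_Fop)
    fix I assume I: "interpretation_of Fop T I"
    have "I (m, n, \<phi>) = pr m n \<phi>" if \<phi>: "\<phi> \<in> Fun m n" for m n \<phi>
    proof (rule hom_eqI)
      have F: "\<phi> \<in> {1..m} \<rightarrow> {1..n}" using \<phi> by (auto simp: Fun_def)
      have a: "(m, n, \<phi>) \<in> Arr Fop" using \<phi> by (simp add: Fop_def)
      have "I (m, n, \<phi>) \<in> Arr T" "Dom T (I (m, n, \<phi>)) = Dom Fop (m, n, \<phi>)"
          "Cod T (I (m, n, \<phi>)) = Cod Fop (m, n, \<phi>)"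
        using I a unfolding interpretation_of_def by (blast dest: PiE_mem)+
      then show "I (m, n, \<phi>) \<in> hom n m" by (simp add: Hom_def Fop_def)
      show "pr m n \<phi> \<in> hom n m" by (rule pr_hom[OF F])
      fix i assume i: "i \<in> {1..m}"
      have "Proj Fop m i \<in> Arr Fop" "Dom Fop (Proj Fop m i) = Cod Fop (m, n, \<phi>)"
        using i by (auto simp: Fop_def Fun_def)
      then have "I (Comp Fop (Proj Fop m i) (m, n, \<phi>)) = I (Proj Fop m i) \<bullet> I (m, n, \<phi>)"
        using I a unfolding interpretation_of_def by blast
      moreover have "Comp Fop (Proj Fop m i) (m, n, \<phi>) = Proj Fop n (\<phi> i)"
        by (auto simp: Fop_def compose_def fun_eq_iff)
      moreover have "I (Proj Fop m i) = proj m i" "I (Proj Fop n (\<phi> i)) = proj n (\<phi> i)"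
        using I i F unfolding interpretation_of_def by blast+
      ultimately show "proj m i \<bullet> I (m, n, \<phi>) = proj m i \<bullet> pr m n \<phi>"
        using i F by (simp add: proj_pr)
    qed
    \<comment> \<open>Off the arrows of \<open>Fop\<close> an interpretation is
      \<open>undefined\<close>; this makes it unique as a function.\<close>
    moreover have "I \<in> extensional (Arr Fop)"
      using I unfolding interpretation_of_def by (auto simp: PiE_iff)
    ultimately show "I = (\<lambda>(m, n, \<phi>)\<in>Arr Fop. pr m n \<phi>)"
      by (intro extensionalityI[of _ "Arr Fop"]) (auto simp: Fop_def)
  qed
  with assms show ?thesis by (simp add: pi_arrow_def Fop_def)
qed

lemma pr_restrict: "pr m n (restrict \<phi> {1..m}) = pr m n \<phi>"
  by (rule pr_cong) auto

end

lemma law_iff: "law T \<longleftrightarrow> lawvere_theory T"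
  by (auto simp: law_def law_axioms_def cate_def lawvere_theory_def)

lemma interpretation_hom:
  "interpretation_of T T' I \<Longrightarrow> f \<in> Hom T n m \<Longrightarrow> I f \<in> Hom T' n m"
  unfolding interpretation_of_def Hom_def by (auto dest: PiE_mem)

lemma interpretation_comp:
  "interpretation_of T T' I \<Longrightarrow> f \<in> Hom T n m \<Longrightarrow> g \<in> Hom T m l \<Longrightarrow>
    I (Comp T g f) = Comp T' (I g) (I f)"
  unfolding interpretation_of_def Hom_def by auto

lemma interpretation_proj:
  "interpretation_of T T' I \<Longrightarrow> i \<in> {1..n} \<Longrightarrow> I (Proj T n i) = Proj T' n i"
  unfolding interpretation_of_def by auto

lemma interpretation_one: "interpretation_of T T' I \<Longrightarrow> I (Ident T n) = Ident T' n"
  unfolding interpretation_of_def by auto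

text \<open>Interpretations are only required to preserve projections; a tuple is determined by its
  components, so tuples are preserved too.\<close>

lemma interpretation_tuple:
  assumes T: "law T" and T': "law T'" and I: "interpretation_of T T' I"
    and f: "\<And>i. i \<in> {1..n} \<Longrightarrow> f i \<in> Hom T k 1"
  shows "I (law.tuple T k n f) = law.tuple T' k n (\<lambda>i. I (f i))"
proof -
  interpret T: law T by (rule T)
  interpret T': law T' by (rule T')
  have If: "\<And>i. i \<in> {1..n} \<Longrightarrow> I (f i) \<in> Hom T' k 1" by (rule interpretation_hom[OF I f])
  have t: "T.tuple k n f \<in> Hom T k n" by (rule T.tuple_hom) (rule f)
  show ?thesis
  proof (rule T'.hom_eqI)
    show "I (T.tuple k n f) \<in> Hom T' k n" by (rule interpretation_hom[OF I t])
    show "T'.tuple k n (\<lambda>i. I (f i)) \<in> Hom T' k n" by (rule T'.tuple_hom) (rule If)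
    fix i assume i: "i \<in> {1..n}"
    have "Comp T' (Proj T' n i) (I (T.tuple k n f)) = I (Comp T (Proj T n i) (T.tuple k n f))"
      using interpretation_comp[OF I t T.proj_hom[OF i]] interpretation_proj[OF I i] by simp
    then show "Comp T' (Proj T' n i) (I (T.tuple k n f)) =
        Comp T' (Proj T' n i) (T'.tuple k n (\<lambda>i. I (f i)))"
      by (simp only: T.proj_tuple[OF f i] T'.proj_tuple[OF If i])
  qed
qed

lemma interpretation_pr:
  assumes T: "law T" and T': "law T'" and I: "interpretation_of T T' I"
    and \<phi>: "\<phi> \<in> {1..m} \<rightarrow> {1..n}"
  shows "I (law.pr T m n \<phi>) = law.pr T' m n \<phi>"
proof -
  have "I (law.tuple T n m (\<lambda>i. Proj T n (\<phi> i))) = law.tuple T' n m (\<lambda>i. I (Proj T n (\<phi> i)))"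
    using \<phi> by (intro interpretation_tuple[OF T T' I] law.proj_hom[OF T]) auto
  also have "\<dots> = law.tuple T' n m (\<lambda>i. Proj T' n (\<phi> i))"
    using \<phi> I by (intro law.tuple_cong[OF T'] interpretation_proj) auto
  finally show ?thesis by (simp add: law.pr_def[OF T] law.pr_def[OF T'])
qed

lemma interpretation_par:
  assumes T: "law T" and T': "law T'" and I: "interpretation_of T T' I"
    and f: "\<And>i. i \<in> {1..k} \<Longrightarrow> f i \<in> Hom T (n i) 1"
  shows "I (law.par T k n f) = law.par T' k n (\<lambda>i. I (f i))"
proof -
  interpret T: law T by (rule T)
  interpret T': law T' by (rule T')
  let ?N = "\<Sum>i=1..k. n i"
  have "I (T.par k n f) = T'.tuple ?N k (\<lambda>i. I (Comp T (f i) (T.pr (n i) ?N (pos n i))))"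
    unfolding T.par_def using f
    by (intro interpretation_tuple[OF T T' I] T.comp_hom[OF T.pr_hom] T.pos_Pi) auto
  also have "\<dots> = T'.par k n (\<lambda>i. I (f i))"
    unfolding T'.par_def
  proof (rule T'.tuple_cong)
    fix i assume i: "i \<in> {1..k}"
    show "I (Comp T (f i) (T.pr (n i) ?N (pos n i))) =
        Comp T' (I (f i)) (T'.pr (n i) ?N (pos n i))"
      using interpretation_comp[OF I T.pr_hom[OF T.pos_Pi[OF i, of n]] f[OF i]]
        interpretation_pr[OF T T' I T.pos_Pi[OF i, of n]] by simp
  qed
  finally show ?thesis .
qed


section \<open>Regular operads\<close>

locale operad =
  fixes P :: "'a regop"
  assumes regular_operad: "regular_operad P"
begin

abbreviation unit where "unit \<equiv> op_unit P"

text \<open>With the restriction built in, a surjection may be given by any function with the right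
  values on \<open>{1..n}\<close>, not necessarily an extensional one.\<close>

definition act :: "nat \<Rightarrow> nat \<Rightarrow> (nat \<Rightarrow> nat) \<Rightarrow> 'a \<Rightarrow> 'a" where
  "act n m \<phi> a = op_act P n m (restrict \<phi> {1..n}) a"

definition mul :: "nat \<Rightarrow> (nat \<Rightarrow> nat) \<Rightarrow> (nat \<Rightarrow> 'a) \<Rightarrow> 'a \<Rightarrow> 'a" where
  "mul k n b a = op_mult P (tup k n) (tup k b) a"

lemma restrict_Surj: "\<phi> ` {1..n} = {1..m} \<Longrightarrow> restrict \<phi> {1..n} \<in> Surj n m"
  by (auto simp: Surj_def Fun_def)

lemmas operad_laws = regular_operad[unfolded regular_operad_def]
lemmas mul_closed = operad_laws[THEN conjunct2, THEN conjunct1, rule_format]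
lemmas operad_laws1 = operad_laws[THEN conjunct2, THEN conjunct2]
lemmas act_closed = operad_laws1[THEN conjunct1, rule_format]
lemmas act_idf = operad_laws1[THEN conjunct2, THEN conjunct1, rule_format]
lemmas act_compose = operad_laws1[THEN conjunct2, THEN conjunct2, THEN conjunct1, rule_format]
lemmas operad_laws2 = operad_laws1[THEN conjunct2, THEN conjunct2, THEN conjunct2]
lemmas mult_assoc = operad_laws2[THEN conjunct1, rule_format]
lemmas mult_unit = operad_laws2[THEN conjunct2, THEN conjunct1, rule_format]
lemmas mult_units = operad_laws2[THEN conjunct2, THEN conjunct2, THEN conjunct1, rule_format]
lemmas mult_act = operad_laws2[THEN conjunct2, THEN conjunct2, THEN conjunct2, rule_format]

lemma unit_mem: "unit \<in> ops P 1"
  by (rule operad_laws[THEN conjunct1])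

lemma mul_mem: "(\<And>i. i \<in> {1..k} \<Longrightarrow> b i \<in> ops P (n i)) \<Longrightarrow> a \<in> ops P k \<Longrightarrow>
    mul k n b a \<in> ops P (\<Sum>i=1..k. n i)"
  unfolding mul_def by (rule mul_closed)

lemma act_mem: "\<phi> ` {1..n} = {1..m} \<Longrightarrow> a \<in> ops P n \<Longrightarrow> act n m \<phi> a \<in> ops P m"
  unfolding act_def by (rule act_closed[OF restrict_Surj])

lemma act_cong: "(\<And>x. x \<in> {1..n} \<Longrightarrow> \<phi> x = \<psi> x) \<Longrightarrow> act n m \<phi> a = act n m \<psi> a"
  unfolding act_def by (metis restrict_ext)

lemma act_ident: "(\<And>x. x \<in> {1..n} \<Longrightarrow> \<phi> x = x) \<Longrightarrow> a \<in> ops P n \<Longrightarrow> act n n \<phi> a = a"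
proof -
  assume \<phi>: "\<And>x. x \<in> {1..n} \<Longrightarrow> \<phi> x = x" and a: "a \<in> ops P n"
  have "restrict \<phi> {1..n} = idf n" using \<phi> by (auto simp: restrict_def)
  moreover have "op_act P n n (idf n) a = a"
    using a by (rule act_idf)
  ultimately show ?thesis by (simp add: act_def)
qed

lemma act_act:
  assumes "\<phi> ` {1..n} = {1..m}" "\<psi> ` {1..m} = {1..l}" "a \<in> ops P n"
  shows "act m l \<psi> (act n m \<phi> a) = act n l (\<lambda>x. \<psi> (\<phi> x)) a"
proof -
  have "op_act P n l (compose {1..n} (restrict \<psi> {1..m}) (restrict \<phi> {1..n})) a =
      op_act P m l (restrict \<psi> {1..m}) (op_act P n m (restrict \<phi> {1..n}) a)"
    by (rule act_compose[OF restrict_Surj[OF assms(1)] restrict_Surj[OF assms(2)] assms(3)])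
  moreover have "compose {1..n} (restrict \<psi> {1..m}) (restrict \<phi> {1..n}) =
      restrict (\<lambda>x. \<psi> (\<phi> x)) {1..n}"
    using assms(1) by (fastforce simp: compose_def restrict_def)
  ultimately show ?thesis by (simp add: act_def)
qed

lemma mul_cong: "(\<And>i. i \<in> {1..k} \<Longrightarrow> n i = n' i) \<Longrightarrow> (\<And>i. i \<in> {1..k} \<Longrightarrow> b i = b' i) \<Longrightarrow>
    mul k n b a = mul k n' b' a"
  unfolding mul_def by (metis tup_cong)

lemma mul_mul:
  assumes "a \<in> ops P k" "\<And>i. i \<in> {1..k} \<Longrightarrow> b i \<in> ops P (n i)"
    "\<And>i j. i \<in> {1..k} \<Longrightarrow> j \<in> {1..n i} \<Longrightarrow> c i j \<in> ops P (q i j)"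
  shows "mul (\<Sum>i=1..k. n i) (cop n q) (cop n c) (mul k n b a) =
    mul k (\<lambda>i. \<Sum>j=1..n i. q i j) (\<lambda>i. mul (n i) (q i) (c i) (b i)) a"
  unfolding mul_def concat_tup[symmetric] by (rule mult_assoc[OF assms])

lemma mul_unit: "a \<in> ops P (n 1) \<Longrightarrow> b 1 = a \<Longrightarrow> mul 1 n b unit = a"
  using mult_unit unfolding mul_def by (simp add: tup_def upt_conv_Cons)

lemma mul_units: "a \<in> ops P n \<Longrightarrow> mul n (\<lambda>_. 1) (\<lambda>_. unit) a = a"
  unfolding mul_def by (rule mult_units)

text \<open>The equivariance law with \<open>star\<close> written as a copairing, so that it can be
  evaluated in coordinates.\<close>

lemma mul_act:
  assumes \<phi>: "\<phi> ` {1..n} = {1..m}" and a: "a \<in> ops P n"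
    and \<psi>: "\<And>i. i \<in> {1..m} \<Longrightarrow> \<psi> i ` {1..k i} = {1..l i}"
    and b: "\<And>i. i \<in> {1..m} \<Longrightarrow> b i \<in> ops P (k i)"
  shows "mul m l (\<lambda>i. act (k i) (l i) (\<psi> i) (b i)) (act n m \<phi> a) =
    act (\<Sum>j=1..n. k (\<phi> j)) (\<Sum>i=1..m. l i)
      (cop (\<lambda>j. k (\<phi> j)) (\<lambda>j x. pos l (\<phi> j) (\<psi> (\<phi> j) x)))
      (mul n (\<lambda>j. k (\<phi> j)) (\<lambda>j. b (\<phi> j)) a)"
proof -
  let ?\<phi> = "restrict \<phi> {1..n}" and ?\<psi> = "\<lambda>i. restrict (\<psi> i) {1..k i}"
  have "op_mult P (tup m l) (tup m (\<lambda>i. op_act P (k i) (l i) (?\<psi> i) (b i))) (op_act P n m ?\<phi> a) =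
        op_act P (\<Sum>j=1..n. k (?\<phi> j)) (\<Sum>i=1..m. l i) (star n ?\<phi> k l ?\<psi>)
          (op_mult P (tup n (\<lambda>j. k (?\<phi> j))) (tup n (\<lambda>j. b (?\<phi> j))) a)"
  proof -
    have "\<And>i. i \<in> {1..m} \<Longrightarrow> ?\<psi> i \<in> Surj (k i) (l i) \<and> b i \<in> ops P (k i)"
      using restrict_Surj \<psi> b by blast
    then show ?thesis by (rule mult_act[OF restrict_Surj[OF \<phi>] a])
  qed
  moreover have "(\<Sum>j=1..n. k (?\<phi> j)) = (\<Sum>j=1..n. k (\<phi> j))" by (intro sum.cong) auto
  moreover have "tup n (\<lambda>j. k (?\<phi> j)) = tup n (\<lambda>j. k (\<phi> j))"
    "tup n (\<lambda>j. b (?\<phi> j)) = tup n (\<lambda>j. b (\<phi> j))" by (auto intro: tup_cong)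
  moreover have "star n ?\<phi> k l ?\<psi> =
      restrict (cop (\<lambda>j. k (\<phi> j)) (\<lambda>j x. pos l (\<phi> j) (\<psi> (\<phi> j) x))) {1..\<Sum>j=1..n. k (\<phi> j)}"
    unfolding star_def \<open>(\<Sum>j=1..n. k (?\<phi> j)) = (\<Sum>j=1..n. k (\<phi> j))\<close>
  proof (rule restrict_ext)
    fix p assume p: "p \<in> {1..\<Sum>j=1..n. k (\<phi> j)}"
    have "cop (\<lambda>j. k (\<phi> j)) (\<lambda>j x. pos l (\<phi> j) (\<psi> (\<phi> j) x)) p =
        cop (\<lambda>j. k (?\<phi> j)) (\<lambda>j x. pos l (?\<phi> j) (?\<psi> (?\<phi> j) x)) p"
      using p by (rule cop_cong) auto
    then show "(let j = block (k \<circ> ?\<phi>) p; x = offset (k \<circ> ?\<phi>) p in pos l (?\<phi> j) (?\<psi> (?\<phi> j) x)) =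
        cop (\<lambda>j. k (\<phi> j)) (\<lambda>j x. pos l (\<phi> j) (\<psi> (\<phi> j) x)) p"
      by (simp add: cop_def comp_def Let_def)
  qed
  ultimately show ?thesis by (simp add: act_def mul_def)
qed


section \<open>Normal forms\<close>

text \<open>
  A pair of \<open>\<phi> : (k] \<rightarrow> (n]\<close> and \<open>g \<in> \<O>\<^sub>k\<close> is an arrow \<open>n \<rightarrow> 1\<close>.  Factoring \<open>\<phi>\<close> as the increasing
  enumeration of its image after a surjection, and letting the surjection act on \<open>g\<close>, one gets a
  representation of this arrow by the image and an operation in as many variables; it is unique.
\<close>

definition nf :: "nat \<Rightarrow> (nat \<Rightarrow> nat) \<Rightarrow> 'a \<Rightarrow> nat set \<times> 'a" where
  "nf k \<phi> g = (\<phi> ` {1..k}, act k (card (\<phi> ` {1..k})) (\<lambda>x. rank (\<phi> ` {1..k}) (\<phi> x)) g)"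

definition elts :: "nat \<Rightarrow> (nat set \<times> 'a) set" where
  "elts n = (SIGMA A:Pow {1..n}. ops P (card A))"

lemma rank_image: "(\<lambda>x. rank (\<phi> ` {1..k}) (\<phi> x)) ` {1..k} = {1..card (\<phi> ` {1..k})}" for k :: nat
  using bij_betw_imp_surj_on[OF bij_betw_rank[of "\<phi> ` {1..k}"]] by (simp add: image_image)

lemma nf_mem: "\<phi> \<in> {1..k} \<rightarrow> {1..n} \<Longrightarrow> g \<in> ops P k \<Longrightarrow> nf k \<phi> g \<in> elts n"
  unfolding nf_def elts_def using act_mem[OF rank_image] by auto

lemma nf_cong: "(\<And>x. x \<in> {1..k} \<Longrightarrow> \<phi> x = \<psi> x) \<Longrightarrow> nf k \<phi> g = nf k \<psi> g"
proof -
  assume \<phi>: "\<And>x. x \<in> {1..k} \<Longrightarrow> \<phi> x = \<psi> x"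
  then have "\<phi> ` {1..k} = \<psi> ` {1..k}" by simp
  then show ?thesis using \<phi> unfolding nf_def by (auto intro: act_cong)
qed

text \<open>A surjection can be moved from the operation into the reindexing without changing the
  image. This makes \<open>nf\<close> invariant under the equivalence of spans and under
  regularization.\<close>

lemma nf_act:
  assumes "\<psi> ` {1..k} = {1..l}" "g \<in> ops P k"
  shows "nf l \<phi> (act k l \<psi> g) = nf k (\<lambda>x. \<phi> (\<psi> x)) g"
proof -
  have "\<phi> ` {1..l} = (\<lambda>x. \<phi> (\<psi> x)) ` {1..k}" using assms(1) by (metis image_image)
  then show ?thesis using act_act[OF assms(1) rank_image assms(2), of \<phi>] by (simp add: nf_def)
qed

lemma nf_enum:
  assumes "finite A" "g \<in> ops P (card A)"
  shows "nf (card A) (enum A) g = (A, g)"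
  using act_ident[OF rank_enum assms(2)] assms by (simp add: nf_def enum_image)

lemma nf_ident: "(\<And>x. x \<in> {1..n} \<Longrightarrow> \<phi> x = x) \<Longrightarrow> g \<in> ops P n \<Longrightarrow> nf n \<phi> g = ({1..n}, g)"
  using nf_enum[of "{1..n}" g] nf_cong[of n \<phi> "enum {1..n}" g] by (simp add: enum_interval)

lemma nf_singleton: "g \<in> ops P 1 \<Longrightarrow> nf 1 (\<lambda>_. i) g = ({i}, g)"
  using nf_enum[of "{i}" g] nf_cong[of 1 "\<lambda>_. i" "enum {i}" g] enum_singleton[of _ i]
  by (simp flip: One_nat_def)

lemma elts_finite: "(A, g) \<in> elts n \<Longrightarrow> finite A"
  unfolding elts_def using finite_subset by auto

text \<open>Elements are mostly handled through arbitrary representatives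
  \<open>nf m \<phi> g\<close>, because substitution does not produce its results in enumerated
  form.\<close>

lemma elts_nf:
  assumes "c \<in> elts n"
  obtains m \<phi> g where "\<phi> \<in> {1..m} \<rightarrow> {1..n}" "g \<in> ops P m" "c = nf m \<phi> g"
proof -
  obtain A g where c: "c = (A, g)" "A \<subseteq> {1..n}" "g \<in> ops P (card A)"
    using assms by (auto simp: elts_def)
  moreover have "finite A" using c finite_subset by blast
  ultimately show ?thesis using that[of "enum A" "card A" g] enum_mem nf_enum by fastforce
qed

section \<open>Substitution of normal forms\<close>

definition sub :: "nat \<Rightarrow> (nat \<Rightarrow> nat) \<Rightarrow> (nat \<Rightarrow> nat) \<Rightarrow> (nat \<Rightarrow> nat \<Rightarrow> nat) \<Rightarrow> (nat \<Rightarrow> 'a) \<Rightarrow> 'a \<Rightarrow>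
    nat set \<times> 'a" where
  "sub m \<phi> k \<chi> b g = nf (\<Sum>j=1..m. k (\<phi> j)) (cop (\<lambda>j. k (\<phi> j)) (\<lambda>j. \<chi> (\<phi> j)))
     (mul m (\<lambda>j. k (\<phi> j)) (\<lambda>j. b (\<phi> j)) g)"

text \<open>In \<open>sub\<close>, variable \<open>j\<close> of \<open>g\<close> stands for the
  ambient variable \<open>\<phi> j\<close>, for which \<open>b (\<phi> j)\<close> is substituted
  with its own variables renamed by \<open>\<chi> (\<phi> j)\<close>. While \<open>sub\<close>
  accepts any representatives, \<open>csub\<close> reads them off from normal forms;
  \<open>csub_nf\<close> shows that the choice does not matter.\<close>

definition csub :: "(nat \<Rightarrow> nat set \<times> 'a) \<Rightarrow> nat set \<times> 'a \<Rightarrow> nat set \<times> 'a" where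
  "csub F c = sub (card (fst c)) (enum (fst c)) (\<lambda>i. card (fst (F i))) (\<lambda>i. enum (fst (F i)))
     (\<lambda>i. snd (F i)) (snd c)"

lemma cop_Pi: "(\<And>j. j \<in> {1..m} \<Longrightarrow> F j \<in> {1..k j} \<rightarrow> B) \<Longrightarrow> cop k F \<in> {1..\<Sum>j=1..m. k j} \<rightarrow> B"
proof -
  assume F: "\<And>j. j \<in> {1..m} \<Longrightarrow> F j \<in> {1..k j} \<rightarrow> B"
  have "(\<Union>j\<in>{1..m}. F j ` {1..k j}) \<subseteq> B" using F by blast
  then show ?thesis unfolding cop_image[symmetric] by blast
qed

lemma sub_cong:
  assumes "\<And>j. j \<in> {1..m} \<Longrightarrow> \<phi> j = \<phi>' j" "\<And>j. j \<in> {1..m} \<Longrightarrow> k (\<phi> j) = k' (\<phi> j)"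
    "\<And>j. j \<in> {1..m} \<Longrightarrow> b (\<phi> j) = b' (\<phi> j)"
    "\<And>j x. j \<in> {1..m} \<Longrightarrow> x \<in> {1..k (\<phi> j)} \<Longrightarrow> \<chi> (\<phi> j) x = \<chi>' (\<phi> j) x"
  shows "sub m \<phi> k \<chi> b g = sub m \<phi>' k' \<chi>' b' g"
proof -
  have k: "\<And>j. j \<in> {1..m} \<Longrightarrow> k (\<phi> j) = k' (\<phi>' j)" using assms by metis
  then have "(\<Sum>j=1..m. k (\<phi> j)) = (\<Sum>j=1..m. k' (\<phi>' j))" by simp
  moreover have "mul m (\<lambda>j. k (\<phi> j)) (\<lambda>j. b (\<phi> j)) g = mul m (\<lambda>j. k' (\<phi>' j)) (\<lambda>j. b' (\<phi>' j)) g"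
    using k assms by (intro mul_cong) metis+
  moreover have "nf (\<Sum>j=1..m. k (\<phi> j)) (cop (\<lambda>j. k (\<phi> j)) (\<lambda>j. \<chi> (\<phi> j))) g' =
      nf (\<Sum>j=1..m. k (\<phi> j)) (cop (\<lambda>j. k' (\<phi>' j)) (\<lambda>j. \<chi>' (\<phi>' j))) g'" for g'
  proof (rule nf_cong)
    fix p assume "p \<in> {1..\<Sum>j=1..m. k (\<phi> j)}"
    then show "cop (\<lambda>j. k (\<phi> j)) (\<lambda>j. \<chi> (\<phi> j)) p = cop (\<lambda>j. k' (\<phi>' j)) (\<lambda>j. \<chi>' (\<phi>' j)) p"
      by (rule cop_cong) (use k assms in \<open>metis\<close>)+
  qed
  ultimately show ?thesis unfolding sub_def by simp
qed

text \<open>Surjections acting on the outer operation and on the inner ones combine, by equivariance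
  of multiplication, to a single surjection acting on the product; \<open>nf_act\<close> then moves
  it into the reindexing.\<close>

lemma sub_act:
  assumes \<theta>: "\<theta> ` {1..m} = {1..m'}" and g: "g \<in> ops P m" and \<phi>: "\<phi> \<in> {1..m'} \<rightarrow> {1..n}"
    and \<psi>: "\<And>i. i \<in> {1..n} \<Longrightarrow> \<psi> i ` {1..k i} = {1..l i}"
    and b: "\<And>i. i \<in> {1..n} \<Longrightarrow> b i \<in> ops P (k i)"
  shows "sub m' \<phi> l \<chi> (\<lambda>i. act (k i) (l i) (\<psi> i) (b i)) (act m m' \<theta> g) =
    sub m (\<lambda>j. \<phi> (\<theta> j)) k (\<lambda>i x. \<chi> i (\<psi> i x)) b g"
proof -
  have \<phi>': "\<And>i. i \<in> {1..m'} \<Longrightarrow> \<phi> i \<in> {1..n}" using \<phi> by auto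
  have \<theta>': "\<And>i. i \<in> {1..m} \<Longrightarrow> \<theta> i \<in> {1..m'}" using \<theta> by blast
  let ?s = "cop (\<lambda>j. k (\<phi> (\<theta> j))) (\<lambda>j x. pos (\<lambda>j. l (\<phi> j)) (\<theta> j) (\<psi> (\<phi> (\<theta> j)) x))"
  let ?M = "\<Sum>j=1..m. k (\<phi> (\<theta> j))" and ?L = "\<Sum>i=1..m'. l (\<phi> i)"
  let ?g = "mul m (\<lambda>j. k (\<phi> (\<theta> j))) (\<lambda>j. b (\<phi> (\<theta> j))) g"
  have eq: "mul m' (\<lambda>j. l (\<phi> j)) (\<lambda>j. act (k (\<phi> j)) (l (\<phi> j)) (\<psi> (\<phi> j)) (b (\<phi> j))) (act m m' \<theta> g) =
      act ?M ?L ?s ?g"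
    using mul_act[OF \<theta> g, of "\<lambda>j. \<psi> (\<phi> j)" "\<lambda>j. k (\<phi> j)" "\<lambda>j. l (\<phi> j)" "\<lambda>j. b (\<phi> j)"] \<psi> b \<phi>'
    by blast
  \<comment> \<open>Surjectivity of the combined map: the inner surjections fill the blocks they
    land in, and \<theta> reaches every block.\<close>
  have "?s ` {1..?M} = (\<Union>j\<in>{1..m}. pos (\<lambda>j. l (\<phi> j)) (\<theta> j) ` \<psi> (\<phi> (\<theta> j)) ` {1..k (\<phi> (\<theta> j))})"
    by (simp add: cop_image image_image)
  also have "\<dots> = (\<Union>j\<in>{1..m}. pos (\<lambda>j. l (\<phi> j)) (\<theta> j) ` {1..l (\<phi> (\<theta> j))})"
    using \<psi> \<phi>' \<theta>' by simp
  also have "\<dots> = (\<Union>i\<in>\<theta> ` {1..m}. pos (\<lambda>j. l (\<phi> j)) i ` {1..l (\<phi> i)})"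
    by simp
  also have "\<dots> = cop (\<lambda>j. l (\<phi> j)) (pos (\<lambda>j. l (\<phi> j))) ` {1..?L}"
    unfolding \<theta> by (simp add: cop_image)
  also have "\<dots> = {1..?L}"
    by (subst image_cong[OF refl cop_pos_id]) auto
  finally have s: "?s ` {1..?M} = {1..?L}" .
  have g': "?g \<in> ops P ?M" using b \<phi>' \<theta>' g by (intro mul_mem) blast+
  have "nf ?L (cop (\<lambda>j. l (\<phi> j)) (\<lambda>j. \<chi> (\<phi> j))) (act ?M ?L ?s ?g) =
      nf ?M (\<lambda>x. cop (\<lambda>j. l (\<phi> j)) (\<lambda>j. \<chi> (\<phi> j)) (?s x)) ?g"
    by (rule nf_act[OF s g'])
  also have "\<dots> = nf ?M (cop (\<lambda>j. k (\<phi> (\<theta> j))) (\<lambda>j x. \<chi> (\<phi> (\<theta> j)) (\<psi> (\<phi> (\<theta> j)) x))) ?g"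
  proof (rule nf_cong)
    fix p assume p: "p \<in> {1..?M}"
    then obtain j x where j: "j \<in> {1..m}" "x \<in> {1..k (\<phi> (\<theta> j))}"
      and p: "p = pos (\<lambda>j. k (\<phi> (\<theta> j))) j x"
      by (rule pos_cases)
    have "\<psi> (\<phi> (\<theta> j)) x \<in> {1..l (\<phi> (\<theta> j))}" using \<psi>[OF \<phi>'[OF \<theta>'[OF j(1)]]] j(2) by blast
    then show "cop (\<lambda>j. l (\<phi> j)) (\<lambda>j. \<chi> (\<phi> j)) (?s p) =
        cop (\<lambda>j. k (\<phi> (\<theta> j))) (\<lambda>j x. \<chi> (\<phi> (\<theta> j)) (\<psi> (\<phi> (\<theta> j)) x)) p"
      using j \<theta>'[OF j(1)] by (simp add: p)
  qed
  finally show ?thesis unfolding sub_def eq .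
qed

text \<open>Substitution is well defined: the surjections onto supports introduced by
  \<open>nf\<close> are absorbed by \<open>sub_act\<close>, and enumerating the rank of an element
  gives the element back.\<close>

lemma csub_nf:
  assumes \<phi>: "\<phi> \<in> {1..m} \<rightarrow> {1..n}" and g: "g \<in> ops P m"
    and F: "\<And>i. i \<in> {1..n} \<Longrightarrow> F i = nf (k i) (\<chi> i) (b i)"
    and b: "\<And>i. i \<in> {1..n} \<Longrightarrow> b i \<in> ops P (k i)"
  shows "csub F (nf m \<phi> g) = sub m \<phi> k \<chi> b g"
proof -
  let ?A = "\<phi> ` {1..m}" and ?B = "\<lambda>i. \<chi> i ` {1..k i}"
  let ?l = "\<lambda>i. card (?B i)" and ?\<psi> = "\<lambda>i x. rank (?B i) (\<chi> i x)"
  let ?g = "act m (card ?A) (\<lambda>x. rank ?A (\<phi> x)) g"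
  have "enum ?A j \<in> {1..n}" if "j \<in> {1..card ?A}" for j
    using \<phi> enum_mem[OF _ that] by auto
  then have e: "enum ?A \<in> {1..card ?A} \<rightarrow> {1..n}" by blast
  have "csub F (nf m \<phi> g) =
      sub (card ?A) (enum ?A) ?l (\<lambda>i. enum (?B i)) (\<lambda>i. act (k i) (?l i) (?\<psi> i) (b i)) ?g"
    unfolding csub_def nf_def fst_conv snd_conv
    by (rule sub_cong) (use e F in \<open>auto simp: nf_def Pi_iff\<close>)
  also have "\<dots> = sub m (\<lambda>j. enum ?A (rank ?A (\<phi> j))) k (\<lambda>i x. enum (?B i) (?\<psi> i x)) b g"
    by (rule sub_act[OF rank_image g e]) (use rank_image b in auto)
  also have "\<dots> = sub m \<phi> k \<chi> b g"
    by (rule sub_cong) (auto simp: enum_rank)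
  finally show ?thesis .
qed

lemma sub_mem:
  assumes "\<phi> \<in> {1..m} \<rightarrow> {1..n}" "g \<in> ops P m"
    "\<And>i. i \<in> {1..n} \<Longrightarrow> \<chi> i \<in> {1..k i} \<rightarrow> {1..l}" "\<And>i. i \<in> {1..n} \<Longrightarrow> b i \<in> ops P (k i)"
  shows "sub m \<phi> k \<chi> b g \<in> elts l"
  unfolding sub_def using assms by (intro nf_mem cop_Pi mul_mem) (auto simp: Pi_iff)

lemma elts_nf_family:
  assumes "\<And>i. i \<in> {1..n} \<Longrightarrow> F i \<in> elts l"
  shows "\<exists>k \<chi> b. \<forall>i\<in>{1..n}. \<chi> i \<in> {1..k i} \<rightarrow> {1..l} \<and> b i \<in> ops P (k i) \<and>
    F i = nf (k i) (\<chi> i) (b i)"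
proof -
  have "\<forall>i\<in>{1..n}. \<exists>k \<chi> b. \<chi> \<in> {1..k} \<rightarrow> {1..l} \<and> b \<in> ops P k \<and> F i = nf k \<chi> b"
    using elts_nf[OF assms] by metis
  then obtain k where "\<forall>i\<in>{1..n}. \<exists>\<chi> b. \<chi> \<in> {1..k i} \<rightarrow> {1..l} \<and> b \<in> ops P (k i) \<and>
      F i = nf (k i) \<chi> b"
    unfolding bchoice_iff by blast
  then obtain \<chi> where "\<forall>i\<in>{1..n}. \<exists>b. \<chi> i \<in> {1..k i} \<rightarrow> {1..l} \<and> b \<in> ops P (k i) \<and>
      F i = nf (k i) (\<chi> i) b"
    unfolding bchoice_iff by blast
  then show ?thesis unfolding bchoice_iff by blast
qed

lemma csub_mem:
  assumes "c \<in> elts n" "\<And>i. i \<in> {1..n} \<Longrightarrow> F i \<in> elts l"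
  shows "csub F c \<in> elts l"
proof -
  obtain m \<phi> g where c: "\<phi> \<in> {1..m} \<rightarrow> {1..n}" "g \<in> ops P m" "c = nf m \<phi> g"
    using assms(1) by (rule elts_nf)
  obtain k \<chi> b where "\<forall>i\<in>{1..n}. \<chi> i \<in> {1..k i} \<rightarrow> {1..l} \<and> b i \<in> ops P (k i) \<and>
      F i = nf (k i) (\<chi> i) (b i)"
    using elts_nf_family[of n F l, OF assms(2)] by blast
  then have F: "\<And>i. i \<in> {1..n} \<Longrightarrow> \<chi> i \<in> {1..k i} \<rightarrow> {1..l}"
    "\<And>i. i \<in> {1..n} \<Longrightarrow> b i \<in> ops P (k i)" "\<And>i. i \<in> {1..n} \<Longrightarrow> F i = nf (k i) (\<chi> i) (b i)"
    by blast+
  have "csub F (nf m \<phi> g) = sub m \<phi> k \<chi> b g" by (rule csub_nf[OF c(1,2)]) (use F in auto)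
  then show ?thesis unfolding c(3) using sub_mem[of \<phi> m n g \<chi> k l b] c F by simp
qed

lemma csub_cong:
  assumes "c \<in> elts n" "\<And>i. i \<in> {1..n} \<Longrightarrow> F i = F' i"
  shows "csub F c = csub F' c"
proof -
  obtain A g where c: "c = (A, g)" "A \<subseteq> {1..n}" using assms(1) by (auto simp: elts_def)
  then have "finite A" using finite_subset by blast
  then have e: "j \<in> {1..card A} \<Longrightarrow> F (enum A j) = F' (enum A j)" for j
    using c enum_mem[of A] assms(2) by blast
  show ?thesis unfolding csub_def c fst_conv snd_conv by (rule sub_cong) (auto simp: e)
qed

text \<open>Both sides are computed on representatives that are not normalized in between. They
  become normal forms of the two bracketings of a threefold product, which \<open>mul_mul\<close>
  identifies, along reindexings that \<open>cop_cop\<close> identifies.\<close>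

lemma csub_csub:
  assumes c: "c \<in> elts n" and F: "\<And>i. i \<in> {1..n} \<Longrightarrow> F i \<in> elts l"
    and G: "\<And>i. i \<in> {1..l} \<Longrightarrow> G i \<in> elts r"
  shows "csub G (csub F c) = csub (\<lambda>i. csub G (F i)) c"
proof -
  obtain m \<phi> g where c: "\<phi> \<in> {1..m} \<rightarrow> {1..n}" "g \<in> ops P m" "c = nf m \<phi> g"
    using c by (rule elts_nf)
  obtain k \<chi> b where "\<forall>i\<in>{1..n}. \<chi> i \<in> {1..k i} \<rightarrow> {1..l} \<and> b i \<in> ops P (k i) \<and>
      F i = nf (k i) (\<chi> i) (b i)"
    using elts_nf_family[of n F l, OF F] by blast
  then have F: "\<And>i. i \<in> {1..n} \<Longrightarrow> \<chi> i \<in> {1..k i} \<rightarrow> {1..l}"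
    "\<And>i. i \<in> {1..n} \<Longrightarrow> b i \<in> ops P (k i)" "\<And>i. i \<in> {1..n} \<Longrightarrow> F i = nf (k i) (\<chi> i) (b i)"
    by blast+
  obtain q \<omega> d where "\<forall>i\<in>{1..l}. \<omega> i \<in> {1..q i} \<rightarrow> {1..r} \<and> d i \<in> ops P (q i) \<and>
      G i = nf (q i) (\<omega> i) (d i)"
    using elts_nf_family[of l G r, OF G] by blast
  then have G: "\<And>i. i \<in> {1..l} \<Longrightarrow> \<omega> i \<in> {1..q i} \<rightarrow> {1..r}"
    "\<And>i. i \<in> {1..l} \<Longrightarrow> d i \<in> ops P (q i)" "\<And>i. i \<in> {1..l} \<Longrightarrow> G i = nf (q i) (\<omega> i) (d i)"
    by blast+
  have \<phi>: "\<And>j. j \<in> {1..m} \<Longrightarrow> \<phi> j \<in> {1..n}" using c by auto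
  have \<chi>: "\<And>i x. i \<in> {1..n} \<Longrightarrow> x \<in> {1..k i} \<Longrightarrow> \<chi> i x \<in> {1..l}" using F by (auto simp: Pi_iff)
  let ?k = "\<lambda>j. k (\<phi> j)" and ?M = "\<Sum>j=1..m. k (\<phi> j)"
  let ?\<chi> = "cop ?k (\<lambda>j. \<chi> (\<phi> j))" and ?g = "mul m ?k (\<lambda>j. b (\<phi> j)) g"
  let ?K = "\<lambda>i. \<Sum>x=1..k i. q (\<chi> i x)" and ?X = "\<lambda>i. cop (\<lambda>x. q (\<chi> i x)) (\<lambda>x. \<omega> (\<chi> i x))"
  let ?B = "\<lambda>i. mul (k i) (\<lambda>x. q (\<chi> i x)) (\<lambda>x. d (\<chi> i x)) (b i)"
  have "csub F c = nf ?M ?\<chi> ?g"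
    unfolding c(3) sub_def[symmetric] by (rule csub_nf[OF c(1,2)]) (use F in auto)
  moreover have "csub G (nf ?M ?\<chi> ?g) = sub ?M ?\<chi> q \<omega> d ?g"
  proof (rule csub_nf)
    show "?\<chi> \<in> {1..?M} \<rightarrow> {1..l}" by (rule cop_Pi) (use F(1) \<phi> in blast)
    show "?g \<in> ops P ?M" by (rule mul_mem) (use F(2) \<phi> c in blast)+
  qed (use G in auto)
  moreover have "csub (\<lambda>i. csub G (F i)) c = sub m \<phi> ?K ?X ?B g"
    unfolding c(3)
  proof (rule csub_nf[OF c(1,2)])
    fix i assume i: "i \<in> {1..n}"
    show "csub G (F i) = nf (?K i) (?X i) (?B i)"
      unfolding F(3)[OF i] sub_def[symmetric]
      by (rule csub_nf[OF F(1)[OF i] F(2)[OF i]]) (use G in auto)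
    show "?B i \<in> ops P (?K i)" by (rule mul_mem) (use G(2) \<chi> F(2) i in blast)+
  qed
  moreover have "sub ?M ?\<chi> q \<omega> d ?g = sub m \<phi> ?K ?X ?B g"
  proof -
    \<comment> \<open>A function applied to a copaired index is the copairing of its values; this
      serves for \<open>q\<close>, \<omega> and \<open>d\<close> alike, hence the arbitrary result
      type.\<close>
    have cop1: "(\<lambda>p. f (?\<chi> p)) = cop ?k (\<lambda>j x. f (\<chi> (\<phi> j) x))" for f :: "nat \<Rightarrow> 'z"
      by (auto simp: cop_def)
    have "mul ?M (cop ?k (\<lambda>j x. q (\<chi> (\<phi> j) x))) (cop ?k (\<lambda>j x. d (\<chi> (\<phi> j) x))) ?g =
        mul m (\<lambda>j. ?K (\<phi> j)) (\<lambda>j. ?B (\<phi> j)) g"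
      using mul_mul[OF c(2), of "\<lambda>j. b (\<phi> j)" ?k "\<lambda>j x. d (\<chi> (\<phi> j) x)" "\<lambda>j x. q (\<chi> (\<phi> j) x)"]
        F(2) G(2) \<phi> \<chi> by blast
    moreover have "(\<Sum>p=1..?M. cop ?k (\<lambda>j x. q (\<chi> (\<phi> j) x)) p) = (\<Sum>j=1..m. ?K (\<phi> j))"
      by (rule sum_cop)
    ultimately show ?thesis
      unfolding sub_def cop1 by (auto intro!: nf_cong cop_cop)
  qed
  ultimately show ?thesis by simp
qed

text \<open>Substituting variables for variables only renames, because multiplication with units
  leaves the operation unchanged.\<close>

lemma csub_proj:
  assumes \<phi>: "\<phi> \<in> {1..m} \<rightarrow> {1..n}" and g: "g \<in> ops P m"
    and F: "\<And>i. i \<in> {1..n} \<Longrightarrow> F i = ({\<psi> i}, unit)"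
  shows "csub F (nf m \<phi> g) = nf m (\<lambda>j. \<psi> (\<phi> j)) g"
proof -
  have "csub F (nf m \<phi> g) = sub m \<phi> (\<lambda>_. 1) (\<lambda>i _. \<psi> i) (\<lambda>_. unit) g"
    by (rule csub_nf[OF \<phi> g]) (auto simp: F nf_singleton unit_mem)
  also have "\<dots> = nf m (\<lambda>j. \<psi> (\<phi> j)) g"
    unfolding sub_def using g by (auto simp: mul_units intro!: nf_cong cop_one)
  finally show ?thesis .
qed

lemma csub_unit_right:
  assumes "c \<in> elts n" "\<And>i. i \<in> {1..n} \<Longrightarrow> F i = ({i}, unit)"
  shows "csub F c = c"
  using assms(1)
proof (rule elts_nf)
  fix m \<phi> g assume "\<phi> \<in> {1..m} \<rightarrow> {1..n}" "g \<in> ops P m" "c = nf m \<phi> g"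
  then show ?thesis using csub_proj[of \<phi> m n g F "\<lambda>i. i"] assms(2) by auto
qed

lemma csub_unit_left:
  assumes "F i \<in> elts n"
  shows "csub F ({i}, unit) = F i"
  using assms
proof (rule elts_nf)
  fix m \<phi> g assume Fi: "\<phi> \<in> {1..m} \<rightarrow> {1..n}" "g \<in> ops P m" "F i = nf m \<phi> g"
  text \<open>\<open>csub\<close> only looks at the component \<open>i\<close>, so \<open>F\<close> may be replaced by a constant family.\<close>
  have "csub F ({i}, unit) = csub (\<lambda>_. F i) ({1}, unit)"
  proof -
    have e: "enum {i} j = i" "enum {1} j = 1" if "j \<in> {1..1}" for j :: nat
      using that using enum_singleton[of j] by (auto simp flip: One_nat_def)
    have "(\<Sum>j=1..1. card (fst (F (enum {i} j)))) = (\<Sum>j=1..1::nat. card (fst (F i)))"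
      using e by (intro sum.cong) auto
    moreover have "mul 1 (\<lambda>j. card (fst (F (enum {i} j)))) (\<lambda>j. snd (F (enum {i} j))) unit =
        mul 1 (\<lambda>j. card (fst (F i))) (\<lambda>j. snd (F i)) unit"
      using e by (intro mul_cong) auto
    moreover have "nf (\<Sum>j=1..1. card (fst (F (enum {i} j))))
          (cop (\<lambda>j. card (fst (F (enum {i} j)))) (\<lambda>j. enum (fst (F (enum {i} j))))) g' =
        nf (\<Sum>j=1..1. card (fst (F (enum {i} j))))
          (cop (\<lambda>j. card (fst (F i))) (\<lambda>j. enum (fst (F i)))) g'" for g'
    proof (rule nf_cong)
      fix p assume "p \<in> {1..\<Sum>j=1..1. card (fst (F (enum {i} j)))}"
      then show "cop (\<lambda>j. card (fst (F (enum {i} j)))) (\<lambda>j. enum (fst (F (enum {i} j)))) p =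
          cop (\<lambda>j. card (fst (F i))) (\<lambda>j. enum (fst (F i))) p"
        by (rule cop_cong) (simp_all only: e)
    qed
    ultimately show ?thesis
      by (simp add: csub_def sub_def del: One_nat_def flip: One_nat_def)
  qed
  also have "\<dots> = csub (\<lambda>_. nf m \<phi> g) (nf 1 (\<lambda>_. 1) unit)"
    unfolding nf_singleton[OF unit_mem] Fi(3) ..
  also have "\<dots> = sub 1 (\<lambda>_. 1) (\<lambda>_. m) (\<lambda>_. \<phi>) (\<lambda>_. g) unit"
    by (rule csub_nf[of _ _ 1]) (use Fi unit_mem in auto)
  also have "\<dots> = nf m \<phi> g"
    unfolding sub_def using Fi(2) by (auto simp: mul_unit intro!: nf_cong cop_first)
  finally show ?thesis using Fi by simp
qed

end


section \<open>Monotone functions and their fibres\<close>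

lemma down_closed_eq:
  assumes "A \<subseteq> {1..q}" "\<And>x y. x \<in> A \<Longrightarrow> 1 \<le> y \<Longrightarrow> y \<le> x \<Longrightarrow> y \<in> A"
  shows "A = {1..card A}"
proof (cases "A = {}")
  case False
  have fin: "finite A" using assms(1) finite_subset by blast
  have "A = {1..Max A}"
  proof
    show "A \<subseteq> {1..Max A}" using assms(1) fin by fastforce
    show "{1..Max A} \<subseteq> A" using assms(2)[OF Max_in[OF fin False]] by auto
  qed
  then show ?thesis by (metis card_atLeastAtMost diff_Suc_1)
qed auto

text \<open>The points with value at most \<open>j\<close> form an initial segment because
  \<open>f\<close> is monotone, and their number is the total size of the first \<open>j\<close>
  fibres.\<close>

lemma mono_le_iff:
  fixes f :: "nat \<Rightarrow> nat"
  assumes f: "f \<in> {1..q} \<rightarrow> {1..m}" and mono: "mono_on {1..q} f"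
    and k: "\<And>i. i \<in> {1..m} \<Longrightarrow> k i = card {x \<in> {1..q}. f x = i}"
    and j: "j \<le> m" and x: "x \<in> {1..q}"
  shows "f x \<le> j \<longleftrightarrow> x \<le> (\<Sum>i=1..j. k i)"
proof -
  let ?S = "\<lambda>j. {x \<in> {1..q}. f x \<le> j}"
  have card: "card (?S j) = (\<Sum>i=1..j. k i)" if "j \<le> m" for j
    using that
  proof (induction j)
    case 0
    have "?S 0 = {}" using f by force
    then show ?case by (simp only: card.empty) simp
  next
    case (Suc j)
    have "?S (Suc j) = ?S j \<union> {x \<in> {1..q}. f x = Suc j}" by auto
    moreover have "card (?S j \<union> {x \<in> {1..q}. f x = Suc j}) = card (?S j) + card {x \<in> {1..q}. f x = Suc j}"
      by (rule card_Un_disjoint) auto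
    ultimately show ?case using Suc k[of "Suc j"] by simp
  qed
  have "?S j = {1..card (?S j)}"
  proof (rule down_closed_eq)
    fix x y assume "x \<in> ?S j" "1 \<le> y" "y \<le> x"
    then show "y \<in> ?S j" using mono_onD[OF mono, of y x] by auto
  qed auto
  then have "x \<in> ?S j \<longleftrightarrow> x \<in> {1..\<Sum>i=1..j. k i}" using card[OF j] by simp
  then show ?thesis using x by auto
qed

text \<open>Comparing the bounds of \<open>mono_le_iff\<close> for \<open>i\<close> and for
  \<open>i - 1\<close> pins down the value on the \<open>i\<close>-th block.\<close>

lemma mono_fibres:
  fixes f :: "nat \<Rightarrow> nat"
  assumes f: "f \<in> {1..q} \<rightarrow> {1..m}" and mono: "mono_on {1..q} f"
    and k: "\<And>i. i \<in> {1..m} \<Longrightarrow> k i = card {x \<in> {1..q}. f x = i}"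
  shows "(\<Sum>i=1..m. k i) = q" "\<And>i x. i \<in> {1..m} \<Longrightarrow> x \<in> {1..k i} \<Longrightarrow> f (pos k i x) = i"
proof -
  have "(\<Sum>i=1..m. k i) = (\<Sum>i=1..m. \<Sum>x | x \<in> {1..q} \<and> f x = i. 1)" using k by simp
  also have "\<dots> = (\<Sum>x=1..q. 1)"
    by (rule sum.group) (use f in auto)
  finally show q: "(\<Sum>i=1..m. k i) = q" by simp
  fix i x assume i: "i \<in> {1..m}" and x: "x \<in> {1..k i}"
  have p: "pos k i x \<in> {1..q}" using pos_mem[where k = k, OF i x] q by simp
  have le: "i \<le> m" "i - 1 \<le> m" using i by auto
  have "{1..i} = insert i {1..<i}" "{1..i - 1} = {1..<i}" using i by auto
  then have "pos k i x \<le> (\<Sum>i=1..i. k i)" "\<not> pos k i x \<le> (\<Sum>i=1..i - 1. k i)"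
    using x by (auto simp: pos_def)
  then have "f (pos k i x) \<le> i" "\<not> f (pos k i x) \<le> i - 1"
    using mono_le_iff[OF f mono k le(1) p] mono_le_iff[OF f mono k le(2) p] by blast+
  then show "f (pos k i x) = i" by simp
qed

lemma fibre_eq:
  assumes q: "(\<Sum>i=1..m. k i) = q" and f: "\<And>i x. i \<in> {1..m} \<Longrightarrow> x \<in> {1..k i} \<Longrightarrow> f (pos k i x) = i"
    and i: "i \<in> {1..m}"
  shows "{p \<in> {1..q}. f p = i} = pos k i ` {1..k i}" "card {p \<in> {1..q}. f p = i} = k i"
proof -
  show eq: "{p \<in> {1..q}. f p = i} = pos k i ` {1..k i}"
  proof
    show "{p \<in> {1..q}. f p = i} \<subseteq> pos k i ` {1..k i}"
    proof
      fix p assume "p \<in> {p \<in> {1..q}. f p = i}"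
      then have p: "p \<in> {1..\<Sum>i=1..m. k i}" and fp: "f p = i" using q by auto
      from p obtain j x where "j \<in> {1..m}" "x \<in> {1..k j}" "p = pos k j x" by (rule pos_cases)
      moreover from this have "j = i" using f fp by simp
      ultimately show "p \<in> pos k i ` {1..k i}" by simp
    qed
    show "pos k i ` {1..k i} \<subseteq> {p \<in> {1..q}. f p = i}"
      using f[OF i] pos_mem[where k = k, OF i] q by auto
  qed
  show "card {p \<in> {1..q}. f p = i} = k i"
    unfolding eq by (subst card_image) (auto simp: inj_on_def pos_def)
qed

lemma pos_le_pos:
  assumes "pos k j x \<le> pos k j' x'" "1 \<le> j'" "x' \<in> {1..k j'}" "1 \<le> x"
  shows "j \<le> j'"
  using pos_less_pos[of j' j x' k x] assms by (meson atLeastAtMost_iff not_le)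

lemma mono_cop: "mono_on {1..\<Sum>i=1..m. k i} (cop k (\<lambda>i _. i))"
proof (rule mono_onI)
  fix p p' assume p: "p \<in> {1..\<Sum>i=1..m. k i}" and p': "p' \<in> {1..\<Sum>i=1..m. k i}" and le: "p \<le> p'"
  from p obtain j x where "j \<in> {1..m}" "x \<in> {1..k j}" "p = pos k j x" by (rule pos_cases)
  moreover from p' obtain j' x' where "j' \<in> {1..m}" "x' \<in> {1..k j'}" "p' = pos k j' x'" by (rule pos_cases)
  ultimately show "cop k (\<lambda>i _. i) p \<le> cop k (\<lambda>i _. i) p'"
    using pos_le_pos[of k j x j' x'] le by simp
qed

text \<open>The image of the initial segment up to \<open>x\<close> is the initial segment up to
  \<open>f x\<close>; comparing sizes gives the claim.\<close>

lemma mono_bij_ident: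
  fixes f :: "nat \<Rightarrow> nat"
  assumes bij: "bij_betw f {1..n} {1..n}" and mono: "mono_on {1..n} f" and x: "x \<in> {1..n}"
  shows "f x = x"
proof -
  have "f ` {1..x} = {1..f x}"
  proof
    show "f ` {1..x} \<subseteq> {1..f x}" using bij_betwE[OF bij] mono_onD[OF mono] x by auto
    show "{1..f x} \<subseteq> f ` {1..x}"
    proof
      fix z assume z: "z \<in> {1..f x}"
      moreover have "f x \<le> n" using bij_betwE[OF bij] x by auto
      ultimately have "z \<in> f ` {1..n}" using bij unfolding bij_betw_def by auto
      then obtain y where y: "y \<in> {1..n}" "z = f y" by blast
      have "y \<le> x"
      proof (rule ccontr)
        assume "\<not> y \<le> x"
        then have "f x \<le> f y" using mono_onD[OF mono x y(1)] by simp
        then have "f x = f y" using z y by simp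
        then have "x = y" using bij x y unfolding bij_betw_def inj_on_def by blast
        with \<open>\<not> y \<le> x\<close> show False by simp
      qed
      then show "z \<in> f ` {1..x}" using y by auto
    qed
  qed
  moreover have "inj_on f {1..x}"
    using bij x unfolding bij_betw_def by (auto elim: inj_on_subset)
  ultimately show ?thesis by (metis card_atLeastAtMost card_image diff_Suc_1)
qed


section \<open>Spans and their codes\<close>

context operad
begin

text \<open>Monotonicity of the right leg makes the fibre over \<open>i\<close> the \<open>i\<close>-th block of the apex.\<close>

abbreviation leg :: "'a span \<Rightarrow> nat \<Rightarrow> nat \<Rightarrow> nat" where
  "leg s i x \<equiv> lleg s (pos (fcard s) i x)"

text \<open>The complete invariant of spans: equivalence of spans is equality of codes
  (\<open>span_rel_iff\<close>).\<close>

definition code :: "'a span \<Rightarrow> nat \<times> nat \<times> (nat \<Rightarrow> nat set \<times> 'a)" where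
  "code s = (src s, tgt s, \<lambda>i\<in>{1..tgt s}. nf (fcard s i) (leg s i) (lab s i))"

definition cls :: "nat \<Rightarrow> nat \<Rightarrow> (nat \<Rightarrow> nat set \<times> 'a) \<Rightarrow> 'a span set" where
  "cls n m F = {s. is_span P s \<and> code s = (n, m, F)}"

lemma prespan_apex:
  assumes "is_prespan P s"
  shows "(\<Sum>i=1..tgt s. fcard s i) = apex s"
    and "\<And>i x. i \<in> {1..tgt s} \<Longrightarrow> x \<in> {1..fcard s i} \<Longrightarrow> rleg s (pos (fcard s) i x) = i"
  using mono_fibres[of "rleg s" "apex s" "tgt s" "fcard s"] assms
  unfolding is_prespan_def Fun_def by (auto simp: fcard_def fib_def)

lemma prespan_fib:
  assumes "is_prespan P s" "i \<in> {1..tgt s}"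
  shows "fib s i = pos (fcard s) i ` {1..fcard s i}"
  unfolding fib_def by (rule fibre_eq(1)[OF prespan_apex[OF assms(1)] assms(2)])

lemma prespan_pos:
  assumes "is_prespan P s" "i \<in> {1..tgt s}" "x \<in> {1..fcard s i}"
  shows "pos (fcard s) i x \<in> {1..apex s}"
  using pos_mem[where k = "fcard s", OF assms(2,3)] prespan_apex(1)[OF assms(1)] by simp

lemma prespan_leg:
  assumes "is_prespan P s" "i \<in> {1..tgt s}"
  shows "leg s i \<in> {1..fcard s i} \<rightarrow> {1..src s}"
  using prespan_pos[OF assms] assms(1) unfolding is_prespan_def Fun_def by blast

lemma prespan_lab: "is_prespan P s \<Longrightarrow> i \<in> {1..tgt s} \<Longrightarrow> lab s i \<in> ops P (fcard s i)"
  unfolding is_prespan_def by auto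

lemma span_leg_inj:
  assumes "is_span P s" "i \<in> {1..tgt s}"
  shows "inj_on (leg s i) {1..fcard s i}"
proof (rule inj_onI)
  fix x y assume xy: "x \<in> {1..fcard s i}" "y \<in> {1..fcard s i}" and eq: "leg s i x = leg s i y"
  have s: "is_prespan P s" and inj: "inj_on (lleg s) (fib s i)" using assms by (auto simp: is_span_def)
  have "pos (fcard s) i x = pos (fcard s) i y"
    using inj eq xy unfolding prespan_fib[OF s assms(2)] inj_on_def by blast
  then show "x = y" by (simp add: pos_def)
qed

lemma code_mem: "is_prespan P s \<Longrightarrow> snd (snd (code s)) \<in> {1..tgt s} \<rightarrow>\<^sub>E elts (src s)"
  unfolding code_def using nf_mem[OF prespan_leg prespan_lab] by auto

text \<open>Injective reindexings with equal image differ by the permutation \<sigma> with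
  \<open>\<phi> \<circ> \<sigma> = \<phi>'\<close>. Equality of the normalized operations says that
  \<open>g\<close> and the result of \<sigma> acting on \<open>g'\<close> agree after the action of
  the permutation \<open>?r\<close>, which can be cancelled.\<close>

lemma nf_inj:
  assumes \<phi>: "inj_on \<phi> {1..k}" and \<phi>': "inj_on \<phi>' {1..k'}" and g: "g \<in> ops P k" "g' \<in> ops P k'"
    and eq: "nf k \<phi> g = nf k' \<phi>' g'"
  shows "k = k'" "\<exists>\<sigma>\<in>Sym k. g = act k k \<sigma> g' \<and> (\<forall>x\<in>{1..k}. \<phi> (\<sigma> x) = \<phi>' x)"
proof -
  let ?A = "\<phi> ` {1..k}"
  have A: "?A = \<phi>' ` {1..k'}" using eq by (simp add: nf_def)
  have card: "card ?A = k" "card ?A = k'"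
    using card_image[OF \<phi>] card_image[OF \<phi>'] A by simp_all
  then show kk: "k = k'" by simp
  let ?r = "\<lambda>x. rank ?A (\<phi> x)"
  have "bij_betw \<phi> {1..k} ?A" "bij_betw (rank ?A) ?A {1..k}"
    using \<phi> bij_betw_rank[of ?A] card by (auto simp: bij_betw_def)
  then have r: "bij_betw ?r {1..k} {1..k}" using bij_betw_trans by (fastforce simp: comp_def)
  define \<sigma> where "\<sigma> = restrict (\<lambda>x. inv_into {1..k} \<phi> (\<phi>' x)) {1..k}"
  have b': "bij_betw \<phi>' {1..k} ?A" using \<phi>' A kk by (simp add: bij_betw_def)
  have "bij_betw (inv_into {1..k} \<phi> \<circ> \<phi>') {1..k} {1..k}"
    by (rule bij_betw_trans[OF b' bij_betw_inv_into]) (use \<phi> in \<open>auto simp: bij_betw_def\<close>)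
  then have \<sigma>: "bij_betw \<sigma> {1..k} {1..k}"
    unfolding \<sigma>_def by (subst bij_betw_cong[of _ _ "inv_into {1..k} \<phi> \<circ> \<phi>'"]) auto
  then have \<sigma>S: "\<sigma> \<in> Sym k"
    unfolding Sym_def Fun_def using bij_betwE[OF \<sigma>] by (auto simp: \<sigma>_def)
  have \<phi>\<sigma>: "\<phi> (\<sigma> x) = \<phi>' x" if "x \<in> {1..k}" for x
  proof -
    have "\<phi>' x \<in> ?A" using b' that bij_betwE by blast
    then show ?thesis using that by (simp add: \<sigma>_def f_inv_into_f)
  qed
  have \<sigma>im: "\<sigma> ` {1..k} = {1..k}" and rim: "?r ` {1..k} = {1..k}"
    using \<sigma> r by (auto simp: bij_betw_def)
  have g': "g' \<in> ops P k" using g kk by simp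
  have "act k k ?r (act k k \<sigma> g') = act k k (\<lambda>x. rank ?A (\<phi>' x)) g'"
    using act_act[OF \<sigma>im rim g'] act_cong[of k "\<lambda>x. ?r (\<sigma> x)" "\<lambda>x. rank ?A (\<phi>' x)"] \<phi>\<sigma> by simp
  also have "\<dots> = act k k ?r g" using eq card A unfolding nf_def by simp
  finally have e: "act k k ?r (act k k \<sigma> g') = act k k ?r g" .
  let ?s = "inv_into {1..k} ?r"
  have sim: "?s ` {1..k} = {1..k}" using bij_betw_inv_into[OF r] by (simp add: bij_betw_def)
  have cancel: "act k k ?s (act k k ?r h) = h" if "h \<in> ops P k" for h
    unfolding act_act[OF rim sim that]
    by (rule act_ident[OF _ that]) (rule bij_betw_inv_into_left[OF r])
  have "act k k \<sigma> g' = g" using e cancel act_mem[OF \<sigma>im g'] g by metis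
  with \<sigma>S \<phi>\<sigma> show "\<exists>\<sigma>\<in>Sym k. g = act k k \<sigma> g' \<and> (\<forall>x\<in>{1..k}. \<phi> (\<sigma> x) = \<phi>' x)" by blast
qed

lemma restrict_Sym: "\<sigma> \<in> Sym k \<Longrightarrow> restrict \<sigma> {1..k} = \<sigma>"
  unfolding Sym_def Fun_def by (auto intro: PiE_restrict)

lemma Sym_image: "\<sigma> \<in> Sym k \<Longrightarrow> \<sigma> ` {1..k} = {1..k}"
  by (simp add: Sym_def bij_betw_def)

lemma compose_sum_fun:
  assumes "is_prespan P s"
  shows "compose {1..apex s} (lleg s) (sum_fun (tgt s) (fcard s) (fcard s) \<sigma>) =
    restrict (cop (fcard s) (\<lambda>i x. leg s i (\<sigma> i x))) {1..apex s}"
  using prespan_apex(1)[OF assms] by (auto simp: compose_def sum_fun_def cop_def)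

text \<open>Turns the equation between left legs in \<open>span_rel\<close> into one equation for
  each fibre. The second arity function \<open>k'\<close> lets the two spans use their own fibre
  sizes.\<close>

lemma cop_eq_iff:
  assumes "\<And>i. i \<in> {1..m} \<Longrightarrow> k i = k' i" "h \<in> extensional {1..\<Sum>i=1..m. k i}"
  shows "restrict (cop k F) {1..\<Sum>i=1..m. k i} = h \<longleftrightarrow>
    (\<forall>i\<in>{1..m}. \<forall>x\<in>{1..k i}. F i x = h (pos k' i x))"
proof
  have pos: "pos k i x = pos k' i x" if "i \<in> {1..m}" for i x
    using assms(1) that unfolding pos_def by (auto intro!: sum.cong)
  {
    assume eq: "restrict (cop k F) {1..\<Sum>i=1..m. k i} = h"
    show "\<forall>i\<in>{1..m}. \<forall>x\<in>{1..k i}. F i x = h (pos k' i x)"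
    proof (intro ballI)
      fix i x assume "i \<in> {1..m}" "x \<in> {1..k i}"
      then have "restrict (cop k F) {1..\<Sum>i=1..m. k i} (pos k i x) = F i x"
        using pos_mem[of i m x k] by simp
      with eq pos \<open>i \<in> {1..m}\<close> show "F i x = h (pos k' i x)" by simp
    qed
  }
  assume F: "\<forall>i\<in>{1..m}. \<forall>x\<in>{1..k i}. F i x = h (pos k' i x)"
  show "restrict (cop k F) {1..\<Sum>i=1..m. k i} = h"
  proof (rule extensionalityI[OF restrict_extensional assms(2)])
    fix p assume p: "p \<in> {1..\<Sum>i=1..m. k i}"
    then obtain j x where jx: "j \<in> {1..m}" "x \<in> {1..k j}" "p = pos k j x" by (rule pos_cases)
    then have "cop k F p = F j x" by simp
    with F jx pos p show "restrict (cop k F) {1..\<Sum>i=1..m. k i} p = h p" by simp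
  qed
qed

text \<open>From left to right, the permutations in \<open>span_rel\<close> are absorbed by
  \<open>nf_act\<close>. From right to left, injectivity on the fibres lets \<open>nf_inj\<close>
  produce the permutations, and equal fibre sizes force the apexes and the monotone right legs to
  coincide.\<close>

lemma span_rel_iff: "(s, s') \<in> span_rel P \<longleftrightarrow> is_span P s \<and> is_span P s' \<and> code s = code s'"
proof
  assume rel: "(s, s') \<in> span_rel P"
  then have sp: "is_span P s" "is_span P s'" and eqs: "src s = src s'" "tgt s = tgt s'" "apex s = apex s'"
      "rleg s = rleg s'"
    unfolding span_rel_def by auto
  obtain \<sigma> where \<sigma>: "\<And>i. i \<in> {1..tgt s} \<Longrightarrow> \<sigma> i \<in> Sym (fcard s i) \<and>
        lab s i = op_act P (fcard s i) (fcard s i) (\<sigma> i) (lab s' i)"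
      and comp: "compose {1..apex s} (lleg s) (sum_fun (tgt s) (fcard s) (fcard s) \<sigma>) = lleg s'"
    using rel unfolding span_rel_def by blast
  have ps: "is_prespan P s" "is_prespan P s'" using sp by (auto simp: is_span_def)
  have fc: "fcard s = fcard s'" using eqs by (simp add: fun_eq_iff fcard_def fib_def)
  have ext: "lleg s' \<in> extensional {1..\<Sum>i=1..tgt s. fcard s i}"
    using ps(2) prespan_apex(1)[OF ps(1)] eqs unfolding is_prespan_def Fun_def by (auto simp: PiE_iff)
  have leg: "leg s i (\<sigma> i x) = leg s' i x" if "i \<in> {1..tgt s}" "x \<in> {1..fcard s i}" for i x
    using cop_eq_iff[where k = "fcard s" and k' = "fcard s'" and m = "tgt s", OF _ ext] comp that
      compose_sum_fun[OF ps(1)] prespan_apex(1)[OF ps(1)] fc by simp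
  have "nf (fcard s i) (leg s i) (lab s i) = nf (fcard s' i) (leg s' i) (lab s' i)"
    if i: "i \<in> {1..tgt s}" for i
  proof -
    have S: "\<sigma> i \<in> Sym (fcard s i)" and lab: "lab s i = act (fcard s i) (fcard s i) (\<sigma> i) (lab s' i)"
      using \<sigma>[OF i] restrict_Sym[of "\<sigma> i" "fcard s i"] by (auto simp: act_def)
    have "lab s' i \<in> ops P (fcard s i)" using prespan_lab[OF ps(2)] i eqs fc by simp
    then have "nf (fcard s i) (leg s i) (lab s i) = nf (fcard s i) (\<lambda>x. leg s i (\<sigma> i x)) (lab s' i)"
      unfolding lab by (rule nf_act[OF Sym_image[OF S]])
    then show ?thesis using nf_cong[of "fcard s i" "\<lambda>x. leg s i (\<sigma> i x)" "leg s' i"] leg[OF i] fc by simp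
  qed
  then have "code s = code s'" unfolding code_def using eqs by (auto intro: restrict_ext)
  with sp show "is_span P s \<and> is_span P s' \<and> code s = code s'" by blast
next
  assume "is_span P s \<and> is_span P s' \<and> code s = code s'"
  then have sp: "is_span P s" "is_span P s'" and code: "code s = code s'" by auto
  have ps: "is_prespan P s" "is_prespan P s'" using sp by (auto simp: is_span_def)
  have st: "src s = src s'" "tgt s = tgt s'" using code by (auto simp: code_def)
  have nf: "nf (fcard s i) (leg s i) (lab s i) = nf (fcard s' i) (leg s' i) (lab s' i)"
    if "i \<in> {1..tgt s}" for i
    using code that unfolding code_def by (metis (no_types, lifting) Pair_inject restrict_apply')
  have ex: "fcard s i = fcard s' i \<and> (\<exists>\<sigma>\<in>Sym (fcard s i). lab s i = act (fcard s i) (fcard s i) \<sigma> (lab s' i) \<and>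
      (\<forall>x\<in>{1..fcard s i}. leg s i (\<sigma> x) = leg s' i x))" if i: "i \<in> {1..tgt s}" for i
    using nf_inj[OF span_leg_inj[OF sp(1) i] span_leg_inj[OF sp(2)] prespan_lab[OF ps(1) i]
        prespan_lab[OF ps(2)] nf[OF i]] i st by simp
  then have fc: "\<And>i. i \<in> {1..tgt s} \<Longrightarrow> fcard s i = fcard s' i" by blast
  have "\<forall>i\<in>{1..tgt s}. \<exists>\<sigma>. \<sigma> \<in> Sym (fcard s i) \<and> lab s i = act (fcard s i) (fcard s i) \<sigma> (lab s' i) \<and>
      (\<forall>x\<in>{1..fcard s i}. leg s i (\<sigma> x) = leg s' i x)" using ex by blast
  then obtain \<sigma> where \<sigma>: "\<And>i. i \<in> {1..tgt s} \<Longrightarrow> \<sigma> i \<in> Sym (fcard s i) \<and>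
      lab s i = act (fcard s i) (fcard s i) (\<sigma> i) (lab s' i) \<and>
      (\<forall>x\<in>{1..fcard s i}. leg s i (\<sigma> i x) = leg s' i x)"
    unfolding bchoice_iff by blast
  have apex: "apex s = apex s'"
    using prespan_apex(1)[OF ps(1)] prespan_apex(1)[OF ps(2)] fc st by simp
  have ext: "lleg s' \<in> extensional {1..\<Sum>i=1..tgt s. fcard s i}"
    "rleg s' \<in> extensional {1..\<Sum>i=1..tgt s. fcard s i}"
    using ps(2) prespan_apex(1)[OF ps(1)] apex unfolding is_prespan_def Fun_def by (auto simp: PiE_iff)
  have pos: "pos (fcard s) i x = pos (fcard s') i x" if "i \<in> {1..tgt s}" for i x
    using fc that unfolding pos_def by (auto intro!: sum.cong)
  have "rleg s = rleg s'"
  proof (rule extensionalityI[of _ "{1..\<Sum>i=1..tgt s. fcard s i}"])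
    show "rleg s \<in> extensional {1..\<Sum>i=1..tgt s. fcard s i}"
      using ps(1) prespan_apex(1)[OF ps(1)] unfolding is_prespan_def Fun_def by (auto simp: PiE_iff)
    fix p assume "p \<in> {1..\<Sum>i=1..tgt s. fcard s i}"
    then obtain i x where ix: "i \<in> {1..tgt s}" "x \<in> {1..fcard s i}" "p = pos (fcard s) i x"
      by (rule pos_cases)
    then show "rleg s p = rleg s' p"
      using prespan_apex(2)[OF ps(1)] prespan_apex(2)[OF ps(2), of i x] fc st pos by simp
  qed (rule ext)
  moreover have "compose {1..apex s} (lleg s) (sum_fun (tgt s) (fcard s) (fcard s) \<sigma>) = lleg s'"
    using cop_eq_iff[where k = "fcard s" and k' = "fcard s'" and m = "tgt s", OF fc ext(1)] \<sigma>
      compose_sum_fun[OF ps(1)] prespan_apex(1)[OF ps(1)] by simp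
  moreover have "\<forall>i\<in>{1..tgt s}. \<sigma> i \<in> Sym (fcard s i) \<and>
      lab s i = op_act P (fcard s i) (fcard s i) (\<sigma> i) (lab s' i)"
    using \<sigma> restrict_Sym by (auto simp: act_def)
  ultimately show "(s, s') \<in> span_rel P"
    unfolding span_rel_def using sp st apex by blast
qed

lemma span_rel_image: "is_span P s \<Longrightarrow> code s = (n, m, F) \<Longrightarrow> span_rel P `` {s} = cls n m F"
  by (auto simp: span_rel_iff cls_def)

text \<open>Spans assembled from blocks: regularizations, representatives of a code, identities and
  projections are all recognized as instances.\<close>

lemma block_span:
  assumes t_def: "t = \<lparr>src = n, tgt = m, apex = (\<Sum>i=1..m. k i), lleg = copair m k \<phi>,
      rleg = (\<lambda>p\<in>{1..\<Sum>i=1..m. k i}. block k p), lab = restrict g {1..m}\<rparr>"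
  assumes \<phi>: "\<And>i. i \<in> {1..m} \<Longrightarrow> \<phi> i \<in> Inj (k i) n" and g: "\<And>i. i \<in> {1..m} \<Longrightarrow> g i \<in> ops P (k i)"
  shows "is_span P t" "code t = (n, m, \<lambda>i\<in>{1..m}. nf (k i) (\<phi> i) (g i))"
proof -
  have b: "block k = cop k (\<lambda>i _. i)" by (auto simp: cop_def)
  have c: "copair m k \<phi> = restrict (cop k \<phi>) {1..\<Sum>i=1..m. k i}" by (simp add: copair_def cop_def[abs_def])
  have rl: "rleg t (pos k i x) = i" if "i \<in> {1..m}" "x \<in> {1..k i}" for i x
    using pos_mem[where k = k, OF that] that by (simp add: t_def b)
  have ll: "lleg t (pos k i x) = \<phi> i x" if "i \<in> {1..m}" "x \<in> {1..k i}" for i x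
    using pos_mem[where k = k, OF that] that by (simp add: t_def c)
  have fib: "fib t i = pos k i ` {1..k i}" and fc: "fcard t i = k i" if "i \<in> {1..m}" for i
    using fibre_eq[where k = k and m = m and f = "rleg t", OF refl rl that]
    by (auto simp: fib_def fcard_def t_def)
  have pos: "pos (fcard t) i x = pos k i x" if "i \<in> {1..m}" for i x
    using fc that unfolding pos_def by (auto intro!: sum.cong)
  have ps: "is_prespan P t"
    unfolding is_prespan_def
  proof (intro conjI)
    have "cop k \<phi> \<in> {1..\<Sum>i=1..m. k i} \<rightarrow> {1..n}" by (rule cop_Pi) (use \<phi> in \<open>auto simp: Inj_def Fun_def\<close>)
    then show "lleg t \<in> Fun (apex t) (src t)" by (auto simp: t_def c Fun_def)
    have "cop k (\<lambda>i _. i) \<in> {1..\<Sum>i=1..m. k i} \<rightarrow> {1..m}" by (rule cop_Pi) auto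
    then show "rleg t \<in> Fun (apex t) (tgt t)" by (auto simp: t_def b Fun_def)
    show "mono_on {1..apex t} (rleg t)"
      using mono_cop[where k = k and m = m] by (auto simp: t_def b mono_on_def)
    show "lab t \<in> (\<Pi>\<^sub>E i\<in>{1..tgt t}. ops P (fcard t i))"
      using g fc by (auto simp: t_def)
  qed
  have "inj_on (lleg t) (fib t i)" if i: "i \<in> {1..m}" for i
  proof (rule inj_onI)
    fix p p' assume p: "p \<in> fib t i" "p' \<in> fib t i" "lleg t p = lleg t p'"
    then obtain x x' where "x \<in> {1..k i}" "x' \<in> {1..k i}" "p = pos k i x" "p' = pos k i x'"
      using fib[OF i] by auto
    moreover from this have "\<phi> i x = \<phi> i x'" using p ll[OF i] by simp
    moreover have "inj_on (\<phi> i) {1..k i}" using \<phi>[OF i] by (simp add: Inj_def)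
    ultimately show "p = p'" by (metis inj_onD)
  qed
  with ps show "is_span P t" by (simp add: is_span_def t_def)
  have "nf (fcard t i) (leg t i) (lab t i) = nf (k i) (\<phi> i) (g i)" if i: "i \<in> {1..m}" for i
  proof -
    have "lab t i = g i" using i by (simp add: t_def)
    then show ?thesis using nf_cong[of "k i" "leg t i" "\<phi> i"] fc[OF i] pos[OF i] ll[OF i] by simp
  qed
  then show "code t = (n, m, \<lambda>i\<in>{1..m}. nf (k i) (\<phi> i) (g i))"
    by (auto simp: code_def t_def intro!: restrict_ext)
qed

text \<open>The representative takes the increasing enumerations of the supports as its left
  leg.\<close>

lemma cls_nonempty:
  assumes "F \<in> {1..m} \<rightarrow>\<^sub>E elts n"
  shows "\<exists>s. is_span P s \<and> code s = (n, m, F)"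
proof -
  let ?k = "\<lambda>i. card (fst (F i))" and ?\<phi> = "\<lambda>i. restrict (enum (fst (F i))) {1..card (fst (F i))}"
  have F: "fst (F i) \<subseteq> {1..n} \<and> finite (fst (F i)) \<and> snd (F i) \<in> ops P (?k i)" if "i \<in> {1..m}" for i
  proof -
    have "F i \<in> elts n" using assms that by (rule PiE_mem)
    then have "fst (F i) \<subseteq> {1..n}" "snd (F i) \<in> ops P (?k i)" by (auto simp: elts_def)
    then show ?thesis using finite_subset by blast
  qed
  have \<phi>: "?\<phi> i \<in> Inj (?k i) n" if "i \<in> {1..m}" for i
  proof -
    have "bij_betw (enum (fst (F i))) {1..?k i} (fst (F i))" using F[OF that] bij_betw_enum by blast
    then have e: "inj_on (enum (fst (F i))) {1..?k i}" "enum (fst (F i)) ` {1..?k i} = fst (F i)"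
      by (auto simp: bij_betw_def)
    then have "\<And>x. x \<in> {1..?k i} \<Longrightarrow> enum (fst (F i)) x \<in> {1..n}" using F[OF that] by blast
    then show ?thesis using e(1) unfolding Inj_def Fun_def by (simp add: inj_on_restrict_eq)
  qed
  have "nf (?k i) (?\<phi> i) (snd (F i)) = F i" if "i \<in> {1..m}" for i
    using F[OF that] nf_enum[of "fst (F i)" "snd (F i)"]
      nf_cong[of "?k i" "?\<phi> i" "enum (fst (F i))" "snd (F i)"] by simp
  then have "(\<lambda>i\<in>{1..m}. nf (?k i) (?\<phi> i) (snd (F i))) = F"
    using assms by (intro extensionalityI[of _ "{1..m}"]) (auto simp: PiE_iff)
  then show ?thesis
    using block_span[OF refl, where m = m and \<phi> = ?\<phi> and k = ?k and n = n and g = "\<lambda>i. snd (F i)"]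
      \<phi> F by auto
qed

text \<open>By \<open>nf_act\<close> the surjection acting on a label is undone in the normal form,
  so it does not matter which factorization a regularization uses.\<close>

lemma regularization_code:
  assumes s: "is_prespan P s" and t: "is_regularization P s t"
  shows "is_span P t" "code t = code s"
proof -
  obtain k \<phi> \<psi> where *: "\<And>i. i \<in> {1..tgt s} \<Longrightarrow> \<psi> i \<in> Surj (fcard s i) (k i) \<and> \<phi> i \<in> Inj (k i) (src s) \<and>
        (\<forall>x\<in>{1..fcard s i}. leg s i x = \<phi> i (\<psi> i x))"
     and t: "t = \<lparr>src = src s, tgt = tgt s, apex = (\<Sum>i=1..tgt s. k i),
          lleg = copair (tgt s) k \<phi>,
          rleg = (\<lambda>p\<in>{1..\<Sum>i=1..tgt s. k i}. block k p),
          lab = (\<lambda>i\<in>{1..tgt s}. op_act P (fcard s i) (k i) (\<psi> i) (lab s i))\<rparr>"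
    using t unfolding is_regularization_def by blast
  have \<psi>: "\<psi> i ` {1..fcard s i} = {1..k i}"
    and act: "op_act P (fcard s i) (k i) (\<psi> i) (lab s i) = act (fcard s i) (k i) (\<psi> i) (lab s i)"
    if "i \<in> {1..tgt s}" for i
    using *[OF that] by (auto simp: Surj_def Fun_def act_def PiE_restrict)
  have lab: "op_act P (fcard s i) (k i) (\<psi> i) (lab s i) \<in> ops P (k i)" if "i \<in> {1..tgt s}" for i
    unfolding act[OF that] by (rule act_mem[OF \<psi>[OF that] prespan_lab[OF s that]])
  note n = block_span[OF t, OF _ lab]
  show "is_span P t" using n(1) * by blast
  have "nf (k i) (\<phi> i) (op_act P (fcard s i) (k i) (\<psi> i) (lab s i)) = nf (fcard s i) (leg s i) (lab s i)"
    if i: "i \<in> {1..tgt s}" for i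
    unfolding act[OF i] nf_act[OF \<psi>[OF i] prespan_lab[OF s i]] by (rule nf_cong) (use *[OF i] in auto)
  then have "(\<lambda>i\<in>{1..tgt s}. nf (k i) (\<phi> i) (op_act P (fcard s i) (k i) (\<psi> i) (lab s i))) =
      (\<lambda>i\<in>{1..tgt s}. nf (fcard s i) (leg s i) (lab s i))" by (intro restrict_ext)
  moreover have "code t = (src s, tgt s,
      \<lambda>i\<in>{1..tgt s}. nf (k i) (\<phi> i) (op_act P (fcard s i) (k i) (\<psi> i) (lab s i)))"
    by (rule n(2)) (use * in blast)
  ultimately show "code t = code s" by (simp only: code_def[of s])
qed

text \<open>The factorization through the image, with \<open>rank\<close> giving the surjection and
  \<open>enum\<close> the injection.\<close>

lemma regularization_exists:
  assumes s: "is_prespan P s"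
  shows "\<exists>t. is_regularization P s t"
proof -
  let ?A = "\<lambda>i. leg s i ` {1..fcard s i}"
  let ?\<psi> = "\<lambda>i. restrict (\<lambda>x. rank (?A i) (leg s i x)) {1..fcard s i}"
  let ?\<phi> = "\<lambda>i. restrict (enum (?A i)) {1..card (?A i)}"
  have "?\<psi> i \<in> Surj (fcard s i) (card (?A i)) \<and> ?\<phi> i \<in> Inj (card (?A i)) (src s) \<and>
        (\<forall>x\<in>{1..fcard s i}. leg s i x = ?\<phi> i (?\<psi> i x))" if i: "i \<in> {1..tgt s}" for i
  proof (intro conjI)
    show "?\<psi> i \<in> Surj (fcard s i) (card (?A i))"
      using rank_image[of "leg s i" "fcard s i"] by (rule restrict_Surj)
    have "bij_betw (enum (?A i)) {1..card (?A i)} (?A i)" by (rule bij_betw_enum) simp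
    then have e: "enum (?A i) ` {1..card (?A i)} = ?A i" "inj_on (enum (?A i)) {1..card (?A i)}"
      unfolding bij_betw_def by auto
    have "?A i \<subseteq> {1..src s}" using prespan_leg[OF s i] by blast
    with e have "enum (?A i) x \<in> {1..src s}" if "x \<in> {1..card (?A i)}" for x using that by blast
    then show "?\<phi> i \<in> Inj (card (?A i)) (src s)"
      using e(2) unfolding Inj_def Fun_def by (simp add: inj_on_restrict_eq)
    show "\<forall>x\<in>{1..fcard s i}. leg s i x = ?\<phi> i (?\<psi> i x)"
    proof
      fix x assume x: "x \<in> {1..fcard s i}"
      then have "leg s i x \<in> ?A i" by blast
      then show "leg s i x = ?\<phi> i (?\<psi> i x)"
        using rank_mem[of "?A i" "leg s i x"] enum_rank[of "?A i" "leg s i x"] x by simp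
    qed
  qed
  then show ?thesis unfolding is_regularization_def
    by (intro exI[of _ "\<lparr>src = src s, tgt = tgt s, apex = (\<Sum>i=1..tgt s. card (?A i)),
          lleg = copair (tgt s) (\<lambda>i. card (?A i)) ?\<phi>,
          rleg = (\<lambda>p\<in>{1..\<Sum>i=1..tgt s. card (?A i)}. block (\<lambda>i. card (?A i)) p),
          lab = (\<lambda>i\<in>{1..tgt s}. op_act P (fcard s i) (card (?A i)) (?\<psi> i) (lab s i))\<rparr>"]
        exI[of _ "\<lambda>i. card (?A i)"] exI[of _ ?\<phi>] exI[of _ ?\<psi>]) blast
qed

end


section \<open>Composition of spans in terms of codes\<close>

context operad
begin

text \<open>The monotonicity conditions make the chosen pullback rigid. The fibre of
  \<open>f\<close> over \<open>y\<close> is the \<open>y\<close>-th block, and \<phi> maps it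
  bijectively and monotonically onto the fibre of the right leg of \<open>s\<close> over
  \<open>lleg s' y\<close>; in coordinates this is a monotone bijection of an initial segment, hence
  the identity.\<close>

lemma pullback_fibres:
  assumes s: "is_prespan P s" and s': "is_prespan P s'" and st: "tgt s = src s'"
    and pb: "is_pullback s s' q \<phi> f"
  defines "K \<equiv> \<lambda>y. fcard s (lleg s' y)"
  shows "(\<Sum>y=1..apex s'. K y) = q"
    and "\<And>y x. y \<in> {1..apex s'} \<Longrightarrow> x \<in> {1..K y} \<Longrightarrow> f (pos K y x) = y"
    and "\<And>y x. y \<in> {1..apex s'} \<Longrightarrow> x \<in> {1..K y} \<Longrightarrow> \<phi> (pos K y x) = pos (fcard s) (lleg s' y) x"
proof -
  let ?B = "{(x, y). x \<in> {1..apex s} \<and> y \<in> {1..apex s'} \<and> rleg s x = lleg s' y}"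
  have f: "f \<in> {1..q} \<rightarrow> {1..apex s'}" and mf: "mono_on {1..q} f"
    and bij: "bij_betw (\<lambda>p. (\<phi> p, f p)) {1..q} ?B"
    and m\<phi>: "\<And>y. y \<in> {1..apex s'} \<Longrightarrow> mono_on {p \<in> {1..q}. f p = y} \<phi>"
    using pb unfolding is_pullback_def Fun_def by (auto simp: PiE_iff)
  have bijy: "bij_betw \<phi> {p \<in> {1..q}. f p = y} (fib s (lleg s' y))" if y: "y \<in> {1..apex s'}" for y
    unfolding bij_betw_def
  proof
    show "inj_on \<phi> {p \<in> {1..q}. f p = y}"
    proof (rule inj_onI)
      fix p p' assume "p \<in> {p \<in> {1..q}. f p = y}" "p' \<in> {p \<in> {1..q}. f p = y}" "\<phi> p = \<phi> p'"
      then show "p = p'" using inj_onD[OF bij_betw_imp_inj_on[OF bij], of p p'] by auto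
    qed
    show "\<phi> ` {p \<in> {1..q}. f p = y} = fib s (lleg s' y)"
    proof (intro set_eqI iffI)
      fix x assume "x \<in> \<phi> ` {p \<in> {1..q}. f p = y}"
      then obtain p where "p \<in> {1..q}" "f p = y" "x = \<phi> p" by blast
      then show "x \<in> fib s (lleg s' y)" using bij_betwE[OF bij] unfolding fib_def by auto
    next
      fix x assume "x \<in> fib s (lleg s' y)"
      then have "(x, y) \<in> (\<lambda>p. (\<phi> p, f p)) ` {1..q}"
        using y unfolding bij_betw_imp_surj_on[OF bij] fib_def by auto
      then show "x \<in> \<phi> ` {p \<in> {1..q}. f p = y}" by auto
    qed
  qed
  have K: "K y = card {p \<in> {1..q}. f p = y}" if "y \<in> {1..apex s'}" for y
    using bij_betw_same_card[OF bijy[OF that]] by (simp add: K_def fcard_def)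
  show q: "(\<Sum>y=1..apex s'. K y) = q" by (rule mono_fibres(1)[OF f mf K])
  show fp: "f (pos K y x) = y" if "y \<in> {1..apex s'}" "x \<in> {1..K y}" for y x
    by (rule mono_fibres(2)[OF f mf K that])
  fix y x assume y: "y \<in> {1..apex s'}" and x: "x \<in> {1..K y}"
  have i: "lleg s' y \<in> {1..tgt s}"
    using s' st y unfolding is_prespan_def Fun_def by (auto simp: PiE_iff)
  let ?i = "lleg s' y"
  have fibK: "fib s ?i = pos (fcard s) ?i ` {1..K y}" unfolding K_def by (rule prespan_fib[OF s i])
  have fibf: "{p \<in> {1..q}. f p = y} = pos K y ` {1..K y}" by (rule fibre_eq(1)[OF q fp y])
  have b1: "bij_betw (pos k j) {1..n} (pos k j ` {1..n})" for k j n
    by (auto simp: bij_betw_def inj_on_def pos_def)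
  \<comment> \<open>\<open>h\<close> is \<phi> read in the coordinates of the two blocks.\<close>
  define h where "h = (\<lambda>x. inv_into {1..K y} (pos (fcard s) ?i) (\<phi> (pos K y x)))"
  have "bij_betw (inv_into {1..K y} (pos (fcard s) ?i) \<circ> (\<phi> \<circ> pos K y)) {1..K y} {1..K y}"
    by (intro bij_betw_trans[of _ _ "fib s ?i"] bij_betw_trans[of _ _ "{p \<in> {1..q}. f p = y}"] bijy[OF y])
      (use b1 fibf bij_betw_inv_into[OF b1] fibK in auto)
  then have hb: "bij_betw h {1..K y} {1..K y}" by (simp add: h_def comp_def)
  have hp: "pos (fcard s) ?i (h z) = \<phi> (pos K y z)" if "z \<in> {1..K y}" for z
  proof -
    have "pos K y z \<in> {p \<in> {1..q}. f p = y}" unfolding fibf using that by blast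
    then have "\<phi> (pos K y z) \<in> pos (fcard s) ?i ` {1..K y}"
      using bij_betwE[OF bijy[OF y]] fibK by blast
    then show ?thesis unfolding h_def by (rule f_inv_into_f)
  qed
  have "mono_on {1..K y} h"
  proof (rule mono_onI)
    fix a b assume ab: "a \<in> {1..K y}" "b \<in> {1..K y}" "a \<le> b"
    have "pos K y a \<in> {p \<in> {1..q}. f p = y}" "pos K y b \<in> {p \<in> {1..q}. f p = y}"
      unfolding fibf using ab by blast+
    moreover have "pos K y a \<le> pos K y b" using ab by (simp add: pos_def)
    ultimately have "\<phi> (pos K y a) \<le> \<phi> (pos K y b)" using mono_onD[OF m\<phi>[OF y]] by blast
    then have "pos (fcard s) ?i (h a) \<le> pos (fcard s) ?i (h b)" using hp ab by simp
    then show "h a \<le> h b" by (simp add: pos_def)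
  qed
  then have "h x = x" using mono_bij_ident[OF hb _ x] by blast
  then show "\<phi> (pos K y x) = pos (fcard s) ?i x" using hp[OF x] by simp
qed

text \<open>The pullback lists, for each \<open>y\<close> in turn, the fibre of the right leg of
  \<open>s\<close> over \<open>lleg s' y\<close>.\<close>

lemma pullback_exists:
  assumes s: "is_prespan P s" and s': "is_prespan P s'" and st: "tgt s = src s'"
  shows "\<exists>q \<phi> f. is_pullback s s' q \<phi> f"
proof -
  define K where "K = (\<lambda>y. fcard s (lleg s' y))"
  let ?q = "\<Sum>y=1..apex s'. K y"
  let ?F = "cop K (\<lambda>y x. y)" and ?G = "cop K (\<lambda>y x. pos (fcard s) (lleg s' y) x)"
  have i: "lleg s' y \<in> {1..tgt s}" if "y \<in> {1..apex s'}" for y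
    using s' st that unfolding is_prespan_def Fun_def by (auto simp: PiE_iff)
  have G: "?G \<in> {1..?q} \<rightarrow> {1..apex s}"
    by (rule cop_Pi) (use prespan_pos[OF s i] in \<open>auto simp: K_def\<close>)
  have F: "?F \<in> {1..?q} \<rightarrow> {1..apex s'}" by (rule cop_Pi) auto
  have "is_pullback s s' ?q (restrict ?G {1..?q}) (restrict ?F {1..?q})"
    unfolding is_pullback_def
  proof (intro conjI ballI)
    show "restrict ?G {1..?q} \<in> Fun ?q (apex s)" "restrict ?F {1..?q} \<in> Fun ?q (apex s')"
      using F G unfolding Fun_def by auto
    show "mono_on {1..?q} (restrict ?F {1..?q})"
      using mono_cop[where k = K and m = "apex s'"] by (auto simp: mono_on_def)
    let ?B = "{(x, y). x \<in> {1..apex s} \<and> y \<in> {1..apex s'} \<and> rleg s x = lleg s' y}"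
    have inj: "inj_on (\<lambda>p. (?G p, ?F p)) {1..?q}"
    proof (rule inj_onI)
      fix p p' assume p: "p \<in> {1..?q}" and p': "p' \<in> {1..?q}" and eq: "(?G p, ?F p) = (?G p', ?F p')"
      from p obtain y x where "y \<in> {1..apex s'}" "x \<in> {1..K y}" "p = pos K y x" by (rule pos_cases)
      moreover from p' obtain y' x' where "y' \<in> {1..apex s'}" "x' \<in> {1..K y'}" "p' = pos K y' x'"
        by (rule pos_cases)
      ultimately show "p = p'" using eq by (auto simp: pos_def[of "fcard s"])
    qed
    have "(\<lambda>p. (?G p, ?F p)) ` {1..?q} = ?B"
    proof (intro set_eqI iffI)
      fix z assume "z \<in> (\<lambda>p. (?G p, ?F p)) ` {1..?q}"
      then obtain p where p: "p \<in> {1..?q}" and z: "z = (?G p, ?F p)" by blast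
      from p obtain y x where yx: "y \<in> {1..apex s'}" "x \<in> {1..K y}" "p = pos K y x" by (rule pos_cases)
      then have "z = (pos (fcard s) (lleg s' y) x, y)" by (simp add: z)
      then show "z \<in> ?B"
        using yx prespan_pos[OF s i[OF yx(1)]] prespan_apex(2)[OF s i[OF yx(1)]] by (simp add: K_def)
    next
      fix z assume "z \<in> ?B"
      then obtain w y where z: "z = (w, y)" "w \<in> {1..apex s}" "y \<in> {1..apex s'}" "rleg s w = lleg s' y"
        by blast
      then have "w \<in> fib s (lleg s' y)" by (simp add: fib_def)
      then obtain x where x: "x \<in> {1..K y}" "w = pos (fcard s) (lleg s' y) x"
        using prespan_fib[OF s i[OF z(3)]] by (auto simp: K_def)
      have "z = (?G (pos K y x), ?F (pos K y x))" using z x by simp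
      then show "z \<in> (\<lambda>p. (?G p, ?F p)) ` {1..?q}" using pos_mem[where k = K, OF z(3) x(1)] by blast
    qed
    with inj have "bij_betw (\<lambda>p. (?G p, ?F p)) {1..?q} ?B" by (simp add: bij_betw_def)
    then show "bij_betw (\<lambda>p. (restrict ?G {1..?q} p, restrict ?F {1..?q} p)) {1..?q} ?B"
      by (subst bij_betw_cong[of _ _ "\<lambda>p. (?G p, ?F p)"]) auto
    fix y assume y: "y \<in> {1..apex s'}"
    show "mono_on {p \<in> {1..?q}. restrict ?F {1..?q} p = y} (restrict ?G {1..?q})"
    proof (rule mono_onI)
      fix p p' assume "p \<in> {p \<in> {1..?q}. restrict ?F {1..?q} p = y}"
        "p' \<in> {p \<in> {1..?q}. restrict ?F {1..?q} p = y}" and le: "p \<le> p'"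
      then have p: "p \<in> {1..?q}" "?F p = y" and p': "p' \<in> {1..?q}" "?F p' = y" by auto
      from p(1) obtain z x where 1: "z \<in> {1..apex s'}" "x \<in> {1..K z}" "p = pos K z x" by (rule pos_cases)
      from p'(1) obtain z' x' where 2: "z' \<in> {1..apex s'}" "x' \<in> {1..K z'}" "p' = pos K z' x'"
        by (rule pos_cases)
      have "z = y" "z' = y" using 1 2 p p' by auto
      then have "?G p = pos (fcard s) (lleg s' y) x" "?G p' = pos (fcard s) (lleg s' y) x'"
        using 1 2 by simp_all
      moreover have "x \<le> x'" using 1 2 le \<open>z = y\<close> \<open>z' = y\<close> by (simp add: pos_def)
      ultimately show "restrict ?G {1..?q} p \<le> restrict ?G {1..?q} p'"
        using p(1) p'(1) by (simp add: pos_def)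
    qed
  qed
  then show ?thesis by blast
qed

text \<open>A fibre is a block, so sorting it lists its elements in coordinate order; this connects
  the argument lists in \<open>is_precomposite\<close> with \<open>mul\<close>.\<close>

lemma sorted_list_of_image_pos:
  "sorted_list_of_set (pos k i ` {1..n}) = map (pos k i) [1..<Suc n]"
proof -
  have "sorted (map (pos k i) [1..<Suc n])"
    unfolding sorted_map by (rule sorted_wrt_mono_rel[OF _ sorted_upt]) (simp add: pos_def)
  moreover have "distinct (map (pos k i) [1..<Suc n])"
    by (auto simp: distinct_map inj_on_def pos_def)
  moreover have "set (map (pos k i) [1..<Suc n]) = pos k i ` {1..n}"
    by (simp add: atLeastLessThanSuc_atLeastAtMost del: upt_Suc)
  ultimately show ?thesis by (metis sorted_list_of_set.idem_if_sorted_distinct)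
qed

text \<open>The pullback is indexed by the apex of \<open>s'\<close>, whereas the code of the
  composite is indexed by its target. The fibre over \<open>j\<close> is a sum of fibres of
  \<open>s\<close>, one for each element of the fibre of \<open>s'\<close> over \<open>j\<close>;
  \<open>pos_pos\<close> translates between the two numberings, and the result is \<open>sub\<close>
  for the legs and labels of \<open>s\<close> and \<open>s'\<close>.\<close>

lemma precomposite_code:
  assumes s: "is_prespan P s" and s': "is_prespan P s'" and cs: "code s = (n, m, F)"
    and cs': "code s' = (m, l, G)" and u: "is_precomposite P s s' u"
  shows "is_prespan P u" "code u = (n, l, \<lambda>j\<in>{1..l}. csub F (G j))"
proof -
  have eqs: "src s = n" "tgt s = m" "src s' = m" "tgt s' = l" using cs cs' by (auto simp: code_def)
  have F: "F = (\<lambda>i\<in>{1..m}. nf (fcard s i) (leg s i) (lab s i))"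
    and G: "G = (\<lambda>i\<in>{1..l}. nf (fcard s' i) (leg s' i) (lab s' i))"
    using cs cs' by (auto simp: code_def)
  obtain q \<phi> f where pb: "is_pullback s s' q \<phi> f"
    and u: "u = \<lparr>src = src s, tgt = tgt s', apex = q,
          lleg = compose {1..q} (lleg s) \<phi>,
          rleg = compose {1..q} (rleg s') f,
          lab = (\<lambda>j\<in>{1..tgt s'}. let ys = sorted_list_of_set (fib s' j) in
            op_mult P (map (\<lambda>y. fcard s (lleg s' y)) ys) (map (\<lambda>y. lab s (lleg s' y)) ys)
              (lab s' j))\<rparr>"
    using u unfolding is_precomposite_def by blast
  \<comment> \<open>\<open>K\<close> counts the pullback over each element of the apex of
    \<open>s'\<close>, \<open>r\<close> regroups these numbers by the target, and \<open>N\<close>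
    is the size of a fibre of the composite.\<close>
  define K where "K = (\<lambda>y. fcard s (lleg s' y))"
  define r where "r = (\<lambda>j x. K (pos (fcard s') j x))"
  define N where "N = (\<lambda>j. \<Sum>x=1..fcard s' j. r j x)"
  have st: "tgt s = src s'" using eqs by simp
  have K_eq: "K y = fcard s (lleg s' y)" for y by (simp add: K_def)
  note pf = pullback_fibres[OF s s' st pb, folded K_def, folded K_eq]
  have i: "leg s' j x \<in> {1..m}" if "j \<in> {1..l}" "x \<in> {1..fcard s' j}" for j x
    using prespan_leg[OF s', of j] that eqs by auto
  have Kcop: "K y = cop (fcard s') r y" if "y \<in> {1..apex s'}" for y
  proof -
    have "y \<in> {1..\<Sum>i=1..tgt s'. fcard s' i}" using that prespan_apex(1)[OF s'] by simp
    then obtain j x where "j \<in> {1..tgt s'}" "x \<in> {1..fcard s' j}" "y = pos (fcard s') j x"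
      by (rule pos_cases)
    then show ?thesis by (simp add: r_def)
  qed
  have posK: "pos K (pos (fcard s') j x) z = pos N j (pos (r j) x z)"
    if "j \<in> {1..l}" "x \<in> {1..fcard s' j}" for j x z
  proof -
    have "pos (fcard s') j x \<le> apex s'" using prespan_pos[OF s', of j x] that eqs by simp
    then have "pos K (pos (fcard s') j x) z = pos (cop (fcard s') r) (pos (fcard s') j x) z"
      using Kcop unfolding pos_def[of K] pos_def[of "cop (fcard s') r"]
      by (intro arg_cong2[of _ _ _ _ "(+)"] sum.cong) auto
    then show ?thesis unfolding N_def using that by (simp add: pos_pos)
  qed
  have q: "(\<Sum>j=1..l. N j) = q"
  proof -
    have "q = (\<Sum>y=1..apex s'. cop (fcard s') r y)" unfolding pf(1)[symmetric] by (intro sum.cong) (auto simp: Kcop)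
    also have "\<dots> = (\<Sum>j=1..l. N j)"
      unfolding N_def prespan_apex(1)[OF s', symmetric] eqs by (rule sum_cop)
    finally show ?thesis by simp
  qed
  have legs: "rleg u (pos N j (pos (r j) x z)) = j \<and> lleg u (pos N j (pos (r j) x z)) = leg s (leg s' j x) z"
    if j: "j \<in> {1..l}" and x: "x \<in> {1..fcard s' j}" and z: "z \<in> {1..r j x}" for j x z
  proof -
    have y: "pos (fcard s') j x \<in> {1..apex s'}" using prespan_pos[OF s', of j x] j x eqs by simp
    have z': "z \<in> {1..K (pos (fcard s') j x)}" using z by (simp add: r_def)
    have p: "pos N j (pos (r j) x z) \<in> {1..q}"
      using pos_mem[where k = K, OF y z'] pf(1) posK[OF j x] by simp
    have "f (pos N j (pos (r j) x z)) = pos (fcard s') j x"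
      using pf(2)[OF y z'] posK[OF j x] by simp
    moreover have "\<phi> (pos N j (pos (r j) x z)) = pos (fcard s) (leg s' j x) z"
      using pf(3)[OF y z'] posK[OF j x] by simp
    moreover have "rleg s' (pos (fcard s') j x) = j" using prespan_apex(2)[OF s', of j x] j x eqs by simp
    ultimately show ?thesis using p by (simp add: u compose_eq)
  qed
  have rl: "rleg u (pos N j w) = j" if j: "j \<in> {1..l}" and w: "w \<in> {1..N j}" for j w
  proof -
    from w obtain x z where "x \<in> {1..fcard s' j}" "z \<in> {1..r j x}" "w = pos (r j) x z"
      unfolding N_def by (rule pos_cases)
    then show ?thesis using legs[OF j] by simp
  qed
  have fc: "fcard u j = N j" if "j \<in> {1..l}" for j
    using fibre_eq(2)[where k = N and f = "rleg u", OF q rl that] by (simp add: fcard_def fib_def u)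
  have posu: "pos (fcard u) j w = pos N j w" if "j \<in> {1..l}" for j w
    using fc that unfolding pos_def by (auto intro!: sum.cong)
  have lab: "lab u j = mul (fcard s' j) (r j) (\<lambda>x. lab s (leg s' j x)) (lab s' j)" if j: "j \<in> {1..l}" for j
  proof -
    have "sorted_list_of_set (fib s' j) = map (pos (fcard s') j) [1..<Suc (fcard s' j)]"
      using prespan_fib[OF s', of j] j eqs sorted_list_of_image_pos by simp
    then show ?thesis
      using j eqs by (simp add: u Let_def mul_def tup_def r_def K_def comp_def del: upt_Suc)
  qed
  have labs: "lab s (leg s' j x) \<in> ops P (r j x)" if "j \<in> {1..l}" "x \<in> {1..fcard s' j}" for j x
    using prespan_lab[OF s, of "leg s' j x"] i[OF that] eqs by (simp add: r_def K_def)
  have labs': "lab s' j \<in> ops P (fcard s' j)" if "j \<in> {1..l}" for j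
    using prespan_lab[OF s', of j] that eqs by simp
  show "is_prespan P u"
    unfolding is_prespan_def
  proof (intro conjI)
    have P: "\<phi> \<in> {1..q} \<rightarrow> {1..apex s}" "f \<in> {1..q} \<rightarrow> {1..apex s'}" "mono_on {1..q} f"
      using pb unfolding is_pullback_def Fun_def by (auto simp: PiE_iff)
    have Q: "lleg s \<in> {1..apex s} \<rightarrow> {1..src s}" "rleg s' \<in> {1..apex s'} \<rightarrow> {1..tgt s'}"
      "mono_on {1..apex s'} (rleg s')"
      using s s' unfolding is_prespan_def Fun_def by (auto simp: PiE_iff)
    show "lleg u \<in> Fun (apex u) (src u)" "rleg u \<in> Fun (apex u) (tgt u)"
      using P Q by (fastforce simp: u Fun_def compose_def)+
    show "mono_on {1..apex u} (rleg u)"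
    proof (rule mono_onI)
      fix a b assume ab: "a \<in> {1..apex u}" "b \<in> {1..apex u}" "a \<le> b"
      then have "f a \<le> f b" using mono_onD[OF P(3)] by (simp add: u)
      moreover have "f a \<in> {1..apex s'}" "f b \<in> {1..apex s'}" using P(2) ab by (auto simp: u)
      ultimately show "rleg u a \<le> rleg u b" using mono_onD[OF Q(3)] ab by (simp add: u compose_eq)
    qed
    have "lab u j \<in> ops P (fcard u j)" if j: "j \<in> {1..l}" for j
      unfolding lab[OF j] fc[OF j] N_def using labs[OF j] labs'[OF j] by (intro mul_mem) auto
    then show "lab u \<in> (\<Pi>\<^sub>E i\<in>{1..tgt u}. ops P (fcard u i))"
      using eqs by (auto simp: PiE_iff u)
  qed
  have "nf (fcard u j) (leg u j) (lab u j) = csub F (G j)" if j: "j \<in> {1..l}" for j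
  proof -
    have "csub F (nf (fcard s' j) (leg s' j) (lab s' j)) =
        sub (fcard s' j) (leg s' j) (fcard s) (leg s) (lab s) (lab s' j)"
    proof (rule csub_nf)
      show "leg s' j \<in> {1..fcard s' j} \<rightarrow> {1..m}" using i[OF j] by blast
      show "lab s' j \<in> ops P (fcard s' j)" by (rule labs'[OF j])
      show "\<And>i. i \<in> {1..m} \<Longrightarrow> F i = nf (fcard s i) (leg s i) (lab s i)" by (simp add: F)
      show "\<And>i. i \<in> {1..m} \<Longrightarrow> lab s i \<in> ops P (fcard s i)" using prespan_lab[OF s] eqs by simp
    qed
    also have "\<dots> = nf (N j) (cop (r j) (\<lambda>x. leg s (leg s' j x))) (lab u j)"
      unfolding sub_def lab[OF j] N_def r_def K_def ..
    also have "\<dots> = nf (N j) (leg u j) (lab u j)"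
    proof (rule nf_cong)
      fix w assume "w \<in> {1..N j}"
      then obtain x z where "x \<in> {1..fcard s' j}" "z \<in> {1..r j x}" "w = pos (r j) x z"
        unfolding N_def by (rule pos_cases)
      then show "cop (r j) (\<lambda>x. leg s (leg s' j x)) w = leg u j w"
        using legs[OF j, of x z] posu[OF j] by simp
    qed
    finally show ?thesis using j fc by (simp add: G)
  qed
  then have "(\<lambda>j\<in>{1..l}. nf (fcard u j) (leg u j) (lab u j)) = (\<lambda>j\<in>{1..l}. csub F (G j))"
    by (intro restrict_ext)
  moreover have "src u = n" "tgt u = l" using eqs by (auto simp: u)
  ultimately show "code u = (n, l, \<lambda>j\<in>{1..l}. csub F (G j))" by (simp add: code_def)
qed


section \<open>The Lawvere theory of a regular operad\<close>

abbreviation families :: "nat \<Rightarrow> nat \<Rightarrow> (nat \<Rightarrow> nat set \<times> 'a) set" where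
  "families n m \<equiv> {1..m} \<rightarrow>\<^sub>E elts n"

definition units :: "nat \<Rightarrow> nat \<Rightarrow> (nat \<Rightarrow> nat) \<Rightarrow> nat \<Rightarrow> nat set \<times> 'a" where
  "units n m \<phi> = (\<lambda>i\<in>{1..m}. ({\<phi> i}, unit))"

lemma units_mem: "\<phi> \<in> {1..m} \<rightarrow> {1..n} \<Longrightarrow> units n m \<phi> \<in> families n m"
  using unit_mem by (auto simp: units_def elts_def Pi_iff simp flip: One_nat_def)

lemma csub_family: "F \<in> families n m \<Longrightarrow> G \<in> families m l \<Longrightarrow>
    (\<lambda>j\<in>{1..l}. csub F (G j)) \<in> families n l"
proof -
  assume F: "F \<in> families n m" and G: "G \<in> families m l"
  have "csub F (G j) \<in> elts n" if "j \<in> {1..l}" for j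
    by (rule csub_mem[of _ m]) (use F G that in auto)
  then show ?thesis by simp
qed

lemma cls_memD: "s \<in> cls n m F \<Longrightarrow> is_span P s \<and> is_prespan P s \<and> code s = (n, m, F) \<and> src s = n \<and> tgt s = m"
  by (auto simp: cls_def is_span_def code_def)

lemma cls_eq_iff:
  assumes "F \<in> families n m"
  shows "cls n m F = cls n' m' F' \<longleftrightarrow> n = n' \<and> m = m' \<and> F = F'"
proof
  assume eq: "cls n m F = cls n' m' F'"
  obtain s where "s \<in> cls n m F" using cls_nonempty[OF assms] by (auto simp: cls_def)
  moreover from this have "s \<in> cls n' m' F'" using eq by simp
  ultimately have "code s = (n, m, F)" "code s = (n', m', F')" by (simp_all add: cls_def)
  then show "n = n' \<and> m = m' \<and> F = F'" by simp
qed auto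

text \<open>Each arrow is the class of a family, unique by \<open>cls_eq_iff\<close>; from here on
  arrows are handled as families instead of spans.\<close>

lemma Arr_Pf: "Arr (Pf_obj P) = {cls n m F | n m F. F \<in> families n m}"
proof (intro set_eqI iffI)
  fix A assume "A \<in> Arr (Pf_obj P)"
  then obtain s where s: "is_span P s" "A = span_rel P `` {s}" by (auto simp: Pf_obj_def quotient_def)
  have "A = cls (src s) (tgt s) (snd (snd (code s)))"
    unfolding s(2) by (rule span_rel_image[OF s(1)]) (simp add: code_def)
  moreover have "snd (snd (code s)) \<in> families (src s) (tgt s)"
    by (rule code_mem) (use s in \<open>simp add: is_span_def\<close>)
  ultimately show "A \<in> {cls n m F | n m F. F \<in> families n m}" by blast
next
  fix A assume "A \<in> {cls n m F | n m F. F \<in> families n m}"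
  then obtain n m F where A: "A = cls n m F" "F \<in> families n m" by blast
  then obtain s where s: "is_span P s" "code s = (n, m, F)" using cls_nonempty by blast
  then have "A = span_rel P `` {s}" using A span_rel_image by simp
  then show "A \<in> Arr (Pf_obj P)" using s by (auto simp: Pf_obj_def quotient_def)
qed

lemma Dom_cls: "F \<in> families n m \<Longrightarrow> Dom (Pf_obj P) (cls n m F) = n"
  and Cod_cls: "F \<in> families n m \<Longrightarrow> Cod (Pf_obj P) (cls n m F) = m"
proof -
  assume "F \<in> families n m"
  then obtain s where s: "s \<in> cls n m F" using cls_nonempty unfolding cls_def by blast
  then show "Dom (Pf_obj P) (cls n m F) = n" "Cod (Pf_obj P) (cls n m F) = m"
    using cls_memD by (auto simp: Pf_obj_def intro!: the_equality)
qed

lemma Hom_Pf: "A \<in> Hom (Pf_obj P) n m \<longleftrightarrow> (\<exists>F\<in>families n m. A = cls n m F)"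
  unfolding Hom_def Arr_Pf using Dom_cls Cod_cls by fastforce

text \<open>The definition collects all regularized composites of all representatives. They all have
  the code given by \<open>csub\<close>, and there is at least one, so closing under equivalence
  gives exactly one class.\<close>

lemma Comp_cls:
  assumes F: "F \<in> families n m" and G: "G \<in> families m l"
  shows "Comp (Pf_obj P) (cls m l G) (cls n m F) = cls n l (\<lambda>j\<in>{1..l}. csub F (G j))" (is "_ = ?R")
proof -
  let ?T = "{t. \<exists>s\<in>cls n m F. \<exists>s'\<in>cls m l G. \<exists>u. is_precomposite P s s' u \<and> is_regularization P u t}"
  have T: "is_span P t \<and> code t = (n, l, \<lambda>j\<in>{1..l}. csub F (G j))" if t: "t \<in> ?T" for t
  proof -
    obtain s s' u where su: "s \<in> cls n m F" "s' \<in> cls m l G" "is_precomposite P s s' u"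
      "is_regularization P u t" using t by blast
    have u: "is_prespan P u" "code u = (n, l, \<lambda>j\<in>{1..l}. csub F (G j))"
      using precomposite_code[OF _ _ _ _ su(3)] cls_memD[OF su(1)] cls_memD[OF su(2)] by auto
    show ?thesis using regularization_code[OF u(1) su(4)] u(2) by simp
  qed
  obtain s s' where ss: "s \<in> cls n m F" "s' \<in> cls m l G"
    using cls_nonempty[OF F] cls_nonempty[OF G] by (auto simp: cls_def)
  have "\<exists>q \<phi> f. is_pullback s s' q \<phi> f"
    using pullback_exists cls_memD[OF ss(1)] cls_memD[OF ss(2)] by simp
  then obtain u where u: "is_precomposite P s s' u" unfolding is_precomposite_def by blast
  have "is_prespan P u" using precomposite_code(1)[OF _ _ _ _ u] cls_memD[OF ss(1)] cls_memD[OF ss(2)] by auto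
  then obtain t where "is_regularization P u t" using regularization_exists by blast
  then have t: "t \<in> ?T" using ss u by blast
  have "span_rel P `` ?T = ?R"
  proof (intro set_eqI iffI)
    fix v assume "v \<in> span_rel P `` ?T"
    then obtain t' where t': "t' \<in> ?T" "(t', v) \<in> span_rel P" by blast
    then show "v \<in> ?R" using T[OF t'(1)] unfolding span_rel_iff cls_def by auto
  next
    fix v assume "v \<in> ?R"
    then have "(t, v) \<in> span_rel P" using T[OF t] unfolding span_rel_iff cls_def by auto
    then show "v \<in> span_rel P `` ?T" using t by blast
  qed
  then show ?thesis by (simp add: Pf_obj_def)
qed

lemma nf_unit: "nf 1 (\<lambda>_. i) unit = ({i}, unit)"
  by (rule nf_singleton[OF unit_mem])

text \<open>Identities and projections are the case in which every block has size one and is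
  labelled by the unit.\<close>

lemma unit_span:
  assumes t: "t = \<lparr>src = n, tgt = m, apex = m, lleg = restrict \<phi> {1..m}, rleg = idf m,
     lab = (\<lambda>_\<in>{1..m}. unit)\<rparr>" and \<phi>: "\<phi> \<in> {1..m} \<rightarrow> {1..n}"
  shows "is_span P t" "code t = (n, m, units n m \<phi>)"
proof -
  let ?\<phi> = "\<lambda>i. \<lambda>x\<in>{1..1::nat}. \<phi> i"
  \<comment> \<open>In a sum of one-element blocks, position \<open>p\<close> is the only element of
    block \<open>p\<close>.\<close>
  have p: "p = pos (\<lambda>_. 1) p 1" if "1 \<le> p" for p using that by (simp add: pos_def)
  have b: "block (\<lambda>_. 1) p = p" "offset (\<lambda>_. 1) p = 1" if "1 \<le> p" for p
    using block_pos[of p 1 "\<lambda>_. 1"] offset_pos[of p 1 "\<lambda>_. 1"] that p[OF that] by auto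
  have "t = \<lparr>src = n, tgt = m, apex = (\<Sum>i=1..m. 1), lleg = copair m (\<lambda>_. 1) ?\<phi>,
      rleg = (\<lambda>p\<in>{1..\<Sum>i=1..m. 1}. block (\<lambda>_. 1) p), lab = restrict (\<lambda>_. unit) {1..m}\<rparr>"
    using b by (auto simp: t copair_def intro!: restrict_ext)
  note bs = block_span[OF this]
  have \<phi>I: "?\<phi> i \<in> Inj 1 n" if "i \<in> {1..m}" for i using \<phi> that by (auto simp: Inj_def Fun_def)
  show "is_span P t" by (rule bs(1)) (use \<phi>I unit_mem in auto)
  have "code t = (n, m, \<lambda>i\<in>{1..m}. nf 1 (?\<phi> i) unit)" by (rule bs(2)) (use \<phi>I unit_mem in auto)
  moreover have "nf 1 (?\<phi> i) unit = ({\<phi> i}, unit)" for i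
    unfolding nf_unit[symmetric] by (rule nf_cong) auto
  ultimately show "code t = (n, m, units n m \<phi>)" by (simp add: units_def)
qed

lemma Ident_Pf: "Ident (Pf_obj P) n = cls n n (units n n (\<lambda>i. i))"
proof -
  have id: "id_span P n = \<lparr>src = n, tgt = n, apex = n, lleg = restrict (\<lambda>i. i) {1..n}, rleg = idf n,
     lab = (\<lambda>_\<in>{1..n}. unit)\<rparr>" by (simp add: id_span_def id_def)
  show ?thesis using span_rel_image unit_span[OF id] by (simp add: Pf_obj_def)
qed

lemma Proj_Pf: "i \<in> {1..n} \<Longrightarrow> Proj (Pf_obj P) n i = cls n 1 (units n 1 (\<lambda>_. i))"
proof -
  assume i: "i \<in> {1..n}"
  have pr: "proj_span P n i = \<lparr>src = n, tgt = 1, apex = 1, lleg = restrict (\<lambda>_. i) {1..1}, rleg = idf 1,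
     lab = (\<lambda>_\<in>{1..1}. unit)\<rparr>" by (simp add: proj_span_def)
  show ?thesis using span_rel_image unit_span[OF pr] i by (simp add: Pf_obj_def)
qed

lemma csub_units:
  assumes "F \<in> families n m" "i \<in> {1..m}"
  shows "csub F ({i}, unit) = F i"
  by (rule csub_unit_left[of F i n]) (use assms in auto)

text \<open>The category laws are the laws \<open>csub_unit_right\<close>,
  \<open>csub_unit_left\<close> and \<open>csub_csub\<close> of substitution, applied to each
  component.\<close>

lemma category_Pf: "category (Pf_obj P)"
  unfolding category_def
proof (intro conjI ballI impI)
  fix f assume "f \<in> Arr (Pf_obj P)"
  then obtain n m F where f: "f = cls n m F" and F: "F \<in> families n m" by (auto simp: Arr_Pf)
  show "Dom (Pf_obj P) f \<in> Obj (Pf_obj P)" "Cod (Pf_obj P) f \<in> Obj (Pf_obj P)"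
    by (simp_all add: Pf_obj_def)
  have "(\<lambda>j\<in>{1..m}. csub (units n n (\<lambda>i. i)) (F j)) = F"
  proof (rule extensionalityI[of _ "{1..m}"])
    fix j assume j: "j \<in> {1..m}"
    have "csub (units n n (\<lambda>i. i)) (F j) = F j"
      by (rule csub_unit_right[of _ n]) (use F j in \<open>auto simp: units_def\<close>)
    then show "(\<lambda>j\<in>{1..m}. csub (units n n (\<lambda>i. i)) (F j)) j = F j" using j by simp
  qed (use F in \<open>auto simp: PiE_iff\<close>)
  then show "Comp (Pf_obj P) f (Ident (Pf_obj P) (Dom (Pf_obj P) f)) = f"
    using Comp_cls[OF units_mem F, of "\<lambda>i. i"] by (simp add: f Dom_cls[OF F] Ident_Pf)
  have "(\<lambda>j\<in>{1..m}. csub F (units m m (\<lambda>i. i) j)) = F"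
  proof (rule extensionalityI[of _ "{1..m}"])
    fix j assume "j \<in> {1..m}"
    then show "(\<lambda>j\<in>{1..m}. csub F (units m m (\<lambda>i. i) j)) j = F j"
      using csub_units[OF F] by (simp add: units_def)
  qed (use F in \<open>auto simp: PiE_iff\<close>)
  then show "Comp (Pf_obj P) (Ident (Pf_obj P) (Cod (Pf_obj P) f)) f = f"
    using Comp_cls[OF F units_mem, of "\<lambda>i. i"] by (simp add: f Cod_cls[OF F] Ident_Pf)
  fix g assume "g \<in> Arr (Pf_obj P)" and "Dom (Pf_obj P) g = Cod (Pf_obj P) f"
  then obtain l G where g: "g = cls m l G" and G: "G \<in> families m l"
    using Dom_cls Cod_cls F by (auto simp: Arr_Pf f)
  have gf: "Comp (Pf_obj P) g f = cls n l (\<lambda>j\<in>{1..l}. csub F (G j))" unfolding f g by (rule Comp_cls[OF F G])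
  show "Comp (Pf_obj P) g f \<in> Hom (Pf_obj P) (Dom (Pf_obj P) f) (Cod (Pf_obj P) g)"
    unfolding gf Hom_Pf using csub_family[OF F G] Dom_cls[OF F] Cod_cls[OF G] f g by metis
  fix h assume "h \<in> Arr (Pf_obj P)" and "Dom (Pf_obj P) h = Cod (Pf_obj P) g"
  then obtain k H where h: "h = cls l k H" and H: "H \<in> families l k"
    using Dom_cls Cod_cls G by (auto simp: Arr_Pf g)
  have "csub (\<lambda>j\<in>{1..l}. csub F (G j)) (H i) = csub F (csub G (H i))" if i: "i \<in> {1..k}" for i
  proof -
    have Hi: "H i \<in> elts l" using H i by auto
    have "csub (\<lambda>j\<in>{1..l}. csub F (G j)) (H i) = csub (\<lambda>j. csub F (G j)) (H i)"
      by (rule csub_cong[OF Hi]) auto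
    also have "\<dots> = csub F (csub G (H i))"
      by (rule csub_csub[OF Hi, symmetric]) (use F G in auto)
    finally show ?thesis .
  qed
  then have "(\<lambda>i\<in>{1..k}. csub (\<lambda>j\<in>{1..l}. csub F (G j)) (H i)) =
      (\<lambda>i\<in>{1..k}. csub F ((\<lambda>i\<in>{1..k}. csub G (H i)) i))" by (intro restrict_ext) simp
  then show "Comp (Pf_obj P) h (Comp (Pf_obj P) g f) = Comp (Pf_obj P) (Comp (Pf_obj P) h g) f"
    unfolding f g h Comp_cls[OF F G] Comp_cls[OF G H]
      Comp_cls[OF csub_family[OF F G] H] Comp_cls[OF F csub_family[OF G H]] by simp
next
  fix n show "Ident (Pf_obj P) n \<in> Hom (Pf_obj P) n n"
    unfolding Ident_Pf Hom_Pf using units_mem[of "\<lambda>i. i" n n] by auto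
qed

lemma Proj_Comp:
  assumes F: "F \<in> families n m" and i: "i \<in> {1..m}"
  shows "Comp (Pf_obj P) (Proj (Pf_obj P) m i) (cls n m F) = cls n 1 (\<lambda>_\<in>{1..1}. F i)"
proof -
  have "(\<lambda>j\<in>{1..1}. csub F (units m 1 (\<lambda>_. i) j)) = (\<lambda>_\<in>{1..1}. F i)"
    using csub_units[OF F i] by (intro restrict_ext) (simp add: units_def)
  then show ?thesis
    unfolding Proj_Pf[OF i] using Comp_cls[OF F units_mem, of "\<lambda>_. i" 1] i by simp
qed

text \<open>A family with target \<open>n\<close> consists of \<open>n\<close> elements, each of
  which is the same as a family with target \<open>1\<close>; composing with the \<open>i\<close>-th
  projection extracts the \<open>i\<close>-th element.\<close>

lemma lawvere_Pf: "lawvere_theory (Pf_obj P)"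
  unfolding lawvere_theory_def
proof (intro conjI allI ballI impI)
  show "category (Pf_obj P)" by (rule category_Pf)
  show "Obj (Pf_obj P) = UNIV" by (simp add: Pf_obj_def)
  fix n i :: nat assume "i \<in> {1..n}"
  then show "Proj (Pf_obj P) n i \<in> Hom (Pf_obj P) n 1"
    unfolding Proj_Pf[OF \<open>i \<in> {1..n}\<close>] Hom_Pf using units_mem[of "\<lambda>_. i" 1 n] by auto
next
  have "units 1 1 (\<lambda>_. 1) = units 1 1 (\<lambda>i. i)" unfolding units_def by (rule restrict_ext) auto
  then show "Proj (Pf_obj P) 1 1 = Ident (Pf_obj P) 1" using Proj_Pf[of 1 1] by (simp add: Ident_Pf)
next
  fix n k :: nat and f assume f: "\<forall>i\<in>{1..n}. f i \<in> Hom (Pf_obj P) k 1"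
  then have "\<forall>i\<in>{1..n}. \<exists>F. F \<in> families k 1 \<and> f i = cls k 1 F" unfolding Hom_Pf by blast
  then obtain F where F: "\<And>i. i \<in> {1..n} \<Longrightarrow> F i \<in> families k 1 \<and> f i = cls k 1 (F i)"
    unfolding bchoice_iff by blast
  have F1: "(\<lambda>_\<in>{1..1}. F i 1) = F i" if "i \<in> {1..n}" for i
    by (rule extensionalityI[of _ "{1..1}"]) (use F[OF that] in \<open>auto simp: PiE_iff\<close>)
  show "\<exists>!h. h \<in> Hom (Pf_obj P) k n \<and> (\<forall>i\<in>{1..n}. Comp (Pf_obj P) (Proj (Pf_obj P) n i) h = f i)"
  proof (rule ex1I[of _ "cls k n (\<lambda>i\<in>{1..n}. F i 1)"])
    have "F i 1 \<in> elts k" if "i \<in> {1..n}" for i using F[OF that] by auto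
    then have G: "(\<lambda>i\<in>{1..n}. F i 1) \<in> families k n" by simp
    show "cls k n (\<lambda>i\<in>{1..n}. F i 1) \<in> Hom (Pf_obj P) k n \<and>
      (\<forall>i\<in>{1..n}. Comp (Pf_obj P) (Proj (Pf_obj P) n i) (cls k n (\<lambda>i\<in>{1..n}. F i 1)) = f i)"
    proof (intro conjI ballI)
      show "cls k n (\<lambda>i\<in>{1..n}. F i 1) \<in> Hom (Pf_obj P) k n" unfolding Hom_Pf using G by blast
      fix i assume i: "i \<in> {1..n}"
      then show "Comp (Pf_obj P) (Proj (Pf_obj P) n i) (cls k n (\<lambda>i\<in>{1..n}. F i 1)) = f i"
        unfolding Proj_Comp[OF G i] using F1[OF i] F[OF i] by simp
    qed
    fix h assume h: "h \<in> Hom (Pf_obj P) k n \<and> (\<forall>i\<in>{1..n}. Comp (Pf_obj P) (Proj (Pf_obj P) n i) h = f i)"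
    then obtain H where H: "H \<in> families k n" "h = cls k n H" unfolding Hom_Pf by blast
    have "H i = F i 1" if i: "i \<in> {1..n}" for i
    proof -
      have "(\<lambda>_\<in>{1..1}. H i) \<in> families k 1" using H i by auto
      moreover have "cls k 1 (\<lambda>_\<in>{1..1}. H i) = cls k 1 (F i)"
        using Proj_Comp[OF H(1) i] h H(2) F[OF i] i by simp
      ultimately have "(\<lambda>_\<in>{1..1}. H i) = F i" using cls_eq_iff by blast
      from fun_cong[OF this, of 1] show ?thesis by simp
    qed
    then have "H = (\<lambda>i\<in>{1..n}. F i 1)"
      using H(1) by (intro extensionalityI[of _ "{1..n}"]) (auto simp: PiE_iff)
    then show "h = cls k n (\<lambda>i\<in>{1..n}. F i 1)" using H by simp
  qed
qed

end


section \<open>Powers of automorphisms\<close>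

context law
begin

text \<open>An explicit tuple in place of the definite description \<open>power_arrow\<close>, see
  \<open>power_arrow_eq\<close>.\<close>

definition power :: "nat \<Rightarrow> (nat \<Rightarrow> 'm) \<Rightarrow> 'm" where
  "power n a = tuple n n (\<lambda>i. a i \<bullet> proj n i)"

lemma power_hom: "(\<And>i. i \<in> {1..n} \<Longrightarrow> a i \<in> hom 1 1) \<Longrightarrow> power n a \<in> hom n n"
  unfolding power_def by (rule tuple_hom) (rule comp_hom[OF proj_hom])

lemma proj_power: "(\<And>i. i \<in> {1..n} \<Longrightarrow> a i \<in> hom 1 1) \<Longrightarrow> j \<in> {1..n} \<Longrightarrow>
    proj n j \<bullet> power n a = a j \<bullet> proj n j"
  unfolding power_def by (rule proj_tuple) (rule comp_hom[OF proj_hom])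

lemma power_arrow_eq:
  assumes "\<And>i. i \<in> {1..n} \<Longrightarrow> a i \<in> hom 1 1"
  shows "power_arrow T n a = power n a"
  unfolding power_arrow_def
proof (rule the_equality)
  show "power n a \<in> hom n n \<and> (\<forall>i\<in>{1..n}. proj n i \<bullet> power n a = a i \<bullet> proj n i)"
    using power_hom[of n a] proj_power[of n a] assms by blast
  fix h assume "h \<in> hom n n \<and> (\<forall>i\<in>{1..n}. proj n i \<bullet> h = a i \<bullet> proj n i)"
  then show "h = power n a"
    using hom_eqI[of h n n "power n a"] power_hom[of n a] proj_power[of n a] assms by simp
qed

lemma proj_power_comp:
  assumes a: "\<And>i. i \<in> {1..n} \<Longrightarrow> a i \<in> hom 1 1" and h: "h \<in> hom k n" and j: "j \<in> {1..n}"
  shows "proj n j \<bullet> power n a \<bullet> h = a j \<bullet> proj n j \<bullet> h"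
proof -
  have "proj n j \<bullet> power n a \<bullet> h = (a j \<bullet> proj n j) \<bullet> h"
    using proj_comp_comp[OF power_hom[OF a] h j] proj_power[OF a j] by simp
  then show ?thesis using comp_assoc[OF h proj_hom[OF j] a[OF j]] by simp
qed

lemma power_comp_power:
  assumes a: "\<And>i. i \<in> {1..n} \<Longrightarrow> a i \<in> hom 1 1" and b: "\<And>i. i \<in> {1..n} \<Longrightarrow> b i \<in> hom 1 1"
    and ab: "\<And>i. i \<in> {1..n} \<Longrightarrow> a i \<bullet> b i = one 1"
  shows "power n a \<bullet> power n b = one n"
proof (rule hom_eqI)
  show "power n a \<bullet> power n b \<in> hom n n" by (rule comp_hom[OF power_hom[OF b] power_hom[OF a]])
  show "one n \<in> hom n n" by (simp add: one_hom)
  fix j assume j: "j \<in> {1..n}"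
  have "proj n j \<bullet> power n a \<bullet> power n b = a j \<bullet> b j \<bullet> proj n j"
    using proj_power_comp[OF a power_hom[OF b] j] proj_power[OF b j] by simp
  also have "\<dots> = (a j \<bullet> b j) \<bullet> proj n j" by (rule comp_assoc[OF proj_hom[OF j] b[OF j] a[OF j], symmetric])
  also have "\<dots> = proj n j \<bullet> one n"
    using ab[OF j] one_comp[OF proj_hom[OF j]] comp_one[OF proj_hom[OF j]] by simp
  finally show "proj n j \<bullet> power n a \<bullet> power n b = proj n j \<bullet> one n" .
qed

lemma power_Iso:
  assumes a: "\<And>i. i \<in> {1..n} \<Longrightarrow> a i \<in> Iso T 1 1"
  shows "power n a \<in> Iso T n n"
proof -
  have "\<forall>i\<in>{1..n}. \<exists>b. b \<in> hom 1 1 \<and> b \<bullet> a i = one 1 \<and> a i \<bullet> b = one 1"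
    using a unfolding Iso_iff by blast
  then obtain b where b: "\<And>i. i \<in> {1..n} \<Longrightarrow> b i \<in> hom 1 1 \<and> b i \<bullet> a i = one 1 \<and> a i \<bullet> b i = one 1"
    unfolding bchoice_iff by blast
  have a': "\<And>i. i \<in> {1..n} \<Longrightarrow> a i \<in> hom 1 1" using a by (rule Iso_hom)
  show ?thesis
    by (rule IsoI[of _ _ _ "power n b"]) (use a' b power_hom power_comp_power in auto)
qed

lemma proj_epi:
  assumes "i \<in> {1..n}" "f \<in> hom 1 c" "f' \<in> hom 1 c" "f \<bullet> proj n i = f' \<bullet> proj n i"
  shows "f = f'"
  by (rule pr_inj_epi[of "\<lambda>_. i" 1 n f c f']) (use assms proj_eq_pr[OF assms(1)] in auto)

lemma pr_Iso:
  assumes "bij_betw \<sigma> {1..m} {1..n}"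
  shows "pr m n \<sigma> \<in> Iso T n m"
proof (rule IsoI)
  let ?\<tau> = "inv_into {1..m} \<sigma>"
  have \<tau>: "bij_betw ?\<tau> {1..n} {1..m}" by (rule bij_betw_inv_into[OF assms])
  have s: "\<sigma> \<in> {1..m} \<rightarrow> {1..n}" and t: "?\<tau> \<in> {1..n} \<rightarrow> {1..m}"
    using bij_betwE[OF assms] bij_betwE[OF \<tau>] by blast+
  show "pr m n \<sigma> \<in> hom n m" "pr n m ?\<tau> \<in> hom m n" using s t by (auto intro: pr_hom)
  show "pr n m ?\<tau> \<bullet> pr m n \<sigma> = one n" unfolding pr_pr[OF t s]
    by (rule pr_ident) (rule bij_betw_inv_into_right[OF assms])
  show "pr m n \<sigma> \<bullet> pr n m ?\<tau> = one m" unfolding pr_pr[OF s t]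
    by (rule pr_ident) (rule bij_betw_inv_into_left[OF assms])
qed

text \<open>Components that are automorphisms applied to distinct variables make \<open>p\<close> a
  power of automorphisms after an injective reindexing.\<close>

lemma projection_arrowI:
  assumes p: "p \<in> hom n m" and \<kappa>: "\<kappa> \<in> {1..m} \<rightarrow> {1..n}" "inj_on \<kappa> {1..m}"
    and a: "\<And>i. i \<in> {1..m} \<Longrightarrow> a i \<in> Iso T 1 1"
    and pi: "\<And>i. i \<in> {1..m} \<Longrightarrow> proj m i \<bullet> p = a i \<bullet> proj n (\<kappa> i)"
  shows "p \<in> projection_arrows T"
proof -
  have \<kappa>I: "restrict \<kappa> {1..m} \<in> Inj m n"
    using \<kappa> by (auto simp: Inj_def Fun_def inj_on_restrict_eq)
  then have pa: "pi_arrow T m n (restrict \<kappa> {1..m}) = pr m n \<kappa>"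
    by (simp add: pi_arrow_eq_pr Inj_def pr_restrict)
  have a': "\<And>i. i \<in> {1..m} \<Longrightarrow> a i \<in> hom 1 1" using a by (rule Iso_hom)
  have "p = power m a \<bullet> pr m n \<kappa>"
  proof (rule hom_eqI[OF p comp_hom[OF pr_hom[OF \<kappa>(1)] power_hom[OF a']]])
    fix i assume i: "i \<in> {1..m}"
    then show "proj m i \<bullet> p = proj m i \<bullet> power m a \<bullet> pr m n \<kappa>"
      using proj_power_comp[OF a' pr_hom[OF \<kappa>(1)] i] proj_pr[OF \<kappa>(1) i] pi by simp
  qed
  then have eq: "p = power m a \<bullet> pr m n \<kappa> \<bullet> one n" using comp_one[OF pr_hom[OF \<kappa>(1)]] by simp
  have iso: "power m a \<in> Iso T m m" by (rule power_Iso) (rule a)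
  have "p \<in> Arr T" "Dom T p = n" "Cod T p = m" using homD[OF p] by auto
  then show ?thesis
    unfolding projection_arrows_def
    using \<kappa>I iso Iso_one[of n] eq pa by (intro CollectI conjI exI bexI[of _ "restrict \<kappa> {1..m}"]
      bexI[of _ "one n"] bexI[of _ "power m a"]) auto
qed

lemma pr_projection_arrow:
  assumes "\<phi> \<in> {1..m} \<rightarrow> {1..n}" "inj_on \<phi> {1..m}"
  shows "pr m n \<phi> \<in> projection_arrows T"
proof (rule projection_arrowI[OF pr_hom[OF assms(1)] assms, of "\<lambda>_. one 1"])
  fix i assume i: "i \<in> {1..m}"
  then have "\<phi> i \<in> {1..n}" using assms by blast
  then show "proj m i \<bullet> pr m n \<phi> = one 1 \<bullet> proj n (\<phi> i)"
    using proj_pr[OF assms(1) i] one_comp[OF proj_hom] by simp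
qed (simp add: Iso_one)

text \<open>Reduces the condition that defines regular arrows to injective reindexings, by
  \<open>orthogonal_conjugate\<close>.\<close>

lemma orthogonal_projection_arrow:
  assumes p: "p \<in> projection_arrows T" and r: "r \<in> hom a b"
    and orth: "\<And>n m \<phi>. \<phi> \<in> {1..m} \<rightarrow> {1..n} \<Longrightarrow> inj_on \<phi> {1..m} \<Longrightarrow> orthogonal T (pr m n \<phi>) r"
  shows "orthogonal T p r"
proof -
  obtain m n \<phi> x y where \<phi>: "\<phi> \<in> Inj m n" and x: "x \<in> Iso T (Dom T p) n" and y: "y \<in> Iso T m (Cod T p)"
    and p: "p = y \<bullet> pi_arrow T m n \<phi> \<bullet> x"
    using p unfolding projection_arrows_def by blast
  have F: "\<phi> \<in> Fun m n" "\<phi> \<in> {1..m} \<rightarrow> {1..n}" "inj_on \<phi> {1..m}"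
    using \<phi> by (auto simp: Inj_def Fun_def)
  show ?thesis unfolding p pi_arrow_eq_pr[OF F(1)]
    by (rule orthogonal_conjugate[OF pr_hom[OF F(2)] r x y orth[OF F(2,3)]])
qed

end


section \<open>Presentations of Lawvere theories by regular operads\<close>

text \<open>
  \<open>ev n\<close> embeds the operations of arity \<open>n\<close> into the arrows \<open>n \<rightarrow> 1\<close>; the last assumption says
  that every arrow \<open>n \<rightarrow> 1\<close> is uniquely an operation applied to the variables in a subset of \<open>(n]\<close>.
\<close>

locale presentation = operad P + law T for P :: "'a regop" and T :: "'m lawvere" +
  fixes ev :: "nat \<Rightarrow> 'a \<Rightarrow> 'm"
  assumes ev_hom: "g \<in> ops P n \<Longrightarrow> ev n g \<in> hom n 1"
    and ev_unit: "ev 1 (op_unit P) = one 1"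
    and ev_mul: "\<lbrakk>\<And>i. i \<in> {1..k} \<Longrightarrow> b i \<in> ops P (l i); g \<in> ops P k\<rbrakk> \<Longrightarrow>
      ev (\<Sum>i=1..k. l i) (mul k l b g) = Comp T (ev k g) (par k l (\<lambda>i. ev (l i) (b i)))"
    and ev_act: "\<lbrakk>\<phi> ` {1..n} = {1..m}; g \<in> ops P n\<rbrakk> \<Longrightarrow>
      ev m (act n m \<phi> g) = Comp T (ev n g) (pr n m \<phi>)"
    and ev_bij: "bij_betw (\<lambda>(A, g). Comp T (ev (card A) g) (pr (card A) n (enum A))) (elts n) (hom n 1)"
begin

notation comp (infixr "\<bullet>" 70)

definition val :: "nat \<Rightarrow> nat set \<times> 'a \<Rightarrow> 'm" where
  "val n = (\<lambda>(A, g). ev (card A) g \<bullet> pr (card A) n (enum A))"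

text \<open>The set of variables occurring in \<open>f\<close>, well defined because the normal form
  is unique.\<close>

definition supp :: "nat \<Rightarrow> 'm \<Rightarrow> nat set" where
  "supp n f = fst (inv_into (elts n) (val n) f)"

lemma val_bij: "bij_betw (val n) (elts n) (hom n 1)"
  unfolding val_def by (rule ev_bij)

lemma val_hom: "c \<in> elts n \<Longrightarrow> val n c \<in> hom n 1"
  using val_bij bij_betwE by blast

lemma val_inject: "c \<in> elts n \<Longrightarrow> c' \<in> elts n \<Longrightarrow> val n c = val n c' \<Longrightarrow> c = c'"
  using val_bij unfolding bij_betw_def inj_on_def by blast

lemma hom_val:
  assumes "f \<in> hom n 1"
  obtains c where "c \<in> elts n" "f = val n c"
  using assms val_bij[of n] unfolding bij_betw_def by blast

lemma supp_val: "c \<in> elts n \<Longrightarrow> supp n (val n c) = fst c"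
  unfolding supp_def using bij_betw_inv_into_left[OF val_bij] by metis

lemma supp_subset: "f \<in> hom n 1 \<Longrightarrow> supp n f \<subseteq> {1..n}"
  by (erule hom_val) (auto simp: supp_val elts_def)

lemma val_nf:
  assumes \<phi>: "\<phi> \<in> {1..k} \<rightarrow> {1..n}" and g: "g \<in> ops P k"
  shows "val n (nf k \<phi> g) = ev k g \<bullet> pr k n \<phi>"
proof -
  let ?A = "\<phi> ` {1..k}" and ?r = "\<lambda>x. rank (\<phi> ` {1..k}) (\<phi> x)"
  have r: "?r \<in> {1..k} \<rightarrow> {1..card ?A}" using rank_image[of \<phi> k] by blast
  have e: "enum ?A \<in> {1..card ?A} \<rightarrow> {1..n}" using \<phi> enum_mem[of ?A] by fastforce
  have "val n (nf k \<phi> g) = (ev k g \<bullet> pr k (card ?A) ?r) \<bullet> pr (card ?A) n (enum ?A)"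
    unfolding val_def nf_def using ev_act[OF rank_image g] by simp
  also have "\<dots> = ev k g \<bullet> pr k n (\<lambda>x. enum ?A (?r x))"
    unfolding pr_pr[OF r e, symmetric] by (rule comp_assoc[OF pr_hom[OF e] pr_hom[OF r] ev_hom[OF g]])
  also have "pr k n (\<lambda>x. enum ?A (?r x)) = pr k n \<phi>" by (rule pr_cong) (simp add: enum_rank)
  finally show ?thesis .
qed

text \<open>Evaluation turns substitution into composition. On representatives,
  \<open>ev_mul\<close> evaluates the product as the outer operation after a product of the inner
  ones, and \<open>par_tuple\<close> feeds each inner operation its own variables.\<close>

lemma val_csub:
  assumes c: "c \<in> elts m" and u: "u \<in> hom n m"
    and F: "\<And>i. i \<in> {1..m} \<Longrightarrow> F i \<in> elts n" "\<And>i. i \<in> {1..m} \<Longrightarrow> proj m i \<bullet> u = val n (F i)"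
  shows "val n (csub F c) = val m c \<bullet> u"
proof -
  obtain d \<phi> g where c: "\<phi> \<in> {1..d} \<rightarrow> {1..m}" "g \<in> ops P d" "c = nf d \<phi> g"
    using c by (rule elts_nf)
  obtain k \<chi> b where "\<forall>i\<in>{1..m}. \<chi> i \<in> {1..k i} \<rightarrow> {1..n} \<and> b i \<in> ops P (k i) \<and>
      F i = nf (k i) (\<chi> i) (b i)"
    using elts_nf_family[of m F n, OF F(1)] by blast
  then have F': "\<And>i. i \<in> {1..m} \<Longrightarrow> \<chi> i \<in> {1..k i} \<rightarrow> {1..n}"
    "\<And>i. i \<in> {1..m} \<Longrightarrow> b i \<in> ops P (k i)" "\<And>i. i \<in> {1..m} \<Longrightarrow> F i = nf (k i) (\<chi> i) (b i)"
    by blast+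
  have \<phi>: "\<And>j. j \<in> {1..d} \<Longrightarrow> \<phi> j \<in> {1..m}" using c by auto
  let ?k = "\<lambda>j. k (\<phi> j)" and ?N = "\<Sum>j=1..d. k (\<phi> j)"
  let ?C = "cop ?k (\<lambda>j. \<chi> (\<phi> j))"
  have "csub F c = nf ?N ?C (mul d ?k (\<lambda>j. b (\<phi> j)) g)"
    unfolding c(3) sub_def[symmetric] by (rule csub_nf[OF c(1,2)]) (use F' in auto)
  moreover have C: "?C \<in> {1..?N} \<rightarrow> {1..n}" by (rule cop_Pi) (use F'(1) \<phi> in blast)
  moreover have "mul d ?k (\<lambda>j. b (\<phi> j)) g \<in> ops P ?N" by (rule mul_mem) (use F'(2) \<phi> c in blast)+
  ultimately have "val n (csub F c) = ev ?N (mul d ?k (\<lambda>j. b (\<phi> j)) g) \<bullet> pr ?N n ?C"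
    using val_nf by simp
  also have "ev ?N (mul d ?k (\<lambda>j. b (\<phi> j)) g) = ev d g \<bullet> par d ?k (\<lambda>j. ev (?k j) (b (\<phi> j)))"
    by (rule ev_mul) (use F'(2) \<phi> c in blast)+
  also have "(ev d g \<bullet> par d ?k (\<lambda>j. ev (?k j) (b (\<phi> j)))) \<bullet> pr ?N n ?C =
      ev d g \<bullet> par d ?k (\<lambda>j. ev (?k j) (b (\<phi> j))) \<bullet> pr ?N n ?C"
    by (rule comp_assoc[OF pr_hom[OF C] par_hom ev_hom[OF c(2)]]) (use ev_hom F'(2) \<phi> in blast)
  also have "pr ?N n ?C = tuple n ?N (cop ?k (\<lambda>j x. proj n (\<chi> (\<phi> j) x)))"
    unfolding pr_def by (rule tuple_cong) (simp add: cop_def)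
  also have "par d ?k (\<lambda>j. ev (?k j) (b (\<phi> j))) \<bullet> tuple n ?N (cop ?k (\<lambda>j x. proj n (\<chi> (\<phi> j) x))) =
      tuple n d (\<lambda>j. ev (?k j) (b (\<phi> j)) \<bullet> tuple n (?k j) (\<lambda>x. proj n (\<chi> (\<phi> j) x)))"
  proof (rule par_tuple)
    fix j assume j: "j \<in> {1..d}"
    show "ev (?k j) (b (\<phi> j)) \<in> hom (?k j) 1" by (rule ev_hom[OF F'(2)[OF \<phi>[OF j]]])
    fix x assume "x \<in> {1..?k j}"
    then show "proj n (\<chi> (\<phi> j) x) \<in> hom n 1" using F'(1)[OF \<phi>[OF j]] by (intro proj_hom) blast
  qed
  also have "\<dots> = tuple n d (\<lambda>j. proj m (\<phi> j) \<bullet> u)"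
  proof (rule tuple_cong)
    fix j assume j: "j \<in> {1..d}"
    show "ev (?k j) (b (\<phi> j)) \<bullet> tuple n (?k j) (\<lambda>x. proj n (\<chi> (\<phi> j) x)) = proj m (\<phi> j) \<bullet> u"
      using F(2)[OF \<phi>[OF j]] F'(3)[OF \<phi>[OF j]] val_nf[OF F'(1,2)[OF \<phi>[OF j]]] by (simp add: pr_def)
  qed
  also have "\<dots> = pr d m \<phi> \<bullet> u"
    unfolding pr_def by (rule tuple_comp[OF _ u, symmetric]) (use \<phi> in \<open>auto intro: proj_hom\<close>)
  also have "ev d g \<bullet> pr d m \<phi> \<bullet> u = val m c \<bullet> u"
    unfolding c(3) val_nf[OF c(1,2)] by (rule comp_assoc[OF u pr_hom[OF c(1)] ev_hom[OF c(2)], symmetric])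
  finally show ?thesis .
qed

text \<open>No variable is lost in a substitution: the support of the result is the image of a
  copairing, which is the union of the images of its parts.\<close>

lemma fst_csub:
  assumes c: "c \<in> elts m" and F: "\<And>i. i \<in> {1..m} \<Longrightarrow> F i \<in> elts n"
  shows "fst (csub F c) = (\<Union>j\<in>fst c. fst (F j))"
proof -
  obtain A g where Ag: "c = (A, g)" "A \<subseteq> {1..m}" using c by (auto simp: elts_def)
  then have A: "finite A" using finite_subset by blast
  have "fst (csub F c) = (\<Union>j\<in>{1..card A}. enum (fst (F (enum A j))) ` {1..card (fst (F (enum A j)))})"
    unfolding csub_def sub_def nf_def Ag fst_conv by (rule cop_image)
  also have "\<dots> = (\<Union>j\<in>{1..card A}. fst (F (enum A j)))"
  proof (rule SUP_cong[OF refl])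
    fix j assume "j \<in> {1..card A}"
    then have "enum A j \<in> {1..m}" using enum_mem[OF A] Ag by blast
    then have "finite (fst (F (enum A j)))" using F elts_finite by (metis prod.collapse)
    then show "enum (fst (F (enum A j))) ` {1..card (fst (F (enum A j)))} = fst (F (enum A j))"
      by (rule enum_image)
  qed
  also have "\<dots> = (\<Union>j\<in>enum A ` {1..card A}. fst (F j))" by simp
  finally show ?thesis using enum_image[OF A] by (simp add: Ag)
qed

text \<open>The property of supports from which the description of isomorphisms and that of regular
  arrows both follow.\<close>

lemma supp_comp:
  assumes f: "f \<in> hom m 1" and u: "u \<in> hom n m"
  shows "supp n (f \<bullet> u) = (\<Union>j\<in>supp m f. supp n (proj m j \<bullet> u))"
proof -
  obtain c where c: "c \<in> elts m" "f = val m c" using f by (rule hom_val)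
  have "\<forall>i\<in>{1..m}. \<exists>F. F \<in> elts n \<and> proj m i \<bullet> u = val n F"
    using proj_comp_hom[OF u] hom_val by blast
  then obtain F where F: "\<forall>i\<in>{1..m}. F i \<in> elts n \<and> proj m i \<bullet> u = val n (F i)"
    unfolding bchoice_iff by blast
  then have F1: "\<And>i. i \<in> {1..m} \<Longrightarrow> F i \<in> elts n" and F2: "\<And>i. i \<in> {1..m} \<Longrightarrow> proj m i \<bullet> u = val n (F i)"
    by blast+
  have "f \<bullet> u = val n (csub F c)" unfolding c(2) by (rule val_csub[OF c(1) u F1 F2, symmetric])
  moreover have "csub F c \<in> elts n" by (rule csub_mem[OF c(1) F1])
  ultimately have "supp n (f \<bullet> u) = (\<Union>j\<in>fst c. fst (F j))"
    using supp_val fst_csub[OF c(1) F1] by simp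
  also have "\<dots> = (\<Union>j\<in>supp m f. supp n (proj m j \<bullet> u))"
    unfolding c(2) supp_val[OF c(1)]
  proof (rule SUP_cong[OF refl])
    fix j assume "j \<in> fst c"
    then have "j \<in> {1..m}" using c(1) by (auto simp: elts_def)
    then show "fst (F j) = supp n (proj m j \<bullet> u)" using F1 F2 supp_val by simp
  qed
  finally show ?thesis .
qed

lemma supp_nf: "\<phi> \<in> {1..k} \<rightarrow> {1..n} \<Longrightarrow> g \<in> ops P k \<Longrightarrow> supp n (ev k g \<bullet> pr k n \<phi>) = \<phi> ` {1..k}"
  using supp_val[OF nf_mem] val_nf by (simp add: nf_def)

lemma supp_proj: "i \<in> {1..n} \<Longrightarrow> supp n (proj n i) = {i}"
  using supp_nf[of "\<lambda>_. i" 1 n "op_unit P"] unit_mem one_comp[OF proj_hom]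
  by (simp add: ev_unit proj_eq_pr[symmetric])

lemma supp_ev: "g \<in> ops P n \<Longrightarrow> supp n (ev n g) = {1..n}"
  using supp_nf[of "\<lambda>i. i" n n g] comp_one[OF ev_hom] by (simp add: pr_ident)

lemma supp_pr:
  assumes f: "f \<in> hom m 1" and \<phi>: "\<phi> \<in> {1..m} \<rightarrow> {1..n}"
  shows "supp n (f \<bullet> pr m n \<phi>) = \<phi> ` supp m f"
proof -
  have "supp n (proj m j \<bullet> pr m n \<phi>) = {\<phi> j}" if "j \<in> supp m f" for j
  proof -
    have j: "j \<in> {1..m}" using supp_subset[OF f] that by blast
    then have "\<phi> j \<in> {1..n}" using \<phi> by blast
    then show ?thesis by (simp only: proj_pr[OF \<phi> j] supp_proj)
  qed
  then show ?thesis unfolding supp_comp[OF f pr_hom[OF \<phi>]] by auto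
qed

text \<open>The normal form of \<open>f\<close> uses only variables in its support; each has a
  preimage under \<phi>, and the operation is reindexed through these preimages.\<close>

lemma factor_through:
  assumes f: "f \<in> hom n 1" and \<phi>: "\<phi> \<in> {1..m} \<rightarrow> {1..n}" and sub: "supp n f \<subseteq> \<phi> ` {1..m}"
  shows "\<exists>d\<in>hom m 1. f = d \<bullet> pr m n \<phi>"
proof -
  obtain c where c: "c \<in> elts n" "f = val n c" using f by (rule hom_val)
  obtain A g where Ag: "c = (A, g)" "A \<subseteq> {1..n}" "g \<in> ops P (card A)" using c by (auto simp: elts_def)
  then have A: "finite A" using finite_subset by blast
  have "A \<subseteq> \<phi> ` {1..m}" using sub supp_val[OF c(1)] c Ag by simp
  let ?\<psi> = "\<lambda>i. inv_into {1..m} \<phi> (enum A i)"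
  have e: "enum A i \<in> \<phi> ` {1..m}" if "i \<in> {1..card A}" for i
    using enum_mem[OF A that] \<open>A \<subseteq> \<phi> ` {1..m}\<close> by blast
  have \<psi>: "?\<psi> \<in> {1..card A} \<rightarrow> {1..m}" by (rule Pi_I) (rule inv_into_into[OF e])
  have "pr (card A) m ?\<psi> \<bullet> pr m n \<phi> = pr (card A) n (enum A)"
    unfolding pr_pr[OF \<psi> \<phi>] by (rule pr_cong) (rule f_inv_into_f[OF e])
  then have "f = (ev (card A) g \<bullet> pr (card A) m ?\<psi>) \<bullet> pr m n \<phi>"
    unfolding c(2) Ag(1) val_def
    using comp_assoc[OF pr_hom[OF \<phi>] pr_hom[OF \<psi>] ev_hom[OF Ag(3)]] by simp
  moreover have "ev (card A) g \<bullet> pr (card A) m ?\<psi> \<in> hom m 1"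
    by (rule comp_hom[OF pr_hom[OF \<psi>] ev_hom[OF Ag(3)]])
  ultimately show ?thesis by blast
qed

text \<open>With full support the enumeration in the normal form is the identity.\<close>

lemma full_support_ev:
  assumes f: "f \<in> hom n 1" and s: "supp n f = {1..n}"
  shows "\<exists>g\<in>ops P n. f = ev n g"
proof -
  obtain c where c: "c \<in> elts n" "f = val n c" using f by (rule hom_val)
  obtain A g where Ag: "c = (A, g)" "A \<subseteq> {1..n}" "g \<in> ops P (card A)" using c by (auto simp: elts_def)
  have A: "A = {1..n}" using s supp_val[OF c(1)] c Ag by simp
  have "pr n n (enum {1..n}) = one n" by (rule pr_ident) (rule enum_interval)
  then have "f = ev n g" using c Ag A comp_one[OF ev_hom] by (simp add: val_def)
  then show ?thesis using Ag A by auto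
qed

text \<open>Let \<open>?K\<close> and \<open>?L\<close> be the supports of the components of
  \<open>s\<close> and of its inverse \<open>t\<close>. As both composites are identities, the
  unions of supports given by \<open>supp_comp\<close> are singletons; hence all these supports are
  singletons and define mutually inverse bijections. A component with support \<open>{j}\<close>
  factors through projection \<open>j\<close> as an endomorphism of \<open>1\<close>, whose inverse
  is the corresponding factor for \<open>t\<close>.\<close>

lemma Iso_components:
  assumes s: "s \<in> Iso T n m"
  shows "\<exists>\<kappa> a. bij_betw \<kappa> {1..m} {1..n} \<and>
    (\<forall>i\<in>{1..m}. a i \<in> Iso T 1 1 \<and> proj m i \<bullet> s = a i \<bullet> proj n (\<kappa> i))"
proof -
  obtain t where t: "t \<in> Iso T m n" "t \<bullet> s = one n" "s \<bullet> t = one m" using s by (rule Iso_inverse)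
  have sh: "s \<in> hom n m" and th: "t \<in> hom m n" using s t by (auto dest: Iso_hom)
  let ?K = "\<lambda>i. supp n (proj m i \<bullet> s)" and ?L = "\<lambda>j. supp m (proj n j \<bullet> t)"
  have st: "(proj m i \<bullet> s) \<bullet> t = proj m i" if "i \<in> {1..m}" for i
    using comp_assoc[OF th sh proj_hom[OF that]] t comp_one[OF proj_hom[OF that]] by simp
  have ts: "(proj n j \<bullet> t) \<bullet> s = proj n j" if "j \<in> {1..n}" for j
    using comp_assoc[OF sh th proj_hom[OF that]] t comp_one[OF proj_hom[OF that]] by simp
  have KL: "(\<Union>j\<in>?K i. ?L j) = {i}" if "i \<in> {1..m}" for i
    using supp_comp[OF proj_comp_hom[OF sh that] th] st[OF that] supp_proj[OF that] by simp
  have LK: "(\<Union>i\<in>?L j. ?K i) = {j}" if "j \<in> {1..n}" for j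
    using supp_comp[OF proj_comp_hom[OF th that] sh] ts[OF that] supp_proj[OF that] by simp
  have Kn: "?K i \<subseteq> {1..n}" if "i \<in> {1..m}" for i by (rule supp_subset[OF proj_comp_hom[OF sh that]])
  have Lm: "?L j \<subseteq> {1..m}" if "j \<in> {1..n}" for j by (rule supp_subset[OF proj_comp_hom[OF th that]])
  have exK: "\<exists>j\<in>{1..n}. ?K i = {j} \<and> ?L j = {i}" if i: "i \<in> {1..m}" for i
  proof -
    obtain j where j: "j \<in> ?K i" using KL[OF i] by blast
    then have jn: "j \<in> {1..n}" using Kn[OF i] by blast
    \<comment> \<open>The union over \<open>?L j\<close> is \<open>{j}\<close>, so it cannot be
      indexed by the empty set; this excludes components without variables.\<close>
    have "?L j \<noteq> {}" using LK[OF jn] by blast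
    moreover have "?L j \<subseteq> {i}" unfolding KL[OF i, symmetric] using j by blast
    ultimately have L: "?L j = {i}" by blast
    then have "?K i = {j}" using LK[OF jn] by simp
    with L jn show ?thesis by blast
  qed
  then obtain \<kappa> where \<kappa>: "\<forall>i\<in>{1..m}. \<kappa> i \<in> {1..n} \<and> ?K i = {\<kappa> i} \<and> ?L (\<kappa> i) = {i}" by metis
  have exL: "\<exists>i\<in>{1..m}. ?L j = {i} \<and> ?K i = {j}" if j: "j \<in> {1..n}" for j
  proof -
    obtain i where i: "i \<in> ?L j" using LK[OF j] by blast
    then have im: "i \<in> {1..m}" using Lm[OF j] by blast
    have "?K i \<subseteq> {j}" unfolding LK[OF j, symmetric] using i by blast
    then have "j = \<kappa> i" using \<kappa> im by auto
    then show ?thesis using \<kappa> im by blast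
  qed
  have bij: "bij_betw \<kappa> {1..m} {1..n}"
    unfolding bij_betw_def
  proof
    show "inj_on \<kappa> {1..m}"
    proof (rule inj_onI)
      fix x y assume "x \<in> {1..m}" "y \<in> {1..m}" "\<kappa> x = \<kappa> y"
      then have "{x} = {y}" using \<kappa> by metis
      then show "x = y" by simp
    qed
    show "\<kappa> ` {1..m} = {1..n}"
    proof
      show "\<kappa> ` {1..m} \<subseteq> {1..n}" using \<kappa> by blast
      show "{1..n} \<subseteq> \<kappa> ` {1..m}"
      proof
        fix j assume "j \<in> {1..n}"
        then obtain i where i: "i \<in> {1..m}" "?K i = {j}" using exL by blast
        then have "j = \<kappa> i" using \<kappa> by force
        then show "j \<in> \<kappa> ` {1..m}" using i by blast
      qed
    qed
  qed
  have ex: "\<exists>a. a \<in> hom 1 1 \<and> f = a \<bullet> proj k j"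
    if "f \<in> hom k 1" "j \<in> {1..k}" "supp k f = {j}" for f k j
    using factor_through[OF that(1), of "\<lambda>_. j" 1] that proj_eq_pr[OF that(2)] by auto
  have "\<forall>i\<in>{1..m}. \<exists>a. a \<in> hom 1 1 \<and> proj m i \<bullet> s = a \<bullet> proj n (\<kappa> i)"
  proof
    fix i assume "i \<in> {1..m}"
    then show "\<exists>a. a \<in> hom 1 1 \<and> proj m i \<bullet> s = a \<bullet> proj n (\<kappa> i)"
      using \<kappa> by (intro ex[OF proj_comp_hom[OF sh]]) auto
  qed
  then obtain a where a: "\<forall>i\<in>{1..m}. a i \<in> hom 1 1 \<and> proj m i \<bullet> s = a i \<bullet> proj n (\<kappa> i)"
    unfolding bchoice_iff by blast
  have "a i \<in> Iso T 1 1" if i: "i \<in> {1..m}" for i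
  proof -
    have ki: "\<kappa> i \<in> {1..n}" and ai: "a i \<in> hom 1 1" and si: "proj m i \<bullet> s = a i \<bullet> proj n (\<kappa> i)"
      using \<kappa> a i by auto
    have "\<exists>b. b \<in> hom 1 1 \<and> proj n (\<kappa> i) \<bullet> t = b \<bullet> proj m i"
      using i \<kappa> by (intro ex[OF proj_comp_hom[OF th ki]]) auto
    then obtain b where b: "b \<in> hom 1 1" "proj n (\<kappa> i) \<bullet> t = b \<bullet> proj m i" by blast
    \<comment> \<open>Projections are epimorphisms (\<open>proj_epi\<close>), so the inverse laws
      may be checked after composition with one.\<close>
    have "(a i \<bullet> b) \<bullet> proj m i = a i \<bullet> proj n (\<kappa> i) \<bullet> t"
      using comp_assoc[OF proj_hom[OF i] b(1) ai] b(2) by simp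
    also have "\<dots> = (proj m i \<bullet> s) \<bullet> t" unfolding si by (rule comp_assoc[OF th proj_hom[OF ki] ai, symmetric])
    also have "\<dots> = one 1 \<bullet> proj m i" using st[OF i] one_comp[OF proj_hom[OF i]] by simp
    finally have ab: "a i \<bullet> b = one 1"
      using proj_epi[OF i comp_hom[OF b(1) ai] one_hom] by simp
    have "(b \<bullet> a i) \<bullet> proj n (\<kappa> i) = b \<bullet> proj m i \<bullet> s"
      using comp_assoc[OF proj_hom[OF ki] ai b(1)] si by simp
    also have "\<dots> = (proj n (\<kappa> i) \<bullet> t) \<bullet> s" unfolding b(2) by (rule comp_assoc[OF sh proj_hom[OF i] b(1), symmetric])
    also have "\<dots> = one 1 \<bullet> proj n (\<kappa> i)" using ts[OF ki] one_comp[OF proj_hom[OF ki]] by simp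
    finally have "b \<bullet> a i = one 1"
      using proj_epi[OF ki comp_hom[OF ai b(1)] one_hom] by simp
    with ab ai b show ?thesis by (auto intro: IsoI)
  qed
  with bij a show ?thesis by blast
qed

lemma Iso_eq: "s \<in> Iso T n m \<Longrightarrow> n = m"
  using Iso_components[of s n m] by (auto dest: bij_betw_same_card)

text \<open>A projection arrow is an injective reindexing between two isomorphisms, and
  \<open>Iso_components\<close> describes both of these. In this form closure under composition is a
  matter of composing injections and automorphisms.\<close>

lemma projection_arrow_components:
  assumes p: "p \<in> projection_arrows T" and ph: "p \<in> hom n m"
  shows "\<exists>\<kappa> a. \<kappa> \<in> {1..m} \<rightarrow> {1..n} \<and> inj_on \<kappa> {1..m} \<and>
    (\<forall>i\<in>{1..m}. a i \<in> Iso T 1 1 \<and> proj m i \<bullet> p = a i \<bullet> proj n (\<kappa> i))"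
proof -
  obtain m' n' \<phi> x y where \<phi>: "\<phi> \<in> Inj m' n'" and x: "x \<in> Iso T n n'" and y: "y \<in> Iso T m' m"
    and p: "p = y \<bullet> pi_arrow T m' n' \<phi> \<bullet> x"
    using p homD[OF ph] unfolding projection_arrows_def by blast
  have "n' = n" "m' = m" using Iso_eq[OF x] Iso_eq[OF y] by auto
  note [simp] = this
  have F: "\<phi> \<in> Fun m n" "\<phi> \<in> {1..m} \<rightarrow> {1..n}" "inj_on \<phi> {1..m}"
    using \<phi> by (auto simp: Inj_def Fun_def)
  obtain \<sigma> a where \<sigma>: "bij_betw \<sigma> {1..n} {1..n}"
    and *: "\<forall>i\<in>{1..n}. a i \<in> Iso T 1 1 \<and> proj n i \<bullet> x = a i \<bullet> proj n (\<sigma> i)"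
    using Iso_components x unfolding \<open>n' = n\<close> by blast
  obtain \<tau> b where \<tau>: "bij_betw \<tau> {1..m} {1..m}"
    and **: "\<forall>i\<in>{1..m}. b i \<in> Iso T 1 1 \<and> proj m i \<bullet> y = b i \<bullet> proj m (\<tau> i)"
    using Iso_components y unfolding \<open>m' = m\<close> by blast
  have a: "\<And>i. i \<in> {1..n} \<Longrightarrow> a i \<in> Iso T 1 1" and b: "\<And>i. i \<in> {1..m} \<Longrightarrow> b i \<in> Iso T 1 1"
    and xa: "\<And>i. i \<in> {1..n} \<Longrightarrow> proj n i \<bullet> x = a i \<bullet> proj n (\<sigma> i)"
    and yb: "\<And>i. i \<in> {1..m} \<Longrightarrow> proj m i \<bullet> y = b i \<bullet> proj m (\<tau> i)" using * ** by blast+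
  have xh: "x \<in> hom n n" and yh: "y \<in> hom m m" using x y by (auto dest: Iso_hom)
  have t: "\<tau> i \<in> {1..m}" if "i \<in> {1..m}" for i using bij_betwE[OF \<tau>] that by blast
  have ft: "\<phi> (\<tau> i) \<in> {1..n}" if "i \<in> {1..m}" for i using F(2) t[OF that] by blast
  have sft: "\<sigma> (\<phi> (\<tau> i)) \<in> {1..n}" if "i \<in> {1..m}" for i using bij_betwE[OF \<sigma>] ft[OF that] by blast
  have px: "pr m n \<phi> \<bullet> x \<in> hom n m" by (rule comp_hom[OF xh pr_hom[OF F(2)]])
  show ?thesis
  proof (intro exI[of _ "\<lambda>i. \<sigma> (\<phi> (\<tau> i))"] exI[of _ "\<lambda>i. b i \<bullet> a (\<phi> (\<tau> i))"] conjI ballI)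
    show "(\<lambda>i. \<sigma> (\<phi> (\<tau> i))) \<in> {1..m} \<rightarrow> {1..n}" using sft by blast
    show "inj_on (\<lambda>i. \<sigma> (\<phi> (\<tau> i))) {1..m}"
    proof (rule inj_onI)
      fix i j assume ij: "i \<in> {1..m}" "j \<in> {1..m}" "\<sigma> (\<phi> (\<tau> i)) = \<sigma> (\<phi> (\<tau> j))"
      have "\<phi> (\<tau> i) = \<phi> (\<tau> j)" using inj_onD[OF bij_betw_imp_inj_on[OF \<sigma>] ij(3)] ft ij by blast
      then have "\<tau> i = \<tau> j" using inj_onD[OF F(3)] t ij by blast
      then show "i = j" using inj_onD[OF bij_betw_imp_inj_on[OF \<tau>]] ij by blast
    qed
    fix i assume i: "i \<in> {1..m}"
    show "b i \<bullet> a (\<phi> (\<tau> i)) \<in> Iso T 1 1" by (rule Iso_comp[OF a[OF ft[OF i]] b[OF i]])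
    note bh = Iso_hom[OF b[OF i]] and ah = Iso_hom[OF a[OF ft[OF i]]]
    have "proj m i \<bullet> p = (proj m i \<bullet> y) \<bullet> pr m n \<phi> \<bullet> x"
      using proj_comp_comp[OF yh px i] p pi_arrow_eq_pr[OF F(1)] by simp
    also have "\<dots> = b i \<bullet> proj m (\<tau> i) \<bullet> pr m n \<phi> \<bullet> x"
      unfolding yb[OF i] by (rule comp_assoc[OF px proj_hom[OF t[OF i]] bh])
    also have "proj m (\<tau> i) \<bullet> pr m n \<phi> \<bullet> x = proj n (\<phi> (\<tau> i)) \<bullet> x"
      using proj_comp_comp[OF pr_hom[OF F(2)] xh t[OF i]] proj_pr[OF F(2) t[OF i]] by simp
    also have "\<dots> = a (\<phi> (\<tau> i)) \<bullet> proj n (\<sigma> (\<phi> (\<tau> i)))" by (rule xa[OF ft[OF i]])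
    also have "b i \<bullet> a (\<phi> (\<tau> i)) \<bullet> proj n (\<sigma> (\<phi> (\<tau> i))) =
        (b i \<bullet> a (\<phi> (\<tau> i))) \<bullet> proj n (\<sigma> (\<phi> (\<tau> i)))"
      by (rule comp_assoc[OF proj_hom[OF sft[OF i]] ah bh, symmetric])
    finally show "proj m i \<bullet> p = (b i \<bullet> a (\<phi> (\<tau> i))) \<bullet> proj n (\<sigma> (\<phi> (\<tau> i)))" .
  qed
qed

lemma projection_arrows_comp:
  assumes p: "p \<in> projection_arrows T" "p \<in> hom n m" and q: "q \<in> projection_arrows T" "q \<in> hom m l"
  shows "q \<bullet> p \<in> projection_arrows T"
proof -
  obtain \<kappa> a where \<kappa>: "\<kappa> \<in> {1..m} \<rightarrow> {1..n}" "inj_on \<kappa> {1..m}"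
    and *: "\<forall>i\<in>{1..m}. a i \<in> Iso T 1 1 \<and> proj m i \<bullet> p = a i \<bullet> proj n (\<kappa> i)"
    using projection_arrow_components[OF p] by blast
  obtain \<mu> b where \<mu>: "\<mu> \<in> {1..l} \<rightarrow> {1..m}" "inj_on \<mu> {1..l}"
    and **: "\<forall>i\<in>{1..l}. b i \<in> Iso T 1 1 \<and> proj l i \<bullet> q = b i \<bullet> proj m (\<mu> i)"
    using projection_arrow_components[OF q] by blast
  have a: "\<And>i. i \<in> {1..m} \<Longrightarrow> a i \<in> Iso T 1 1" and b: "\<And>i. i \<in> {1..l} \<Longrightarrow> b i \<in> Iso T 1 1"
    and pa: "\<And>i. i \<in> {1..m} \<Longrightarrow> proj m i \<bullet> p = a i \<bullet> proj n (\<kappa> i)"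
    and qb: "\<And>i. i \<in> {1..l} \<Longrightarrow> proj l i \<bullet> q = b i \<bullet> proj m (\<mu> i)" using * ** by blast+
  have m: "\<mu> i \<in> {1..m}" if "i \<in> {1..l}" for i using \<mu> that by blast
  have km: "\<kappa> (\<mu> i) \<in> {1..n}" if "i \<in> {1..l}" for i using \<kappa> m[OF that] by blast
  show ?thesis
  proof (rule projection_arrowI[of _ n l "\<lambda>i. \<kappa> (\<mu> i)" "\<lambda>i. b i \<bullet> a (\<mu> i)"])
    show "q \<bullet> p \<in> hom n l" by (rule comp_hom[OF p(2) q(2)])
    show "(\<lambda>i. \<kappa> (\<mu> i)) \<in> {1..l} \<rightarrow> {1..n}" using km by blast
    show "inj_on (\<lambda>i. \<kappa> (\<mu> i)) {1..l}"
    proof (rule inj_onI)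
      fix i j assume ij: "i \<in> {1..l}" "j \<in> {1..l}" "\<kappa> (\<mu> i) = \<kappa> (\<mu> j)"
      have "\<mu> i = \<mu> j" using inj_onD[OF \<kappa>(2) ij(3)] m ij by blast
      then show "i = j" using inj_onD[OF \<mu>(2)] ij by blast
    qed
    fix i assume i: "i \<in> {1..l}"
    show "b i \<bullet> a (\<mu> i) \<in> Iso T 1 1" by (rule Iso_comp[OF a[OF m[OF i]] b[OF i]])
    note bh = Iso_hom[OF b[OF i]] and ah = Iso_hom[OF a[OF m[OF i]]]
    have "proj l i \<bullet> q \<bullet> p = (b i \<bullet> proj m (\<mu> i)) \<bullet> p"
      using proj_comp_comp[OF q(2) p(2) i] qb[OF i] by simp
    also have "\<dots> = b i \<bullet> a (\<mu> i) \<bullet> proj n (\<kappa> (\<mu> i))"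
      using comp_assoc[OF p(2) proj_hom[OF m[OF i]] bh] pa[OF m[OF i]] by simp
    also have "\<dots> = (b i \<bullet> a (\<mu> i)) \<bullet> proj n (\<kappa> (\<mu> i))"
      by (rule comp_assoc[OF proj_hom[OF km[OF i]] ah bh, symmetric])
    finally show "proj l i \<bullet> q \<bullet> p = (b i \<bullet> a (\<mu> i)) \<bullet> proj n (\<kappa> (\<mu> i))" .
  qed
qed

section \<open>Regular arrows and full support\<close>

definition full :: "nat \<Rightarrow> nat \<Rightarrow> 'm \<Rightarrow> bool" where
  "full n m r \<longleftrightarrow> (\<Union>i\<in>{1..m}. supp n (proj m i \<bullet> r)) = {1..n}"

text \<open>Each variable \<open>j\<close> of the source of \<open>r\<close> occurs in some
  component of \<open>r\<close>, so the support of component \<open>j\<close> of \<open>u\<close> is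
  contained in that of a component of \<open>r \<bullet> u = v \<bullet> pr m n \<phi>\<close>,
  hence in the image of \<phi>. Thus \<open>u\<close> factors through \<open>pr m n \<phi>\<close>;
  as this arrow is epi, the factor is unique and the other triangle commutes.\<close>

lemma full_orthogonal:
  assumes r: "r \<in> hom a b" "full a b r" and \<phi>: "\<phi> \<in> {1..m} \<rightarrow> {1..n}" "inj_on \<phi> {1..m}"
  shows "orthogonal T (pr m n \<phi>) r"
proof -
  have "\<exists>!d. d \<in> hom m a \<and> d \<bullet> pr m n \<phi> = u \<and> r \<bullet> d = v"
    if u: "u \<in> hom n a" and v: "v \<in> hom m b" and eq: "r \<bullet> u = v \<bullet> pr m n \<phi>" for u v
  proof -
    have "supp n (proj a j \<bullet> u) \<subseteq> \<phi> ` {1..m}" if j: "j \<in> {1..a}" for j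
    proof -
      obtain i where i: "i \<in> {1..b}" "j \<in> supp a (proj b i \<bullet> r)"
        using r(2) j unfolding full_def by blast
      have "supp n (proj a j \<bullet> u) \<subseteq> supp n ((proj b i \<bullet> r) \<bullet> u)"
        unfolding supp_comp[OF proj_comp_hom[OF r(1) i(1)] u] using i(2) by blast
      also have "(proj b i \<bullet> r) \<bullet> u = (proj b i \<bullet> v) \<bullet> pr m n \<phi>"
        using proj_comp_comp[OF r(1) u i(1)] proj_comp_comp[OF v pr_hom[OF \<phi>(1)] i(1)] eq by simp
      also have "supp n \<dots> = \<phi> ` supp m (proj b i \<bullet> v)"
        by (rule supp_pr[OF proj_comp_hom[OF v i(1)] \<phi>(1)])
      also have "\<dots> \<subseteq> \<phi> ` {1..m}" using supp_subset[OF proj_comp_hom[OF v i(1)]] by blast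
      finally show ?thesis .
    qed
    then have "\<forall>j\<in>{1..a}. \<exists>d. d \<in> hom m 1 \<and> proj a j \<bullet> u = d \<bullet> pr m n \<phi>"
      using factor_through[OF proj_comp_hom[OF u] \<phi>(1)] unfolding Bex_def by blast
    then obtain d where d: "\<forall>j\<in>{1..a}. d j \<in> hom m 1 \<and> proj a j \<bullet> u = d j \<bullet> pr m n \<phi>"
      unfolding bchoice_iff by blast
    then have dh: "\<And>j. j \<in> {1..a} \<Longrightarrow> d j \<in> hom m 1" by blast
    have t: "tuple m a d \<in> hom m a" by (rule tuple_hom) (rule dh)
    have tu: "tuple m a d \<bullet> pr m n \<phi> = u"
    proof -
      have "tuple m a d \<bullet> pr m n \<phi> = tuple n a (\<lambda>j. proj a j \<bullet> u)"
        by (rule trans[OF tuple_comp[OF _ pr_hom[OF \<phi>(1)]] tuple_cong]) (use d in auto)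
      then show ?thesis using tuple_proj[OF u] by simp
    qed
    have "(r \<bullet> tuple m a d) \<bullet> pr m n \<phi> = v \<bullet> pr m n \<phi>"
      using comp_assoc[OF pr_hom[OF \<phi>(1)] t r(1)] tu eq by simp
    then have "r \<bullet> tuple m a d = v" by (rule pr_inj_epi[OF \<phi> comp_hom[OF t r(1)] v])
    with t tu show ?thesis using pr_inj_epi[OF \<phi>] by (intro ex1I[of _ "tuple m a d"]) auto
  qed
  then show ?thesis unfolding orthogonal_iff[OF pr_hom[OF \<phi>(1)] r(1)] by blast
qed

lemma full_regular:
  assumes r: "r \<in> hom n m" "full n m r"
  shows "r \<in> regular_arrows T"
  unfolding regular_arrows_def
  using homD[OF r(1)] orthogonal_projection_arrow[OF _ r(1) full_orthogonal[OF r]] by blast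

lemma enum_Pi: "finite A \<Longrightarrow> A \<subseteq> {1..n} \<Longrightarrow> enum A \<in> {1..card A} \<rightarrow> {1..n}"
  by (rule Pi_I) (rule subsetD[OF _ enum_mem])

lemma enum_inj: "finite A \<Longrightarrow> inj_on (enum A) {1..card A}"
  by (rule bij_betw_imp_inj_on[OF bij_betw_enum])

text \<open>The projection part selects the variables occurring in \<open>f\<close>; the remaining
  arrow then depends on all of its variables.\<close>

lemma full_factorization:
  assumes f: "f \<in> hom n m"
  defines "A \<equiv> \<Union>i\<in>{1..m}. supp n (proj m i \<bullet> f)"
  shows "finite A" "A \<subseteq> {1..n}"
    "\<exists>r\<in>hom (card A) m. full (card A) m r \<and> f = r \<bullet> pr (card A) n (enum A)"
proof -
  show A: "A \<subseteq> {1..n}" unfolding A_def using supp_subset[OF proj_comp_hom[OF f]] by blast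
  then show fin: "finite A" using finite_subset by blast
  note e = enum_Pi[OF fin A]
  have "\<forall>i\<in>{1..m}. \<exists>d. d \<in> hom (card A) 1 \<and> proj m i \<bullet> f = d \<bullet> pr (card A) n (enum A)"
  proof
    fix i assume i: "i \<in> {1..m}"
    then have "supp n (proj m i \<bullet> f) \<subseteq> enum A ` {1..card A}" unfolding enum_image[OF fin] by (auto simp: A_def)
    then show "\<exists>d. d \<in> hom (card A) 1 \<and> proj m i \<bullet> f = d \<bullet> pr (card A) n (enum A)"
      using factor_through[OF proj_comp_hom[OF f i] e] by blast
  qed
  then obtain d where d: "\<forall>i\<in>{1..m}. d i \<in> hom (card A) 1 \<and> proj m i \<bullet> f = d i \<bullet> pr (card A) n (enum A)"
    unfolding bchoice_iff by blast
  then have dh: "\<And>j. j \<in> {1..m} \<Longrightarrow> d j \<in> hom (card A) 1" by blast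
  let ?r = "tuple (card A) m d"
  have r: "?r \<in> hom (card A) m" by (rule tuple_hom) (rule dh)
  have "?r \<bullet> pr (card A) n (enum A) = tuple n m (\<lambda>i. proj m i \<bullet> f)"
    by (rule trans[OF tuple_comp[OF _ pr_hom[OF e]] tuple_cong]) (use d in auto)
  then have eq: "f = ?r \<bullet> pr (card A) n (enum A)" using tuple_proj[OF f] by simp
  have "supp n (proj m i \<bullet> f) = enum A ` supp (card A) (proj m i \<bullet> ?r)" if "i \<in> {1..m}" for i
    using d that supp_pr[OF dh[OF that] e] proj_tuple[where f = d and n = m, OF dh that] by simp
  \<comment> \<open>Supports before and after the reindexing correspond under \<open>enum A\<close>,
    whose injectivity makes the supports of \<open>?r\<close> cover all of
    \<open>{1..card A}\<close>.\<close>
  then have "A = enum A ` (\<Union>i\<in>{1..m}. supp (card A) (proj m i \<bullet> ?r))"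
    unfolding image_UN by (subst A_def) (auto intro: SUP_cong)
  moreover have sub: "(\<Union>i\<in>{1..m}. supp (card A) (proj m i \<bullet> ?r)) \<subseteq> {1..card A}"
    using supp_subset[OF proj_comp_hom[OF r]] by blast
  ultimately have "(\<Union>i\<in>{1..m}. supp (card A) (proj m i \<bullet> ?r)) = {1..card A}"
    using inj_on_image_eq_iff[OF enum_inj[OF fin] sub order.refl] enum_image[OF fin] by simp
  then have "full (card A) m ?r" by (simp add: full_def)
  with r eq show "\<exists>r\<in>hom (card A) m. full (card A) m r \<and> f = r \<bullet> pr (card A) n (enum A)" by blast
qed

text \<open>If \<open>r\<close> is regular, take its own factorization
  \<open>r = r' \<bullet> pr (card A) n (enum A)\<close>, with \<open>A\<close> the union of the
  supports. Orthogonality with the identity as upper side gives \<open>d\<close> with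
  \<open>d \<bullet> pr (card A) n (enum A) = one n\<close>; comparing supports of components, each
  variable \<open>j\<close> lies in \<open>A\<close>.\<close>

lemma regular_iff_full:
  assumes r: "r \<in> hom n m"
  shows "r \<in> regular_arrows T \<longleftrightarrow> full n m r"
proof
  assume reg: "r \<in> regular_arrows T"
  define A where "A = (\<Union>i\<in>{1..m}. supp n (proj m i \<bullet> r))"
  note fact = full_factorization[OF r, folded A_def]
  note e = enum_Pi[OF fact(1,2)] and ei = enum_inj[OF fact(1)]
  obtain r' where r': "r' \<in> hom (card A) m" "r = r' \<bullet> pr (card A) n (enum A)" using fact(3) by blast
  have "orthogonal T (pr (card A) n (enum A)) r"
    using reg pr_projection_arrow[OF e ei] by (auto simp: regular_arrows_def)
  moreover have "r \<bullet> one n = r' \<bullet> pr (card A) n (enum A)" using comp_one[OF r] r' by simp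
  moreover have "one n \<in> hom n n" by (simp add: one_hom)
  ultimately obtain d where d: "d \<in> hom (card A) n" "d \<bullet> pr (card A) n (enum A) = one n"
    using r'(1) unfolding orthogonal_iff[OF pr_hom[OF e] r] by blast
  have "j \<in> A" if j: "j \<in> {1..n}" for j
  proof -
    have "(proj n j \<bullet> d) \<bullet> pr (card A) n (enum A) = proj n j"
      using proj_comp_comp[OF d(1) pr_hom[OF e] j] d(2) comp_one[OF proj_hom[OF j]] by simp
    then have "enum A ` supp (card A) (proj n j \<bullet> d) = {j}"
      using supp_pr[OF proj_comp_hom[OF d(1) j] e] supp_proj[OF j] by simp
    then have "j \<in> enum A ` supp (card A) (proj n j \<bullet> d)" by (simp only: singletonI)
    also have "\<dots> \<subseteq> enum A ` {1..card A}"
      by (rule image_mono[OF supp_subset[OF proj_comp_hom[OF d(1) j]]])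
    also have "\<dots> = A" by (rule enum_image[OF fact(1)])
    finally show ?thesis .
  qed
  then show "full n m r" using fact(2) unfolding full_def A_def[symmetric] by blast
qed (rule full_regular[OF r])

lemma regular_ev: "g \<in> ops P n \<Longrightarrow> ev n g \<in> regular_arrows T"
proof -
  assume g: "g \<in> ops P n"
  have "proj 1 1 \<bullet> ev n g = ev n g" using one_comp[OF ev_hom[OF g]] by (simp add: proj_one)
  then show ?thesis using supp_ev[OF g] unfolding regular_iff_full[OF ev_hom[OF g]] full_def by simp
qed

lemma regular_is_ev: "r \<in> regular_arrows T \<Longrightarrow> r \<in> hom n 1 \<Longrightarrow> \<exists>g\<in>ops P n. r = ev n g"
proof -
  assume r: "r \<in> regular_arrows T" "r \<in> hom n 1"
  have "proj 1 1 \<bullet> r = r" using one_comp[OF r(2)] by (simp add: proj_one)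
  then have "supp n r = {1..n}" using r(1) unfolding regular_iff_full[OF r(2)] full_def by simp
  then show ?thesis by (rule full_support_ev[OF r(2)])
qed

lemma factorization_system_projection_regular:
  "factorization_system T (projection_arrows T) (regular_arrows T)"
  unfolding factorization_system_def
proof (intro conjI ballI impI)
  show "projection_arrows T \<subseteq> Arr T" "regular_arrows T \<subseteq> Arr T"
    by (auto simp: projection_arrows_def regular_arrows_def)
  show "iso_arrows T \<subseteq> projection_arrows T"
  proof
    fix s assume "s \<in> iso_arrows T"
    then have s: "s \<in> Iso T (Dom T s) (Cod T s)" by (simp add: iso_arrows_iff)
    obtain \<kappa> a where \<kappa>: "bij_betw \<kappa> {1..Cod T s} {1..Dom T s}"
      and a: "\<forall>i\<in>{1..Cod T s}. a i \<in> Iso T 1 1 \<and>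
        proj (Cod T s) i \<bullet> s = a i \<bullet> proj (Dom T s) (\<kappa> i)"
      using Iso_components[OF s] by blast
    show "s \<in> projection_arrows T"
    proof (rule projection_arrowI[OF Iso_hom[OF s] _ bij_betw_imp_inj_on[OF \<kappa>]])
      show "\<kappa> \<in> {1..Cod T s} \<rightarrow> {1..Dom T s}" using bij_betwE[OF \<kappa>] by blast
    qed (use a in blast)+
  qed
  show "iso_arrows T \<subseteq> regular_arrows T"
  proof
    fix s assume "s \<in> iso_arrows T"
    then have s: "s \<in> Arr T" "s \<in> Iso T (Dom T s) (Cod T s)" by (simp_all add: iso_arrows_iff)
    then show "s \<in> regular_arrows T"
      unfolding regular_arrows_def projection_arrows_def using orthogonal_Iso[OF arr_hom s(2)] by blast
  qed
next
  fix f g assume f: "f \<in> projection_arrows T" and g: "g \<in> projection_arrows T" and d: "Dom T g = Cod T f"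
  have "f \<in> Arr T" "g \<in> Arr T" using f g by (auto simp: projection_arrows_def)
  then have "f \<in> hom (Dom T f) (Cod T f)" "g \<in> hom (Cod T f) (Cod T g)" using arr_hom d by metis+
  with f g show "g \<bullet> f \<in> projection_arrows T" by (blast intro: projection_arrows_comp)
next
  fix f g assume f: "f \<in> regular_arrows T" and g: "g \<in> regular_arrows T" and d: "Dom T g = Cod T f"
  have fa: "f \<in> Arr T" "g \<in> Arr T" using f g by (auto simp: regular_arrows_def)
  then have fg: "f \<in> hom (Dom T f) (Cod T f)" "g \<in> hom (Cod T f) (Cod T g)" using arr_hom d by metis+
  have "orthogonal T p (g \<bullet> f)" if p: "p \<in> projection_arrows T" for p
  proof (rule orthogonal_comp[OF _ fg])
    show "p \<in> hom (Dom T p) (Cod T p)" using p arr_hom by (auto simp: projection_arrows_def)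
  qed (use f g p in \<open>auto simp: regular_arrows_def\<close>)
  then show "g \<bullet> f \<in> regular_arrows T" using homD[OF comp_hom[OF fg]] by (auto simp: regular_arrows_def)
next
  fix e m assume "e \<in> projection_arrows T" "m \<in> regular_arrows T"
  then show "orthogonal T e m" by (auto simp: regular_arrows_def)
next
  fix f assume "f \<in> Arr T"
  then have f: "f \<in> hom (Dom T f) (Cod T f)" by (rule arr_hom)
  define A where "A = (\<Union>i\<in>{1..Cod T f}. supp (Dom T f) (proj (Cod T f) i \<bullet> f))"
  note fact = full_factorization[OF f, folded A_def]
  note e = enum_Pi[OF fact(1,2)] and ei = enum_inj[OF fact(1)]
  obtain r where r: "r \<in> hom (card A) (Cod T f)" "full (card A) (Cod T f) r"
    "f = r \<bullet> pr (card A) (Dom T f) (enum A)" using fact(3) by blast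
  show "\<exists>e\<in>projection_arrows T. \<exists>m\<in>regular_arrows T. Dom T m = Cod T e \<and> f = m \<bullet> e"
    using r pr_projection_arrow[OF e ei] full_regular[OF r(1,2)] homD[OF r(1)] homD[OF pr_hom[OF e]]
    by (intro bexI[of _ "pr (card A) (Dom T f) (enum A)"] bexI[of _ r]) auto
qed

text \<open>An invertible \<open>a\<close> depends on its variable: if its support were empty, so
  would be the support of \<open>a \<bullet> b = one 1\<close>.\<close>

lemma supp_Iso_proj:
  assumes a: "a \<in> Iso T 1 1" and j: "j \<in> {1..n}"
  shows "supp n (a \<bullet> proj n j) = {j}"
proof -
  obtain b where b: "b \<in> Iso T 1 1" "a \<bullet> b = one 1" using a by (auto elim: Iso_inverse)
  have "supp 1 (one 1) = {1}" using supp_proj[of 1 1] by (simp add: proj_one)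
  then have "supp 1 a \<noteq> {}" using supp_comp[OF Iso_hom[OF a] Iso_hom[OF b(1)]] b(2) by auto
  then have "supp 1 a = {1}" using supp_subset[OF Iso_hom[OF a]] by auto
  then have "supp n (a \<bullet> proj n j) = supp n (proj 1 1 \<bullet> proj n j)"
    using supp_comp[OF Iso_hom[OF a] proj_hom[OF j]] by simp
  also have "proj 1 1 \<bullet> proj n j = proj n j" using one_comp[OF proj_hom[OF j]] by (simp add: proj_one)
  finally show ?thesis using supp_proj[OF j] by simp
qed

text \<open>Surjectivity is \<open>Iso_components\<close>. For injectivity, the permutation is read
  off from the supports of the components, and then the automorphisms of \<open>1\<close> by
  cancelling projections.\<close>

lemma simple_automorphisms: "simple_automorphisms T"
  unfolding simple_automorphisms_def
proof
  fix n
  let ?f = "\<lambda>(\<sigma>, a). power_arrow T n a \<bullet> pi_arrow T n n \<sigma>"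
  let ?X = "Sym n \<times> ({1..n} \<rightarrow>\<^sub>E Iso T 1 1)"
  have f: "?f (\<sigma>, a) \<in> Iso T n n \<and> (\<forall>i\<in>{1..n}. proj n i \<bullet> ?f (\<sigma>, a) = a i \<bullet> proj n (\<sigma> i))"
    if \<sigma>: "\<sigma> \<in> Sym n" and a: "a \<in> {1..n} \<rightarrow>\<^sub>E Iso T 1 1" for \<sigma> a
  proof -
    have a': "\<And>i. i \<in> {1..n} \<Longrightarrow> a i \<in> hom 1 1" "\<And>i. i \<in> {1..n} \<Longrightarrow> a i \<in> Iso T 1 1"
      using a by (auto dest: Iso_hom)
    have F: "\<sigma> \<in> Fun n n" and b: "bij_betw \<sigma> {1..n} {1..n}" and Pi: "\<sigma> \<in> {1..n} \<rightarrow> {1..n}"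
      using \<sigma> by (auto simp: Sym_def Fun_def)
    have "?f (\<sigma>, a) = power n a \<bullet> pr n n \<sigma>"
      using power_arrow_eq[of n a, OF a'(1)] pi_arrow_eq_pr[OF F] by simp
    moreover have "power n a \<bullet> pr n n \<sigma> \<in> Iso T n n"
      by (rule Iso_comp[OF pr_Iso[OF b] power_Iso[OF a'(2)]])
    moreover have "proj n i \<bullet> power n a \<bullet> pr n n \<sigma> = a i \<bullet> proj n (\<sigma> i)" if i: "i \<in> {1..n}" for i
      using proj_power_comp[OF a'(1) pr_hom[OF Pi] i] proj_pr[OF Pi i] by simp
    ultimately show ?thesis by simp
  qed
  show "bij_betw ?f ?X (Iso T n n)"
    unfolding bij_betw_def
  proof
    show "inj_on ?f ?X"
    proof (rule inj_onI, clarify)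
      fix \<sigma> a \<tau> b assume \<sigma>: "\<sigma> \<in> Sym n" and a: "a \<in> {1..n} \<rightarrow>\<^sub>E Iso T 1 1" and \<tau>: "\<tau> \<in> Sym n"
        and b: "b \<in> {1..n} \<rightarrow>\<^sub>E Iso T 1 1"
        and eq: "power_arrow T n a \<bullet> pi_arrow T n n \<sigma> = power_arrow T n b \<bullet> pi_arrow T n n \<tau>"
      have pe: "a i \<bullet> proj n (\<sigma> i) = b i \<bullet> proj n (\<tau> i)" if "i \<in> {1..n}" for i
        using f[OF \<sigma> a] f[OF \<tau> b] eq that by simp
      have st: "\<sigma> i \<in> {1..n}" "\<tau> i \<in> {1..n}" "a i \<in> Iso T 1 1" "b i \<in> Iso T 1 1" if "i \<in> {1..n}" for i
        using \<sigma> \<tau> a b that by (auto simp: Sym_def Fun_def)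
      have s: "\<sigma> i = \<tau> i" if i: "i \<in> {1..n}" for i
        using supp_Iso_proj[OF st(3,1)[OF i]] supp_Iso_proj[OF st(4,2)[OF i]] pe[OF i] by simp
      have "a i = b i" if i: "i \<in> {1..n}" for i
        using proj_epi[OF st(1)[OF i] Iso_hom[OF st(3)[OF i]] Iso_hom[OF st(4)[OF i]]] pe[OF i] s[OF i] by simp
      then have "a = b" using a b by (intro extensionalityI[of _ "{1..n}"]) (auto simp: PiE_iff)
      moreover have "\<sigma> = \<tau>" using s \<sigma> \<tau>
        by (intro extensionalityI[of _ "{1..n}"]) (auto simp: PiE_iff Sym_def Fun_def)
      ultimately show "\<sigma> = \<tau> \<and> a = b" by blast
    qed
    show "?f ` ?X = Iso T n n"
    proof (intro set_eqI iffI)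
      fix s assume "s \<in> ?f ` ?X"
      then show "s \<in> Iso T n n" using f by auto
    next
      fix s assume s: "s \<in> Iso T n n"
      obtain \<kappa> a where \<kappa>: "bij_betw \<kappa> {1..n} {1..n}"
        and *: "\<forall>i\<in>{1..n}. a i \<in> Iso T 1 1 \<and> proj n i \<bullet> s = a i \<bullet> proj n (\<kappa> i)"
        using Iso_components[OF s] by blast
      then have a: "\<And>i. i \<in> {1..n} \<Longrightarrow> a i \<in> Iso T 1 1"
        and sa: "\<And>i. i \<in> {1..n} \<Longrightarrow> proj n i \<bullet> s = a i \<bullet> proj n (\<kappa> i)" by blast+
      show "s \<in> ?f ` ?X"
      proof -
        let ?\<kappa> = "restrict \<kappa> {1..n}" and ?a = "restrict a {1..n}"
        have K: "?\<kappa> \<in> Sym n" "?a \<in> {1..n} \<rightarrow>\<^sub>E Iso T 1 1"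
          using \<kappa> a bij_betwE[OF \<kappa>] by (auto simp: Sym_def Fun_def bij_betw_restrict_eq)
        have "?f (?\<kappa>, ?a) = s"
        proof (rule hom_eqI)
          show "?f (?\<kappa>, ?a) \<in> hom n n" "s \<in> hom n n" using f[OF K] s by (auto dest: Iso_hom)
          show "\<And>i. i \<in> {1..n} \<Longrightarrow> proj n i \<bullet> ?f (?\<kappa>, ?a) = proj n i \<bullet> s" using f[OF K] sa by auto
        qed
        then show ?thesis using K by (intro image_eqI[of _ _ "(?\<kappa>, ?a)"]) auto
      qed
    qed
  qed
qed

theorem regular_lawvere_theory: "regular_lawvere_theory T"
  unfolding regular_lawvere_theory_def
  using lawvere_theory factorization_system_projection_regular simple_automorphisms by blast

end


section \<open>Regular Lawvere theories\<close>

context law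
begin

text \<open>Associativity of products of arrows, in the flattened indexing of the operad laws; the
  variables of each component are matched by \<open>pos_pos\<close>.\<close>

lemma par_par:
  assumes b: "\<And>i. i \<in> {1..k} \<Longrightarrow> b i \<in> hom (n i) 1"
    and c: "\<And>i j. i \<in> {1..k} \<Longrightarrow> j \<in> {1..n i} \<Longrightarrow> c i j \<in> hom (q i j) 1"
  shows "par k n b \<bullet> par (\<Sum>i=1..k. n i) (cop n q) (cop n c) =
    par k (\<lambda>i. \<Sum>j=1..n i. q i j) (\<lambda>i. b i \<bullet> par (n i) (q i) (c i))"
proof -
  let ?N = "\<Sum>i=1..k. n i" and ?Q = "\<lambda>i. \<Sum>j=1..n i. q i j"
  let ?M = "\<Sum>i=1..k. ?Q i"
  have M: "(\<Sum>p=1..?N. cop n q p) = ?M" by (rule sum_cop)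
  have cc: "cop n c p \<in> hom (cop n q p) 1" if "p \<in> {1..?N}" for p
    using that
  proof (rule pos_cases)
    fix j x assume "j \<in> {1..k}" "x \<in> {1..n j}" "p = pos n j x"
    then show ?thesis using c[of j x] by simp
  qed
  have p1: "par k n b \<in> hom ?N k" by (rule par_hom) (rule b)
  have p2: "par ?N (cop n q) (cop n c) \<in> hom ?M ?N" using par_hom[of ?N "cop n c" "cop n q", OF cc] M by simp
  have ch: "par (n i) (q i) (c i) \<in> hom (?Q i) (n i)" if "i \<in> {1..k}" for i
    by (rule par_hom) (rule c[OF that])
  have bc: "b i \<bullet> par (n i) (q i) (c i) \<in> hom (?Q i) 1" if "i \<in> {1..k}" for i
    by (rule comp_hom[OF ch[OF that] b[OF that]])
  show ?thesis
  proof (rule hom_eqI[OF comp_hom[OF p2 p1] par_hom])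
    show "\<And>i. i \<in> {1..k} \<Longrightarrow> b i \<bullet> par (n i) (q i) (c i) \<in> hom (?Q i) 1" by (rule bc)
    fix i assume i: "i \<in> {1..k}"
    have e1: "pr (n i) ?N (pos n i) \<in> hom ?N (n i)" by (rule pr_hom[OF pos_Pi[OF i]])
    have e2: "pr (?Q i) ?M (pos ?Q i) \<in> hom ?M (?Q i)" by (rule pr_hom[OF pos_Pi[OF i]])
    have inner: "pr (n i) ?N (pos n i) \<bullet> par ?N (cop n q) (cop n c) =
        par (n i) (q i) (c i) \<bullet> pr (?Q i) ?M (pos ?Q i)"
    proof (rule hom_eqI[OF comp_hom[OF p2 e1] comp_hom[OF e2 ch[OF i]]])
      fix j assume j: "j \<in> {1..n i}"
      have pj: "pos n i j \<in> {1..?N}" by (rule pos_mem[where k = n, OF i j])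
      have qj: "cop n q (pos n i j) = q i j" "cop n c (pos n i j) = c i j" using i j by auto
      have "proj (n i) j \<bullet> pr (n i) ?N (pos n i) \<bullet> par ?N (cop n q) (cop n c) =
          proj ?N (pos n i j) \<bullet> par ?N (cop n q) (cop n c)"
        using proj_comp_comp[OF e1 p2 j] proj_pr[OF pos_Pi[OF i, of n] j] by simp
      also have "\<dots> = c i j \<bullet> pr (q i j) ?M (pos (cop n q) (pos n i j))"
        using proj_par[of ?N "cop n c" "cop n q" "pos n i j", OF cc pj] qj M by simp
      also have "pr (q i j) ?M (pos (cop n q) (pos n i j)) =
          pr (q i j) (?Q i) (pos (q i) j) \<bullet> pr (?Q i) ?M (pos ?Q i)"
        unfolding pr_pr[OF pos_Pi[OF j, of "q i"] pos_Pi[OF i, of ?Q]] by (rule pr_cong) (use i j in \<open>simp add: pos_pos\<close>)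
      also have "c i j \<bullet> \<dots> = (c i j \<bullet> pr (q i j) (?Q i) (pos (q i) j)) \<bullet> pr (?Q i) ?M (pos ?Q i)"
        by (rule comp_assoc[OF e2 pr_hom[OF pos_Pi[OF j, of "q i"]] c[OF i j], symmetric])
      also have "\<dots> = proj (n i) j \<bullet> par (n i) (q i) (c i) \<bullet> pr (?Q i) ?M (pos ?Q i)"
        using proj_par[of "n i" "c i" "q i", OF c[OF i] j] proj_comp_comp[OF ch[OF i] e2 j] by simp
      finally show "proj (n i) j \<bullet> pr (n i) ?N (pos n i) \<bullet> par ?N (cop n q) (cop n c) =
          proj (n i) j \<bullet> par (n i) (q i) (c i) \<bullet> pr (?Q i) ?M (pos ?Q i)" .
    qed
    have "proj k i \<bullet> par k n b \<bullet> par ?N (cop n q) (cop n c) =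
        (b i \<bullet> pr (n i) ?N (pos n i)) \<bullet> par ?N (cop n q) (cop n c)"
      using proj_comp_comp[OF p1 p2 i] proj_par[of k b n, OF b i] by simp
    also have "\<dots> = b i \<bullet> pr (n i) ?N (pos n i) \<bullet> par ?N (cop n q) (cop n c)"
      by (rule comp_assoc[OF p2 e1 b[OF i]])
    also have "\<dots> = (b i \<bullet> par (n i) (q i) (c i)) \<bullet> pr (?Q i) ?M (pos ?Q i)"
      unfolding inner by (rule comp_assoc[OF e2 ch[OF i] b[OF i], symmetric])
    also have "\<dots> = proj k i \<bullet> par k ?Q (\<lambda>i. b i \<bullet> par (n i) (q i) (c i))"
      by (rule proj_par[symmetric, OF bc i])
    finally show "proj k i \<bullet> par k n b \<bullet> par ?N (cop n q) (cop n c) =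
        proj k i \<bullet> par k ?Q (\<lambda>i. b i \<bullet> par (n i) (q i) (c i))" .
  qed
qed

lemma par_single:
  assumes "f 1 \<in> hom (n 1) 1"
  shows "par 1 n f = f 1"
proof -
  have S: "(\<Sum>i=1..1. n i) = n 1" by simp
  have f: "\<And>i. i \<in> {1..1} \<Longrightarrow> f i \<in> hom (n i) 1" using assms by auto
  have p: "par 1 n f \<in> hom (n 1) 1" using par_hom[of 1 f n, OF f] S by simp
  have "par 1 n f = proj 1 1 \<bullet> par 1 n f" using one_comp[OF p] by (simp add: proj_one)
  also have "\<dots> = f 1 \<bullet> pr (n 1) (n 1) (pos n 1)" using proj_par[of 1 f n 1, OF f] S by simp
  also have "pr (n 1) (n 1) (pos n 1) = one (n 1)" by (rule pr_ident) (rule pos_first)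
  finally show ?thesis using comp_one[OF assms] by simp
qed

lemma par_units: "par n (\<lambda>_. 1) (\<lambda>_. one 1) = one n"
proof -
  have S: "(\<Sum>i=1..n. 1) = n" by simp
  have f: "\<And>i. i \<in> {1..n} \<Longrightarrow> one 1 \<in> hom 1 1" by (simp add: one_hom)
  show ?thesis
  proof (rule hom_eqI)
    show "par n (\<lambda>_. 1) (\<lambda>_. one 1) \<in> hom n n" using par_hom[of n "\<lambda>_. one 1" "\<lambda>_. 1", OF f] S by simp
    show "one n \<in> hom n n" by (simp add: one_hom)
    fix i assume i: "i \<in> {1..n}"
    have "proj n i \<bullet> par n (\<lambda>_. 1) (\<lambda>_. one 1) = one 1 \<bullet> pr 1 n (pos (\<lambda>_. 1) i)"
      using proj_par[of n "\<lambda>_. one 1" "\<lambda>_. 1" i, OF f i] S by simp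
    also have "pr 1 n (pos (\<lambda>_. 1) i) = proj n i"
      unfolding proj_eq_pr[OF i] by (rule pr_cong) (use i in \<open>auto simp: pos_def\<close>)
    finally show "proj n i \<bullet> par n (\<lambda>_. 1) (\<lambda>_. one 1) = proj n i \<bullet> one n"
      using one_comp[OF proj_hom[OF i]] comp_one[OF proj_hom[OF i]] by simp
  qed
qed

text \<open>Equivariance inside the theory: moving \<phi> and the reindexings \<psi> past a product
  of arrows yields exactly the reindexing that \<open>star\<close> describes.\<close>

lemma pr_par:
  assumes \<phi>: "\<phi> \<in> {1..n} \<rightarrow> {1..m}" and b: "\<And>i. i \<in> {1..m} \<Longrightarrow> b i \<in> hom (k i) 1"
    and \<psi>: "\<And>i. i \<in> {1..m} \<Longrightarrow> \<psi> i \<in> {1..k i} \<rightarrow> {1..l i}"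
  shows "pr n m \<phi> \<bullet> par m l (\<lambda>i. b i \<bullet> pr (k i) (l i) (\<psi> i)) =
    par n (\<lambda>j. k (\<phi> j)) (\<lambda>j. b (\<phi> j)) \<bullet> pr (\<Sum>j=1..n. k (\<phi> j)) (\<Sum>i=1..m. l i)
      (cop (\<lambda>j. k (\<phi> j)) (\<lambda>j x. pos l (\<phi> j) (\<psi> (\<phi> j) x)))" (is "_ = ?p \<bullet> ?s")
proof -
  let ?K = "\<Sum>j=1..n. k (\<phi> j)" and ?L = "\<Sum>i=1..m. l i"
  let ?t = "cop (\<lambda>j. k (\<phi> j)) (\<lambda>j x. pos l (\<phi> j) (\<psi> (\<phi> j) x))"
  have \<phi>': "\<And>j. j \<in> {1..n} \<Longrightarrow> \<phi> j \<in> {1..m}" using \<phi> by blast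
  have bp: "b i \<bullet> pr (k i) (l i) (\<psi> i) \<in> hom (l i) 1" if "i \<in> {1..m}" for i
    by (rule comp_hom[OF pr_hom[OF \<psi>[OF that]] b[OF that]])
  have tPi: "?t \<in> {1..?K} \<rightarrow> {1..?L}"
  proof (rule Pi_I)
    fix p assume "p \<in> {1..?K}"
    then obtain j x where jx: "j \<in> {1..n}" "x \<in> {1..k (\<phi> j)}" "p = pos (\<lambda>j. k (\<phi> j)) j x"
      by (rule pos_cases)
    then have "?t p = pos l (\<phi> j) (\<psi> (\<phi> j) x)" by simp
    also have "\<dots> \<in> {1..?L}" using pos_mem[OF \<phi>'[OF jx(1)]] \<psi>[OF \<phi>'[OF jx(1)]] jx(2) by blast
    finally show "?t p \<in> {1..?L}" .
  qed
  have s: "?s \<in> hom ?L ?K" by (rule pr_hom[OF tPi])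
  have bh: "\<And>j. j \<in> {1..n} \<Longrightarrow> b (\<phi> j) \<in> hom (k (\<phi> j)) 1" using b \<phi>' by blast
  have p: "?p \<in> hom ?K n" by (rule par_hom) (rule bh)
  have r: "par m l (\<lambda>i. b i \<bullet> pr (k i) (l i) (\<psi> i)) \<in> hom ?L m" by (rule par_hom) (rule bp)
  show ?thesis
  proof (rule hom_eqI[OF comp_hom[OF r pr_hom[OF \<phi>]] comp_hom[OF s p]])
    fix j assume j: "j \<in> {1..n}"
    note P1 = pr_hom[OF pos_Pi[OF \<phi>'[OF j], of l]]
    note P2 = pr_hom[OF pos_Pi[OF j, of "\<lambda>j. k (\<phi> j)"]]
    have "proj n j \<bullet> pr n m \<phi> \<bullet> par m l (\<lambda>i. b i \<bullet> pr (k i) (l i) (\<psi> i)) =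
        proj m (\<phi> j) \<bullet> par m l (\<lambda>i. b i \<bullet> pr (k i) (l i) (\<psi> i))"
      using proj_comp_comp[OF pr_hom[OF \<phi>] r j] proj_pr[OF \<phi> j] by simp
    also have "\<dots> = (b (\<phi> j) \<bullet> pr (k (\<phi> j)) (l (\<phi> j)) (\<psi> (\<phi> j))) \<bullet> pr (l (\<phi> j)) ?L (pos l (\<phi> j))"
      by (rule proj_par[OF bp \<phi>'[OF j]])
    also have "\<dots> = b (\<phi> j) \<bullet> pr (k (\<phi> j)) (l (\<phi> j)) (\<psi> (\<phi> j)) \<bullet> pr (l (\<phi> j)) ?L (pos l (\<phi> j))"
      by (rule comp_assoc[OF P1 pr_hom[OF \<psi>[OF \<phi>'[OF j]]] bh[OF j]])
    also have "pr (k (\<phi> j)) (l (\<phi> j)) (\<psi> (\<phi> j)) \<bullet> pr (l (\<phi> j)) ?L (pos l (\<phi> j)) =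
        pr (k (\<phi> j)) ?K (pos (\<lambda>j. k (\<phi> j)) j) \<bullet> ?s"
      unfolding pr_pr[OF \<psi>[OF \<phi>'[OF j]] pos_Pi[OF \<phi>'[OF j], of l]]
        pr_pr[OF pos_Pi[OF j, of "\<lambda>j. k (\<phi> j)"] tPi]
      by (rule pr_cong) (use j in auto)
    also have "b (\<phi> j) \<bullet> \<dots> = (b (\<phi> j) \<bullet> pr (k (\<phi> j)) ?K (pos (\<lambda>j. k (\<phi> j)) j)) \<bullet> ?s"
      by (rule comp_assoc[OF s P2 bh[OF j], symmetric])
    also have "\<dots> = proj n j \<bullet> ?p \<bullet> ?s"
      using proj_par[of n "\<lambda>j. b (\<phi> j)" "\<lambda>j. k (\<phi> j)" j, OF bh j] proj_comp_comp[OF p s j] by simp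
    finally show "proj n j \<bullet> pr n m \<phi> \<bullet> par m l (\<lambda>i. b i \<bullet> pr (k i) (l i) (\<psi> i)) = proj n j \<bullet> ?p \<bullet> ?s" .
  qed
qed

text \<open>
  The diagonal is read off from \<open>v\<close> along a section of \<open>\<phi>\<close>; as \<open>\<pi>\<^sub>\<psi>\<close> is right cancellable, the
  choice of the section does not matter.
\<close>

lemma pr_surj_orthogonal:
  assumes \<phi>: "\<phi> ` {1..n} = {1..m}" and \<psi>: "\<psi> \<in> {1..b} \<rightarrow> {1..a}" "inj_on \<psi> {1..b}"
  shows "orthogonal T (pr b a \<psi>) (pr n m \<phi>)"
proof -
  have \<phi>P: "\<phi> \<in> {1..n} \<rightarrow> {1..m}" using \<phi> by blast
  note r = pr_hom[OF \<phi>P] and p = pr_hom[OF \<psi>(1)]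
  have "\<exists>!d. d \<in> hom b m \<and> d \<bullet> pr b a \<psi> = u \<and> pr n m \<phi> \<bullet> d = v"
    if u: "u \<in> hom a m" and v: "v \<in> hom b n" and eq: "pr n m \<phi> \<bullet> u = v \<bullet> pr b a \<psi>" for u v
  proof -
    have vj: "(proj n j \<bullet> v) \<bullet> pr b a \<psi> = proj m (\<phi> j) \<bullet> u" if j: "j \<in> {1..n}" for j
      using proj_comp_comp[OF v p j] proj_comp_comp[OF r u j] proj_pr[OF \<phi>P j] eq by simp
    define s where "s = inv_into {1..n} \<phi>"
    have s: "s i \<in> {1..n}" "\<phi> (s i) = i" if "i \<in> {1..m}" for i
      using that \<phi> inv_into_into[of i \<phi> "{1..n}"] f_inv_into_f[of i \<phi> "{1..n}"] by (auto simp: s_def)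
    let ?d = "tuple b m (\<lambda>i. proj n (s i) \<bullet> v)"
    have dh: "\<And>i. i \<in> {1..m} \<Longrightarrow> proj n (s i) \<bullet> v \<in> hom b 1" by (rule proj_comp_hom[OF v s(1)])
    have d: "?d \<in> hom b m" by (rule tuple_hom) (rule dh)
    have du: "?d \<bullet> pr b a \<psi> = u"
    proof (rule hom_eqI[OF comp_hom[OF p d] u])
      fix i assume i: "i \<in> {1..m}"
      have "proj m i \<bullet> ?d \<bullet> pr b a \<psi> = (proj n (s i) \<bullet> v) \<bullet> pr b a \<psi>"
        using proj_comp_comp[OF d p i] proj_tuple[of m "\<lambda>i. proj n (s i) \<bullet> v", OF dh i] by simp
      then show "proj m i \<bullet> ?d \<bullet> pr b a \<psi> = proj m i \<bullet> u" using vj[OF s(1)[OF i]] s(2)[OF i] by simp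
    qed
    have "(pr n m \<phi> \<bullet> ?d) \<bullet> pr b a \<psi> = v \<bullet> pr b a \<psi>"
      using comp_assoc[OF p d r] du eq by simp
    then have dv: "pr n m \<phi> \<bullet> ?d = v" by (rule pr_inj_epi[OF \<psi> comp_hom[OF d r] v])
    show ?thesis
      using d du dv pr_inj_epi[OF \<psi>] by (intro ex1I[of _ ?d]) auto
  qed
  then show ?thesis unfolding orthogonal_iff[OF p r] by blast
qed

text \<open>The factors of a product can be lifted separately: the block projections
  \<open>?e i\<close> turn a square for the product into squares for the factors, and the diagonals
  obtained are concatenated.\<close>

lemma par_orthogonal:
  assumes p: "p \<in> hom x y" and f: "\<And>i. i \<in> {1..k} \<Longrightarrow> f i \<in> hom (n i) 1"
    and orth: "\<And>i. i \<in> {1..k} \<Longrightarrow> orthogonal T p (f i)"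
  shows "orthogonal T p (par k n f)"
proof -
  let ?N = "\<Sum>i=1..k. n i" and ?e = "\<lambda>i. pr (n i) (\<Sum>i=1..k. n i) (pos n i)"
  have pf: "par k n f \<in> hom ?N k" by (rule par_hom) (rule f)
  have e: "?e i \<in> hom ?N (n i)" if "i \<in> {1..k}" for i by (rule pr_hom[OF pos_Pi[OF that]])
  have comp: "proj k i \<bullet> par k n f \<bullet> d = f i \<bullet> ?e i \<bullet> d" if i: "i \<in> {1..k}" and d: "d \<in> hom z ?N" for i d z
    using proj_comp_comp[OF pf d i] proj_par[of k f n, OF f i] comp_assoc[OF d e[OF i] f[OF i]] by simp
  have "\<exists>!d. d \<in> hom y ?N \<and> d \<bullet> p = u \<and> par k n f \<bullet> d = v"
    if u: "u \<in> hom x ?N" and v: "v \<in> hom y k" and eq: "par k n f \<bullet> u = v \<bullet> p" for u v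
  proof -
    have sq: "f i \<bullet> ?e i \<bullet> u = (proj k i \<bullet> v) \<bullet> p" if i: "i \<in> {1..k}" for i
      using comp[OF i u] proj_comp_comp[OF v p i] eq by simp
    have "\<exists>!d. d \<in> hom y (n i) \<and> d \<bullet> p = ?e i \<bullet> u \<and> f i \<bullet> d = proj k i \<bullet> v" if i: "i \<in> {1..k}" for i
      using orth[OF i] comp_hom[OF u e[OF i]] proj_comp_hom[OF v i] sq[OF i]
      unfolding orthogonal_iff[OF p f[OF i]] by blast
    then have ex: "\<forall>i\<in>{1..k}. \<exists>d. d \<in> hom y (n i) \<and> d \<bullet> p = ?e i \<bullet> u \<and> f i \<bullet> d = proj k i \<bullet> v"
      and uniq: "\<And>i d d'. i \<in> {1..k} \<Longrightarrow> d \<in> hom y (n i) \<Longrightarrow> d \<bullet> p = ?e i \<bullet> u \<Longrightarrow> f i \<bullet> d = proj k i \<bullet> v \<Longrightarrow>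
        d' \<in> hom y (n i) \<Longrightarrow> d' \<bullet> p = ?e i \<bullet> u \<Longrightarrow> f i \<bullet> d' = proj k i \<bullet> v \<Longrightarrow> d = d'"
      by blast+
    obtain D where D: "\<forall>i\<in>{1..k}. D i \<in> hom y (n i) \<and> D i \<bullet> p = ?e i \<bullet> u \<and> f i \<bullet> D i = proj k i \<bullet> v"
      using ex unfolding bchoice_iff by blast
    then have Dh: "\<And>i. i \<in> {1..k} \<Longrightarrow> D i \<in> hom y (n i)" by blast
    let ?c = "cop n (\<lambda>i j. proj (n i) j \<bullet> D i)"
    let ?d = "tuple y ?N ?c"
    have ch: "?c q \<in> hom y 1" if "q \<in> {1..?N}" for q
      using that
    proof (rule pos_cases)
      fix j z assume "j \<in> {1..k}" "z \<in> {1..n j}" "q = pos n j z"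
      then show ?thesis using proj_comp_hom[OF Dh[of j], of z] by simp
    qed
    have d: "?d \<in> hom y ?N" by (rule tuple_hom) (rule ch)
    have ed: "?e i \<bullet> ?d = D i" if i: "i \<in> {1..k}" for i
    proof -
      have "?e i \<bullet> ?d = tuple y (n i) (\<lambda>j. ?c (pos n i j))" by (rule pr_tuple[OF pos_Pi[OF i] ch])
      also have "\<dots> = tuple y (n i) (\<lambda>j. proj (n i) j \<bullet> D i)" using i by (intro tuple_cong) auto
      finally show ?thesis using tuple_proj[OF Dh[OF i]] by simp
    qed
    \<comment> \<open>The block projections are jointly monic, because each single projection
      factors through one of them.\<close>
    have eqI: "w = w'" if w: "w \<in> hom z ?N" "w' \<in> hom z ?N" and e': "\<And>i. i \<in> {1..k} \<Longrightarrow> ?e i \<bullet> w = ?e i \<bullet> w'"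
      for w w' z
    proof (rule hom_eqI[OF w])
      fix q assume "q \<in> {1..?N}"
      then obtain i j where ij: "i \<in> {1..k}" "j \<in> {1..n i}" "q = pos n i j" by (rule pos_cases)
      have "proj ?N q \<bullet> t = proj (n i) j \<bullet> ?e i \<bullet> t" if "t \<in> hom z ?N" for t
        using proj_comp_comp[OF e[OF ij(1)] that ij(2)] proj_pr[OF pos_Pi[OF ij(1), of n] ij(2)] ij(3) by simp
      with w e'[OF ij(1)] show "proj ?N q \<bullet> w = proj ?N q \<bullet> w'" by simp
    qed
    have "?d \<bullet> p = u"
    proof (rule eqI[OF comp_hom[OF p d] u])
      fix i assume i: "i \<in> {1..k}"
      have "?e i \<bullet> ?d \<bullet> p = (?e i \<bullet> ?d) \<bullet> p" by (rule comp_assoc[OF p d e[OF i], symmetric])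
      then show "?e i \<bullet> ?d \<bullet> p = ?e i \<bullet> u" unfolding ed[OF i] using D i by simp
    qed
    moreover have "par k n f \<bullet> ?d = v"
    proof (rule hom_eqI[OF comp_hom[OF d pf] v])
      fix i assume i: "i \<in> {1..k}"
      show "proj k i \<bullet> par k n f \<bullet> ?d = proj k i \<bullet> v" unfolding comp[OF i d] ed[OF i] using D i by blast
    qed
    moreover have "d' = ?d" if d': "d' \<in> hom y ?N" "d' \<bullet> p = u" "par k n f \<bullet> d' = v" for d'
    proof (rule eqI[OF d'(1) d])
      fix i assume i: "i \<in> {1..k}"
      show "?e i \<bullet> d' = ?e i \<bullet> ?d"
        unfolding ed[OF i]
      proof (rule uniq[OF i])
        show "?e i \<bullet> d' \<in> hom y (n i)" by (rule comp_hom[OF d'(1) e[OF i]])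
        show "(?e i \<bullet> d') \<bullet> p = ?e i \<bullet> u" using comp_assoc[OF p d'(1) e[OF i]] d'(2) by simp
        show "f i \<bullet> ?e i \<bullet> d' = proj k i \<bullet> v" using comp[OF i d'(1)] d'(3) by simp
      qed (use D i in auto)
    qed
    ultimately show ?thesis using d by (intro ex1I[of _ ?d]) blast+
  qed
  then show ?thesis unfolding orthogonal_iff[OF p pf] by blast
qed

end


section \<open>Consequences of simple automorphisms\<close>

locale regular_law = law T for T :: "'m lawvere" +
  assumes regular: "regular_lawvere_theory T"
begin

notation comp (infixr "\<bullet>" 70)

text \<open>If the two projections coincided, the identity and the transposition
  \<open>3 - i\<close> of two variables would give the same automorphism, against the injectivity in
  \<open>simple_automorphisms\<close>.\<close>

lemma proj_distinct: "proj 2 1 \<noteq> proj 2 2"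
proof
  assume eq: "proj 2 1 = proj 2 2"
  have range: "{1..2} = {1, 2::nat}" by auto
  let ?\<sigma> = "\<lambda>i\<in>{1..2::nat}. 3 - i" and ?a = "\<lambda>i\<in>{1..2::nat}. one 1"
  have S: "idf 2 \<in> Sym 2" "?\<sigma> \<in> Sym 2"
    unfolding Sym_def Fun_def range by (auto simp: bij_betw_def)
  have "pr 2 2 (idf 2) = pr 2 2 ?\<sigma>"
    unfolding pr_def by (rule tuple_cong) (use eq in \<open>auto simp: range simp flip: One_nat_def\<close>)
  then have eq': "pi_arrow T 2 2 (idf 2) = pi_arrow T 2 2 ?\<sigma>"
    using pi_arrow_eq_pr[of "idf 2" 2 2] pi_arrow_eq_pr[of ?\<sigma> 2 2] S by (simp add: Sym_def)
  have inj: "inj_on (\<lambda>(\<sigma>, a). power_arrow T 2 a \<bullet> pi_arrow T 2 2 \<sigma>) (Sym 2 \<times> ({1..2} \<rightarrow>\<^sub>E Iso T 1 1))"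
    using regular unfolding regular_lawvere_theory_def simple_automorphisms_def bij_betw_def by blast
  have "?a \<in> {1..2} \<rightarrow>\<^sub>E Iso T 1 1" by (simp add: Iso_one)
  then have "(idf 2, ?a) = (?\<sigma>, ?a)"
    using S eq' by (intro inj_onD[OF inj]) auto
  then have "idf 2 1 = ?\<sigma> 1" by (metis prod.inject)
  then show False by simp
qed

text \<open>Two substitutions into two variables: \<open>?\<rho>\<close> sends \<open>i\<close> to
  the second and all others to the first, \<open>?\<rho>'\<close> sends everything to the first. If
  \<phi> misses \<open>i\<close>, the right-hand side cannot distinguish them, so the two
  projections of \<open>2\<close> agree after the invertible \<open>a\<close>, hence agree.\<close>

lemma proj_independent:
  assumes i: "i \<in> {1..n}" and \<phi>: "\<phi> \<in> {1..m} \<rightarrow> {1..n}" and w: "w \<in> hom m 1" and a: "a \<in> Iso T 1 1"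
    and eq: "a \<bullet> proj n i = w \<bullet> pr m n \<phi>"
  shows "i \<in> \<phi> ` {1..m}"
proof (rule ccontr)
  assume ni: "i \<notin> \<phi> ` {1..m}"
  let ?\<rho> = "\<lambda>j. if j = i then 2 else 1 :: nat" and ?\<rho>' = "\<lambda>_. 1 :: nat"
  have P: "?\<rho> \<in> {1..n} \<rightarrow> {1..2}" "?\<rho>' \<in> {1..n} \<rightarrow> {1..2}" by auto
  have "pr m n \<phi> \<bullet> pr n 2 ?\<rho> = pr m n \<phi> \<bullet> pr n 2 ?\<rho>'"
    unfolding pr_pr[OF \<phi> P(1)] pr_pr[OF \<phi> P(2)] by (rule pr_cong) (use ni in auto)
  then have "(a \<bullet> proj n i) \<bullet> pr n 2 ?\<rho> = (a \<bullet> proj n i) \<bullet> pr n 2 ?\<rho>'"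
    unfolding eq comp_assoc[OF pr_hom[OF P(1)] pr_hom[OF \<phi>] w] comp_assoc[OF pr_hom[OF P(2)] pr_hom[OF \<phi>] w]
    by simp
  then have aa: "a \<bullet> proj 2 2 = a \<bullet> proj 2 1"
    unfolding comp_assoc[OF pr_hom[OF P(1)] proj_hom[OF i] Iso_hom[OF a]]
      comp_assoc[OF pr_hom[OF P(2)] proj_hom[OF i] Iso_hom[OF a]] proj_pr[OF P(1) i] proj_pr[OF P(2) i] by simp
  obtain b where b: "b \<in> Iso T 1 1" "b \<bullet> a = one 1" using a by (auto elim: Iso_inverse)
  have "b \<bullet> a \<bullet> proj 2 j = proj 2 j" if "j \<in> {1..2}" for j
    using comp_assoc[OF proj_hom[OF that] Iso_hom[OF a] Iso_hom[OF b(1)]] b(2) one_comp[OF proj_hom[OF that]] by simp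
  from this[of 1] this[of 2] show False using aa proj_distinct by simp
qed

text \<open>The surjectivity in \<open>simple_automorphisms\<close>, component by component.\<close>

lemma automorphism_components:
  assumes s: "s \<in> Iso T n n"
  shows "\<exists>\<kappa> a. bij_betw \<kappa> {1..n} {1..n} \<and>
    (\<forall>i\<in>{1..n}. a i \<in> Iso T 1 1 \<and> proj n i \<bullet> s = a i \<bullet> proj n (\<kappa> i))"
proof -
  have "s \<in> (\<lambda>(\<sigma>, a). power_arrow T n a \<bullet> pi_arrow T n n \<sigma>) ` (Sym n \<times> ({1..n} \<rightarrow>\<^sub>E Iso T 1 1))"
    using regular s unfolding regular_lawvere_theory_def simple_automorphisms_def bij_betw_def by blast
  then obtain \<sigma> a where \<sigma>: "\<sigma> \<in> Sym n" and a: "a \<in> {1..n} \<rightarrow>\<^sub>E Iso T 1 1"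
    and s: "s = power_arrow T n a \<bullet> pi_arrow T n n \<sigma>" by auto
  have aI: "\<And>i. i \<in> {1..n} \<Longrightarrow> a i \<in> Iso T 1 1" using a by auto
  have a': "\<And>i. i \<in> {1..n} \<Longrightarrow> a i \<in> hom 1 1" by (rule Iso_hom[OF aI])
  have F: "\<sigma> \<in> Fun n n" and b: "bij_betw \<sigma> {1..n} {1..n}" and Pi: "\<sigma> \<in> {1..n} \<rightarrow> {1..n}"
    using \<sigma> by (auto simp: Sym_def Fun_def)
  have "s = power n a \<bullet> pr n n \<sigma>"
    unfolding s using power_arrow_eq[of n a, OF a'] pi_arrow_eq_pr[OF F] by simp
  then have "proj n i \<bullet> s = a i \<bullet> proj n (\<sigma> i)" if i: "i \<in> {1..n}" for i
    using proj_power_comp[of n a, OF a' pr_hom[OF Pi] i] proj_pr[OF Pi i] by simp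
  then show ?thesis using b aI by blast
qed

text \<open>For inverse isomorphisms \<open>s : n \<rightarrow> m\<close> and \<open>t : m \<rightarrow> n\<close> this is the automorphism \<open>s \<times> t\<close> of \<open>n + m\<close>.\<close>

definition cross :: "nat \<Rightarrow> nat \<Rightarrow> 'm \<Rightarrow> 'm \<Rightarrow> 'm" where
  "cross n m s t = tuple (n + m) (n + m) (\<lambda>i. if i \<le> m then (proj m i \<bullet> s) \<bullet> pr n (n + m) (\<lambda>j. j)
     else (proj n (i - m) \<bullet> t) \<bullet> pr m (n + m) (\<lambda>j. n + j))"

lemma cross_facts:
  assumes s: "s \<in> hom n m" and t: "t \<in> hom m n"
  shows "cross n m s t \<in> hom (n + m) (n + m)"
    and "\<And>i. i \<in> {1..m} \<Longrightarrow> proj (n + m) i \<bullet> cross n m s t = (proj m i \<bullet> s) \<bullet> pr n (n + m) (\<lambda>j. j)"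
    and "pr m (m + n) (\<lambda>j. j) \<bullet> cross n m s t = s \<bullet> pr n (n + m) (\<lambda>j. j)"
    and "pr n (m + n) (\<lambda>j. m + j) \<bullet> cross n m s t = t \<bullet> pr m (n + m) (\<lambda>j. n + j)"
proof -
  let ?f = "\<lambda>i. if i \<le> m then (proj m i \<bullet> s) \<bullet> pr n (n + m) (\<lambda>j. j)
     else (proj n (i - m) \<bullet> t) \<bullet> pr m (n + m) (\<lambda>j. n + j)"
  have P: "(\<lambda>j. j) \<in> {1..n} \<rightarrow> {1..n + m}" "(\<lambda>j. n + j) \<in> {1..m} \<rightarrow> {1..n + m}" by auto
  have Q: "(\<lambda>j. j) \<in> {1..m} \<rightarrow> {1..m + n}" "(\<lambda>j. m + j) \<in> {1..n} \<rightarrow> {1..m + n}" by auto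
  have f: "?f i \<in> hom (n + m) 1" if i: "i \<in> {1..n + m}" for i
  proof (cases "i \<le> m")
    case True
    with i have im: "i \<in> {1..m}" by auto
    show ?thesis using True comp_hom[OF pr_hom[OF P(1)] proj_comp_hom[OF s im]] by simp
  next
    case False
    with i have im: "i - m \<in> {1..n}" by auto
    show ?thesis using False comp_hom[OF pr_hom[OF P(2)] proj_comp_hom[OF t im]] by simp
  qed
  show c: "cross n m s t \<in> hom (n + m) (n + m)" unfolding cross_def by (rule tuple_hom) (rule f)
  have pc: "proj (n + m) i \<bullet> cross n m s t = ?f i" if "i \<in> {1..n + m}" for i
    unfolding cross_def by (rule proj_tuple[OF f that])
  show "\<And>i. i \<in> {1..m} \<Longrightarrow> proj (n + m) i \<bullet> cross n m s t = (proj m i \<bullet> s) \<bullet> pr n (n + m) (\<lambda>j. j)"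
    using pc by simp
  \<comment> \<open>In the target the \<open>m\<close> components of \<open>s\<close> come before
    those of \<open>t\<close>, so it is read as \<open>m + n\<close>.\<close>
  have c': "cross n m s t \<in> hom (n + m) (m + n)" using c by (simp add: add.commute)
  show "pr m (m + n) (\<lambda>j. j) \<bullet> cross n m s t = s \<bullet> pr n (n + m) (\<lambda>j. j)"
  proof (rule hom_eqI[OF comp_hom[OF c' pr_hom[OF Q(1)]] comp_hom[OF pr_hom[OF P(1)] s]])
    fix i assume i: "i \<in> {1..m}"
    show "proj m i \<bullet> pr m (m + n) (\<lambda>j. j) \<bullet> cross n m s t = proj m i \<bullet> s \<bullet> pr n (n + m) (\<lambda>j. j)"
      using proj_comp_comp[OF pr_hom[OF Q(1)] c' i] proj_pr[OF Q(1) i] pc[of i] i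
        proj_comp_comp[OF s pr_hom[OF P(1)] i] by (simp add: add.commute)
  qed
  show "pr n (m + n) (\<lambda>j. m + j) \<bullet> cross n m s t = t \<bullet> pr m (n + m) (\<lambda>j. n + j)"
  proof (rule hom_eqI[OF comp_hom[OF c' pr_hom[OF Q(2)]] comp_hom[OF pr_hom[OF P(2)] t]])
    fix i assume i: "i \<in> {1..n}"
    show "proj n i \<bullet> pr n (m + n) (\<lambda>j. m + j) \<bullet> cross n m s t = proj n i \<bullet> t \<bullet> pr m (n + m) (\<lambda>j. n + j)"
    proof -
      have "proj (n + m) (m + i) \<bullet> cross n m s t = (proj n i \<bullet> t) \<bullet> pr m (n + m) (\<lambda>j. n + j)"
        using pc[of "m + i"] i by simp
      then show ?thesis
        using proj_comp_comp[OF pr_hom[OF Q(2)] c' i] proj_pr[OF Q(2) i] proj_comp_comp[OF t pr_hom[OF P(2)] i]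
        unfolding add.commute[of m n] by simp
    qed
  qed
qed

text \<open>Checked after the projections to the two blocks, where the composite reduces to
  \<open>t \<bullet> s\<close> and \<open>s \<bullet> t\<close>.\<close>

lemma cross_inverse:
  assumes s: "s \<in> hom n m" and t: "t \<in> hom m n" and ts: "t \<bullet> s = one n" and st: "s \<bullet> t = one m"
  shows "cross m n t s \<bullet> cross n m s t = one (n + m)"
proof -
  let ?c = "cross n m s t" and ?c' = "cross m n t s"
  have P: "(\<lambda>j. j) \<in> {1..n} \<rightarrow> {1..n + m}" "(\<lambda>j. n + j) \<in> {1..m} \<rightarrow> {1..n + m}" by auto
  have Q: "(\<lambda>j. j) \<in> {1..m} \<rightarrow> {1..m + n}" "(\<lambda>j. m + j) \<in> {1..n} \<rightarrow> {1..m + n}" by auto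
  have c: "?c \<in> hom (n + m) (m + n)" and c': "?c' \<in> hom (m + n) (n + m)"
    using cross_facts(1)[OF s t] cross_facts(1)[OF t s] by (simp_all add: add.commute)
  have cc: "?c' \<bullet> ?c \<in> hom (n + m) (n + m)" by (rule comp_hom[OF c c'])
  note p1 = pr_hom[OF P(1)] and p2 = pr_hom[OF P(2)] and q1 = pr_hom[OF Q(1)] and q2 = pr_hom[OF Q(2)]
  have "pr n (n + m) (\<lambda>j. j) \<bullet> ?c' \<bullet> ?c = (pr n (n + m) (\<lambda>j. j) \<bullet> ?c') \<bullet> ?c"
    by (rule comp_assoc[OF c c' p1, symmetric])
  also have "\<dots> = (t \<bullet> pr m (m + n) (\<lambda>j. j)) \<bullet> ?c" unfolding cross_facts(3)[OF t s] ..
  also have "\<dots> = t \<bullet> s \<bullet> pr n (n + m) (\<lambda>j. j)"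
    unfolding comp_assoc[OF c q1 t] cross_facts(3)[OF s t] ..
  also have "\<dots> = pr n (n + m) (\<lambda>j. j)"
    using comp_assoc[OF p1 s t] ts one_comp[OF p1] by simp
  finally have 1: "pr n (n + m) (\<lambda>j. j) \<bullet> ?c' \<bullet> ?c = pr n (n + m) (\<lambda>j. j)" .
  have "pr m (n + m) (\<lambda>j. n + j) \<bullet> ?c' \<bullet> ?c = (pr m (n + m) (\<lambda>j. n + j) \<bullet> ?c') \<bullet> ?c"
    by (rule comp_assoc[OF c c' p2, symmetric])
  also have "\<dots> = (s \<bullet> pr n (m + n) (\<lambda>j. m + j)) \<bullet> ?c" unfolding cross_facts(4)[OF t s] ..
  also have "\<dots> = s \<bullet> t \<bullet> pr m (n + m) (\<lambda>j. n + j)"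
    unfolding comp_assoc[OF c q2 s] cross_facts(4)[OF s t] ..
  also have "\<dots> = pr m (n + m) (\<lambda>j. n + j)"
    using comp_assoc[OF p2 t s] st one_comp[OF p2] by simp
  finally have 2: "pr m (n + m) (\<lambda>j. n + j) \<bullet> ?c' \<bullet> ?c = pr m (n + m) (\<lambda>j. n + j)" .
  show ?thesis
  proof (rule hom_eqI[OF cc])
    show "one (n + m) \<in> hom (n + m) (n + m)" by (simp add: one_hom)
    fix i assume i: "i \<in> {1..n + m}"
    have "proj (n + m) i \<bullet> ?c' \<bullet> ?c = proj (n + m) i"
    proof (cases "i \<le> n")
      case True
      with i have j: "i \<in> {1..n}" by auto
      show ?thesis using 1 proj_comp_comp[OF p1 cc j] proj_pr[OF P(1) j] by simp
    next
      case False
      with i have j: "i - n \<in> {1..m}" and "n + (i - n) = i" by auto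
      then show ?thesis using 2 proj_comp_comp[OF p2 cc j] proj_pr[OF P(2) j] by simp
    qed
    then show "proj (n + m) i \<bullet> ?c' \<bullet> ?c = proj (n + m) i \<bullet> one (n + m)"
      using comp_one[OF proj_hom[OF i]] by simp
  qed
qed

text \<open>Each component of the automorphism \<open>s \<times> t\<close> is an automorphism of
  \<open>1\<close> applied to a variable \<open>\<kappa> i\<close>. The first \<open>m\<close>
  components are those of \<open>s\<close> and involve only the first \<open>n\<close> variables, so
  by \<open>proj_independent\<close> the injective \<kappa> maps \<open>{1..m}\<close> into
  \<open>{1..n}\<close>.\<close>

lemma Iso_le:
  assumes s: "s \<in> Iso T n m"
  shows "m \<le> n"
proof -
  obtain t where t: "t \<in> Iso T m n" "t \<bullet> s = one n" "s \<bullet> t = one m" using s by (rule Iso_inverse)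
  have sh: "s \<in> hom n m" and th: "t \<in> hom m n" using s t by (auto dest: Iso_hom)
  have "cross n m s t \<in> Iso T (n + m) (n + m)"
  proof (rule IsoI)
    show "cross n m s t \<in> hom (n + m) (n + m)" by (rule cross_facts(1)[OF sh th])
    show "cross m n t s \<in> hom (n + m) (n + m)" using cross_facts(1)[OF th sh] by (simp add: add.commute)
    show "cross m n t s \<bullet> cross n m s t = one (n + m)" by (rule cross_inverse[OF sh th t(2,3)])
    show "cross n m s t \<bullet> cross m n t s = one (n + m)"
      using cross_inverse[OF th sh t(3,2)] by (simp add: add.commute)
  qed
  then obtain \<kappa> a where \<kappa>: "bij_betw \<kappa> {1..n + m} {1..n + m}" and
    a: "\<forall>i\<in>{1..n + m}. a i \<in> Iso T 1 1 \<and> proj (n + m) i \<bullet> cross n m s t = a i \<bullet> proj (n + m) (\<kappa> i)"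
    using automorphism_components by blast
  have P: "(\<lambda>j. j) \<in> {1..n} \<rightarrow> {1..n + m}" by auto
  have "\<kappa> i \<in> {1..n}" if i: "i \<in> {1..m}" for i
  proof -
    have i': "i \<in> {1..n + m}" using i by auto
    have "\<kappa> i \<in> (\<lambda>j. j) ` {1..n}"
    proof (rule proj_independent[OF _ P proj_comp_hom[OF sh i]])
      show "\<kappa> i \<in> {1..n + m}" using bij_betwE[OF \<kappa>] i' by blast
      show "a i \<in> Iso T 1 1" using a i' by blast
      show "a i \<bullet> proj (n + m) (\<kappa> i) = (proj m i \<bullet> s) \<bullet> pr n (n + m) (\<lambda>j. j)"
        using a i' cross_facts(2)[OF sh th i] by simp
    qed
    then show ?thesis by simp
  qed
  then have "\<kappa> ` {1..m} \<subseteq> {1..n}" by blast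
  moreover have "inj_on \<kappa> {1..m}" by (rule inj_on_subset[OF bij_betw_imp_inj_on[OF \<kappa>]]) auto
  ultimately show "m \<le> n" using card_inj_on_le[of \<kappa> "{1..m}" "{1..n}"] by simp
qed

lemma Iso_eq: "s \<in> Iso T n m \<Longrightarrow> n = m"
  using Iso_le Iso_inverse by (metis le_antisym)

section \<open>Unique decomposition of the arrows into \<open>1\<close>\<close>

lemma projection_regular_system: "factorization_system T (projection_arrows T) (regular_arrows T)"
  using regular by (simp add: regular_lawvere_theory_def)

lemma regular_comp:
  assumes "r \<in> regular_arrows T" "r \<in> hom a b" "r' \<in> regular_arrows T" "r' \<in> hom b c"
  shows "r' \<bullet> r \<in> regular_arrows T"
  using projection_regular_system assms homD[OF assms(2)] homD[OF assms(4)] unfolding factorization_system_def by metis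

lemma regular_Iso: "s \<in> Iso T n m \<Longrightarrow> s \<in> regular_arrows T"
  using projection_regular_system unfolding factorization_system_def Iso_def by blast

lemma regular_pr:
  assumes \<phi>: "\<phi> ` {1..n} = {1..m}"
  shows "pr n m \<phi> \<in> regular_arrows T"
proof -
  have "\<phi> \<in> {1..n} \<rightarrow> {1..m}" using \<phi> by blast
  note p = pr_hom[OF this]
  show ?thesis unfolding regular_arrows_def
    using homD[OF p] orthogonal_projection_arrow[OF _ p pr_surj_orthogonal[OF \<phi>]] by blast
qed

lemma regular_par:
  assumes f: "\<And>i. i \<in> {1..k} \<Longrightarrow> f i \<in> regular_arrows T" "\<And>i. i \<in> {1..k} \<Longrightarrow> f i \<in> hom (n i) 1"
  shows "par k n f \<in> regular_arrows T"
proof -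
  have "orthogonal T p (par k n f)" if p: "p \<in> projection_arrows T" for p
  proof (rule par_orthogonal)
    show "p \<in> hom (Dom T p) (Cod T p)" using p arr_hom by (auto simp: projection_arrows_def)
    show "\<And>i. i \<in> {1..k} \<Longrightarrow> orthogonal T p (f i)" using f(1) p by (auto simp: regular_arrows_def)
  qed (rule f(2))
  then show ?thesis using homD[OF par_hom[of k f n, OF f(2)]] by (auto simp: regular_arrows_def)
qed

text \<open>The factorization system gives \<open>f = r \<bullet> e\<close> with \<open>e\<close> an
  injective reindexing between isomorphisms \<open>x\<close> and \<open>y\<close>. By
  \<open>Iso_eq\<close>, \<open>x\<close> is an automorphism: its permutation is merged into the
  reindexing, while its automorphisms of \<open>1\<close>, the reordering of variables and
  \<open>y\<close> are merged into the regular part.\<close>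

lemma regular_decomposition:
  assumes f: "f \<in> hom n 1"
  shows "\<exists>A r. A \<subseteq> {1..n} \<and> r \<in> regular_arrows T \<and> r \<in> hom (card A) 1 \<and> f = r \<bullet> pr (card A) n (enum A)"
proof -
  have "f \<in> Arr T" using homD[OF f] by blast
  then obtain e r where e: "e \<in> projection_arrows T" and r: "r \<in> regular_arrows T"
    and re: "Dom T r = Cod T e" "f = r \<bullet> e"
    using projection_regular_system unfolding factorization_system_def by blast
  have ra: "r \<in> Arr T" "e \<in> Arr T" using e r by (auto simp: projection_arrows_def regular_arrows_def)
  define k where "k = Cod T e"
  have rh: "r \<in> hom k 1" and eh: "e \<in> hom n k"
    using ra re homD[OF f] cod_comp[of e r] dom_comp[of e r] by (auto simp: Hom_def k_def)
  obtain m n' \<phi> x y where \<phi>: "\<phi> \<in> Inj m n'" and x: "x \<in> Iso T n n'" and y: "y \<in> Iso T m k"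
    and e: "e = y \<bullet> pi_arrow T m n' \<phi> \<bullet> x"
    using e homD[OF eh] unfolding projection_arrows_def by blast
  have n': "n' = n" using Iso_eq[OF x] by simp
  have F: "\<phi> \<in> Fun m n" "\<phi> \<in> {1..m} \<rightarrow> {1..n}" "inj_on \<phi> {1..m}"
    using \<phi> by (auto simp: Inj_def Fun_def n')
  obtain \<kappa> a where \<kappa>: "bij_betw \<kappa> {1..n} {1..n}"
    and a: "\<forall>i\<in>{1..n}. a i \<in> Iso T 1 1 \<and> proj n i \<bullet> x = a i \<bullet> proj n (\<kappa> i)"
    using automorphism_components x unfolding n' by blast
  let ?\<psi> = "\<lambda>j. \<kappa> (\<phi> j)"
  have \<psi>: "?\<psi> \<in> {1..m} \<rightarrow> {1..n}" using F(2) bij_betwE[OF \<kappa>] by blast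
  have \<psi>i: "inj_on ?\<psi> {1..m}"
  proof (rule inj_onI)
    fix i j assume ij: "i \<in> {1..m}" "j \<in> {1..m}" "\<kappa> (\<phi> i) = \<kappa> (\<phi> j)"
    have "\<phi> i = \<phi> j" using inj_onD[OF bij_betw_imp_inj_on[OF \<kappa>] ij(3)] F(2) ij by blast
    then show "i = j" using inj_onD[OF F(3)] ij by blast
  qed
  let ?A = "?\<psi> ` {1..m}"
  have cA: "card ?A = m" using card_image[OF \<psi>i] by simp
  have A: "?A \<subseteq> {1..n}" using \<psi> by blast
  \<comment> \<open>The reordering that turns the injection \<open>?\<psi>\<close> into the
    increasing enumeration of its image.\<close>
  let ?\<rho> = "\<lambda>j. rank ?A (?\<psi> j)"
  have \<rho>: "?\<rho> ` {1..m} = {1..m}"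
    using bij_betw_imp_surj_on[OF bij_betw_rank[of ?A]] cA by (simp add: image_image)
  have \<rho>b: "bij_betw ?\<rho> {1..m} {1..m}"
    using \<rho> by (simp add: bij_betw_def eq_card_imp_inj_on)
  have \<rho>P: "?\<rho> \<in> {1..m} \<rightarrow> {1..m}" using \<rho> by blast
  have E: "enum ?A \<in> {1..m} \<rightarrow> {1..n}"
  proof (rule Pi_I)
    fix i assume "i \<in> {1..m}"
    then have "enum ?A i \<in> ?A" using enum_mem[of ?A i] cA by simp
    then show "enum ?A i \<in> {1..n}" using A by blast
  qed
  have aI: "\<And>j. j \<in> {1..m} \<Longrightarrow> a (\<phi> j) \<in> Iso T 1 1" using a F(2) by blast
  have ah: "\<And>j. j \<in> {1..m} \<Longrightarrow> a (\<phi> j) \<in> hom 1 1" by (rule Iso_hom[OF aI])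
  let ?w = "power m (\<lambda>j. a (\<phi> j))"
  have w: "?w \<in> Iso T m m" by (rule power_Iso) (rule aI)
  have xh: "x \<in> hom n n" using Iso_hom[OF x] n' by simp
  \<comment> \<open>Moves the automorphisms of \<open>1\<close> contained in \<open>x\<close> to the
    other side of the reindexing.\<close>
  have "pr m n \<phi> \<bullet> x = ?w \<bullet> pr m n ?\<psi>"
  proof (rule hom_eqI[OF comp_hom[OF xh pr_hom[OF F(2)]] comp_hom[OF pr_hom[OF \<psi>] Iso_hom[OF w]]])
    fix i assume i: "i \<in> {1..m}"
    then have \<phi>i: "\<phi> i \<in> {1..n}" using F(2) by blast
    show "proj m i \<bullet> pr m n \<phi> \<bullet> x = proj m i \<bullet> ?w \<bullet> pr m n ?\<psi>"
      using proj_comp_comp[OF pr_hom[OF F(2)] xh i] proj_pr[OF F(2) i] a \<phi>i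
        proj_power_comp[of m "\<lambda>j. a (\<phi> j)", OF ah pr_hom[OF \<psi>] i] proj_pr[OF \<psi> i] by simp
  qed
  also have "pr m n ?\<psi> = pr m m ?\<rho> \<bullet> pr m n (enum ?A)"
    unfolding pr_pr[OF \<rho>P E] by (rule pr_cong) (simp add: enum_rank)
  finally have px: "pr m n \<phi> \<bullet> x = ?w \<bullet> pr m m ?\<rho> \<bullet> pr m n (enum ?A)" .
  let ?r = "r \<bullet> y \<bullet> ?w \<bullet> pr m m ?\<rho>"
  note h = pr_hom[OF E] pr_hom[OF \<rho>P] Iso_hom[OF w] Iso_hom[OF y] rh
  have "f = r \<bullet> y \<bullet> ?w \<bullet> pr m m ?\<rho> \<bullet> pr m n (enum ?A)"
    unfolding re e n' pi_arrow_eq_pr[OF F(1)] px ..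
  also have "\<dots> = ?r \<bullet> pr m n (enum ?A)"
    using h by (simp add: arrow_simps)
  finally have "f = ?r \<bullet> pr m n (enum ?A)" .
  moreover have "?r \<in> hom m 1" using h by (simp add: arrow_simps)
  moreover have "y \<bullet> ?w \<bullet> pr m m ?\<rho> \<in> Iso T m k"
    by (rule Iso_comp[OF Iso_comp[OF pr_Iso[OF \<rho>b] w] y])
  then have "?r \<in> regular_arrows T"
    using regular_comp[OF regular_Iso Iso_hom r rh] by blast
  ultimately show ?thesis using A cA by (intro exI[of _ ?A] exI[of _ ?r]) simp
qed

text \<open>Orthogonality of \<open>r'\<close> to the projection part of the other side yields
  \<open>d\<close> expressing the variables in \<open>A'\<close> through those in \<open>A\<close>;
  by \<open>proj_independent\<close> they belong to \<open>A\<close>.\<close>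

lemma regular_decomposition_subset:
  assumes A: "A \<subseteq> {1..n}" "A' \<subseteq> {1..n}" and r: "r \<in> hom (card A) 1" and r': "r' \<in> hom (card A') 1"
    and reg: "r' \<in> regular_arrows T"
    and eq: "r \<bullet> pr (card A) n (enum A) = r' \<bullet> pr (card A') n (enum A')"
  shows "A' \<subseteq> A"
proof -
  have fin: "finite A" "finite A'" using A finite_subset by blast+
  have E: "enum B \<in> {1..card B} \<rightarrow> {1..n}" if "B \<subseteq> {1..n}" "finite B" for B
    by (rule Pi_I) (rule subsetD[OF that(1) enum_mem[OF that(2)]])
  note EA = E[OF A(1) fin(1)] and EA' = E[OF A(2) fin(2)]
  have "pr (card A) n (enum A) \<in> projection_arrows T"
    by (rule pr_projection_arrow[OF EA bij_betw_imp_inj_on[OF bij_betw_enum[OF fin(1)]]])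
  then have "orthogonal T (pr (card A) n (enum A)) r'" using reg by (auto simp: regular_arrows_def)
  then obtain d where d: "d \<in> hom (card A) (card A')" "d \<bullet> pr (card A) n (enum A) = pr (card A') n (enum A')"
    using eq[symmetric] pr_hom[OF EA'] r unfolding orthogonal_iff[OF pr_hom[OF EA] r'] by blast
  have "enum A' i \<in> A" if i: "i \<in> {1..card A'}" for i
  proof -
    have Ei: "enum A' i \<in> {1..n}" using EA' i by blast
    have "one 1 \<bullet> proj n (enum A' i) = (proj (card A') i \<bullet> d) \<bullet> pr (card A) n (enum A)"
      using proj_comp_comp[OF d(1) pr_hom[OF EA] i] d(2) proj_pr[OF EA' i] one_comp[OF proj_hom[OF Ei]] by simp
    then have "enum A' i \<in> enum A ` {1..card A}"
      by (rule proj_independent[OF Ei EA proj_comp_hom[OF d(1) i] Iso_one, rotated]) simp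
    then show ?thesis unfolding enum_image[OF fin(1)] .
  qed
  then have "enum A' ` {1..card A'} \<subseteq> A" by blast
  then show ?thesis unfolding enum_image[OF fin(2)] .
qed

text \<open>The inclusion holds in both directions, so \<open>A = A'\<close>; then the common
  reindexing, an epimorphism, can be cancelled.\<close>

lemma regular_decomposition_unique:
  assumes A: "A \<subseteq> {1..n}" "A' \<subseteq> {1..n}" and r: "r \<in> hom (card A) 1" and r': "r' \<in> hom (card A') 1"
    and reg: "r \<in> regular_arrows T" "r' \<in> regular_arrows T"
    and eq: "r \<bullet> pr (card A) n (enum A) = r' \<bullet> pr (card A') n (enum A')"
  shows "A = A' \<and> r = r'"
proof -
  have AA: "A = A'"
    using regular_decomposition_subset[OF A r r' reg(2) eq]
      regular_decomposition_subset[OF A(2,1) r' r reg(1) eq[symmetric]] by blast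
  have fin: "finite A" using A finite_subset by blast
  have EA: "enum A \<in> {1..card A} \<rightarrow> {1..n}" by (rule Pi_I) (rule subsetD[OF A(1) enum_mem[OF fin]])
  have "r = r'"
    using pr_inj_epi[OF EA bij_betw_imp_inj_on[OF bij_betw_enum[OF fin]] r] r' eq AA by simp
  with AA show ?thesis by simp
qed

end


section \<open>The operad of regular operations\<close>

text \<open>The injection \<open>e\<close> renames arrows as elements of \<open>'a\<close>, the type
  in which the operations of the constructed operad live.\<close>

locale regular_operations = regular_law T for T :: "'m lawvere" +
  fixes e :: "'m \<Rightarrow> 'a"
  assumes e_inj: "inj_on e (Arr T)"
begin

notation comp (infixr "\<bullet>" 70)

definition dec :: "'a \<Rightarrow> 'm" where "dec = inv_into (Arr T) e"

text \<open>A surjection \<phi> acts by composition with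
  \<open>pr n m \<phi> : m \<rightarrow> n\<close>, that is, by identifying variables. List entries
  are counted from 0, hence \<open>i - 1\<close>.\<close>

definition reg_operad :: "'a regop" where
  "reg_operad = \<lparr>ops = \<lambda>n. e ` (regular_arrows T \<inter> hom n 1),
     op_unit = e (one 1),
     op_mult = \<lambda>ns bs a. e (dec a \<bullet> par (length ns) (\<lambda>i. ns ! (i - 1)) (\<lambda>i. dec (bs ! (i - 1)))),
     op_act = \<lambda>n m \<phi> a. e (dec a \<bullet> pr n m \<phi>)\<rparr>"

lemma dec_e: "f \<in> Arr T \<Longrightarrow> dec (e f) = f"
  unfolding dec_def by (rule inv_into_f_f[OF e_inj])

lemma ops_reg_operad: "a \<in> ops reg_operad n \<longleftrightarrow> (\<exists>f\<in>regular_arrows T. f \<in> hom n 1 \<and> a = e f)"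
  by (auto simp: reg_operad_def)

lemma dec_hom: "a \<in> ops reg_operad n \<Longrightarrow> dec a \<in> hom n 1"
  and dec_regular: "a \<in> ops reg_operad n \<Longrightarrow> dec a \<in> regular_arrows T"
  and e_dec: "a \<in> ops reg_operad n \<Longrightarrow> e (dec a) = a"
  using dec_e homD unfolding ops_reg_operad by fastforce+

lemma e_mem: "f \<in> regular_arrows T \<Longrightarrow> f \<in> hom n 1 \<Longrightarrow> e f \<in> ops reg_operad n"
  by (auto simp: ops_reg_operad)

lemma op_mult_reg_operad: "op_mult reg_operad (tup k n) (tup k b) a = e (dec a \<bullet> par k n (\<lambda>i. dec (b i)))"
proof -
  have "par k (\<lambda>i. tup k n ! (i - 1)) (\<lambda>i. dec (tup k b ! (i - 1))) = par k n (\<lambda>i. dec (b i))"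
    by (rule par_cong) auto
  then show ?thesis by (simp add: reg_operad_def)
qed

lemma op_act_reg_operad: "op_act reg_operad n m \<phi> a = e (dec a \<bullet> pr n m \<phi>)"
  by (simp add: reg_operad_def)

lemma mult_hom:
  assumes "\<And>i. i \<in> {1..k} \<Longrightarrow> b i \<in> ops reg_operad (n i)" "a \<in> ops reg_operad k"
  shows "par k n (\<lambda>i. dec (b i)) \<in> hom (\<Sum>i=1..k. n i) k"
    "dec a \<bullet> par k n (\<lambda>i. dec (b i)) \<in> hom (\<Sum>i=1..k. n i) 1"
    "dec a \<bullet> par k n (\<lambda>i. dec (b i)) \<in> regular_arrows T"
proof -
  have h: "\<And>i. i \<in> {1..k} \<Longrightarrow> dec (b i) \<in> hom (n i) 1" by (rule dec_hom[OF assms(1)])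
  have g: "\<And>i. i \<in> {1..k} \<Longrightarrow> dec (b i) \<in> regular_arrows T" by (rule dec_regular[OF assms(1)])
  show p: "par k n (\<lambda>i. dec (b i)) \<in> hom (\<Sum>i=1..k. n i) k" by (rule par_hom) (rule h)
  show "dec a \<bullet> par k n (\<lambda>i. dec (b i)) \<in> hom (\<Sum>i=1..k. n i) 1" by (rule comp_hom[OF p dec_hom[OF assms(2)]])
  have "par k n (\<lambda>i. dec (b i)) \<in> regular_arrows T" by (rule regular_par[OF g h])
  then show "dec a \<bullet> par k n (\<lambda>i. dec (b i)) \<in> regular_arrows T"
    by (rule regular_comp[OF _ p dec_regular[OF assms(2)] dec_hom[OF assms(2)]])
qed

lemma act_hom:
  assumes "\<phi> ` {1..n} = {1..m}" "a \<in> ops reg_operad n"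
  shows "pr n m \<phi> \<in> hom m n" "dec a \<bullet> pr n m \<phi> \<in> hom m 1" "dec a \<bullet> pr n m \<phi> \<in> regular_arrows T"
proof -
  have "\<phi> \<in> {1..n} \<rightarrow> {1..m}" using assms(1) by blast
  then show p: "pr n m \<phi> \<in> hom m n" by (rule pr_hom)
  show "dec a \<bullet> pr n m \<phi> \<in> hom m 1" by (rule comp_hom[OF p dec_hom[OF assms(2)]])
  show "dec a \<bullet> pr n m \<phi> \<in> regular_arrows T"
    by (rule regular_comp[OF regular_pr[OF assms(1)] p dec_regular[OF assms(2)] dec_hom[OF assms(2)]])
qed

lemma dec_mult: "(\<And>i. i \<in> {1..k} \<Longrightarrow> b i \<in> ops reg_operad (n i)) \<Longrightarrow> a \<in> ops reg_operad k \<Longrightarrow>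
    dec (op_mult reg_operad (tup k n) (tup k b) a) = dec a \<bullet> par k n (\<lambda>i. dec (b i))"
  unfolding op_mult_reg_operad using homD[OF mult_hom(2)] by (intro dec_e) blast

lemma dec_act: "\<phi> ` {1..n} = {1..m} \<Longrightarrow> a \<in> ops reg_operad n \<Longrightarrow>
    dec (op_act reg_operad n m \<phi> a) = dec a \<bullet> pr n m \<phi>"
  unfolding op_act_reg_operad using homD[OF act_hom(2)] by (intro dec_e) blast

lemma mult_mem: "(\<And>i. i \<in> {1..k} \<Longrightarrow> b i \<in> ops reg_operad (n i)) \<Longrightarrow> a \<in> ops reg_operad k \<Longrightarrow>
    op_mult reg_operad (tup k n) (tup k b) a \<in> ops reg_operad (\<Sum>i=1..k. n i)"
  unfolding op_mult_reg_operad by (rule e_mem[OF mult_hom(3,2)])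

lemma act_mem: "\<phi> ` {1..n} = {1..m} \<Longrightarrow> a \<in> ops reg_operad n \<Longrightarrow> op_act reg_operad n m \<phi> a \<in> ops reg_operad m"
  unfolding op_act_reg_operad by (rule e_mem[OF act_hom(3,2)])

lemma Surj_image: "\<phi> \<in> Surj n m \<Longrightarrow> \<phi> ` {1..n} = {1..m}"
  by (simp add: Surj_def)

lemma dec_unit: "dec (op_unit reg_operad) = one 1"
proof -
  have "one 1 \<in> Arr T" using homD[OF one_hom[of 1]] by simp
  then show ?thesis by (simp add: reg_operad_def dec_e)
qed

lemma unit_mem: "op_unit reg_operad \<in> ops reg_operad 1"
proof -
  have "e (one 1) \<in> ops reg_operad 1" by (rule e_mem[OF regular_Iso[OF Iso_one] one_hom]) simp_all
  then show ?thesis by (simp add: reg_operad_def)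
qed

lemma dec_inject: "a \<in> ops reg_operad n \<Longrightarrow> b \<in> ops reg_operad m \<Longrightarrow> dec a = dec b \<Longrightarrow> a = b"
  by (metis e_dec)

text \<open>Once \<open>dec\<close> is pushed inwards, the operad laws become identities between
  composites in the theory: \<open>par_par\<close> gives associativity, \<open>par_single\<close>
  and \<open>par_units\<close> the unit laws, \<open>pr_par\<close> equivariance.\<close>

lemma regular_operad_reg_operad: "regular_operad reg_operad"
  unfolding regular_operad_def
proof (intro conjI allI ballI impI)
  show "op_unit reg_operad \<in> ops reg_operad 1" by (rule unit_mem)
next
  fix k n b a assume "\<forall>i\<in>{1..k}. b i \<in> ops reg_operad (n i)" "a \<in> ops reg_operad k"
  then show "op_mult reg_operad (tup k n) (tup k b) a \<in> ops reg_operad (\<Sum>i=1..k. n i)" by (intro mult_mem) auto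
next
  fix n m \<phi> a assume "\<phi> \<in> Surj n m" "a \<in> ops reg_operad n"
  then show "op_act reg_operad n m \<phi> a \<in> ops reg_operad m" by (intro act_mem Surj_image)
next
  fix n a assume a: "a \<in> ops reg_operad n"
  have "pr n n (idf n) = one n" by (rule pr_ident) simp
  then show "op_act reg_operad n n (idf n) a = a"
    unfolding op_act_reg_operad using comp_one[OF dec_hom[OF a]] e_dec[OF a] by simp
next
  fix n m l \<phi> \<psi> a assume \<phi>: "\<phi> \<in> Surj n m" and \<psi>: "\<psi> \<in> Surj m l" and a: "a \<in> ops reg_operad n"
  have P: "\<phi> \<in> {1..n} \<rightarrow> {1..m}" "\<psi> \<in> {1..m} \<rightarrow> {1..l}" using \<phi> \<psi> by (auto simp: Surj_def Fun_def)
  have "pr n l (compose {1..n} \<psi> \<phi>) = pr n m \<phi> \<bullet> pr m l \<psi>"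
    unfolding pr_pr[OF P] by (rule pr_cong) (simp add: compose_eq)
  then show "op_act reg_operad n l (compose {1..n} \<psi> \<phi>) a = op_act reg_operad m l \<psi> (op_act reg_operad n m \<phi> a)"
    unfolding op_act_reg_operad[of m] dec_act[OF Surj_image[OF \<phi>] a]
    using comp_assoc[OF pr_hom[OF P(2)] pr_hom[OF P(1)] dec_hom[OF a]] by (simp add: op_act_reg_operad)
next
  fix k n q a b c assume a: "a \<in> ops reg_operad k" and "\<forall>i\<in>{1..k}. b i \<in> ops reg_operad (n i)"
    and c': "\<forall>i\<in>{1..k}. \<forall>j\<in>{1..n i}. c i j \<in> ops reg_operad (q i j)"
  then have b: "\<And>i. i \<in> {1..k} \<Longrightarrow> b i \<in> ops reg_operad (n i)" by blast
  have c: "\<And>i j. i \<in> {1..k} \<Longrightarrow> j \<in> {1..n i} \<Longrightarrow> c i j \<in> ops reg_operad (q i j)" using c' by blast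
  have ch: "cop n c p \<in> ops reg_operad (cop n q p)" if "p \<in> {1..\<Sum>i=1..k. n i}" for p
    using that
  proof (rule pos_cases)
    fix j x assume "j \<in> {1..k}" "x \<in> {1..n j}" "p = pos n j x"
    then show ?thesis using c[of j x] by simp
  qed
  have dm: "dec (op_mult reg_operad (tup k n) (tup k b) a) = dec a \<bullet> par k n (\<lambda>i. dec (b i))"
    by (rule dec_mult[OF b a])
  let ?N = "\<Sum>i=1..k. n i"
  have "(dec a \<bullet> par k n (\<lambda>i. dec (b i))) \<bullet> par ?N (cop n q) (\<lambda>p. dec (cop n c p)) =
      dec a \<bullet> par k n (\<lambda>i. dec (b i)) \<bullet> par ?N (cop n q) (\<lambda>p. dec (cop n c p))"
    by (rule comp_assoc[OF mult_hom(1)[OF ch mult_mem[OF b a]] mult_hom(1)[OF b a] dec_hom[OF a]])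
  also have "(\<lambda>p. dec (cop n c p)) = cop n (\<lambda>i j. dec (c i j))" by (auto simp: cop_def)
  also have "par k n (\<lambda>i. dec (b i)) \<bullet> par ?N (cop n q) (cop n (\<lambda>i j. dec (c i j))) =
      par k (\<lambda>i. \<Sum>j=1..n i. q i j) (\<lambda>i. dec (b i) \<bullet> par (n i) (q i) (\<lambda>j. dec (c i j)))"
    by (rule par_par) (use dec_hom b c in blast)+
  also have "\<dots> = par k (\<lambda>i. \<Sum>j=1..n i. q i j)
      (\<lambda>i. dec (op_mult reg_operad (tup (n i) (q i)) (tup (n i) (c i)) (b i)))"
    by (rule par_cong) (use dec_mult[OF c b] in auto)
  finally show "op_mult reg_operad (concat (tup k (\<lambda>i. tup (n i) (q i)))) (concat (tup k (\<lambda>i. tup (n i) (c i))))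
          (op_mult reg_operad (tup k n) (tup k b) a) =
        op_mult reg_operad (tup k (\<lambda>i. \<Sum>j=1..n i. q i j))
          (tup k (\<lambda>i. op_mult reg_operad (tup (n i) (q i)) (tup (n i) (c i)) (b i))) a"
    unfolding concat_tup op_mult_reg_operad[of ?N] op_mult_reg_operad[of k "\<lambda>i. \<Sum>j=1..n i. q i j"]
      dm by (simp add: cop_def[abs_def])
next
  fix n a assume a: "a \<in> ops reg_operad n"
  have "op_mult reg_operad (tup 1 (\<lambda>_. n)) (tup 1 (\<lambda>_. a)) (op_unit reg_operad) = e (one 1 \<bullet> dec a)"
    unfolding op_mult_reg_operad dec_unit using par_single[of "\<lambda>_. dec a" "\<lambda>_. n"] dec_hom[OF a] by simp
  then show "op_mult reg_operad [n] [a] (op_unit reg_operad) = a"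
    using one_comp[OF dec_hom[OF a]] e_dec[OF a] by (simp add: tup_def upt_conv_Cons)
next
  fix n a assume a: "a \<in> ops reg_operad n"
  show "op_mult reg_operad (tup n (\<lambda>_. 1)) (tup n (\<lambda>_. op_unit reg_operad)) a = a"
    unfolding op_mult_reg_operad dec_unit par_units using comp_one[OF dec_hom[OF a]] e_dec[OF a] by simp
next
  fix n m k l \<phi> \<psi> a b assume \<phi>: "\<phi> \<in> Surj n m" and a: "a \<in> ops reg_operad n"
    and "\<forall>i\<in>{1..m}. \<psi> i \<in> Surj (k i) (l i) \<and> b i \<in> ops reg_operad (k i)"
  then have \<psi>: "\<And>i. i \<in> {1..m} \<Longrightarrow> \<psi> i ` {1..k i} = {1..l i}" and b: "\<And>i. i \<in> {1..m} \<Longrightarrow> b i \<in> ops reg_operad (k i)"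
    by (auto simp: Surj_def)
  have \<phi>P: "\<phi> \<in> {1..n} \<rightarrow> {1..m}" using \<phi> by (auto simp: Surj_def Fun_def)
  have \<psi>P: "\<And>i. i \<in> {1..m} \<Longrightarrow> \<psi> i \<in> {1..k i} \<rightarrow> {1..l i}" using \<psi> by blast
  have b\<phi>: "\<And>j. j \<in> {1..n} \<Longrightarrow> b (\<phi> j) \<in> ops reg_operad (k (\<phi> j))" using b \<phi>P by blast
  have ab: "op_act reg_operad (k i) (l i) (\<psi> i) (b i) \<in> ops reg_operad (l i)" if "i \<in> {1..m}" for i
    by (rule act_mem[OF \<psi>[OF that] b[OF that]])
  let ?K = "\<Sum>j=1..n. k (\<phi> j)" and ?L = "\<Sum>i=1..m. l i"
  let ?t = "cop (\<lambda>j. k (\<phi> j)) (\<lambda>j x. pos l (\<phi> j) (\<psi> (\<phi> j) x))"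
  have st: "pr ?K ?L (star n \<phi> k l \<psi>) = pr ?K ?L ?t"
    by (rule pr_cong) (simp add: star_def cop_def comp_def Let_def)
  have tPi: "?t \<in> {1..?K} \<rightarrow> {1..?L}"
  proof (rule Pi_I)
    fix p assume "p \<in> {1..?K}"
    then obtain j x where jx: "j \<in> {1..n}" "x \<in> {1..k (\<phi> j)}" "p = pos (\<lambda>j. k (\<phi> j)) j x"
      by (rule pos_cases)
    then have "?t p = pos l (\<phi> j) (\<psi> (\<phi> j) x)" by simp
    also have "\<dots> \<in> {1..?L}"
      by (rule pos_mem) (use \<phi>P \<psi>P jx in blast)+
    finally show "?t p \<in> {1..?L}" .
  qed
  have dm: "dec (op_mult reg_operad (tup n (\<lambda>j. k (\<phi> j))) (tup n (\<lambda>j. b (\<phi> j))) a) =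
      dec a \<bullet> par n (\<lambda>j. k (\<phi> j)) (\<lambda>j. dec (b (\<phi> j)))"
    by (rule dec_mult[OF b\<phi> a])
  have "op_mult reg_operad (tup m l) (tup m (\<lambda>i. op_act reg_operad (k i) (l i) (\<psi> i) (b i))) (op_act reg_operad n m \<phi> a) =
      e ((dec a \<bullet> pr n m \<phi>) \<bullet> par m l (\<lambda>i. dec (op_act reg_operad (k i) (l i) (\<psi> i) (b i))))"
    unfolding op_mult_reg_operad dec_act[OF Surj_image[OF \<phi>] a] ..
  also have "par m l (\<lambda>i. dec (op_act reg_operad (k i) (l i) (\<psi> i) (b i))) =
      par m l (\<lambda>i. dec (b i) \<bullet> pr (k i) (l i) (\<psi> i))"
    by (rule par_cong) (use dec_act[OF \<psi> b] in auto)
  also have "(dec a \<bullet> pr n m \<phi>) \<bullet> par m l (\<lambda>i. dec (b i) \<bullet> pr (k i) (l i) (\<psi> i)) =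
      dec a \<bullet> pr n m \<phi> \<bullet> par m l (\<lambda>i. dec (b i) \<bullet> pr (k i) (l i) (\<psi> i))"
  proof (rule comp_assoc[OF par_hom pr_hom[OF \<phi>P] dec_hom[OF a]])
    fix i assume i: "i \<in> {1..m}"
    show "dec (b i) \<bullet> pr (k i) (l i) (\<psi> i) \<in> hom (l i) 1" by (rule act_hom(2)[OF \<psi>[OF i] b[OF i]])
  qed
  also have "pr n m \<phi> \<bullet> par m l (\<lambda>i. dec (b i) \<bullet> pr (k i) (l i) (\<psi> i)) =
      par n (\<lambda>j. k (\<phi> j)) (\<lambda>j. dec (b (\<phi> j))) \<bullet> pr ?K ?L ?t"
    by (rule pr_par[OF \<phi>P dec_hom[OF b] \<psi>P])
  also have "dec a \<bullet> par n (\<lambda>j. k (\<phi> j)) (\<lambda>j. dec (b (\<phi> j))) \<bullet> pr ?K ?L ?t =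
      (dec a \<bullet> par n (\<lambda>j. k (\<phi> j)) (\<lambda>j. dec (b (\<phi> j)))) \<bullet> pr ?K ?L ?t"
    by (rule comp_assoc[OF pr_hom[OF tPi] mult_hom(1)[OF b\<phi> a] dec_hom[OF a], symmetric])
  also have "e \<dots> = op_act reg_operad ?K ?L (star n \<phi> k l \<psi>)
          (op_mult reg_operad (tup n (\<lambda>j. k (\<phi> j))) (tup n (\<lambda>j. b (\<phi> j))) a)"
    unfolding op_act_reg_operad st dm ..
  finally show "op_mult reg_operad (tup m l) (tup m (\<lambda>i. op_act reg_operad (k i) (l i) (\<psi> i) (b i))) (op_act reg_operad n m \<phi> a) =
        op_act reg_operad ?K ?L (star n \<phi> k l \<psi>)
          (op_mult reg_operad (tup n (\<lambda>j. k (\<phi> j))) (tup n (\<lambda>j. b (\<phi> j))) a)" .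
qed

text \<open>The bijection condition is existence and uniqueness of the decomposition into a
  projection and a regular arrow.\<close>

theorem presentation_reg_operad: "presentation reg_operad T (\<lambda>_. dec)"
proof -
  interpret operad reg_operad by unfold_locales (rule regular_operad_reg_operad)
  show ?thesis
  proof unfold_locales
    fix g n assume "g \<in> ops reg_operad n"
    then show "dec g \<in> hom n 1" by (rule dec_hom)
  next
    show "dec (op_unit reg_operad) = one 1" by (rule dec_unit)
  next
    fix k b l g assume "\<And>i. i \<in> {1..k} \<Longrightarrow> b i \<in> ops reg_operad (l i)" "g \<in> ops reg_operad k"
    then show "dec (mul k l b g) = dec g \<bullet> par k l (\<lambda>i. dec (b i))"
      unfolding mul_def by (rule dec_mult)
  next
    fix \<phi> :: "nat \<Rightarrow> nat" and n m g assume \<phi>: "\<phi> ` {1..n} = {1..m}" and g: "g \<in> ops reg_operad n"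
    have "restrict \<phi> {1..n} ` {1..n} = {1..m}" using \<phi> by simp
    then show "dec (act n m \<phi> g) = dec g \<bullet> pr n m \<phi>"
      unfolding act_def using dec_act[OF _ g] pr_restrict by metis
  next
    fix n
    let ?f = "\<lambda>(A, g). dec g \<bullet> pr (card A) n (enum A)"
    show "bij_betw ?f (elts n) (hom n 1)"
      unfolding bij_betw_def
    proof
      show "inj_on ?f (elts n)"
      proof (rule inj_onI)
        fix c c' assume "c \<in> elts n" "c' \<in> elts n" and eq: "?f c = ?f c'"
        then obtain A g A' g' where c: "c = (A, g)" "A \<subseteq> {1..n}" "g \<in> ops reg_operad (card A)"
          and c': "c' = (A', g')" "A' \<subseteq> {1..n}" "g' \<in> ops reg_operad (card A')" by (auto simp: elts_def)
        have "A = A' \<and> dec g = dec g'"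
          by (rule regular_decomposition_unique[OF c(2) c'(2) dec_hom[OF c(3)] dec_hom[OF c'(3)]
            dec_regular[OF c(3)] dec_regular[OF c'(3)]]) (use eq c c' in simp)
        then show "c = c'" using dec_inject[OF c(3) c'(3)] c(1) c'(1) by simp
      qed
      show "?f ` elts n = hom n 1"
      proof (intro set_eqI iffI)
        fix f assume "f \<in> ?f ` elts n"
        then obtain A g where f: "f = dec g \<bullet> pr (card A) n (enum A)" "A \<subseteq> {1..n}" "g \<in> ops reg_operad (card A)"
          by (auto simp: elts_def)
        have "finite A" using f(2) finite_subset by blast
        then have "enum A \<in> {1..card A} \<rightarrow> {1..n}"
          by (intro Pi_I) (rule subsetD[OF f(2) enum_mem])
        then show "f \<in> hom n 1" unfolding f(1) by (rule comp_hom[OF pr_hom dec_hom[OF f(3)]])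
      next
        fix f assume "f \<in> hom n 1"
        then obtain A r where A: "A \<subseteq> {1..n}" "r \<in> regular_arrows T" "r \<in> hom (card A) 1"
          "f = r \<bullet> pr (card A) n (enum A)" using regular_decomposition by blast
        have "e r \<in> ops reg_operad (card A)" by (rule e_mem[OF A(2,3)])
        moreover have "dec (e r) = r" using homD[OF A(3)] by (intro dec_e) blast
        ultimately show "f \<in> ?f ` elts n"
          using A by (intro image_eqI[of _ _ "(A, e r)"]) (auto simp: elts_def)
      qed
    qed
  qed
qed

end


section \<open>The presentation of the theory of an operad\<close>

context operad
begin

definition evP :: "nat \<Rightarrow> 'a \<Rightarrow> 'a span set" where
  "evP n g = cls n 1 (\<lambda>_\<in>{1..1}. ({1..n}, g))"

lemma evP_family: "g \<in> ops P n \<Longrightarrow> (\<lambda>_\<in>{1..1}. ({1..n}, g)) \<in> families n 1"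
  by (auto simp: elts_def)

lemma const_family: "c \<in> elts n \<Longrightarrow> (\<lambda>_\<in>{1..1}. c) \<in> families n 1"
  by auto

lemma Comp_evP:
  assumes g: "g \<in> ops P k" and F: "F \<in> families n k"
  shows "Comp (Pf_obj P) (evP k g) (cls n k F) = cls n 1 (\<lambda>_\<in>{1..1}. csub F (nf k (\<lambda>i. i) g))"
proof -
  have "(\<lambda>j\<in>{1..1::nat}. csub F ((\<lambda>_\<in>{1..1}. ({1..k}, g)) j)) = (\<lambda>_\<in>{1..1}. csub F (nf k (\<lambda>i. i) g))"
    using nf_ident[of k "\<lambda>i. i" g] g by (intro restrict_ext) simp
  then show ?thesis unfolding evP_def using Comp_cls[OF F evP_family[OF g]] by simp
qed

lemma law_Pf: "law (Pf_obj P)"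
  by (simp add: law_iff lawvere_Pf)

lemma pr_Pf:
  assumes \<phi>: "\<phi> \<in> {1..m} \<rightarrow> {1..n}"
  shows "law.pr (Pf_obj P) m n \<phi> = cls n m (units n m \<phi>)"
proof -
  interpret L: law "Pf_obj P" by (rule law_Pf)
  show ?thesis
  proof (rule L.hom_eqI[OF L.pr_hom[OF \<phi>]])
    show "cls n m (units n m \<phi>) \<in> Hom (Pf_obj P) n m" unfolding Hom_Pf using units_mem[OF \<phi>] by blast
    fix i assume i: "i \<in> {1..m}"
    then have \<phi>i: "\<phi> i \<in> {1..n}" using \<phi> by blast
    have "(\<lambda>_\<in>{1..1}. units n m \<phi> i) = units n 1 (\<lambda>_. \<phi> i)"
      unfolding units_def using i by (intro restrict_ext) simp
    then show "Comp (Pf_obj P) (Proj (Pf_obj P) m i) (L.pr m n \<phi>) =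
        Comp (Pf_obj P) (Proj (Pf_obj P) m i) (cls n m (units n m \<phi>))"
      unfolding L.proj_pr[OF \<phi> i] Proj_Comp[OF units_mem[OF \<phi>] i] Proj_Pf[OF \<phi>i] by simp
  qed
qed

lemma tuple_Pf:
  assumes F: "F \<in> families n m"
  shows "law.tuple (Pf_obj P) n m (\<lambda>i. cls n 1 (\<lambda>_\<in>{1..1}. F i)) = cls n m F"
proof -
  interpret L: law "Pf_obj P" by (rule law_Pf)
  have h: "cls n m F \<in> Hom (Pf_obj P) n m" unfolding Hom_Pf using F by blast
  have "L.tuple n m (\<lambda>i. cls n 1 (\<lambda>_\<in>{1..1}. F i)) =
      L.tuple n m (\<lambda>i. Comp (Pf_obj P) (Proj (Pf_obj P) m i) (cls n m F))"
    by (rule L.tuple_cong) (rule Proj_Comp[OF F, symmetric])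
  then show ?thesis using L.tuple_proj[OF h] by simp
qed

lemma Comp_evP_pr:
  assumes g: "g \<in> ops P k" and \<phi>: "\<phi> \<in> {1..k} \<rightarrow> {1..n}"
  shows "Comp (Pf_obj P) (evP k g) (law.pr (Pf_obj P) k n \<phi>) = cls n 1 (\<lambda>_\<in>{1..1}. nf k \<phi> g)"
proof -
  have "csub (units n k \<phi>) (nf k (\<lambda>i. i) g) = nf k \<phi> g"
    by (rule csub_proj[of _ _ k]) (use g in \<open>auto simp: units_def\<close>)
  then show ?thesis unfolding pr_Pf[OF \<phi>] Comp_evP[OF g units_mem[OF \<phi>]] by simp
qed

text \<open>Evaluating a normal form in \<open>Pf_obj P\<close> returns the class with this code, so
  the bijection required of a presentation is the parametrization of arrows by families.\<close>

lemma Comp_evP_enum: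
  assumes c: "c \<in> elts n"
  shows "(\<lambda>(A, g). Comp (Pf_obj P) (evP (card A) g) (law.pr (Pf_obj P) (card A) n (enum A))) c =
    cls n 1 (\<lambda>_\<in>{1..1}. c)"
proof -
  obtain A g where Ag: "c = (A, g)" "A \<subseteq> {1..n}" "g \<in> ops P (card A)" using c by (auto simp: elts_def)
  have fin: "finite A" using Ag(2) finite_subset by blast
  have E: "enum A \<in> {1..card A} \<rightarrow> {1..n}" by (rule Pi_I) (rule subsetD[OF Ag(2) enum_mem[OF fin]])
  show ?thesis using Comp_evP_pr[OF Ag(3) E] nf_enum[OF fin Ag(3)] Ag(1) by simp
qed

text \<open>With products and reindexings of the theory identified as explicit classes, the
  conditions on multiplication and action become computations with \<open>csub_nf\<close> and
  \<open>nf_act\<close>.\<close>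

theorem presentation_Pf: "presentation P (Pf_obj P) evP"
proof -
  interpret L: law "Pf_obj P" by (rule law_Pf)
  show ?thesis
  proof unfold_locales
    fix g n assume "g \<in> ops P n"
    then show "evP n g \<in> Hom (Pf_obj P) n 1" unfolding Hom_Pf evP_def using evP_family by blast
  next
    have "units 1 1 (\<lambda>i. i) = (\<lambda>_\<in>{1..1}. ({1..1}, unit))" unfolding units_def by (rule restrict_ext) auto
    then show "evP 1 unit = Ident (Pf_obj P) 1" by (simp add: evP_def Ident_Pf)
  next
    fix k b l g assume b: "\<And>i. i \<in> {1..k} \<Longrightarrow> b i \<in> ops P (l i)" and g: "g \<in> ops P k"
    let ?N = "\<Sum>i=1..k. l i"
    let ?F = "\<lambda>i\<in>{1..k}. nf (l i) (pos l i) (b i)"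
    have "\<And>i. i \<in> {1..k} \<Longrightarrow> nf (l i) (pos l i) (b i) \<in> elts ?N"
      by (rule nf_mem[OF L.pos_Pi[of _ k l] b])
    then have F: "?F \<in> families ?N k" by simp
    have "L.par k l (\<lambda>i. evP (l i) (b i)) = L.tuple ?N k (\<lambda>i. cls ?N 1 (\<lambda>_\<in>{1..1}. ?F i))"
      unfolding L.par_def
    proof (rule L.tuple_cong)
      fix i assume i: "i \<in> {1..k}"
      show "Comp (Pf_obj P) (evP (l i) (b i)) (L.pr (l i) ?N (pos l i)) = cls ?N 1 (\<lambda>_\<in>{1..1}. ?F i)"
        unfolding Comp_evP_pr[OF b[OF i] L.pos_Pi[OF i, of l]] using i by simp
    qed
    then have par: "L.par k l (\<lambda>i. evP (l i) (b i)) = cls ?N k ?F" unfolding tuple_Pf[OF F] .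
    have "csub ?F (nf k (\<lambda>i. i) g) = sub k (\<lambda>i. i) l (pos l) b g"
      by (rule csub_nf[of _ _ k]) (use g b in auto)
    also have "\<dots> = nf ?N (\<lambda>i. i) (mul k l b g)"
      unfolding sub_def by (rule nf_cong) (rule cop_pos_id)
    also have "\<dots> = ({1..?N}, mul k l b g)" by (rule nf_ident[OF refl mul_mem[OF b g]])
    finally show "evP ?N (mul k l b g) = Comp (Pf_obj P) (evP k g) (L.par k l (\<lambda>i. evP (l i) (b i)))"
      unfolding par Comp_evP[OF g F] by (simp add: evP_def)
  next
    fix \<phi> :: "nat \<Rightarrow> nat" and n m g assume \<phi>: "\<phi> ` {1..n} = {1..m}" and g: "g \<in> ops P n"
    have P: "\<phi> \<in> {1..n} \<rightarrow> {1..m}" using \<phi> by blast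
    have "nf n \<phi> g = nf m (\<lambda>i. i) (act n m \<phi> g)" by (rule nf_act[OF \<phi> g, symmetric])
    also have "\<dots> = ({1..m}, act n m \<phi> g)" by (rule nf_ident[OF refl act_mem[OF \<phi> g]])
    finally show "evP m (act n m \<phi> g) = Comp (Pf_obj P) (evP n g) (L.pr n m \<phi>)"
      unfolding Comp_evP_pr[OF g P] by (simp add: evP_def)
  next
    fix n
    have "bij_betw (\<lambda>c. cls n 1 (\<lambda>_\<in>{1..1}. c)) (elts n) (Hom (Pf_obj P) n 1)"
      unfolding bij_betw_def
    proof
      show "inj_on (\<lambda>c. cls n 1 (\<lambda>_\<in>{1..1}. c)) (elts n)"
      proof (rule inj_onI)
        fix c c' assume "c \<in> elts n" "cls n 1 (\<lambda>_\<in>{1..1}. c) = cls n 1 (\<lambda>_\<in>{1..1}. c')"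
        then have "(\<lambda>_\<in>{1..1::nat}. c) = (\<lambda>_\<in>{1..1}. c')" using cls_eq_iff[OF const_family] by blast
        from fun_cong[OF this, of 1] show "c = c'" by simp
      qed
      show "(\<lambda>c. cls n 1 (\<lambda>_\<in>{1..1}. c)) ` elts n = Hom (Pf_obj P) n 1"
      proof (intro set_eqI iffI)
        fix A assume "A \<in> (\<lambda>c. cls n 1 (\<lambda>_\<in>{1..1}. c)) ` elts n"
        then show "A \<in> Hom (Pf_obj P) n 1" unfolding Hom_Pf using const_family by blast
      next
        fix A assume "A \<in> Hom (Pf_obj P) n 1"
        then obtain F where F: "F \<in> families n 1" "A = cls n 1 F" unfolding Hom_Pf by blast
        have "F = (\<lambda>_\<in>{1..1}. F 1)"
          by (rule extensionalityI[of _ "{1..1}"]) (use F(1) in \<open>auto simp: PiE_iff\<close>)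
        moreover have "F 1 \<in> elts n" using F(1) by auto
        moreover from \<open>F = _\<close> have "A = cls n 1 (\<lambda>_\<in>{1..1}. F 1)"
          unfolding F(2) by (rule arg_cong[where f = "cls n 1"])
        ultimately show "A \<in> (\<lambda>c. cls n 1 (\<lambda>_\<in>{1..1}. c)) ` elts n" by blast
      qed
    qed
    then show "bij_betw (\<lambda>(A, g). Comp (Pf_obj P) (evP (card A) g) (L.pr (card A) n (enum A)))
        (elts n) (Hom (Pf_obj P) n 1)"
      by (subst bij_betw_cong[OF Comp_evP_enum])
  qed
qed

end


section \<open>Interpretations between presented theories\<close>

text \<open>An interpretation is determined by its values on operations: every arrow into
  \<open>1\<close> is an operation after a reindexing, and an arrow into \<open>n\<close> is
  determined by its components.\<close>

lemma interpretation_eqI: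
  assumes T: "presentation P T ev" and S: "law S" and I: "interpretation_of T S I" and J: "interpretation_of T S J"
    and eq: "\<And>n g. g \<in> ops P n \<Longrightarrow> I (ev n g) = J (ev n g)"
  shows "I = J"
proof -
  interpret T: presentation P T ev by (rule T)
  interpret S: law S by (rule S)
  have TL: "law T" by unfold_locales
  have eq1: "I f = J f" if f: "f \<in> Hom T n 1" for f n
  proof -
    obtain c where c: "c \<in> T.elts n" "f = T.val n c" using f by (rule T.hom_val)
    obtain A g where Ag: "c = (A, g)" "A \<subseteq> {1..n}" "g \<in> ops P (card A)" using c by (auto simp: T.elts_def)
    have "finite A" using Ag(2) finite_subset by blast
    then have E: "enum A \<in> {1..card A} \<rightarrow> {1..n}" using Ag(2) by (rule T.enum_Pi)
    have K: "K f = Comp S (K (ev (card A) g)) (S.pr (card A) n (enum A))" if K: "interpretation_of T S K" for K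
      unfolding c(2) Ag(1) T.val_def
      using interpretation_comp[OF K T.pr_hom[OF E] T.ev_hom[OF Ag(3)]] interpretation_pr[OF TL S K E] by simp
    show ?thesis using K[OF I] K[OF J] eq[OF Ag(3)] by simp
  qed
  show ?thesis
  proof (rule extensionalityI[of _ "Arr T"])
    show "I \<in> extensional (Arr T)" "J \<in> extensional (Arr T)"
      using I J unfolding interpretation_of_def by (auto simp: PiE_iff)
    fix f assume "f \<in> Arr T"
    then have f: "f \<in> Hom T (Dom T f) (Cod T f)" by (rule T.arr_hom)
    show "I f = J f"
    proof (rule S.hom_eqI[OF interpretation_hom[OF I f] interpretation_hom[OF J f]])
      fix i assume i: "i \<in> {1..Cod T f}"
      have "Comp S (Proj S (Cod T f) i) (K f) = K (Comp T (Proj T (Cod T f) i) f)"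
        if K: "interpretation_of T S K" for K
        using interpretation_comp[OF K f T.proj_hom[OF i]] interpretation_proj[OF K i] by simp
      then show "Comp S (Proj S (Cod T f) i) (I f) = Comp S (Proj S (Cod T f) i) (J f)"
        using I J eq1[OF T.proj_comp_hom[OF f i]] by simp
    qed
  qed
qed

locale presentation_pair = P: presentation P T ev + Q: presentation Q S ev'
  for P :: "'a regop" and T :: "'m lawvere" and ev and Q :: "'b regop" and S :: "'n lawvere" and ev'
begin

lemma law_T: "law T" and law_S: "law S"
  by unfold_locales

text \<open>The normal form of \<open>I f\<close> has the same set of variables, with the image
  under \<open>h\<close> as its operation.\<close>

lemma supp_interpretation:
  assumes I: "interpretation_of T S I" and h: "\<And>n g. g \<in> ops P n \<Longrightarrow> h n g \<in> ops Q n"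
    and ev: "\<And>n g. g \<in> ops P n \<Longrightarrow> I (ev n g) = ev' n (h n g)" and f: "f \<in> Hom T n 1"
  shows "Q.supp n (I f) = P.supp n f"
proof -
  obtain c where c: "c \<in> P.elts n" "f = P.val n c" using f by (rule P.hom_val)
  obtain A g where Ag: "c = (A, g)" "A \<subseteq> {1..n}" "g \<in> ops P (card A)" using c by (auto simp: P.elts_def)
  have fin: "finite A" using Ag(2) finite_subset by blast
  then have E: "enum A \<in> {1..card A} \<rightarrow> {1..n}" using Ag(2) by (rule P.enum_Pi)
  have "I f = Comp S (ev' (card A) (h (card A) g)) (Q.pr (card A) n (enum A))"
    unfolding c(2) Ag(1) P.val_def
    using interpretation_comp[OF I P.pr_hom[OF E] P.ev_hom[OF Ag(3)]]
      interpretation_pr[OF law_T law_S I E] ev[OF Ag(3)] by simp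
  then have "Q.supp n (I f) = enum A ` {1..card A}" using Q.supp_nf[OF E h[OF Ag(3)]] by simp
  also have "\<dots> = P.supp n f" using P.supp_val[OF c(1)] c(2) Ag(1) enum_image[OF fin] by simp
  finally show ?thesis .
qed

text \<open>By \<open>regular_iff_full\<close> regularity is a condition on the supports of the
  components, and these are preserved.\<close>

lemma interpretation_regular:
  assumes I: "interpretation_of T S I" and h: "\<And>n g. g \<in> ops P n \<Longrightarrow> h n g \<in> ops Q n"
    and ev: "\<And>n g. g \<in> ops P n \<Longrightarrow> I (ev n g) = ev' n (h n g)"
  shows "I ` regular_arrows T \<subseteq> regular_arrows S"
proof
  fix s assume "s \<in> I ` regular_arrows T"
  then obtain r where r: "r \<in> regular_arrows T" "s = I r" by blast
  have rh: "r \<in> Hom T (Dom T r) (Cod T r)" using r(1) by (intro P.arr_hom) (simp add: regular_arrows_def)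
  have "Q.supp (Dom T r) (Comp S (Proj S (Cod T r) i) (I r)) =
      P.supp (Dom T r) (Comp T (Proj T (Cod T r) i) r)" if i: "i \<in> {1..Cod T r}" for i
    using supp_interpretation[OF I h ev P.proj_comp_hom[OF rh i]]
      interpretation_comp[OF I rh P.proj_hom[OF i]] interpretation_proj[OF I i] by simp
  then have "Q.full (Dom T r) (Cod T r) (I r)"
    using r(1) unfolding P.regular_iff_full[OF rh] P.full_def Q.full_def by simp
  then show "s \<in> regular_arrows S" unfolding r(2) by (rule Q.full_regular[OF interpretation_hom[OF I rh]])
qed

text \<open>Operations of arity \<open>n\<close> are the normal forms with support
  \<open>{1..n}\<close>, and evaluation of normal forms is injective.\<close>

lemma ev_inject:
  assumes "g \<in> ops Q n" "g' \<in> ops Q n" "ev' n g = ev' n g'"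
  shows "g = g'"
proof -
  have "Q.val n ({1..n}, g) = ev' n g" if "g \<in> ops Q n" for g
    using Q.comp_one[OF Q.ev_hom[OF that]] Q.pr_ident[of n "enum {1..n}", OF enum_interval]
    by (simp add: Q.val_def)
  moreover have "({1..n}, g) \<in> Q.elts n" if "g \<in> ops Q n" for g using that by (simp add: Q.elts_def)
  ultimately have "({1..n}, g) = ({1..n}, g')" using Q.val_inject assms by metis
  then show ?thesis by simp
qed

text \<open>Regular arrows into \<open>1\<close> are operations, so \<open>I\<close> restricts to a
  map of operations; the laws of a homomorphism may be checked after applying the injective
  \<open>ev'\<close>.\<close>

theorem hom_of_regular_interpretation:
  assumes I: "interpretation_of T S I" and reg: "I ` regular_arrows T \<subseteq> regular_arrows S"
  shows "\<exists>h. regop_hom P Q h \<and> (\<forall>n. \<forall>g\<in>ops P n. I (ev n g) = ev' n (h n g))"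
proof -
  have "\<forall>g\<in>ops P n. \<exists>g'. g' \<in> ops Q n \<and> I (ev n g) = ev' n g'" for n
  proof
    fix g assume g: "g \<in> ops P n"
    have "I (ev n g) \<in> regular_arrows S" using reg P.regular_ev[OF g] by blast
    then show "\<exists>g'. g' \<in> ops Q n \<and> I (ev n g) = ev' n g'"
      using Q.regular_is_ev[OF _ interpretation_hom[OF I P.ev_hom[OF g]]] by blast
  qed
  then have "\<exists>f. \<forall>g\<in>ops P n. f g \<in> ops Q n \<and> I (ev n g) = ev' n (f g)" for n
    unfolding bchoice_iff by blast
  then obtain h0 where h0: "\<And>n g. g \<in> ops P n \<Longrightarrow> h0 n g \<in> ops Q n \<and> I (ev n g) = ev' n (h0 n g)"
    by metis
  \<comment> \<open>Homomorphisms are extensional in each arity, hence the restriction.\<close>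
  define h where "h n = restrict (h0 n) (ops P n)" for n
  have hm: "h n g \<in> ops Q n" and hev: "I (ev n g) = ev' n (h n g)" if "g \<in> ops P n" for n g
    using h0[OF that] that by (auto simp: h_def)
  have "regop_hom P Q h"
    unfolding regop_hom_def
  proof (intro conjI allI ballI impI)
    fix n show "h n \<in> ops P n \<rightarrow>\<^sub>E ops Q n" using hm by (auto simp: h_def)
  next
    show "h 1 (op_unit P) = op_unit Q"
    proof (rule ev_inject[OF hm[OF P.unit_mem] Q.unit_mem])
      show "ev' 1 (h 1 (op_unit P)) = ev' 1 (op_unit Q)"
        using hev[OF P.unit_mem] P.ev_unit Q.ev_unit interpretation_one[OF I] by simp
    qed
  next
    fix k n b a assume b': "\<forall>i\<in>{1..k}. b i \<in> ops P (n i)" and a: "a \<in> ops P k"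
    then have b: "\<And>i. i \<in> {1..k} \<Longrightarrow> b i \<in> ops P (n i)" by blast
    have hb: "\<And>i. i \<in> {1..k} \<Longrightarrow> h (n i) (b i) \<in> ops Q (n i)" by (rule hm[OF b])
    have m1: "P.mul k n b a \<in> ops P (\<Sum>i=1..k. n i)" by (rule P.mul_mem[OF b a])
    have m2: "Q.mul k n (\<lambda>i. h (n i) (b i)) (h k a) \<in> ops Q (\<Sum>i=1..k. n i)"
      by (rule Q.mul_mem[OF hb hm[OF a]])
    have eh: "\<And>i. i \<in> {1..k} \<Longrightarrow> ev (n i) (b i) \<in> Hom T (n i) 1" by (rule P.ev_hom[OF b])
    have "I (ev (\<Sum>i=1..k. n i) (P.mul k n b a)) =
        Comp S (I (ev k a)) (I (P.par k n (\<lambda>i. ev (n i) (b i))))"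
      using P.ev_mul[of k b n a, OF b a] interpretation_comp[OF I P.par_hom[of k "\<lambda>i. ev (n i) (b i)" n, OF eh] P.ev_hom[OF a]]
      by simp
    also have "I (P.par k n (\<lambda>i. ev (n i) (b i))) = Q.par k n (\<lambda>i. I (ev (n i) (b i)))"
      by (rule interpretation_par[OF law_T law_S I eh])
    also have "\<dots> = Q.par k n (\<lambda>i. ev' (n i) (h (n i) (b i)))"
      by (rule Q.par_cong) (use hev[OF b] in auto)
    also have "Comp S (I (ev k a)) \<dots> = ev' (\<Sum>i=1..k. n i) (Q.mul k n (\<lambda>i. h (n i) (b i)) (h k a))"
      unfolding hev[OF a] by (rule Q.ev_mul[OF hb hm[OF a], symmetric])
    finally have "ev' (\<Sum>i=1..k. n i) (h (\<Sum>i=1..k. n i) (P.mul k n b a)) =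
        ev' (\<Sum>i=1..k. n i) (Q.mul k n (\<lambda>i. h (n i) (b i)) (h k a))"
      using hev[OF P.mul_mem[OF b a]] by simp
    then show "h (\<Sum>i=1..k. n i) (op_mult P (tup k n) (tup k b) a) =
        op_mult Q (tup k n) (tup k (\<lambda>i. h (n i) (b i))) (h k a)"
      unfolding P.mul_def[symmetric] Q.mul_def[symmetric]
      by (rule ev_inject[OF hm[OF m1] m2])
  next
    fix n m \<phi> a assume "\<phi> \<in> Surj n m" and a: "a \<in> ops P n"
    then have \<phi>: "\<phi> ` {1..n} = {1..m}" and r: "restrict \<phi> {1..n} = \<phi>" and Pi: "\<phi> \<in> {1..n} \<rightarrow> {1..m}"
      by (auto simp: Surj_def Fun_def PiE_restrict)
    have "I (ev m (P.act n m \<phi> a)) = ev' m (Q.act n m \<phi> (h n a))"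
      using P.ev_act[OF \<phi> a] interpretation_comp[OF I P.pr_hom[OF Pi] P.ev_hom[OF a]]
        interpretation_pr[OF law_T law_S I Pi] hev[OF a] Q.ev_act[OF \<phi> hm[OF a]] by simp
    then have "ev' m (h m (P.act n m \<phi> a)) = ev' m (Q.act n m \<phi> (h n a))"
      using hev[OF P.act_mem[OF \<phi> a]] by simp
    then have "h m (P.act n m \<phi> a) = Q.act n m \<phi> (h n a)"
      by (rule ev_inject[OF hm[OF P.act_mem[OF \<phi> a]] Q.act_mem[OF \<phi> hm[OF a]]])
    then show "h m (op_act P n m \<phi> a) = op_act Q n m \<phi> (h n a)" by (simp add: P.act_def Q.act_def r)
  qed
  then show ?thesis using hev by blast
qed

end

section \<open>From operad homomorphisms to interpretations\<close>

locale presented_hom = presentation_pair P T ev Q S ev'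
  for P :: "'a regop" and T :: "'m lawvere" and ev and Q :: "'b regop" and S :: "'n lawvere" and ev' +
  fixes h
  assumes hom: "regop_hom P Q h"
begin

lemma h_mem: "g \<in> ops P n \<Longrightarrow> h n g \<in> ops Q n"
  using hom unfolding regop_hom_def by (auto simp: PiE_iff)

lemma h_unit: "h 1 (op_unit P) = op_unit Q"
  using hom unfolding regop_hom_def by blast

lemma h_mul: "(\<And>i. i \<in> {1..k} \<Longrightarrow> b i \<in> ops P (n i)) \<Longrightarrow> a \<in> ops P k \<Longrightarrow>
    h (\<Sum>i=1..k. n i) (P.mul k n b a) = Q.mul k n (\<lambda>i. h (n i) (b i)) (h k a)"
  unfolding P.mul_def Q.mul_def
  by (rule hom[unfolded regop_hom_def, THEN conjunct2, THEN conjunct2, THEN conjunct1, rule_format])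

lemma h_act: "\<phi> ` {1..n} = {1..m} \<Longrightarrow> a \<in> ops P n \<Longrightarrow> h m (P.act n m \<phi> a) = Q.act n m \<phi> (h n a)"
  unfolding P.act_def Q.act_def
  by (rule hom[unfolded regop_hom_def, THEN conjunct2, THEN conjunct2, THEN conjunct2, rule_format])
    (rule P.restrict_Surj)

definition hmap :: "nat set \<times> 'a \<Rightarrow> nat set \<times> 'b" where
  "hmap = (\<lambda>(A, g). (A, h (card A) g))"

lemma hmap_mem: "c \<in> P.elts n \<Longrightarrow> hmap c \<in> Q.elts n"
  using h_mem by (auto simp: hmap_def P.elts_def Q.elts_def)

lemma hmap_nf: "g \<in> ops P k \<Longrightarrow> hmap (P.nf k \<phi> g) = Q.nf k \<phi> (h k g)"
  using h_act[OF P.rank_image] by (simp add: hmap_def P.nf_def Q.nf_def)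

text \<open>On representatives, substitution consists of multiplication and a reindexing; the
  homomorphism preserves the former and the passage to normal forms is natural by
  \<open>hmap_nf\<close>.\<close>

lemma hmap_csub:
  assumes c: "c \<in> P.elts m" and F: "\<And>i. i \<in> {1..m} \<Longrightarrow> F i \<in> P.elts n"
  shows "hmap (P.csub F c) = Q.csub (\<lambda>i. hmap (F i)) (hmap c)"
proof -
  obtain d \<phi> g where c: "\<phi> \<in> {1..d} \<rightarrow> {1..m}" "g \<in> ops P d" "c = P.nf d \<phi> g"
    using c by (rule P.elts_nf)
  obtain k \<chi> b where "\<forall>i\<in>{1..m}. \<chi> i \<in> {1..k i} \<rightarrow> {1..n} \<and> b i \<in> ops P (k i) \<and>
      F i = P.nf (k i) (\<chi> i) (b i)"
    using P.elts_nf_family[of m F n, OF F] by blast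
  then have F': "\<And>i. i \<in> {1..m} \<Longrightarrow> b i \<in> ops P (k i)" "\<And>i. i \<in> {1..m} \<Longrightarrow> F i = P.nf (k i) (\<chi> i) (b i)"
    by blast+
  have b: "\<And>j. j \<in> {1..d} \<Longrightarrow> b (\<phi> j) \<in> ops P (k (\<phi> j))" using F'(1) c(1) by blast
  have "P.csub F c = P.sub d \<phi> k \<chi> b g" unfolding c(3) by (rule P.csub_nf[OF c(1,2)]) (use F' in auto)
  then have "hmap (P.csub F c) = Q.sub d \<phi> k \<chi> (\<lambda>i. h (k i) (b i)) (h d g)"
    unfolding P.sub_def Q.sub_def using hmap_nf[OF P.mul_mem[OF b c(2)]] h_mul[OF b c(2)] by simp
  also have "\<dots> = Q.csub (\<lambda>i. hmap (F i)) (Q.nf d \<phi> (h d g))"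
    by (rule Q.csub_nf[OF c(1) h_mem[OF c(2)], symmetric]) (use F' hmap_nf h_mem in auto)
  finally show ?thesis unfolding c(3) hmap_nf[OF c(2)] .
qed

text \<open>Extends \<open>h\<close> to arrows into \<open>1\<close> through their normal forms: the
  support is kept and the operation replaced by its image.\<close>

definition lift1 :: "nat \<Rightarrow> 'm \<Rightarrow> 'n" where
  "lift1 n f = Q.val n (hmap (inv_into (P.elts n) (P.val n) f))"

definition lift :: "'m \<Rightarrow> 'n" where
  "lift = (\<lambda>f\<in>Arr T. Q.tuple (Dom T f) (Cod T f) (\<lambda>i. lift1 (Dom T f) (Comp T (Proj T (Cod T f) i) f)))"

lemma lift1_val: "c \<in> P.elts n \<Longrightarrow> lift1 n (P.val n c) = Q.val n (hmap c)"
  unfolding lift1_def using bij_betw_inv_into_left[OF P.val_bij] by metis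

lemma lift1_hom:
  assumes "f \<in> Hom T n 1"
  shows "lift1 n f \<in> Hom S n 1"
proof -
  obtain c where c: "c \<in> P.elts n" "f = P.val n c" using assms by (rule P.hom_val)
  show ?thesis unfolding c(2) lift1_val[OF c(1)] by (rule Q.val_hom[OF hmap_mem[OF c(1)]])
qed

lemma lift1_nf:
  assumes \<phi>: "\<phi> \<in> {1..k} \<rightarrow> {1..n}" and g: "g \<in> ops P k"
  shows "lift1 n (Comp T (ev k g) (P.pr k n \<phi>)) = Comp S (ev' k (h k g)) (Q.pr k n \<phi>)"
  unfolding P.val_nf[OF \<phi> g, symmetric] lift1_val[OF P.nf_mem[OF \<phi> g]] hmap_nf[OF g]
  by (rule Q.val_nf[OF \<phi> h_mem[OF g]])

lemma lift1_ev: "g \<in> ops P n \<Longrightarrow> lift1 n (ev n g) = ev' n (h n g)"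
  using lift1_nf[of "\<lambda>i. i" n n g] P.comp_one[OF P.ev_hom] Q.comp_one[OF Q.ev_hom] h_mem
  by (simp add: P.pr_ident Q.pr_ident)

lemma lift1_proj: "i \<in> {1..n} \<Longrightarrow> lift1 n (Proj T n i) = Proj S n i"
  using lift1_nf[of "\<lambda>_. i" 1 n "op_unit P"] P.unit_mem P.one_comp[OF P.proj_hom] Q.one_comp[OF Q.proj_hom]
  by (simp add: P.ev_unit h_unit Q.ev_unit P.proj_eq_pr[symmetric] Q.proj_eq_pr[symmetric])

lemma lift_eq: "f \<in> Hom T n m \<Longrightarrow> lift f = Q.tuple n m (\<lambda>i. lift1 n (Comp T (Proj T m i) f))"
  using P.homD by (simp add: lift_def)

lemma lift_hom: "f \<in> Hom T n m \<Longrightarrow> lift f \<in> Hom S n m"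
  unfolding lift_eq by (rule Q.tuple_hom) (rule lift1_hom[OF P.proj_comp_hom])

lemma proj_lift:
  assumes f: "f \<in> Hom T n m" and i: "i \<in> {1..m}"
  shows "Comp S (Proj S m i) (lift f) = lift1 n (Comp T (Proj T m i) f)"
  unfolding lift_eq[OF f] by (rule Q.proj_tuple[OF lift1_hom[OF P.proj_comp_hom[OF f]] i])

lemma lift_lift1:
  assumes f: "f \<in> Hom T n 1"
  shows "lift f = lift1 n f"
  using proj_lift[OF f, of 1] P.one_comp[OF f] Q.one_comp[OF lift_hom[OF f]]
  by (simp add: P.proj_one Q.proj_one)

text \<open>Functoriality on arrows into \<open>1\<close>: in both theories composition is
  substitution by \<open>val_csub\<close>, so \<open>hmap_csub\<close> applies.\<close>

lemma lift1_comp: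
  assumes f: "f \<in> Hom T m 1" and u: "u \<in> Hom T n m"
  shows "lift1 n (Comp T f u) = Comp S (lift1 m f) (lift u)"
proof -
  obtain c where c: "c \<in> P.elts m" "f = P.val m c" using f by (rule P.hom_val)
  have "\<forall>i\<in>{1..m}. \<exists>F. F \<in> P.elts n \<and> Comp T (Proj T m i) u = P.val n F"
    using P.proj_comp_hom[OF u] P.hom_val by blast
  then obtain F where "\<forall>i\<in>{1..m}. F i \<in> P.elts n \<and> Comp T (Proj T m i) u = P.val n (F i)"
    unfolding bchoice_iff by blast
  then have F: "\<And>i. i \<in> {1..m} \<Longrightarrow> F i \<in> P.elts n"
    and Fu: "\<And>i. i \<in> {1..m} \<Longrightarrow> Comp T (Proj T m i) u = P.val n (F i)" by blast+
  have "Comp T f u = P.val n (P.csub F c)" unfolding c(2) by (rule P.val_csub[OF c(1) u F Fu, symmetric])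
  then have "lift1 n (Comp T f u) = Q.val n (Q.csub (\<lambda>i. hmap (F i)) (hmap c))"
    using lift1_val[OF P.csub_mem[OF c(1) F]] hmap_csub[OF c(1) F] by simp
  also have "\<dots> = Comp S (Q.val m (hmap c)) (lift u)"
  proof (rule Q.val_csub[OF hmap_mem[OF c(1)] lift_hom[OF u] hmap_mem[OF F]])
    fix i assume i: "i \<in> {1..m}"
    show "Comp S (Proj S m i) (lift u) = Q.val n (hmap (F i))"
      unfolding proj_lift[OF u i] Fu[OF i] by (rule lift1_val[OF F[OF i]])
  qed
  finally show ?thesis unfolding c(2) lift1_val[OF c(1)] .
qed

theorem interpretation_lift: "interpretation_of T S lift"
  unfolding interpretation_of_def
proof (intro conjI allI ballI impI)
  have "lift f \<in> Arr S" if "f \<in> Arr T" for f using Q.homD[OF lift_hom[OF P.arr_hom[OF that]]] by blast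
  then show "lift \<in> Arr T \<rightarrow>\<^sub>E Arr S" by (auto simp: PiE_iff lift_def)
  fix f assume "f \<in> Arr T"
  then have f: "f \<in> Hom T (Dom T f) (Cod T f)" by (rule P.arr_hom)
  show "Dom S (lift f) = Dom T f" "Cod S (lift f) = Cod T f" using Q.homD[OF lift_hom[OF f]] by auto
  fix g assume "g \<in> Arr T" "Dom T g = Cod T f"
  then have g: "g \<in> Hom T (Cod T f) (Cod T g)" using P.arr_hom by metis
  show "lift (Comp T g f) = Comp S (lift g) (lift f)"
  proof (rule Q.hom_eqI[OF lift_hom[OF P.comp_hom[OF f g]] Q.comp_hom[OF lift_hom[OF f] lift_hom[OF g]]])
    fix i assume i: "i \<in> {1..Cod T g}"
    show "Comp S (Proj S (Cod T g) i) (lift (Comp T g f)) =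
        Comp S (Proj S (Cod T g) i) (Comp S (lift g) (lift f))"
      unfolding proj_lift[OF P.comp_hom[OF f g] i] P.proj_comp_comp[OF g f i]
        lift1_comp[OF P.proj_comp_hom[OF g i] f] Q.proj_comp_comp[OF lift_hom[OF g] lift_hom[OF f] i]
        proj_lift[OF g i] ..
  qed
next
  fix n
  have o: "Ident T n \<in> Hom T n n" by (simp add: P.one_hom)
  show "lift (Ident T n) = Ident S n"
  proof (rule Q.hom_eqI[OF lift_hom[OF o]])
    show "Ident S n \<in> Hom S n n" by (simp add: Q.one_hom)
    fix i assume i: "i \<in> {1..n}"
    show "Comp S (Proj S n i) (lift (Ident T n)) = Comp S (Proj S n i) (Ident S n)"
      unfolding proj_lift[OF o i] P.comp_one[OF P.proj_hom[OF i]] Q.comp_one[OF Q.proj_hom[OF i]]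
      by (rule lift1_proj[OF i])
  qed
next
  fix n i :: nat assume i: "i \<in> {1..n}"
  show "lift (Proj T n i) = Proj S n i"
    unfolding lift_lift1[OF P.proj_hom[OF i]] by (rule lift1_proj[OF i])
qed

lemma lift_ev: "g \<in> ops P n \<Longrightarrow> lift (ev n g) = ev' n (h n g)"
  using lift_lift1[OF P.ev_hom] lift1_ev by simp

end


section \<open>Equivalences of categories\<close>

lemma functor_hom:
  "is_functor C D F \<Longrightarrow> f \<in> Hom C x y \<Longrightarrow> snd F f \<in> Hom D (fst F x) (fst F y)"
  unfolding is_functor_def Hom_def by fastforce

lemma functor_comp_arrow:
  "is_functor C D F \<Longrightarrow> f \<in> Hom C x y \<Longrightarrow> g \<in> Hom C y z \<Longrightarrow>
    snd F (Comp C g f) = Comp D (snd F g) (snd F f)"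
  unfolding is_functor_def Hom_def by fastforce

text \<open>The quasi-inverse sends \<open>d\<close> to a chosen object \<open>G0 d\<close> whose
  image is isomorphic to \<open>d\<close> by \<open>e d\<close>, and an arrow \<open>g\<close> to a
  preimage of its conjugate \<open>k g\<close>; faithfulness turns each equation in \<open>C\<close>
  into one in \<open>D\<close>. The unit is a preimage of the inverse of \<open>e\<close> at
  \<open>fst F x\<close>, the counit is \<open>e\<close> itself.\<close>

lemma equivalence_criterion:
  assumes F: "is_functor C D F"
    and full: "\<And>x y g. x \<in> Obj C \<Longrightarrow> y \<in> Obj C \<Longrightarrow> g \<in> Hom D (fst F x) (fst F y) \<Longrightarrow>
      \<exists>f\<in>Hom C x y. snd F f = g"
    and faithful: "\<And>x y f f'. f \<in> Hom C x y \<Longrightarrow> f' \<in> Hom C x y \<Longrightarrow> snd F f = snd F f' \<Longrightarrow> f = f'"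
    and surj: "\<And>d. d \<in> Obj D \<Longrightarrow> \<exists>c\<in>Obj C. Iso D (fst F c) d \<noteq> {}"
  shows "equivalent_categories C D"
proof -
  interpret C: cate C using F by unfold_locales (simp add: is_functor_def)
  interpret D: cate D using F by unfold_locales (simp add: is_functor_def)
  have F0: "fst F x \<in> Obj D" and Fid: "snd F (Ident C x) = Ident D (fst F x)" if "x \<in> Obj C" for x
    using F that unfolding is_functor_def by auto
  have "\<forall>d\<in>Obj D. \<exists>c. c \<in> Obj C \<and> Iso D (fst F c) d \<noteq> {}" using surj by blast
  then obtain G0 where G0': "\<forall>d\<in>Obj D. G0 d \<in> Obj C \<and> Iso D (fst F (G0 d)) d \<noteq> {}"
    unfolding bchoice_iff by blast
  then have G0: "\<And>d. d \<in> Obj D \<Longrightarrow> G0 d \<in> Obj C" by blast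
  have "\<forall>d\<in>Obj D. \<exists>e. e \<in> Iso D (fst F (G0 d)) d" using G0' by blast
  then obtain e where e': "\<forall>d\<in>Obj D. e d \<in> Iso D (fst F (G0 d)) d"
    unfolding bchoice_iff by blast
  then have e: "\<And>d. d \<in> Obj D \<Longrightarrow> e d \<in> Iso D (fst F (G0 d)) d" by blast
  have "\<forall>d\<in>Obj D. \<exists>i. i \<in> Hom D d (fst F (G0 d)) \<and> Comp D i (e d) = Ident D (fst F (G0 d)) \<and>
      Comp D (e d) i = Ident D d"
    using e' unfolding D.Iso_iff by blast
  then obtain i where i': "\<forall>d\<in>Obj D. i d \<in> Hom D d (fst F (G0 d)) \<and>
      Comp D (i d) (e d) = Ident D (fst F (G0 d)) \<and> Comp D (e d) (i d) = Ident D d"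
    unfolding bchoice_iff by blast
  then have i: "\<And>d. d \<in> Obj D \<Longrightarrow> i d \<in> Hom D d (fst F (G0 d)) \<and>
      Comp D (i d) (e d) = Ident D (fst F (G0 d)) \<and> Comp D (e d) (i d) = Ident D d" by blast
  have eh: "e d \<in> Hom D (fst F (G0 d)) d" and ih: "i d \<in> Hom D d (fst F (G0 d))"
    and ie: "Comp D (i d) (e d) = Ident D (fst F (G0 d))" and ei: "Comp D (e d) (i d) = Ident D d"
    if "d \<in> Obj D" for d
    using e[OF that] i[OF that] by (auto dest: D.Iso_hom)
  have obj: "Dom D g \<in> Obj D" "Cod D g \<in> Obj D" if "g \<in> Arr D" for g
    using D.hom_obj[OF D.arr_hom[OF that]] by auto
  define k where "k g = Comp D (i (Cod D g)) (Comp D g (e (Dom D g)))" for g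
  have kh: "k g \<in> Hom D (fst F (G0 (Dom D g))) (fst F (G0 (Cod D g)))" if g: "g \<in> Arr D" for g
    unfolding k_def by (rule D.comp_hom[OF D.comp_hom[OF eh[OF obj(1)[OF g]] D.arr_hom[OF g]] ih[OF obj(2)[OF g]]])
  have "\<forall>g\<in>Arr D. \<exists>f. f \<in> Hom C (G0 (Dom D g)) (G0 (Cod D g)) \<and> snd F f = k g"
  proof
    fix g assume g: "g \<in> Arr D"
    show "\<exists>f. f \<in> Hom C (G0 (Dom D g)) (G0 (Cod D g)) \<and> snd F f = k g"
      using full[OF G0[OF obj(1)[OF g]] G0[OF obj(2)[OF g]] kh[OF g]] by blast
  qed
  then obtain G1 where "\<forall>g\<in>Arr D. G1 g \<in> Hom C (G0 (Dom D g)) (G0 (Cod D g)) \<and> snd F (G1 g) = k g"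
    unfolding bchoice_iff by blast
  then have G1: "\<And>g. g \<in> Arr D \<Longrightarrow> G1 g \<in> Hom C (G0 (Dom D g)) (G0 (Cod D g)) \<and> snd F (G1 g) = k g"
    by blast
  let ?G = "(G0, G1)"
  have G: "is_functor D C ?G"
    unfolding is_functor_def fst_conv snd_conv
  proof (intro conjI ballI impI)
    show "category D" "category C" by (rule D.category, rule C.category)
    show "\<And>d. d \<in> Obj D \<Longrightarrow> G0 d \<in> Obj C" by (rule G0)
    show "\<And>g. g \<in> Arr D \<Longrightarrow> G1 g \<in> Hom C (G0 (Dom D g)) (G0 (Cod D g))" using G1 by blast
  next
    fix d assume d: "d \<in> Obj D"
    have o: "Ident D d \<in> Arr D" "Dom D (Ident D d) = d" "Cod D (Ident D d) = d"
      using D.homD[OF D.one_hom[OF d]] by auto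
    show "G1 (Ident D d) = Ident C (G0 d)"
    proof (rule faithful)
      show "G1 (Ident D d) \<in> Hom C (G0 d) (G0 d)" "Ident C (G0 d) \<in> Hom C (G0 d) (G0 d)"
        using G1[OF o(1)] o C.one_hom[OF G0[OF d]] by auto
      show "snd F (G1 (Ident D d)) = snd F (Ident C (G0 d))"
        using G1[OF o(1)] o D.one_comp[OF eh[OF d]] ie[OF d] Fid[OF G0[OF d]] by (simp add: k_def)
    qed
  next
    fix f g assume f: "f \<in> Arr D" and g: "g \<in> Arr D" and fg: "Dom D g = Cod D f"
    have gf: "Comp D g f \<in> Arr D" "Dom D (Comp D g f) = Dom D f" "Cod D (Comp D g f) = Cod D g"
      using f g fg by (auto intro: D.arr_comp D.dom_comp D.cod_comp)
    have Gf: "G1 f \<in> Hom C (G0 (Dom D f)) (G0 (Cod D f))" using G1[OF f] by blast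
    have Gg: "G1 g \<in> Hom C (G0 (Cod D f)) (G0 (Cod D g))" using G1[OF g] fg by simp
    show "G1 (Comp D g f) = Comp C (G1 g) (G1 f)"
    proof (rule faithful)
      show "G1 (Comp D g f) \<in> Hom C (G0 (Dom D f)) (G0 (Cod D g))" using G1[OF gf(1)] gf by simp
      show "Comp C (G1 g) (G1 f) \<in> Hom C (G0 (Dom D f)) (G0 (Cod D g))" by (rule C.comp_hom[OF Gf Gg])
      let ?a = "Dom D f" and ?b = "Cod D f" and ?c = "Cod D g"
      note oa = obj(1)[OF f] and ob = obj(2)[OF f] and oc = obj(2)[OF g]
      note h = eh[OF oa] ih[OF ob] eh[OF ob] ih[OF oc]
      have "snd F (Comp C (G1 g) (G1 f)) = Comp D (k g) (k f)"
        using functor_comp_arrow[OF F Gf Gg] G1[OF f] G1[OF g] by simp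
      also have "\<dots> = Comp D (i ?c) (Comp D g (Comp D (e ?b) (Comp D (i ?b) (Comp D f (e ?a)))))"
        using h f g fg by (simp add: k_def D.arrow_simps)
      also have "Comp D (e ?b) (Comp D (i ?b) (Comp D f (e ?a))) = Comp D f (e ?a)"
        using h f by (intro D.cancel_left[OF ei[OF ob] ih[OF ob] eh[OF ob]]) (simp_all add: D.arrow_simps)
      also have "Comp D (i ?c) (Comp D g (Comp D f (e ?a))) = k (Comp D g f)"
        using h f g fg gf by (simp add: k_def D.arrow_simps)
      finally show "snd F (G1 (Comp D g f)) = snd F (Comp C (G1 g) (G1 f))" using G1[OF gf(1)] by simp
    qed
  qed
  have "\<forall>x\<in>Obj C. \<exists>f. f \<in> Hom C x (G0 (fst F x)) \<and> snd F f = i (fst F x)"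
  proof
    fix x assume x: "x \<in> Obj C"
    show "\<exists>f. f \<in> Hom C x (G0 (fst F x)) \<and> snd F f = i (fst F x)"
      using full[OF x G0[OF F0[OF x]] ih[OF F0[OF x]]] by blast
  qed
  then obtain \<eta> where "\<forall>x\<in>Obj C. \<eta> x \<in> Hom C x (G0 (fst F x)) \<and> snd F (\<eta> x) = i (fst F x)"
    unfolding bchoice_iff by blast
  then have \<eta>: "\<And>x. x \<in> Obj C \<Longrightarrow> \<eta> x \<in> Hom C x (G0 (fst F x)) \<and> snd F (\<eta> x) = i (fst F x)"
    by blast
  have "natural_iso C C (id, id) (functor_comp ?G F) \<eta>"
    unfolding natural_iso_def functor_comp_def fst_conv snd_conv comp_def id_def
  proof (intro conjI ballI)
    fix x assume x: "x \<in> Obj C"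
    obtain t where t: "t \<in> Hom C (G0 (fst F x)) x" "snd F t = e (fst F x)"
      using full[OF G0[OF F0[OF x]] x eh[OF F0[OF x]]] by blast
    have hx: "\<eta> x \<in> Hom C x (G0 (fst F x))" using \<eta>[OF x] by blast
    show "\<eta> x \<in> Iso C x (G0 (fst F x))"
    proof (rule C.IsoI[OF hx t(1)])
      show "Comp C t (\<eta> x) = Ident C x"
        by (rule faithful[OF C.comp_hom[OF hx t(1)] C.one_hom[OF x]])
          (use functor_comp_arrow[OF F hx t(1)] t(2) \<eta>[OF x] ei[OF F0[OF x]] Fid[OF x] in simp)
      show "Comp C (\<eta> x) t = Ident C (G0 (fst F x))"
        by (rule faithful[OF C.comp_hom[OF t(1) hx] C.one_hom[OF G0[OF F0[OF x]]]])
          (use functor_comp_arrow[OF F t(1) hx] t(2) \<eta>[OF x] ie[OF F0[OF x]] Fid[OF G0[OF F0[OF x]]] in simp)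
    qed
  next
    fix f assume "f \<in> Arr C"
    then have f: "f \<in> Hom C (Dom C f) (Cod C f)" by (rule C.arr_hom)
    let ?x = "Dom C f" and ?y = "Cod C f"
    have xy: "?x \<in> Obj C" "?y \<in> Obj C" using C.hom_obj[OF f] by auto
    note Ff = functor_hom[OF F f]
    have Fa: "snd F f \<in> Arr D" "Dom D (snd F f) = fst F ?x" "Cod D (snd F f) = fst F ?y" using D.homD[OF Ff] by auto
    have hx: "\<eta> ?x \<in> Hom C ?x (G0 (fst F ?x))" and hy: "\<eta> ?y \<in> Hom C ?y (G0 (fst F ?y))" using \<eta> xy by auto
    have Gf: "G1 (snd F f) \<in> Hom C (G0 (fst F ?x)) (G0 (fst F ?y))" using G1[OF Fa(1)] Fa by simp
    show "Comp C (\<eta> ?y) f = Comp C (G1 (snd F f)) (\<eta> ?x)"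
    proof (rule faithful[OF C.comp_hom[OF f hy] C.comp_hom[OF hx Gf]])
      note h = eh[OF F0[OF xy(1)]] ih[OF F0[OF xy(1)]] ih[OF F0[OF xy(2)]]
      have "snd F (Comp C (G1 (snd F f)) (\<eta> ?x)) = Comp D (k (snd F f)) (i (fst F ?x))"
        using functor_comp_arrow[OF F hx Gf] G1[OF Fa(1)] \<eta>[OF xy(1)] by simp
      also have "\<dots> = Comp D (i (fst F ?y)) (Comp D (snd F f) (Comp D (e (fst F ?x)) (i (fst F ?x))))"
        using h Fa by (simp add: k_def D.arrow_simps)
      also have "\<dots> = Comp D (i (fst F ?y)) (snd F f)"
        using ei[OF F0[OF xy(1)]] D.comp_one[OF Ff] by simp
      finally show "snd F (Comp C (\<eta> ?y) f) = snd F (Comp C (G1 (snd F f)) (\<eta> ?x))"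
        using functor_comp_arrow[OF F f hy] \<eta>[OF xy(2)] by simp
    qed
  qed
  moreover have "natural_iso D D (functor_comp F ?G) (id, id) e"
    unfolding natural_iso_def functor_comp_def fst_conv snd_conv comp_def id_def
  proof (intro conjI ballI)
    show "\<And>d. d \<in> Obj D \<Longrightarrow> e d \<in> Iso D (fst F (G0 d)) d" by (rule e)
    fix g assume g: "g \<in> Arr D"
    note h = eh[OF obj(1)[OF g]] ih[OF obj(2)[OF g]] eh[OF obj(2)[OF g]]
    have "Comp D (e (Cod D g)) (k g) = Comp D g (e (Dom D g))"
      unfolding k_def using h g
      by (intro D.cancel_left[OF ei[OF obj(2)[OF g]] ih[OF obj(2)[OF g]] eh[OF obj(2)[OF g]]])
        (simp_all add: D.arrow_simps)
    then show "Comp D (e (Cod D g)) (snd F (G1 g)) = Comp D g (e (Dom D g))" using G1[OF g] by simp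
  qed
  ultimately show ?thesis unfolding equivalent_categories_def using F G by blast
qed


section \<open>Cardinality\<close>

text \<open>Folding an injective pairing over a list is shown to be injective among lists of the
  same length, so the length is recorded separately.\<close>

lemma lists_lepoll:
  assumes "infinite (UNIV :: 'a set)"
  shows "(UNIV :: 'a list set) \<lesssim> (UNIV :: 'a set)"
proof -
  have "(card_of ((UNIV :: 'a set) \<times> (UNIV :: 'a set)), card_of (UNIV :: 'a set)) \<in> ordLeq"
    using card_of_Times_same_infinite[OF assms] ordIso_imp_ordLeq by blast
  then obtain p :: "'a \<times> 'a \<Rightarrow> 'a" where "inj_on p (UNIV \<times> UNIV)"
    unfolding card_of_ordLeq[symmetric] by blast
  then have p: "inj p" by simp
  obtain c :: "nat \<Rightarrow> 'a" where c: "inj c" using assms infinite_countable_subset by blast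
  let ?f = "\<lambda>xs. foldr (\<lambda>x y. p (x, y)) xs (c 0)"
  have f: "length xs = length ys \<Longrightarrow> ?f xs = ?f ys \<Longrightarrow> xs = ys" for xs ys :: "'a list"
    by (induction rule: list_induct2) (auto dest: injD[OF p])
  have "inj (\<lambda>xs. p (c (length xs), ?f xs))"
  proof (rule injI)
    fix xs ys :: "'a list" assume "p (c (length xs), ?f xs) = p (c (length ys), ?f ys)"
    then have "c (length xs) = c (length ys)" "?f xs = ?f ys" using injD[OF p] by blast+
    then show "xs = ys" using f injD[OF c] by blast
  qed
  then show ?thesis unfolding lepoll_def by blast
qed

text \<open>An arrow amounts to source, target and a tuple of finite sets and operations. All of
  this is written as one list over \<open>'a\<close>, with numbers and finite sets of numbers coded
  through an injection of the naturals into \<open>'a\<close>.\<close>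

lemma Arr_Pf_lepoll:
  assumes inf: "infinite (UNIV :: 'a set)" and P: "regular_operad (P :: 'a regop)"
  shows "Arr (Pf_obj P) \<lesssim> (UNIV :: 'a set)"
proof -
  interpret operad P by unfold_locales (rule P)
  let ?X = "{(n, m :: nat, F). F \<in> families n m}"
  obtain c :: "nat \<Rightarrow> 'a" where c: "inj c" using inf infinite_countable_subset by blast
  define f :: "nat \<times> nat \<times> (nat \<Rightarrow> nat set \<times> 'a) \<Rightarrow> 'a list" where
    "f = (\<lambda>(n, m, F). [c n, c m] @ tup m (\<lambda>i. c (set_encode (fst (F i)))) @ tup m (\<lambda>i. snd (F i)))"
  have inj: "inj_on f ?X"
  proof (rule inj_onI)
    fix z z' assume z: "z \<in> ?X" and z': "z' \<in> ?X" and eq: "f z = f z'"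
    obtain n m F where F: "z = (n, m, F)" "F \<in> families n m" using z by blast
    obtain n' m' F' where F': "z' = (n', m', F')" "F' \<in> families n' m'" using z' by blast
    have nm: "n = n'" "m = m'" using eq injD[OF c] F F' by (auto simp: f_def)
    have t: "tup m (\<lambda>i. c (set_encode (fst (F i)))) = tup m (\<lambda>i. c (set_encode (fst (F' i))))"
      "tup m (\<lambda>i. snd (F i)) = tup m (\<lambda>i. snd (F' i))"
      using eq F F' nm by (auto simp: f_def)
    have nth: "f i = g i" if "tup m f = tup m g" "i \<in> {1..m}" for f g :: "nat \<Rightarrow> 'a" and i
    proof -
      have i: "i - 1 < m" "Suc (i - 1) = i" using that(2) by auto
      then show ?thesis using arg_cong[where f = "\<lambda>xs. xs ! (i - 1)", OF that(1)]
        nth_tup[OF i(1), of f] nth_tup[OF i(1), of g] by simp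
    qed
    have "F i = F' i" if i: "i \<in> {1..m}" for i
    proof (rule prod_eqI)
      have "finite (fst (F i))" "finite (fst (F' i))"
        using F F' nm i elts_finite by (metis PiE_mem prod.collapse)+
      moreover have "set_encode (fst (F i)) = set_encode (fst (F' i))" using nth[OF t(1) i] injD[OF c] by blast
      ultimately show "fst (F i) = fst (F' i)" using inj_onD[OF inj_on_set_encode] by blast
      show "snd (F i) = snd (F' i)" by (rule nth[OF t(2) i])
    qed
    then have "F = F'" using F(2) F'(2) nm by (intro extensionalityI[of _ "{1..m}"]) (auto simp: PiE_iff)
    then show "z = z'" using F F' nm by simp
  qed
  have X: "?X \<lesssim> (UNIV :: 'a list set)"
    using subset_imp_lepoll[OF subset_UNIV] inj_on_image_lepoll_1[OF inj] by blast
  have "Arr (Pf_obj P) = (\<lambda>(n, m, F). cls n m F) ` ?X" unfolding Arr_Pf by auto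
  then have "Arr (Pf_obj P) \<lesssim> ?X" by (simp only: image_lepoll)
  then show ?thesis by (rule lepoll_trans[OF lepoll_trans[OF _ X] lists_lepoll[OF inf]])
qed


section \<open>The categories of operads and of Lawvere theories\<close>

lemma regop_hom_ident: "regular_operad P \<Longrightarrow> regop_hom P P (\<lambda>n. restrict id (ops P n))"
proof -
  assume "regular_operad P"
  then interpret operad P by unfold_locales
  show ?thesis
    unfolding regop_hom_def
  proof (intro conjI allI ballI impI)
    fix k n b a assume b: "\<forall>i\<in>{1..k}. b i \<in> ops P (n i)" and a: "a \<in> ops P k"
    have "mul k n (\<lambda>i. restrict id (ops P (n i)) (b i)) (restrict id (ops P k) a) = mul k n b a"
      using a by simp (rule mul_cong, use b in auto)
    then show "restrict id (ops P (\<Sum>i=1..k. n i)) (op_mult P (tup k n) (tup k b) a) =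
        op_mult P (tup k n) (tup k (\<lambda>i. restrict id (ops P (n i)) (b i))) (restrict id (ops P k) a)"
      using mul_mem[of k b n a] a b by (simp add: mul_def)
  next
    fix n m \<phi> a assume "\<phi> \<in> Surj n m" "a \<in> ops P n"
    then show "restrict id (ops P m) (op_act P n m \<phi> a) = op_act P n m \<phi> (restrict id (ops P n) a)"
      using act_closed[of \<phi> n m a] by simp
  qed (use unit_mem in auto)
qed

lemma regop_hom_compose:
  assumes f: "regop_hom P Q f" and g: "regop_hom Q R g" and "regular_operad P"
  shows "regop_hom P R (\<lambda>n. compose (ops P n) (g n) (f n))"
proof -
  interpret P: operad P using assms(3) by unfold_locales
  have fm: "f n a \<in> ops Q n" if "a \<in> ops P n" for n a using f that unfolding regop_hom_def by (auto simp: PiE_iff)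
  have gm: "g n a \<in> ops R n" if "a \<in> ops Q n" for n a using g that unfolding regop_hom_def by (auto simp: PiE_iff)
  note f' = f[unfolded regop_hom_def, THEN conjunct2] and g' = g[unfolded regop_hom_def, THEN conjunct2]
  show ?thesis
    unfolding regop_hom_def
  proof (intro conjI allI ballI impI)
    fix n show "compose (ops P n) (g n) (f n) \<in> ops P n \<rightarrow>\<^sub>E ops R n"
      using fm gm by (auto simp: compose_def)
  next
    show "compose (ops P 1) (g 1) (f 1) (op_unit P) = op_unit R"
      using f'[THEN conjunct1] g'[THEN conjunct1] P.unit_mem by (simp add: compose_eq)
  next
    fix k n b a assume "\<forall>i\<in>{1..k}. b i \<in> ops P (n i)" and a: "a \<in> ops P k"
    then have b: "\<And>i. i \<in> {1..k} \<Longrightarrow> b i \<in> ops P (n i)" by blast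
    have fb: "\<And>i. i \<in> {1..k} \<Longrightarrow> f (n i) (b i) \<in> ops Q (n i)" by (rule fm[OF b])
    have "f (\<Sum>i=1..k. n i) (op_mult P (tup k n) (tup k b) a) =
        op_mult Q (tup k n) (tup k (\<lambda>i. f (n i) (b i))) (f k a)"
      by (rule f'[THEN conjunct2, THEN conjunct1, rule_format, OF b a])
    moreover have "g (\<Sum>i=1..k. n i) (op_mult Q (tup k n) (tup k (\<lambda>i. f (n i) (b i))) (f k a)) =
        op_mult R (tup k n) (tup k (\<lambda>i. g (n i) (f (n i) (b i)))) (g k (f k a))"
      by (rule g'[THEN conjunct2, THEN conjunct1, rule_format, OF fb fm[OF a]])
    moreover have "tup k (\<lambda>i. g (n i) (f (n i) (b i))) = tup k (\<lambda>i. compose (ops P (n i)) (g (n i)) (f (n i)) (b i))"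
      by (rule tup_cong) (simp add: compose_eq[OF b])
    moreover have "op_mult P (tup k n) (tup k b) a \<in> ops P (\<Sum>i=1..k. n i)" by (rule P.mul_closed[OF b a])
    ultimately show "compose (ops P (\<Sum>i=1..k. n i)) (g (\<Sum>i=1..k. n i)) (f (\<Sum>i=1..k. n i))
          (op_mult P (tup k n) (tup k b) a) =
        op_mult R (tup k n) (tup k (\<lambda>i. compose (ops P (n i)) (g (n i)) (f (n i)) (b i)))
          (compose (ops P k) (g k) (f k) a)"
      using a by (simp add: compose_eq)
  next
    fix n m \<phi> a assume \<phi>: "\<phi> \<in> Surj n m" and a: "a \<in> ops P n"
    have "f m (op_act P n m \<phi> a) = op_act Q n m \<phi> (f n a)"
      by (rule f'[THEN conjunct2, THEN conjunct2, rule_format, OF \<phi> a])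
    moreover have "g m (op_act Q n m \<phi> (f n a)) = op_act R n m \<phi> (g n (f n a))"
      by (rule g'[THEN conjunct2, THEN conjunct2, rule_format, OF \<phi> fm[OF a]])
    ultimately show "compose (ops P m) (g m) (f m) (op_act P n m \<phi> a) =
        op_act R n m \<phi> (compose (ops P n) (g n) (f n) a)"
      using a P.act_closed[OF \<phi> a] by (simp add: compose_eq)
  qed
qed

lemma regop_hom_extensional: "regop_hom P Q h \<Longrightarrow> h n \<in> extensional (ops P n)"
  unfolding regop_hom_def by (auto simp: PiE_iff)

lemma regop_hom_mem: "regop_hom P Q h \<Longrightarrow> g \<in> ops P n \<Longrightarrow> h n g \<in> ops Q n"
  unfolding regop_hom_def by (auto simp: PiE_iff)

lemma category_RegOp: "category RegOp"
  unfolding category_def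
proof (intro conjI ballI impI)
  fix x :: "'a regop_arrow" assume "x \<in> Arr RegOp"
  then obtain P h Q where x: "x = (P, h, Q)" "regular_operad P" "regular_operad Q" "regop_hom P Q h"
    by (auto simp: RegOp_def)
  show "Dom RegOp x \<in> Obj RegOp" "Cod RegOp x \<in> Obj RegOp" using x by (auto simp: RegOp_def)
  have "compose (ops P n) (h n) (restrict id (ops P n)) = h n" for n
    using regop_hom_extensional[OF x(4), of n]
    by (intro extensionalityI[of _ "ops P n"]) (auto simp: compose_eq)
  then show "Comp RegOp x (Ident RegOp (Dom RegOp x)) = x" by (simp add: x RegOp_def)
  have "compose (ops P n) (restrict id (ops Q n)) (h n) = h n" for n
    using regop_hom_extensional[OF x(4), of n] regop_hom_mem[OF x(4), of _ n]
    by (intro extensionalityI[of _ "ops P n"]) (auto simp: compose_eq)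
  then show "Comp RegOp (Ident RegOp (Cod RegOp x)) x = x" by (simp add: x RegOp_def)
  fix y :: "'a regop_arrow" assume "y \<in> Arr RegOp" "Dom RegOp y = Cod RegOp x"
  then obtain h' R where y: "y = (Q, h', R)" "regular_operad R" "regop_hom Q R h'"
    by (auto simp: RegOp_def x)
  show "Comp RegOp y x \<in> Hom RegOp (Dom RegOp x) (Cod RegOp y)"
    using regop_hom_compose[OF x(4) y(3) x(2)] x y by (simp add: RegOp_def Hom_def)
  fix z :: "'a regop_arrow" assume "z \<in> Arr RegOp" "Dom RegOp z = Cod RegOp y"
  then obtain h'' S where z: "z = (R, h'', S)" by (auto simp: RegOp_def y)
  have "compose (ops P n) (h'' n) (compose (ops P n) (h' n) (h n)) =
      compose (ops P n) (compose (ops Q n) (h'' n) (h' n)) (h n)" for n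
    using regop_hom_mem[OF x(4), of _ n] by (auto simp: compose_def fun_eq_iff)
  then show "Comp RegOp z (Comp RegOp y x) = Comp RegOp (Comp RegOp z y) x" by (simp add: x y z RegOp_def)
next
  fix P :: "'a regop" assume "P \<in> Obj RegOp"
  then show "Ident RegOp P \<in> Hom RegOp P P" using regop_hom_ident by (simp add: RegOp_def Hom_def)
qed

lemma Hom_RegOp: "x \<in> Hom RegOp P Q \<longleftrightarrow>
    (\<exists>h. x = (P, h, Q) \<and> regular_operad P \<and> regular_operad Q \<and> regop_hom P Q h)"
  by (auto simp: RegOp_def Hom_def)

lemma interpretation_ident:
  assumes "lawvere_theory T"
  shows "interpretation_of T T (restrict id (Arr T))"
proof -
  interpret law T using assms by (simp add: law_iff)
  show ?thesis unfolding interpretation_of_def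
  proof (intro conjI allI ballI impI)
    fix n show "restrict id (Arr T) (Ident T n) = Ident T n" using homD[OF one_hom[of n]] by simp
  next
    fix n i :: nat assume "i \<in> {1..n}"
    then show "restrict id (Arr T) (Proj T n i) = Proj T n i" using homD[OF proj_hom] by simp
  qed (auto simp: arr_comp)
qed

lemma interpretation_compose:
  assumes T: "lawvere_theory T" and I: "interpretation_of T S I" and J: "interpretation_of S R J"
  shows "interpretation_of T R (compose (Arr T) J I)"
proof -
  interpret law T using T by (simp add: law_iff)
  have Ih: "I f \<in> Hom S (Dom T f) (Cod T f)" if "f \<in> Arr T" for f
    by (rule interpretation_hom[OF I arr_hom[OF that]])
  have Jh: "J (I f) \<in> Hom R (Dom T f) (Cod T f)" if "f \<in> Arr T" for f
    by (rule interpretation_hom[OF J Ih[OF that]])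
  show ?thesis unfolding interpretation_of_def
  proof (intro conjI allI ballI impI)
    show "compose (Arr T) J I \<in> Arr T \<rightarrow>\<^sub>E Arr R"
      using Jh by (auto simp: compose_def Hom_def)
    fix f assume f: "f \<in> Arr T"
    show "Dom R (compose (Arr T) J I f) = Dom T f" "Cod R (compose (Arr T) J I f) = Cod T f"
      using Jh[OF f] f by (auto simp: compose_eq Hom_def)
    fix g assume g: "g \<in> Arr T" and fg: "Dom T g = Cod T f"
    have "I (Comp T g f) = Comp S (I g) (I f)"
      using interpretation_comp[OF I arr_hom[OF f]] arr_hom[OF g] fg by simp
    moreover have "J (Comp S (I g) (I f)) = Comp R (J (I g)) (J (I f))"
      using interpretation_comp[OF J Ih[OF f]] Ih[OF g] fg by simp
    ultimately show "compose (Arr T) J I (Comp T g f) =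
        Comp R (compose (Arr T) J I g) (compose (Arr T) J I f)"
      using f g fg arr_comp by (simp add: compose_eq)
  next
    fix n show "compose (Arr T) J I (Ident T n) = Ident R n"
      using homD[OF one_hom[of n]] interpretation_one[OF I] interpretation_one[OF J] by (simp add: compose_eq)
  next
    fix n i :: nat assume i: "i \<in> {1..n}"
    show "compose (Arr T) J I (Proj T n i) = Proj R n i"
      using homD[OF proj_hom[OF i]] interpretation_proj[OF I i] interpretation_proj[OF J i] by (simp add: compose_eq)
  qed
qed

lemma compose_ident:
  assumes "interpretation_of T S I"
  shows "compose (Arr T) I (restrict id (Arr T)) = I" "compose (Arr T) (restrict id (Arr S)) I = I"
proof -
  have I: "I \<in> Arr T \<rightarrow>\<^sub>E Arr S" using assms unfolding interpretation_of_def by blast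
  show "compose (Arr T) I (restrict id (Arr T)) = I" "compose (Arr T) (restrict id (Arr S)) I = I"
    by (rule extensionalityI[of _ "Arr T"]; use I in \<open>auto simp: compose_eq PiE_iff\<close>)+
qed

lemma compose_compose:
  assumes "interpretation_of T S I"
  shows "compose (Arr T) K (compose (Arr T) J I) = compose (Arr T) (compose (Arr S) K J) I"
  using assms unfolding interpretation_of_def by (auto simp: compose_def fun_eq_iff)

lemma LT_objects_law: "T \<in> LT_objects \<Longrightarrow> lawvere_theory T"
  by (simp add: LT_objects_def)

lemma category_LT: "category LT"
  unfolding category_def
proof (intro conjI ballI impI)
  fix x :: "'a theory_arrow" assume "x \<in> Arr LT"
  then obtain T I S where x: "x = (T, I, S)" "T \<in> LT_objects" "S \<in> LT_objects" "interpretation_of T S I"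
    by (auto simp: LT_def)
  show "Dom LT x \<in> Obj LT" "Cod LT x \<in> Obj LT" using x by (auto simp: LT_def)
  show "Comp LT x (Ident LT (Dom LT x)) = x" "Comp LT (Ident LT (Cod LT x)) x = x"
    using compose_ident[OF x(4)] by (simp_all add: x LT_def)
  fix y :: "'a theory_arrow" assume "y \<in> Arr LT" "Dom LT y = Cod LT x"
  then obtain J R where y: "y = (S, J, R)" "R \<in> LT_objects" "interpretation_of S R J"
    by (auto simp: LT_def x)
  show "Comp LT y x \<in> Hom LT (Dom LT x) (Cod LT y)"
    using interpretation_compose[OF LT_objects_law[OF x(2)] x(4) y(3)] x y by (simp add: LT_def Hom_def)
  fix z :: "'a theory_arrow" assume "z \<in> Arr LT" "Dom LT z = Cod LT y"
  then obtain K V where z: "z = (R, K, V)" by (auto simp: LT_def y)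
  show "Comp LT z (Comp LT y x) = Comp LT (Comp LT z y) x"
    using compose_compose[OF x(4)] by (simp add: x y z LT_def)
next
  fix T :: "'a span set lawvere" assume "T \<in> Obj LT"
  then show "Ident LT T \<in> Hom LT T T"
    using interpretation_ident[OF LT_objects_law] by (simp add: LT_def Hom_def)
qed

lemma Hom_LT: "x \<in> Hom LT T S \<longleftrightarrow>
    (\<exists>I. x = (T, I, S) \<and> T \<in> LT_objects \<and> S \<in> LT_objects \<and> interpretation_of T S I)"
  by (auto simp: LT_def Hom_def)

lemma Iso_LT: "x \<in> Iso LT T S \<longleftrightarrow> (\<exists>I J. x = (T, I, S) \<and> T \<in> LT_objects \<and> S \<in> LT_objects \<and>
    interpretation_of T S I \<and> interpretation_of S T J \<and>
    compose (Arr T) J I = restrict id (Arr T) \<and> compose (Arr S) I J = restrict id (Arr S))"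
proof -
  interpret cate LT by unfold_locales (rule category_LT)
  show ?thesis unfolding Iso_iff Bex_def Hom_LT by (auto simp: LT_def)
qed

section \<open>Transport and uniqueness of presentations\<close>

lemma presentation_law: "presentation P T ev \<Longrightarrow> lawvere_theory T"
  by (simp add: presentation_def law_iff)

text \<open>Interpretations preserve \<open>par\<close> and \<open>pr\<close>, so presentations are
  invariant under isomorphism. This yields both that a theory isomorphic to some
  \<open>Pf_obj P\<close> is regular and that isomorphisms preserve regular arrows.\<close>

lemma presentation_transport:
  assumes T: "presentation P T ev" and S: "lawvere_theory S" and I: "interpretation_of T S I"
    and J: "interpretation_of S T J" and JI: "compose (Arr T) J I = restrict id (Arr T)"
    and IJ: "compose (Arr S) I J = restrict id (Arr S)"
  shows "presentation P S (\<lambda>n g. I (ev n g))"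
proof -
  interpret T: presentation P T ev by (rule T)
  interpret S: law S using S by (simp add: law_iff)
  have TL: "law T" and SL: "law S" by unfold_locales
  show ?thesis
  proof unfold_locales
    fix g n assume "g \<in> ops P n"
    then show "I (ev n g) \<in> Hom S n 1" by (rule interpretation_hom[OF I T.ev_hom])
  next
    show "I (ev 1 (op_unit P)) = Ident S 1" using T.ev_unit interpretation_one[OF I] by simp
  next
    fix k b l g assume b: "\<And>i. i \<in> {1..k} \<Longrightarrow> b i \<in> ops P (l i)" and g: "g \<in> ops P k"
    have eh: "\<And>i. i \<in> {1..k} \<Longrightarrow> ev (l i) (b i) \<in> Hom T (l i) 1" by (rule T.ev_hom[OF b])
    have "I (ev (\<Sum>i=1..k. l i) (T.mul k l b g)) = Comp S (I (ev k g)) (I (T.par k l (\<lambda>i. ev (l i) (b i))))"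
      using T.ev_mul[of k b l g, OF b g] interpretation_comp[OF I T.par_hom[of k "\<lambda>i. ev (l i) (b i)" l, OF eh] T.ev_hom[OF g]]
      by simp
    also have "I (T.par k l (\<lambda>i. ev (l i) (b i))) = S.par k l (\<lambda>i. I (ev (l i) (b i)))"
      by (rule interpretation_par[OF TL SL I eh])
    finally show "I (ev (\<Sum>i=1..k. l i) (T.mul k l b g)) = Comp S (I (ev k g)) (S.par k l (\<lambda>i. I (ev (l i) (b i))))" .
  next
    fix \<phi> :: "nat \<Rightarrow> nat" and n m g assume \<phi>: "\<phi> ` {1..n} = {1..m}" and g: "g \<in> ops P n"
    have P: "\<phi> \<in> {1..n} \<rightarrow> {1..m}" using \<phi> by blast
    show "I (ev m (T.act n m \<phi> g)) = Comp S (I (ev n g)) (S.pr n m \<phi>)"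
      using T.ev_act[OF \<phi> g] interpretation_comp[OF I T.pr_hom[OF P] T.ev_hom[OF g]]
        interpretation_pr[OF TL SL I P] by simp
  next
    fix n
    have JI': "J (I f) = f" if "f \<in> Hom T n 1" for f
      using fun_cong[OF JI, of f] T.homD[OF that] by (simp add: compose_eq)
    have IJ': "I (J f) = f" if "f \<in> Hom S n 1" for f
      using fun_cong[OF IJ, of f] S.homD[OF that] by (simp add: compose_eq)
    have "bij_betw I (Hom T n 1) (Hom S n 1)"
      by (rule bij_betw_byWitness[of _ J]) (use JI' IJ' interpretation_hom[OF I] interpretation_hom[OF J] in auto)
    then have "bij_betw (I \<circ> T.val n) (T.elts n) (Hom S n 1)" by (rule bij_betw_trans[OF T.val_bij])
    moreover have "(I \<circ> T.val n) c = (\<lambda>(A, g). Comp S (I (ev (card A) g)) (S.pr (card A) n (enum A))) c"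
      if c: "c \<in> T.elts n" for c
    proof -
      obtain A g where Ag: "c = (A, g)" "A \<subseteq> {1..n}" "g \<in> ops P (card A)" using c by (auto simp: T.elts_def)
      have "finite A" using Ag(2) finite_subset by blast
      then have E: "enum A \<in> {1..card A} \<rightarrow> {1..n}" using Ag(2) by (rule T.enum_Pi)
      show ?thesis
        using interpretation_comp[OF I T.pr_hom[OF E] T.ev_hom[OF Ag(3)]] interpretation_pr[OF TL SL I E]
        by (simp add: Ag T.val_def)
    qed
    ultimately show "bij_betw (\<lambda>(A, g). Comp S (I (ev (card A) g)) (S.pr (card A) n (enum A))) (T.elts n) (Hom S n 1)"
      by (subst (asm) bij_betw_cong)
  qed
qed

text \<open>The identity of \<open>P\<close> lifts in both directions; the composites fix all
  operations, so they are identities by \<open>interpretation_eqI\<close>.\<close>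

lemma presentations_isomorphic:
  assumes T: "presentation P T ev" and S: "presentation P S ev'"
  shows "\<exists>I J. interpretation_of T S I \<and> interpretation_of S T J \<and>
    compose (Arr T) J I = restrict id (Arr T) \<and> compose (Arr S) I J = restrict id (Arr S) \<and>
    (\<forall>n. \<forall>g\<in>ops P n. I (ev n g) = ev' n g)"
proof -
  interpret T: presentation P T ev by (rule T)
  interpret S: presentation P S ev' by (rule S)
  have TL: "law T" and SL: "law S" by unfold_locales
  let ?h = "\<lambda>n. restrict id (ops P n)"
  have h: "regop_hom P P ?h" by (rule regop_hom_ident[OF T.regular_operad])
  interpret TS: presented_hom P T ev P S ev' ?h by unfold_locales (rule h)
  interpret ST: presented_hom P S ev' P T ev ?h by unfold_locales (rule h)
  have I: "interpretation_of T S TS.lift" and J: "interpretation_of S T ST.lift"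
    by (rule TS.interpretation_lift, rule ST.interpretation_lift)
  have Ie: "TS.lift (ev n g) = ev' n g" and Je: "ST.lift (ev' n g) = ev n g" if "g \<in> ops P n" for n g
    using TS.lift_ev[OF that] ST.lift_ev[OF that] that by auto
  have "compose (Arr T) ST.lift TS.lift = restrict id (Arr T)"
  proof (rule interpretation_eqI[OF T TL interpretation_compose[OF T.lawvere_theory I J] interpretation_ident[OF T.lawvere_theory]])
    fix n g assume g: "g \<in> ops P n"
    then show "compose (Arr T) ST.lift TS.lift (ev n g) = restrict id (Arr T) (ev n g)"
      using T.homD[OF T.ev_hom[OF g]] Ie[OF g] Je[OF g] by (simp add: compose_eq)
  qed
  moreover have "compose (Arr S) TS.lift ST.lift = restrict id (Arr S)"
  proof (rule interpretation_eqI[OF S SL interpretation_compose[OF S.lawvere_theory J I] interpretation_ident[OF S.lawvere_theory]])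
    fix n g assume g: "g \<in> ops P n"
    then show "compose (Arr S) TS.lift ST.lift (ev' n g) = restrict id (Arr S) (ev' n g)"
      using S.homD[OF S.ev_hom[OF g]] Ie[OF g] Je[OF g] by (simp add: compose_eq)
  qed
  ultimately show ?thesis using I J Ie by blast
qed

text \<open>The cardinality bound in \<open>LT_objects\<close> supplies the injection by which
  arrows become elements of \<open>'a\<close>.\<close>

lemma regular_has_presentation:
  assumes "T \<in> LT_objects" and "regular_lawvere_theory T"
  shows "\<exists>(P :: 'a regop) ev. presentation P (T :: 'a span set lawvere) ev"
proof -
  obtain e :: "'a span set \<Rightarrow> 'a" where e: "inj_on e (Arr T)"
    using assms(1) unfolding LT_objects_def lepoll_def by blast
  interpret law T using LT_objects_law[OF assms(1)] by (simp add: law_iff)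
  interpret regular_operations T e by unfold_locales (rule assms(2), rule e)
  show ?thesis using presentation_reg_operad by blast
qed


section \<open>The functor and its essential image\<close>

definition Pf_map :: "'a regop \<Rightarrow> (nat \<Rightarrow> 'a \<Rightarrow> 'a) \<Rightarrow> 'a regop \<Rightarrow> 'a span set \<Rightarrow> 'a span set" where
  "Pf_map P h Q = (\<lambda>A\<in>Arr (Pf_obj P). span_rel Q `` (map_span h ` A))"

lemma snd_Pf: "snd Pf (P, h, Q) = (Pf_obj P, Pf_map P h Q, Pf_obj Q)"
  by (simp add: Pf_def Pf_map_def)

text \<open>The map defined on representatives coincides with the lift of \<open>h\<close> between
  the presented theories: \<open>map_span\<close> changes only the labels, so on codes it acts by
  \<open>hmap\<close>, as the lift does.\<close>

lemma Pf_map_facts: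
  assumes P: "regular_operad P" and Q: "regular_operad Q" and h: "regop_hom P Q h"
  shows "interpretation_of (Pf_obj P) (Pf_obj Q) (Pf_map P h Q)"
    and "\<And>n g. g \<in> ops P n \<Longrightarrow> Pf_map P h Q (operad.evP P n g) = operad.evP Q n (h n g)"
proof -
  interpret P: operad P using P by unfold_locales
  interpret Q: operad Q using Q by unfold_locales
  interpret PP: presentation P "Pf_obj P" P.evP by (rule P.presentation_Pf)
  interpret QQ: presentation Q "Pf_obj Q" Q.evP by (rule Q.presentation_Pf)
  interpret H: presented_hom P "Pf_obj P" P.evP Q "Pf_obj Q" Q.evP h by unfold_locales (rule h)
  have "Pf_map P h Q A = H.lift A" if A: "A \<in> Arr (Pf_obj P)" for A
  proof -
    obtain n m F where F: "F \<in> P.families n m" and AF: "A = P.cls n m F" using A P.Arr_Pf by auto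
    let ?F = "\<lambda>i\<in>{1..m}. H.hmap (F i)"
    have Fi: "F i \<in> P.elts n" if "i \<in> {1..m}" for i using F that by auto
    have F': "?F \<in> Q.families n m" using H.hmap_mem[OF Fi] by simp
    have s: "is_span Q (map_span h s) \<and> Q.code (map_span h s) = (n, m, ?F)" if "s \<in> P.cls n m F" for s
    proof -
      have sp: "is_span P s" "is_prespan P s" "P.code s = (n, m, F)" "tgt s = m" "src s = n"
        using P.cls_memD[OF that] by auto
      let ?t = "map_span h s"
      have t: "src ?t = src s" "tgt ?t = tgt s" "apex ?t = apex s" "lleg ?t = lleg s" "rleg ?t = rleg s"
        "lab ?t = (\<lambda>i\<in>{1..tgt s}. h (fcard s i) (lab s i))"
        by (simp_all add: map_span_def)
      have fib: "fib ?t = fib s" by (simp add: fun_eq_iff fib_def t)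
      then have fc: "fcard ?t = fcard s" by (simp add: fun_eq_iff fcard_def)
      have lab: "h (fcard s i) (lab s i) \<in> ops Q (fcard s i)" if "i \<in> {1..tgt s}" for i
        by (rule H.h_mem[OF P.prespan_lab[OF sp(2) that]])
      have "is_span Q ?t"
        using sp(1,2) lab unfolding is_span_def is_prespan_def t fib fc by simp
      moreover have "H.hmap (F i) = Q.nf (fcard s i) (P.leg s i) (h (fcard s i) (lab s i))" if i: "i \<in> {1..m}" for i
      proof -
        have "F = (\<lambda>i\<in>{1..tgt s}. P.nf (fcard s i) (P.leg s i) (lab s i))"
          using sp(3) unfolding P.code_def by blast
        then have "F i = P.nf (fcard s i) (P.leg s i) (lab s i)" using i sp(4) by simp
        then show ?thesis using H.hmap_nf[OF P.prespan_lab[OF sp(2)]] i sp(4) by simp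
      qed
      then have "Q.code ?t = (n, m, ?F)"
        unfolding Q.code_def t fc using sp(4,5) by (auto intro: restrict_ext)
      ultimately show ?thesis by blast
    qed
    obtain s0 where s0: "s0 \<in> P.cls n m F" using P.cls_nonempty[OF F] unfolding P.cls_def by blast
    have "span_rel Q `` (map_span h ` P.cls n m F) = Q.cls n m ?F"
    proof (intro set_eqI iffI)
      fix v assume "v \<in> span_rel Q `` (map_span h ` P.cls n m F)"
      then obtain s where "s \<in> P.cls n m F" "(map_span h s, v) \<in> span_rel Q" by blast
      then show "v \<in> Q.cls n m ?F" using s[of s] unfolding Q.span_rel_iff Q.cls_def by auto
    next
      fix v assume "v \<in> Q.cls n m ?F"
      then have "(map_span h s0, v) \<in> span_rel Q" using s[OF s0] unfolding Q.span_rel_iff Q.cls_def by auto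
      then show "v \<in> span_rel Q `` (map_span h ` P.cls n m F)" using s0 by blast
    qed
    then have 1: "Pf_map P h Q A = Q.cls n m ?F" using A by (simp add: Pf_map_def AF)
    have Ah: "A \<in> Hom (Pf_obj P) n m" unfolding P.Hom_Pf AF using F by blast
    have "H.lift A = QQ.tuple n m (\<lambda>i. Q.cls n 1 (\<lambda>_\<in>{1..1}. ?F i))"
      unfolding H.lift_eq[OF Ah]
    proof (rule QQ.tuple_cong)
      fix i assume i: "i \<in> {1..m}"
      have "Comp (Pf_obj P) (Proj (Pf_obj P) m i) A = PP.val n (F i)"
        unfolding AF P.Proj_Comp[OF F i] PP.val_def by (rule P.Comp_evP_enum[OF Fi[OF i], symmetric])
      then have "H.lift1 n (Comp (Pf_obj P) (Proj (Pf_obj P) m i) A) = QQ.val n (H.hmap (F i))"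
        using H.lift1_val[OF Fi[OF i]] by simp
      also have "\<dots> = Q.cls n 1 (\<lambda>_\<in>{1..1}. H.hmap (F i))"
        unfolding QQ.val_def by (rule Q.Comp_evP_enum[OF H.hmap_mem[OF Fi[OF i]]])
      finally show "H.lift1 n (Comp (Pf_obj P) (Proj (Pf_obj P) m i) A) = Q.cls n 1 (\<lambda>_\<in>{1..1}. ?F i)"
        using i by simp
    qed
    also have "\<dots> = Q.cls n m ?F" by (rule Q.tuple_Pf[OF F'])
    finally show ?thesis using 1 by simp
  qed
  then have eq: "Pf_map P h Q = H.lift"
    by (intro extensionalityI[of _ "Arr (Pf_obj P)"]) (auto simp: Pf_map_def H.lift_def)
  show "interpretation_of (Pf_obj P) (Pf_obj Q) (Pf_map P h Q)" unfolding eq by (rule H.interpretation_lift)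
  show "\<And>n g. g \<in> ops P n \<Longrightarrow> Pf_map P h Q (P.evP n g) = Q.evP n (h n g)" unfolding eq by (rule H.lift_ev)
qed

lemma presentation_Pf_obj: "regular_operad P \<Longrightarrow> presentation P (Pf_obj P) (operad.evP P)"
  by (rule operad.presentation_Pf) unfold_locales

lemma presentation_regular: "presentation P T ev \<Longrightarrow> regular_lawvere_theory T"
  by (rule presentation.regular_lawvere_theory)

lemma presentation_ev_Arr: "presentation P T ev \<Longrightarrow> g \<in> ops P n \<Longrightarrow> ev n g \<in> Arr T"
  using presentation.ev_hom by (fastforce simp: Hom_def)

lemma presentation_pairI: "presentation P T ev \<Longrightarrow> presentation Q S ev' \<Longrightarrow> presentation_pair P T ev Q S ev'"
  by (simp add: presentation_pair_def)

context
  assumes inf: "infinite (UNIV :: 'a set)"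
begin

lemma Pf_obj_LT: "regular_operad (P :: 'a regop) \<Longrightarrow> Pf_obj P \<in> LT_objects"
  using Arr_Pf_lepoll[OF inf] presentation_law[OF presentation_Pf_obj] by (simp add: LT_objects_def)

lemma functor_Pf: "is_functor (RegOp :: ('a regop, 'a regop_arrow) cat) LT Pf"
  unfolding is_functor_def
proof (intro conjI ballI impI)
  show "category (RegOp :: ('a regop, 'a regop_arrow) cat)" "category (LT :: ('a span set lawvere, 'a theory_arrow) cat)"
    by (rule category_RegOp, rule category_LT)
next
  fix P :: "'a regop" assume "P \<in> Obj RegOp"
  then have P: "regular_operad P" by (simp add: RegOp_def)
  show "fst Pf P \<in> Obj LT" using Pf_obj_LT[OF P] by (simp add: Pf_def LT_def)
  let ?h = "\<lambda>n. restrict id (ops P n)"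
  note pres = presentation_Pf_obj[OF P]
  have "Pf_map P ?h P = restrict id (Arr (Pf_obj P))"
  proof (rule interpretation_eqI[OF pres])
    show "law (Pf_obj P)" using presentation_law[OF pres] by (simp add: law_iff)
    show "interpretation_of (Pf_obj P) (Pf_obj P) (Pf_map P ?h P)"
      by (rule Pf_map_facts(1)[OF P P regop_hom_ident[OF P]])
    show "interpretation_of (Pf_obj P) (Pf_obj P) (restrict id (Arr (Pf_obj P)))"
      by (rule interpretation_ident[OF presentation_law[OF pres]])
    fix n g assume g: "g \<in> ops P n"
    show "Pf_map P ?h P (operad.evP P n g) = restrict id (Arr (Pf_obj P)) (operad.evP P n g)"
      using Pf_map_facts(2)[OF P P regop_hom_ident[OF P] g] presentation_ev_Arr[OF pres g] g by simp
  qed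
  then show "snd Pf (Ident RegOp P) = Ident LT (fst Pf P)"
    by (simp add: RegOp_def snd_Pf LT_def) (simp add: Pf_def)
next
  fix x :: "'a regop_arrow" assume "x \<in> Arr RegOp"
  then obtain P h Q where x: "x = (P, h, Q)" and P: "regular_operad P" and Q: "regular_operad Q"
    and h: "regop_hom P Q h" by (auto simp: RegOp_def)
  show "snd Pf x \<in> Hom LT (fst Pf (Dom RegOp x)) (fst Pf (Cod RegOp x))"
    unfolding Hom_LT x snd_Pf using Pf_map_facts(1)[OF P Q h] Pf_obj_LT[OF P] Pf_obj_LT[OF Q]
    by (simp add: RegOp_def Pf_def)
  fix y :: "'a regop_arrow" assume "y \<in> Arr RegOp" "Dom RegOp y = Cod RegOp x"
  then obtain h' R where y: "y = (Q, h', R)" and R: "regular_operad R" and h': "regop_hom Q R h'"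
    by (auto simp: RegOp_def x)
  let ?hh = "\<lambda>n. compose (ops P n) (h' n) (h n)"
  note hh = regop_hom_compose[OF h h' P]
  note pres = presentation_Pf_obj[OF P]
  have "Pf_map P ?hh R = compose (Arr (Pf_obj P)) (Pf_map Q h' R) (Pf_map P h Q)"
  proof (rule interpretation_eqI[OF pres])
    show "law (Pf_obj R)" using presentation_law[OF presentation_Pf_obj[OF R]] by (simp add: law_iff)
    show "interpretation_of (Pf_obj P) (Pf_obj R) (Pf_map P ?hh R)" by (rule Pf_map_facts(1)[OF P R hh])
    show "interpretation_of (Pf_obj P) (Pf_obj R) (compose (Arr (Pf_obj P)) (Pf_map Q h' R) (Pf_map P h Q))"
      by (rule interpretation_compose[OF presentation_law[OF pres] Pf_map_facts(1)[OF P Q h] Pf_map_facts(1)[OF Q R h']])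
    fix n g assume g: "g \<in> ops P n"
    show "Pf_map P ?hh R (operad.evP P n g) =
        compose (Arr (Pf_obj P)) (Pf_map Q h' R) (Pf_map P h Q) (operad.evP P n g)"
      using Pf_map_facts(2)[OF P R hh g] Pf_map_facts(2)[OF P Q h g]
        Pf_map_facts(2)[OF Q R h' regop_hom_mem[OF h g]] presentation_ev_Arr[OF pres g] g
      by (simp add: compose_eq)
  qed
  then show "snd Pf (Comp RegOp y x) = Comp LT (snd Pf y) (snd Pf x)"
    by (simp add: x y RegOp_def snd_Pf LT_def)
qed

lemma Pf_full:
  assumes P: "regular_operad (P :: 'a regop)" and Q: "regular_operad (Q :: 'a regop)"
    and I: "interpretation_of (Pf_obj P) (Pf_obj Q) I"
    and reg: "I ` regular_arrows (Pf_obj P) \<subseteq> regular_arrows (Pf_obj Q)"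
  shows "\<exists>h. regop_hom P Q h \<and> Pf_map P h Q = I"
proof -
  note pP = presentation_Pf_obj[OF P] and pQ = presentation_Pf_obj[OF Q]
  obtain h where h: "regop_hom P Q h" "\<forall>n. \<forall>g\<in>ops P n. I (operad.evP P n g) = operad.evP Q n (h n g)"
    using presentation_pair.hom_of_regular_interpretation[OF presentation_pairI[OF pP pQ] I reg] by blast
  have "Pf_map P h Q = I"
  proof (rule interpretation_eqI[OF pP _ Pf_map_facts(1)[OF P Q h(1)] I])
    show "law (Pf_obj Q)" using presentation_law[OF pQ] by (simp add: law_iff)
  qed (use Pf_map_facts(2)[OF P Q h(1)] h(2) in simp)
  with h(1) show ?thesis by blast
qed

lemma Pf_faithful:
  assumes P: "regular_operad (P :: 'a regop)" and Q: "regular_operad (Q :: 'a regop)"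
    and h: "regop_hom P Q h" and h': "regop_hom P Q h'" and eq: "Pf_map P h Q = Pf_map P h' Q"
  shows "h = h'"
proof
  fix n
  note pP = presentation_Pf_obj[OF P] and pQ = presentation_Pf_obj[OF Q]
  show "h n = h' n"
  proof (rule extensionalityI[OF regop_hom_extensional[OF h] regop_hom_extensional[OF h']])
    fix g assume g: "g \<in> ops P n"
    show "h n g = h' n g"
      by (rule presentation_pair.ev_inject[OF presentation_pairI[OF pP pQ] regop_hom_mem[OF h g] regop_hom_mem[OF h' g]])
        (use Pf_map_facts(2)[OF P Q h g] Pf_map_facts(2)[OF P Q h' g] eq in simp)
  qed
qed

lemma Pf_map_regular:
  assumes "regular_operad (P :: 'a regop)" "regular_operad (Q :: 'a regop)" "regop_hom P Q h"
  shows "Pf_map P h Q ` regular_arrows (Pf_obj P) \<subseteq> regular_arrows (Pf_obj Q)"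
  by (rule presentation_pair.interpretation_regular[OF presentation_pairI[OF presentation_Pf_obj[OF assms(1)]
    presentation_Pf_obj[OF assms(2)]] Pf_map_facts(1)[OF assms] regop_hom_mem[OF assms(3)]
    Pf_map_facts(2)[OF assms]])

text \<open>\<open>S\<close> is presented by \<open>P\<close> through the transported operations
  \<open>I (ev n g)\<close>; relative to this presentation \<open>I\<close> sends operations to
  operations, with \<open>h\<close> the identity, so \<open>interpretation_regular\<close>
  applies.\<close>

lemma iso_regular:
  assumes T: "presentation (P :: 'a regop) T ev" and S: "lawvere_theory S" and I: "interpretation_of T S I"
    and J: "interpretation_of S T J" and JI: "compose (Arr T) J I = restrict id (Arr T)"
    and IJ: "compose (Arr S) I J = restrict id (Arr S)"
  shows "I ` regular_arrows T \<subseteq> regular_arrows S"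
  by (rule presentation_pair.interpretation_regular[OF presentation_pairI[OF T
    presentation_transport[OF T S I J JI IJ]] I, of "\<lambda>n g. g"]) auto

lemma full_on_isos_Pf: "full_on_isos (RegOp :: ('a regop, 'a regop_arrow) cat) LT Pf"
  unfolding full_on_isos_def
proof (intro ballI)
  fix P Q :: "'a regop" and t assume "P \<in> Obj RegOp" "Q \<in> Obj RegOp" and t: "t \<in> Iso LT (fst Pf P) (fst Pf Q)"
  then have P: "regular_operad P" and Q: "regular_operad Q" by (simp_all add: RegOp_def)
  obtain I J where I: "t = (Pf_obj P, I, Pf_obj Q)" "interpretation_of (Pf_obj P) (Pf_obj Q) I"
    "interpretation_of (Pf_obj Q) (Pf_obj P) J" "compose (Arr (Pf_obj P)) J I = restrict id (Arr (Pf_obj P))"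
    "compose (Arr (Pf_obj Q)) I J = restrict id (Arr (Pf_obj Q))"
    using t unfolding Iso_LT by (auto simp: Pf_def)
  have "I ` regular_arrows (Pf_obj P) \<subseteq> regular_arrows (Pf_obj Q)"
    by (rule iso_regular[OF presentation_Pf_obj[OF P] presentation_law[OF presentation_Pf_obj[OF Q]] I(2-5)])
  then obtain h where h: "regop_hom P Q h" "Pf_map P h Q = I" using Pf_full[OF P Q I(2)] by blast
  then show "\<exists>h\<in>Hom RegOp P Q. snd Pf h = t"
    by (intro bexI[of _ "(P, h, Q)"]) (auto simp: snd_Pf I(1) Hom_RegOp P Q)
qed

section \<open>The essential image\<close>

lemma Obj_RegLT: "Obj RegLT = {T \<in> LT_objects. regular_lawvere_theory T}"
  by (simp add: RegLT_def LT_def)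

lemma Arr_RegLT: "t \<in> Arr RegLT \<longleftrightarrow> (\<exists>T I S. t = (T, I, S) \<and> T \<in> LT_objects \<and> S \<in> LT_objects \<and>
    interpretation_of T S I \<and> regular_lawvere_theory T \<and> regular_lawvere_theory S \<and>
    I ` regular_arrows T \<subseteq> regular_arrows S)"
  by (auto simp: RegLT_def LT_def)

lemma RegLT_iso_Pf:
  assumes "T \<in> LT_objects" "presentation (P :: 'a regop) T ev"
  shows "\<exists>I J. (T, I, Pf_obj P) \<in> Iso LT T (Pf_obj P) \<and> (Pf_obj P, J, T) \<in> Iso LT (Pf_obj P) T \<and>
    interpretation_of T (Pf_obj P) I \<and> interpretation_of (Pf_obj P) T J \<and>
    compose (Arr T) J I = restrict id (Arr T) \<and> compose (Arr (Pf_obj P)) I J = restrict id (Arr (Pf_obj P)) \<and>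
    (\<forall>n. \<forall>g\<in>ops P n. I (ev n g) = operad.evP P n g \<and> J (operad.evP P n g) = ev n g)"
proof -
  have P: "regular_operad P" using assms(2) by (simp add: presentation_def operad_def)
  note pP = presentation_Pf_obj[OF P]
  obtain I J where I: "interpretation_of T (Pf_obj P) I" "interpretation_of (Pf_obj P) T J"
    "compose (Arr T) J I = restrict id (Arr T)" "compose (Arr (Pf_obj P)) I J = restrict id (Arr (Pf_obj P))"
    "\<forall>n. \<forall>g\<in>ops P n. I (ev n g) = operad.evP P n g"
    using presentations_isomorphic[OF assms(2) pP] by blast
  have "J (operad.evP P n g) = ev n g" if g: "g \<in> ops P n" for n g
    using fun_cong[OF I(3), of "ev n g"] presentation_ev_Arr[OF assms(2) g] I(5) g by (simp add: compose_eq)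
  moreover have "(T, I, Pf_obj P) \<in> Iso LT T (Pf_obj P)" "(Pf_obj P, J, T) \<in> Iso LT (Pf_obj P) T"
    unfolding Iso_LT using I assms(1) Pf_obj_LT[OF P] by blast+
  ultimately show ?thesis using I by blast
qed

text \<open>On arrows: the conjugate of a value of \<open>Pf\<close> by isomorphisms is regular
  because it respects the operations of the transported presentations. Conversely, a regular
  interpretation \<open>K\<close> induces a homomorphism \<open>h\<close> of presenting operads, and
  conjugating its image by the isomorphisms that match the presentations gives back
  \<open>K\<close>, as both agree on operations.\<close>

lemma essential_image_Pf: "essential_image (RegOp :: ('a regop, 'a regop_arrow) cat) LT Pf = RegLT"
proof -
  let ?O = "{T \<in> Obj LT. \<exists>P\<in>Obj (RegOp :: ('a regop, 'a regop_arrow) cat). Iso LT (fst Pf P) T \<noteq> {}}"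
  let ?A = "{t \<in> Arr LT. \<exists>x\<in>Arr (RegOp :: ('a regop, 'a regop_arrow) cat).
       \<exists>a\<in>Iso LT (Dom LT t) (fst Pf (Dom RegOp x)). \<exists>b\<in>Iso LT (fst Pf (Cod RegOp x)) (Cod LT t).
         t = Comp LT b (Comp LT (snd Pf x) a)}"
  have "?O = Obj RegLT"
  proof (intro set_eqI iffI)
    fix T assume "T \<in> ?O"
    then obtain P t where T: "T \<in> LT_objects" and P: "regular_operad (P :: 'a regop)" and t: "t \<in> Iso LT (Pf_obj P) T"
      by (auto simp: LT_def RegOp_def Pf_def)
    obtain I J where I: "interpretation_of (Pf_obj P) T I" "interpretation_of T (Pf_obj P) J"
      "compose (Arr (Pf_obj P)) J I = restrict id (Arr (Pf_obj P))" "compose (Arr T) I J = restrict id (Arr T)"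
      using t unfolding Iso_LT by blast
    have "regular_lawvere_theory T"
      by (rule presentation_regular[OF presentation_transport[OF presentation_Pf_obj[OF P] LT_objects_law[OF T] I]])
    then show "T \<in> Obj RegLT" using T by (simp add: Obj_RegLT)
  next
    fix T :: "'a span set lawvere" assume "T \<in> Obj RegLT"
    then have T: "T \<in> LT_objects" "regular_lawvere_theory T" by (auto simp: Obj_RegLT)
    obtain P :: "'a regop" and ev where p: "presentation P T ev" using regular_has_presentation[OF T] by blast
    have P: "regular_operad P" using p by (simp add: presentation_def operad_def)
    have "Iso LT (Pf_obj P) T \<noteq> {}" using RegLT_iso_Pf[OF T(1) p] by blast
    then show "T \<in> ?O" using T P by (auto simp: LT_def RegOp_def Pf_def)
  qed
  moreover have "?A = Arr RegLT"
  proof (intro set_eqI iffI)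
    fix t assume "t \<in> ?A"
    then obtain x a b where tA: "t \<in> Arr LT" and x: "x \<in> Arr (RegOp :: ('a regop, 'a regop_arrow) cat)"
      and a: "a \<in> Iso LT (Dom LT t) (fst Pf (Dom RegOp x))" and b: "b \<in> Iso LT (fst Pf (Cod RegOp x)) (Cod LT t)"
      and eq: "t = Comp LT b (Comp LT (snd Pf x) a)" by blast
    obtain T K S where t: "t = (T, K, S)" "T \<in> LT_objects" "S \<in> LT_objects" "interpretation_of T S K"
      using tA by (auto simp: LT_def)
    obtain P h Q where x: "x = (P, h, Q)" and P: "regular_operad P" and Q: "regular_operad Q"
      and h: "regop_hom P Q h" using x by (auto simp: RegOp_def)
    obtain I J where I: "a = (T, I, Pf_obj P)" "interpretation_of T (Pf_obj P) I" "interpretation_of (Pf_obj P) T J"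
      "compose (Arr T) J I = restrict id (Arr T)" "compose (Arr (Pf_obj P)) I J = restrict id (Arr (Pf_obj P))"
      using a unfolding Iso_LT by (auto simp: t x LT_def RegOp_def Pf_def)
    obtain M N where M: "b = (Pf_obj Q, M, S)" "interpretation_of (Pf_obj Q) S M" "interpretation_of S (Pf_obj Q) N"
      "compose (Arr (Pf_obj Q)) N M = restrict id (Arr (Pf_obj Q))" "compose (Arr S) M N = restrict id (Arr S)"
      using b unfolding Iso_LT by (auto simp: t x LT_def RegOp_def Pf_def)
    note pT = presentation_transport[OF presentation_Pf_obj[OF P] LT_objects_law[OF t(2)] I(3,2,5,4)]
    note pS = presentation_transport[OF presentation_Pf_obj[OF Q] LT_objects_law[OF t(3)] M(2-5)]
    have K: "K = compose (Arr T) M (compose (Arr T) (Pf_map P h Q) I)"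
      using eq by (simp add: t x I(1) M(1) snd_Pf LT_def)
    have "K ` regular_arrows T \<subseteq> regular_arrows S"
    proof (rule presentation_pair.interpretation_regular[OF presentation_pairI[OF pT pS] t(4) regop_hom_mem[OF h]])
      fix n g assume g: "g \<in> ops P n"
      \<comment> \<open>The operations of the transported presentation of \<open>T\<close> are the
        arrows \<open>J (operad.evP P n g)\<close>, on which \<open>I\<close> undoes
        \<open>J\<close>.\<close>
      have "I (J (operad.evP P n g)) = operad.evP P n g"
        using fun_cong[OF I(5), of "operad.evP P n g"] presentation_ev_Arr[OF presentation_Pf_obj[OF P] g]
        by (simp add: compose_eq)
      then show "K (J (operad.evP P n g)) = M (operad.evP Q n (h n g))"
        unfolding K using presentation_ev_Arr[OF pT g] Pf_map_facts(2)[OF P Q h g] by (simp add: compose_eq)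
    qed
    then show "t \<in> Arr RegLT"
      unfolding Arr_RegLT using t presentation_regular[OF pT] presentation_regular[OF pS] by blast
  next
    fix t :: "'a theory_arrow" assume "t \<in> Arr RegLT"
    then obtain T K S where t: "t = (T, K, S)" "T \<in> LT_objects" "S \<in> LT_objects" and K: "interpretation_of T S K"
      and rT: "regular_lawvere_theory T" and rS: "regular_lawvere_theory S"
      and reg: "K ` regular_arrows T \<subseteq> regular_arrows S" unfolding Arr_RegLT by blast
    obtain P :: "'a regop" and ev where pT: "presentation P T ev" using regular_has_presentation[OF t(2) rT] by blast
    obtain Q :: "'a regop" and ev' where pS: "presentation Q S ev'" using regular_has_presentation[OF t(3) rS] by blast
    have P: "regular_operad P" and Q: "regular_operad Q" using pT pS by (simp_all add: presentation_def operad_def)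
    obtain h where h: "regop_hom P Q h" and Kh: "\<forall>n. \<forall>g\<in>ops P n. K (ev n g) = ev' n (h n g)"
      using presentation_pair.hom_of_regular_interpretation[OF presentation_pairI[OF pT pS] K reg] by blast
    obtain I where I: "(T, I, Pf_obj P) \<in> Iso LT T (Pf_obj P)" "interpretation_of T (Pf_obj P) I"
      "\<forall>n. \<forall>g\<in>ops P n. I (ev n g) = operad.evP P n g" using RegLT_iso_Pf[OF t(2) pT] by blast
    obtain M where M: "(Pf_obj Q, M, S) \<in> Iso LT (Pf_obj Q) S" "interpretation_of (Pf_obj Q) S M"
      "\<forall>n. \<forall>g\<in>ops Q n. M (operad.evP Q n g) = ev' n g" using RegLT_iso_Pf[OF t(3) pS] by blast
    have "K = compose (Arr T) M (compose (Arr T) (Pf_map P h Q) I)"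
    proof (rule interpretation_eqI[OF pT _ K])
      show "law S" using LT_objects_law[OF t(3)] by (simp add: law_iff)
      show "interpretation_of T S (compose (Arr T) M (compose (Arr T) (Pf_map P h Q) I))"
        by (rule interpretation_compose[OF LT_objects_law[OF t(2)]
          interpretation_compose[OF LT_objects_law[OF t(2)] I(2) Pf_map_facts(1)[OF P Q h]] M(2)])
      fix n g assume g: "g \<in> ops P n"
      show "K (ev n g) = compose (Arr T) M (compose (Arr T) (Pf_map P h Q) I) (ev n g)"
        using presentation_ev_Arr[OF pT g] Kh I(3) M(3) g regop_hom_mem[OF h g] Pf_map_facts(2)[OF P Q h g]
        by (simp add: compose_eq)
    qed
    then have "t = Comp LT (Pf_obj Q, M, S) (Comp LT (snd Pf (P, h, Q)) (T, I, Pf_obj P))"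
      by (simp add: t snd_Pf LT_def)
    moreover have "(P, h, Q) \<in> Arr RegOp" using P Q h by (simp add: RegOp_def)
    moreover have "t \<in> Arr LT" "Dom LT t = T" "Cod LT t = S" using t K by (auto simp: LT_def)
    moreover have "fst Pf (Dom RegOp (P, h, Q)) = Pf_obj P" "fst Pf (Cod RegOp (P, h, Q)) = Pf_obj Q"
      by (simp_all add: Pf_def RegOp_def)
    ultimately show "t \<in> ?A" using I(1) M(1) by (intro CollectI conjI bexI[of _ "(P, h, Q)"]
      bexI[of _ "(T, I, Pf_obj P)"] bexI[of _ "(Pf_obj Q, M, S)"]) auto
  qed
  ultimately show ?thesis unfolding essential_image_def by (simp add: RegLT_def)
qed

section \<open>The equivalence of regular operads and regular Lawvere theories\<close>

lemma category_RegLT: "category (RegLT :: ('a span set lawvere, 'a theory_arrow) cat)"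
proof -
  have D: "Dom RegLT = Dom LT" "Cod RegLT = Cod LT" "Comp RegLT = Comp LT" "Ident RegLT = Ident LT"
    by (simp_all add: RegLT_def)
  have sub: "x \<in> Arr LT" if "x \<in> Arr RegLT" for x :: "'a theory_arrow" using that by (auto simp: RegLT_def)
  interpret LT: cate "LT :: ('a span set lawvere, 'a theory_arrow) cat" by unfold_locales (rule category_LT)
  show ?thesis
    unfolding category_def D
  proof (intro conjI ballI impI)
    fix x :: "'a theory_arrow" assume xA: "x \<in> Arr RegLT"
    then obtain T I S where x: "x = (T, I, S)" "T \<in> LT_objects" "S \<in> LT_objects" "interpretation_of T S I"
      "regular_lawvere_theory T" "regular_lawvere_theory S" "I ` regular_arrows T \<subseteq> regular_arrows S"
      unfolding Arr_RegLT by blast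
    show "Dom LT x \<in> Obj RegLT" "Cod LT x \<in> Obj RegLT" using x by (simp_all add: Obj_RegLT LT_def)
    show "Comp LT x (Ident LT (Dom LT x)) = x" "Comp LT (Ident LT (Cod LT x)) x = x"
      using LT.unit_right[OF sub[OF xA]] LT.unit_left[OF sub[OF xA]] by auto
    fix y :: "'a theory_arrow" assume yA: "y \<in> Arr RegLT" and d: "Dom LT y = Cod LT x"
    then obtain J R where y: "y = (S, J, R)" "R \<in> LT_objects" "interpretation_of S R J"
      "regular_lawvere_theory R" "J ` regular_arrows S \<subseteq> regular_arrows R"
      unfolding Arr_RegLT by (auto simp: LT_def x)
    have "compose (Arr T) J I ` regular_arrows T \<subseteq> regular_arrows R"
    proof
      fix s assume "s \<in> compose (Arr T) J I ` regular_arrows T"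
      then obtain r where r: "r \<in> regular_arrows T" "s = compose (Arr T) J I r" by blast
      then have "s = J (I r)" by (simp add: compose_eq regular_arrows_def)
      then show "s \<in> regular_arrows R" using r(1) x(7) y(5) by blast
    qed
    then have "Comp LT y x \<in> Arr RegLT"
      unfolding Arr_RegLT using interpretation_compose[OF LT_objects_law[OF x(2)] x(4) y(3)] x y
      by (simp add: LT_def)
    then show "Comp LT y x \<in> Hom RegLT (Dom LT x) (Cod LT y)"
      using LT.dom_comp[OF sub[OF xA] sub[OF yA] d] LT.cod_comp[OF sub[OF xA] sub[OF yA] d] by (simp add: Hom_def D)
    fix z :: "'a theory_arrow" assume zA: "z \<in> Arr RegLT" and d': "Dom LT z = Cod LT y"
    show "Comp LT z (Comp LT y x) = Comp LT (Comp LT z y) x"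
      by (rule LT.assoc[OF sub[OF xA] sub[OF yA] sub[OF zA] d d', symmetric])
  next
    fix T :: "'a span set lawvere" assume "T \<in> Obj RegLT"
    then have T: "T \<in> LT_objects" "regular_lawvere_theory T" by (auto simp: Obj_RegLT)
    have "restrict id (Arr T) ` regular_arrows T \<subseteq> regular_arrows T" by (auto simp: regular_arrows_def)
    then show "Ident LT T \<in> Hom RegLT T T"
      using T interpretation_ident[OF LT_objects_law[OF T(1)]] unfolding Hom_def Arr_RegLT D by (simp add: LT_def)
  qed
qed

text \<open>The functor takes values in \<open>RegLT\<close>, and there it is full, faithful and
  essentially surjective. For the last point the isomorphism obtained in \<open>LT\<close> and its
  inverse must both be regular, which \<open>iso_regular\<close> provides.\<close>

lemma equivalence_RegOp_RegLT:
  "equivalent_categories (RegOp :: ('a regop, 'a regop_arrow) cat)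
    (RegLT :: ('a span set lawvere, 'a theory_arrow) cat)"
proof (rule equivalence_criterion[of _ _ Pf])
  have D: "Dom RegLT = Dom LT" "Cod RegLT = Cod LT" "Comp RegLT = Comp LT" "Ident RegLT = Ident LT"
    by (simp_all add: RegLT_def)
  note F = functor_Pf
  show "is_functor (RegOp :: ('a regop, 'a regop_arrow) cat) RegLT Pf"
    unfolding is_functor_def D
  proof (intro conjI ballI impI)
    show "category (RegOp :: ('a regop, 'a regop_arrow) cat)" "category (RegLT :: ('a span set lawvere, 'a theory_arrow) cat)"
      by (rule category_RegOp, rule category_RegLT)
    fix P :: "'a regop" assume P: "P \<in> Obj RegOp"
    then have "regular_operad P" by (simp add: RegOp_def)
    then show "fst Pf P \<in> Obj RegLT"
      using Pf_obj_LT presentation_regular[OF presentation_Pf_obj] by (simp add: Obj_RegLT Pf_def)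
    show "snd Pf (Ident RegOp P) = Ident LT (fst Pf P)" using F P unfolding is_functor_def by blast
  next
    fix x :: "'a regop_arrow" assume xA: "x \<in> Arr RegOp"
    then obtain P h Q where x: "x = (P, h, Q)" and P: "regular_operad P" and Q: "regular_operad Q"
      and h: "regop_hom P Q h" by (auto simp: RegOp_def)
    have "snd Pf x \<in> Hom LT (fst Pf (Dom RegOp x)) (fst Pf (Cod RegOp x))"
      using F xA unfolding is_functor_def by blast
    moreover have "snd Pf x \<in> Arr RegLT"
      unfolding x snd_Pf Arr_RegLT using Pf_map_regular[OF P Q h] Pf_map_facts(1)[OF P Q h] Pf_obj_LT[OF P] Pf_obj_LT[OF Q]
        presentation_regular[OF presentation_Pf_obj[OF P]] presentation_regular[OF presentation_Pf_obj[OF Q]] by blast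
    ultimately show "snd Pf x \<in> Hom RegLT (fst Pf (Dom RegOp x)) (fst Pf (Cod RegOp x))"
      by (simp add: Hom_def D)
    fix y :: "'a regop_arrow" assume "y \<in> Arr RegOp" "Dom RegOp y = Cod RegOp x"
    then show "snd Pf (Comp RegOp y x) = Comp LT (snd Pf y) (snd Pf x)"
      using F xA unfolding is_functor_def by blast
  qed
next
  fix P Q :: "'a regop" and g assume "P \<in> Obj RegOp" "Q \<in> Obj RegOp" and g: "g \<in> Hom RegLT (fst Pf P) (fst Pf Q)"
  then have P: "regular_operad P" and Q: "regular_operad Q" by (simp_all add: RegOp_def)
  obtain I where I: "g = (Pf_obj P, I, Pf_obj Q)" "interpretation_of (Pf_obj P) (Pf_obj Q) I"
    "I ` regular_arrows (Pf_obj P) \<subseteq> regular_arrows (Pf_obj Q)"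
    using g unfolding Hom_def Arr_RegLT by (auto simp: RegLT_def LT_def Pf_def)
  obtain h where h: "regop_hom P Q h" "Pf_map P h Q = I" using Pf_full[OF P Q I(2,3)] by blast
  then show "\<exists>f\<in>Hom RegOp P Q. snd Pf f = g"
    by (intro bexI[of _ "(P, h, Q)"]) (auto simp: snd_Pf I(1) Hom_RegOp P Q)
next
  fix P Q :: "'a regop" and f f' assume f: "f \<in> Hom RegOp P Q" "f' \<in> Hom RegOp P Q" and eq: "snd Pf f = snd Pf f'"
  obtain h where h: "f = (P, h, Q)" "regular_operad P" "regular_operad Q" "regop_hom P Q h"
    using f(1) unfolding Hom_RegOp by blast
  obtain h' where h': "f' = (P, h', Q)" "regop_hom P Q h'" using f(2) unfolding Hom_RegOp by blast
  show "f = f'" using Pf_faithful[OF h(2-4) h'(2)] eq by (simp add: h(1) h'(1) snd_Pf)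
next
  fix T :: "'a span set lawvere" assume "T \<in> Obj RegLT"
  then have T: "T \<in> LT_objects" "regular_lawvere_theory T" by (auto simp: Obj_RegLT)
  obtain P :: "'a regop" and ev where p: "presentation P T ev" using regular_has_presentation[OF T] by blast
  have P: "regular_operad P" using p by (simp add: presentation_def operad_def)
  note pP = presentation_Pf_obj[OF P]
  obtain I J where I: "interpretation_of T (Pf_obj P) I" "interpretation_of (Pf_obj P) T J"
    "compose (Arr T) J I = restrict id (Arr T)" "compose (Arr (Pf_obj P)) I J = restrict id (Arr (Pf_obj P))"
    using RegLT_iso_Pf[OF T(1) p] by blast
  have JA: "(Pf_obj P, J, T) \<in> Arr RegLT"
    unfolding Arr_RegLT using I(2) T Pf_obj_LT[OF P] presentation_regular[OF pP]
      iso_regular[OF pP LT_objects_law[OF T(1)] I(2,1,4,3)] by blast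
  have IA: "(T, I, Pf_obj P) \<in> Arr RegLT"
    unfolding Arr_RegLT using I(1) T Pf_obj_LT[OF P] presentation_regular[OF pP]
      iso_regular[OF p presentation_law[OF pP] I] by blast
  have "(Pf_obj P, J, T) \<in> Iso RegLT (Pf_obj P) T"
  proof (rule cate.IsoI)
    show "cate (RegLT :: ('a span set lawvere, 'a theory_arrow) cat)" by unfold_locales (rule category_RegLT)
    show "(Pf_obj P, J, T) \<in> Hom RegLT (Pf_obj P) T" "(T, I, Pf_obj P) \<in> Hom RegLT T (Pf_obj P)"
      using JA IA by (simp_all add: Hom_def) (simp_all add: RegLT_def LT_def)
    show "Comp RegLT (T, I, Pf_obj P) (Pf_obj P, J, T) = Ident RegLT (Pf_obj P)"
      "Comp RegLT (Pf_obj P, J, T) (T, I, Pf_obj P) = Ident RegLT T"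
      using I by (simp_all add: RegLT_def LT_def)
  qed
  moreover have "P \<in> Obj RegOp" "fst Pf P = Pf_obj P" using P by (simp_all add: RegOp_def Pf_def)
  ultimately show "\<exists>P\<in>Obj RegOp. Iso RegLT (fst Pf P) T \<noteq> {}" by (metis empty_iff)
qed

end

theorem proposition4p5:
  assumes "infinite (UNIV :: 'a set)"
  shows "is_functor (RegOp :: ('a regop, 'a regop_arrow) cat) LT Pf \<and>
         full_on_isos (RegOp :: ('a regop, 'a regop_arrow) cat) LT Pf \<and>
         essential_image (RegOp :: ('a regop, 'a regop_arrow) cat) LT Pf = RegLT \<and>
         equivalent_categories (RegOp :: ('a regop, 'a regop_arrow) cat)
           (RegLT :: ('a span set lawvere, 'a theory_arrow) cat)"
  using functor_Pf[OF assms] full_on_isos_Pf[OF assms] essential_image_Pf[OF assms]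
    equivalence_RegOp_RegLT[OF assms] by blast

end
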